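(* For every $n\ge0$, the map $\mathcal G_n$ is a (topological) isomorphism of $\mathcal S\big(\mathbb C^2,\mathrm{End}(V_n)\big)^K$ onto $\mathcal S(\Sigma^n_{\mathcal D})$.
   Context: Representations. $K=U_2$. For an integer $n\ge0$, $V_n$ is the space of holomorphic homogeneous polynomials of degree $n$ on $\mathbb C^2$, with the representation $[\tau_n(k)p](z)=p(k^{-1}z)$ of $SU_2$ and the inner product making $e_n^j(z)=\binom nj^{1/2}z_1^jz_2^{n-j}$, $j=0,\dots,n$, an orthonormal basis ($\tau_n$ is then unitary). Elements of $\mathrm{End}(V_n)$ are written as matrices in this basis, with indices $0,\dots,n$; $E_{jj}$ is the matrix whose only nonzero entry is a $1$ in position $(j,j)$. A function $F:\mathbb C^2\to\mathrm{End}(V_n)$ is $K$-equivariant if $F(e^{i\theta}kz)=\tau_n(k)F(z)\tau_n(k)^{-1}$ for all $\theta\in\mathbb R$, $k\in SU_2$, $z\in\mathbb C^2$. $\mathcal S(\mathbb C^2,\mathrm{End}(V_n))^K$ is the Fréchet space of $K$-equivariant $\mathrm{End}(V_n)$-valued Schwartz functions on $\mathbb C^2$. Spherical functions and transform. Let $\langle z,\zeta\rangle=\mathrm{Re}(z_1\bar\zeta_1+z_2\bar\zeta_2)$ and let $\sigma$ be the normalized surface measure on the unit sphere $S^3\subset\mathbb C^2$. For $\zeta\in S^3$ let $k_\zeta=\begin{bmatrix}\bar\zeta_2&\zeta_1\\-\bar\zeta_1&\zeta_2\end{bmatrix}\in SU_2$. For $\xi\ge0$ and $j=0,\dots,n$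 the $\mathrm{End}(V_n)$-valued spherical functions are $$\Phi_{\xi,j}(z)=(n+1)\int_{S^3}e^{-i\sqrt\xi\langle z,\zeta\rangle}\,\tau_n(k_\zeta)E_{jj}\tau_n(k_\zeta)^*\,d\sigma(\zeta)$$ ($\Phi_{0,j}=I$ for every $j$). The embedded spectrum is $\Sigma^n_{\mathcal D}=\{(\xi,(-n+2j)\xi):\xi\ge0,\ j=0,\dots,n\}\subset\mathbb R^2$, and $$\mathcal G_nF\big(\xi,(-n+2j)\xi\big)=\frac1{n+1}\int_{\mathbb C^2}\mathrm{tr}\big(F(z)\Phi_{\xi,j}(-z)\big)\,dz .$$ $\mathcal S(\Sigma^n_{\mathcal D})$ is the space of restrictions to $\Sigma^n_{\mathcal D}$ of functions in $\mathcal S(\mathbb R^2)$, with the quotient topology. *)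

theory Defs
  imports
    "HOL-Analysis.Analysis"
    "Jordan_Normal_Form.Schur_Decomposition"
begin

hide_const (open) Determinant.det
no_notation vec_index (infixl \<open>$\<close> 100)

text \<open>
  The space \<open>\<complex>\<^sup>2\<close> is \<^typ>\<open>complex ^ 2\<close>, whose inner product is the real part of the Hermitian one and
  whose Lebesgue measure is \<^const>\<open>lborel\<close>.  Endomorphisms of \<open>V\<^sub>n\<close> are elements of
  \<open>carrier_mat (n+1) (n+1)\<close> over the complex numbers, with indices \<open>0, \<dots>, n\<close>.
\<close>

section \<open>Schwartz functions\<close>

definition iterated_partial :: "'a::euclidean_space list \<Rightarrow> ('a \<Rightarrow> complex) \<Rightarrow> 'a \<Rightarrow> complex" where
  "iterated_partial bs f = foldr (\<lambda>b g x. frechet_derivative g (at x) b) bs f"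

definition smooth :: "('a::euclidean_space \<Rightarrow> complex) \<Rightarrow> bool" where
  "smooth f \<longleftrightarrow> (\<forall>bs\<in>lists Basis. iterated_partial bs f differentiable_on UNIV)"

definition schwartz :: "('a::euclidean_space \<Rightarrow> complex) set" where
  "schwartz = {f. smooth f \<and>
     (\<forall>N::nat. \<forall>bs\<in>lists Basis. bounded (range (\<lambda>x. (1 + norm x) ^ N *\<^sub>R iterated_partial bs f x)))}"

definition schwartz_seminorm :: "nat \<Rightarrow> 'a::euclidean_space list \<Rightarrow> ('a \<Rightarrow> complex) \<Rightarrow> real" where
  "schwartz_seminorm N bs f = (SUP x. (1 + norm x) ^ N * norm (iterated_partial bs f x))"

text \<open>The topology on \<open>S\<close> generated by the balls of a family of pseudometrics; below the
  pseudometrics are \<open>p (f - g)\<close> with \<open>p\<close> a seminorm.\<close>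

definition pseudometric_topology :: "'v set \<Rightarrow> ('v \<Rightarrow> 'v \<Rightarrow> real) set \<Rightarrow> 'v topology" where
  "pseudometric_topology S D =
     topology_generated_by {{g \<in> S. d f g < e} | f d e. f \<in> S \<and> d \<in> D \<and> 0 < e}"

definition schwartz_topology :: "('a::euclidean_space \<Rightarrow> complex) topology" where
  "schwartz_topology = pseudometric_topology schwartz
     {\<lambda>f g. schwartz_seminorm N bs (\<lambda>x. f x - g x) | N bs. bs \<in> lists Basis}"

definition schwartz_mat :: "nat \<Rightarrow> ('a::euclidean_space \<Rightarrow> complex mat) set" where
  "schwartz_mat n = {F. (\<forall>x. F x \<in> carrier_mat (n + 1) (n + 1)) \<and>
     (\<forall>i\<le>n. \<forall>j\<le>n. (\<lambda>x. F x $$ (i, j)) \<in> schwartz)}"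

definition schwartz_mat_topology :: "nat \<Rightarrow> ('a::euclidean_space \<Rightarrow> complex mat) topology" where
  "schwartz_mat_topology n = pseudometric_topology (schwartz_mat n)
     {\<lambda>F G. schwartz_seminorm N bs (\<lambda>x. F x $$ (i, j) - G x $$ (i, j)) | N bs i j.
        bs \<in> lists Basis \<and> i \<le> n \<and> j \<le> n}"

definition quotient_topology :: "'a topology \<Rightarrow> ('a \<Rightarrow> 'b) \<Rightarrow> 'b topology" where
  "quotient_topology X q =
     topology (\<lambda>V. V \<subseteq> q ` topspace X \<and> openin X {x \<in> topspace X. q x \<in> V})"


section \<open>The representations \<open>\<tau>\<^sub>n\<close> of \<open>SU\<^sub>2\<close>\<close>

definition SU2 :: "(complex ^ 2 ^ 2) set" where
  "SU2 = {k. k ** (\<chi> i j. cnj (k $ j $ i)) = Finite_Cartesian_Product.mat 1 \<and> det k = 1}"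

definition V_space :: "nat \<Rightarrow> (complex ^ 2 \<Rightarrow> complex) set" where
  "V_space n = {p. \<exists>c. \<forall>z. p z = (\<Sum>j\<le>n. c j * (z $ 1) ^ j * (z $ 2) ^ (n - j))}"

definition V_basis :: "nat \<Rightarrow> nat \<Rightarrow> complex ^ 2 \<Rightarrow> complex" where
  "V_basis n j z = complex_of_real (sqrt (real (n choose j))) * (z $ 1) ^ j * (z $ 2) ^ (n - j)"

definition tau_op :: "complex ^ 2 ^ 2 \<Rightarrow> (complex ^ 2 \<Rightarrow> complex) \<Rightarrow> complex ^ 2 \<Rightarrow> complex" where
  "tau_op k p = (\<lambda>z. p (matrix_inv k *v z))"

definition represents :: "nat \<Rightarrow> complex mat \<Rightarrow> ((complex ^ 2 \<Rightarrow> complex) \<Rightarrow> complex ^ 2 \<Rightarrow> complex) \<Rightarrow> bool" where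
  "represents n M T \<longleftrightarrow> M \<in> carrier_mat (n + 1) (n + 1) \<and>
     (\<forall>j\<le>n. T (V_basis n j) = (\<lambda>z. \<Sum>i\<le>n. M $$ (i, j) * V_basis n i z))"

text \<open>The matrix of \<open>\<tau>\<^sub>n(k)\<close> in the basis \<open>e\<^sub>n\<^sup>0, \<dots>, e\<^sub>n\<^sup>n\<close>; it exists and is unique by
  \<open>represents_tau\<close> below.\<close>

definition tau :: "nat \<Rightarrow> complex ^ 2 ^ 2 \<Rightarrow> complex mat" where
  "tau n k = (THE M. represents n M (tau_op k))"

definition equivariant :: "nat \<Rightarrow> (complex ^ 2 \<Rightarrow> complex mat) \<Rightarrow> bool" where
  "equivariant n F \<longleftrightarrow> (\<forall>\<theta>::real. \<forall>k\<in>SU2. \<forall>z.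
     F (cis \<theta> *s (k *v z)) = tau n k * F z * the (mat_inverse (tau n k)))"

definition schwartz_equivariant :: "nat \<Rightarrow> (complex ^ 2 \<Rightarrow> complex mat) set" where
  "schwartz_equivariant n = {F \<in> schwartz_mat n. equivariant n F}"

definition schwartz_equivariant_topology :: "nat \<Rightarrow> (complex ^ 2 \<Rightarrow> complex mat) topology" where
  "schwartz_equivariant_topology n = subtopology (schwartz_mat_topology n) (schwartz_equivariant n)"


section \<open>Spherical functions and the spherical transform\<close>

text \<open>Normalized surface measure on \<open>S\<^sup>3\<close>, by polar coordinates: the measure of \<open>E \<subseteq> S\<^sup>3\<close> is the
  proportion of the unit ball occupied by the cone \<open>{r \<zeta> | 0 < r < 1, \<zeta> \<in> E}\<close>.  It is a Borel measure
  on all of \<open>\<complex>\<^sup>2\<close>, concentrated on the sphere.\<close>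

definition sphere_measure :: "(complex ^ 2) measure" where
  "sphere_measure = distr (uniform_measure lborel (ball 0 1 - {0})) borel sgn"

definition k_rot :: "complex ^ 2 \<Rightarrow> complex ^ 2 ^ 2" where
  "k_rot \<zeta> = vector [vector [cnj (\<zeta> $ 2), \<zeta> $ 1], vector [- cnj (\<zeta> $ 1), \<zeta> $ 2]]"

definition E_unit :: "nat \<Rightarrow> nat \<Rightarrow> complex mat" where
  "E_unit n j = Matrix.mat (n + 1) (n + 1) (\<lambda>(a, b). if a = j \<and> b = j then 1 else 0)"

definition Phi :: "nat \<Rightarrow> real \<Rightarrow> nat \<Rightarrow> complex ^ 2 \<Rightarrow> complex mat" where
  "Phi n \<xi> j z = Matrix.mat (n + 1) (n + 1) (\<lambda>(a, b).
     of_nat (n + 1) * (LINT \<zeta>|sphere_measure.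
       exp (- \<i> * complex_of_real (sqrt \<xi> * inner z \<zeta>)) *
       (tau n (k_rot \<zeta>) * E_unit n j * mat_adjoint (tau n (k_rot \<zeta>))) $$ (a, b)))"

definition mat_trace :: "complex mat \<Rightarrow> complex" where
  "mat_trace A = (\<Sum>i<dim_row A. A $$ (i, i))"

definition spectrum_D :: "nat \<Rightarrow> (real \<times> real) set" where
  "spectrum_D n = {(\<xi>, (- real n + 2 * real j) * \<xi>) | \<xi> j. 0 \<le> \<xi> \<and> j \<le> n}"

text \<open>For \<open>\<xi> > 0\<close> a point of the spectrum determines \<open>j\<close>.  At the origin all \<open>j \<le> n\<close> are admissible and
  give the same value, as \<open>\<Phi>\<^bsub>0,j\<^esub>\<close> is the identity; the description operator denotes this common value.
  Functions on the spectrum are \<^const>\<open>undefined\<close> outside of it.\<close>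

definition spherical_transform ::
    "nat \<Rightarrow> (complex ^ 2 \<Rightarrow> complex mat) \<Rightarrow> real \<times> real \<Rightarrow> complex" where
  "spherical_transform n F = (\<lambda>(\<xi>, \<eta>) \<in> spectrum_D n.
     THE w. \<exists>j\<le>n. \<eta> = (- real n + 2 * real j) * \<xi> \<and>
       w = 1 / of_nat (n + 1) * (LINT z|lborel. mat_trace (F z * Phi n \<xi> j (- z))))"

definition schwartz_spectrum_topology :: "nat \<Rightarrow> (real \<times> real \<Rightarrow> complex) topology" where
  "schwartz_spectrum_topology n =
     quotient_topology schwartz_topology (\<lambda>f. restrict f (spectrum_D n))"


section \<open>Well-definedness\<close>

lemma iterated_partial_zero: "iterated_partial bs (\<lambda>x. 0) = (\<lambda>x. 0)"
  by (induction bs) (auto simp: iterated_partial_def)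

lemma schwartz_seminorm_zero: "schwartz_seminorm N bs (\<lambda>x. 0) = 0"
  by (simp add: schwartz_seminorm_def iterated_partial_zero)

lemma topspace_pseudometric_topology:
  assumes "D \<noteq> {}" and "\<And>d f. d \<in> D \<Longrightarrow> f \<in> S \<Longrightarrow> d f f = 0"
  shows "topspace (pseudometric_topology S D) = S"
proof -
  obtain d where "d \<in> D" using assms(1) by blast
  have "f \<in> \<Union>{{g \<in> S. d f g < e} | f d e. f \<in> S \<and> d \<in> D \<and> 0 < e}" if "f \<in> S" for f
  proof (rule UnionI)
    show "{g \<in> S. d f g < 1} \<in> {{g \<in> S. d f g < e} | f d e. f \<in> S \<and> d \<in> D \<and> 0 < (e::real)}"
      unfolding mem_Collect_eq
      by (rule exI[of _ f], rule exI[of _ d], rule exI[of _ 1]) (simp add: \<open>d \<in> D\<close> that)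
    show "f \<in> {g \<in> S. d f g < 1}"
      using assms(2)[OF \<open>d \<in> D\<close> that] that by simp
  qed
  then show ?thesis
    unfolding pseudometric_topology_def topology_generated_by_topspace by blast
qed

lemma topspace_schwartz_topology: "topspace schwartz_topology = schwartz"
  unfolding schwartz_topology_def
  by (rule topspace_pseudometric_topology) (auto simp: schwartz_seminorm_zero)

lemma topspace_schwartz_mat_topology: "topspace (schwartz_mat_topology n) = schwartz_mat n"
  unfolding schwartz_mat_topology_def
proof (rule topspace_pseudometric_topology)
  have "(\<lambda>F G. schwartz_seminorm 0 [] (\<lambda>x. F x $$ (0, 0) - G x $$ (0, 0))) \<in>
      {\<lambda>F G. schwartz_seminorm N bs (\<lambda>x. F x $$ (i, j) - G x $$ (i, j)) | N bs i j.
        bs \<in> lists Basis \<and> i \<le> n \<and> j \<le> n}"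
    unfolding mem_Collect_eq
    by (rule exI[of _ 0], rule exI[of _ "[]"], rule exI[of _ 0], rule exI[of _ 0]) simp
  then show "{\<lambda>F G. schwartz_seminorm N bs (\<lambda>x. F x $$ (i, j) - G x $$ (i, j)) | N bs i j.
        bs \<in> lists Basis \<and> i \<le> n \<and> j \<le> n} \<noteq> {}"
    by (rule ex_in_conv[THEN iffD1, OF exI])
qed (auto simp: schwartz_seminorm_zero)

lemma topspace_schwartz_equivariant_topology:
  "topspace (schwartz_equivariant_topology n) = schwartz_equivariant n"
  by (auto simp: schwartz_equivariant_topology_def topspace_schwartz_mat_topology
      schwartz_equivariant_def)

lemma openin_quotient_topology:
  "openin (quotient_topology X q) V \<longleftrightarrow>
     V \<subseteq> q ` topspace X \<and> openin X {x \<in> topspace X. q x \<in> V}"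
proof -
  have "istopology (\<lambda>V. V \<subseteq> q ` topspace X \<and> openin X {x \<in> topspace X. q x \<in> V})"
    unfolding istopology_def
  proof (intro conjI allI impI; (elim conjE)?)
    fix A B assume "openin X {x \<in> topspace X. q x \<in> A}" "openin X {x \<in> topspace X. q x \<in> B}"
    then have "openin X ({x \<in> topspace X. q x \<in> A} \<inter> {x \<in> topspace X. q x \<in> B})" by blast
    then show "openin X {x \<in> topspace X. q x \<in> A \<inter> B}"
      by (rule back_subst[of "openin X"]) auto
  next
    fix K assume *: "\<forall>V\<in>K. V \<subseteq> q ` topspace X \<and> openin X {x \<in> topspace X. q x \<in> V}"
    then have "openin X (\<Union>V\<in>K. {x \<in> topspace X. q x \<in> V})" by blast
    then show "openin X {x \<in> topspace X. q x \<in> \<Union>K}"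
      by (rule back_subst[of "openin X"]) auto
    show "\<Union>K \<subseteq> q ` topspace X" using * by blast
  qed auto
  then show ?thesis
    unfolding quotient_topology_def by (simp add: topology_inverse')
qed

lemma topspace_quotient_topology: "topspace (quotient_topology X q) = q ` topspace X"
proof
  show "topspace (quotient_topology X q) \<subseteq> q ` topspace X"
    using openin_quotient_topology[of X q] by (metis openin_topspace)
  have "{x \<in> topspace X. q x \<in> q ` topspace X} = topspace X" by auto
  then have "openin (quotient_topology X q) (q ` topspace X)"
    by (simp add: openin_quotient_topology)
  then show "q ` topspace X \<subseteq> topspace (quotient_topology X q)"
    by (rule openin_subset)
qed

lemma quotient_map_quotient_topology: "quotient_map X (quotient_topology X q) q"
  by (auto simp: quotient_map_def topspace_quotient_topology openin_quotient_topology)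

lemma topspace_schwartz_spectrum_topology:
  "topspace (schwartz_spectrum_topology n) = (\<lambda>f. restrict f (spectrum_D n)) ` schwartz"
  by (simp add: schwartz_spectrum_topology_def topspace_quotient_topology topspace_schwartz_topology)

lemma V_basis_in_V:
  assumes "j \<le> n" shows "V_basis n j \<in> V_space n"
proof -
  let ?c = "\<lambda>i. if i = j then complex_of_real (sqrt (real (n choose j))) else 0"
  have "(\<Sum>i\<le>n. ?c i * (z $ 1) ^ i * (z $ 2) ^ (n - i)) =
      (\<Sum>i\<le>n. if i = j then V_basis n j z else 0)" for z :: "complex ^ 2"
    by (rule sum.cong) (simp_all add: V_basis_def)
  then have "\<forall>z. V_basis n j z = (\<Sum>i\<le>n. ?c i * (z $ 1) ^ i * (z $ 2) ^ (n - i))"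
    using assms by simp
  then show ?thesis
    unfolding V_space_def mem_Collect_eq by (rule exI[where x = ?c])
qed

lemma V_mult_linear:
  assumes "p \<in> V_space m" shows "(\<lambda>z. (a * z $ 1 + b * z $ 2) * p z) \<in> V_space (Suc m)"
proof -
  obtain c where c: "\<And>z. p z = (\<Sum>j\<le>m. c j * (z $ 1) ^ j * (z $ 2) ^ (m - j))"
    using assms unfolding V_space_def by blast
  define d where "d j = (if j = 0 then 0 else a * c (j - 1)) + (if j \<le> m then b * c j else 0)" for j
  have "(a * z $ 1 + b * z $ 2) * p z = (\<Sum>j\<le>Suc m. d j * (z $ 1) ^ j * (z $ 2) ^ (Suc m - j))"
    for z :: "complex ^ 2"
  proof -
    let ?x = "z $ 1" and ?y = "z $ 2"
    have "(\<Sum>j\<le>Suc m. d j * ?x ^ j * ?y ^ (Suc m - j)) =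
        (\<Sum>j\<le>Suc m. (if j = 0 then 0 else a * c (j - 1)) * ?x ^ j * ?y ^ (Suc m - j)) +
        (\<Sum>j\<le>Suc m. (if j \<le> m then b * c j else 0) * ?x ^ j * ?y ^ (Suc m - j))"
      unfolding d_def by (simp only: distrib_right sum.distrib)
    also have "(\<Sum>j\<le>Suc m. (if j = 0 then 0 else a * c (j - 1)) * ?x ^ j * ?y ^ (Suc m - j)) =
        a * ?x * p z"
      unfolding sum.atMost_Suc_shift by (simp add: c sum_distrib_left mult_ac)
    also have "(\<Sum>j\<le>Suc m. (if j \<le> m then b * c j else 0) * ?x ^ j * ?y ^ (Suc m - j)) =
        b * ?y * p z"
      by (simp add: c sum_distrib_left Suc_diff_le mult_ac)
    finally show ?thesis by (simp add: algebra_simps)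
  qed
  then show ?thesis unfolding V_space_def by blast
qed

lemma V_scale:
  assumes "p \<in> V_space m" shows "(\<lambda>z. a * p z) \<in> V_space m"
proof -
  obtain c where c: "\<And>z. p z = (\<Sum>j\<le>m. c j * (z $ 1) ^ j * (z $ 2) ^ (m - j))"
    using assms unfolding V_space_def by blast
  then have "\<forall>z. a * p z = (\<Sum>j\<le>m. (a * c j) * (z $ 1) ^ j * (z $ 2) ^ (m - j))"
    by (simp add: sum_distrib_left mult_ac)
  then show ?thesis
    unfolding V_space_def mem_Collect_eq by (rule exI[where x = "\<lambda>j. a * c j"])
qed

lemma linear_forms_in_V:
  "(\<lambda>z. (a * z $ 1 + b * z $ 2) ^ j * (c * z $ 1 + d * z $ 2) ^ l) \<in> V_space (j + l)"
proof (induction j)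
  case 0
  show ?case
  proof (induction l)
    case 0
    show ?case by (auto simp: V_space_def intro: exI[of _ "\<lambda>_. 1"])
  next
    case (Suc l)
    then show ?case using V_mult_linear by fastforce
  qed
next
  case (Suc j)
  then show ?case using V_mult_linear[OF Suc, of a b] by (simp add: mult_ac)
qed

lemma tau_op_V_basis_in_V:
  assumes "j \<le> n" shows "tau_op k (V_basis n j) \<in> V_space n"
proof -
  let ?L = "matrix_inv k" and ?s = "complex_of_real (sqrt (real (n choose j)))"
  have "tau_op k (V_basis n j) = (\<lambda>z. ?s * ((?L $ 1 $ 1 * z $ 1 + ?L $ 1 $ 2 * z $ 2) ^ j *
      (?L $ 2 $ 1 * z $ 1 + ?L $ 2 $ 2 * z $ 2) ^ (n - j)))"
    by (simp add: tau_op_def V_basis_def matrix_vector_mult_def sum_2 mult_ac)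
  also have "\<dots> \<in> V_space (j + (n - j))"
    by (intro V_scale linear_forms_in_V)
  finally show ?thesis using assms by simp
qed

lemma V_basis_spans:
  assumes "p \<in> V_space n" shows "\<exists>c. p = (\<lambda>z. \<Sum>i\<le>n. c i * V_basis n i z)"
proof -
  obtain c where c: "\<And>z. p z = (\<Sum>j\<le>n. c j * (z $ 1) ^ j * (z $ 2) ^ (n - j))"
    using assms unfolding V_space_def by blast
  let ?d = "\<lambda>i. c i / complex_of_real (sqrt (real (n choose i)))"
  have "p = (\<lambda>z. \<Sum>i\<le>n. ?d i * V_basis n i z)"
    unfolding c V_basis_def by (intro ext sum.cong) auto
  then show ?thesis by (rule exI[where x = ?d])
qed

lemma V_basis_independent:
  assumes "\<And>z. (\<Sum>i\<le>n. c i * V_basis n i z) = (\<Sum>i\<le>n. d i * V_basis n i z)" and "i \<le> n"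
  shows "c i = d i"
proof -
  let ?s = "\<lambda>i. complex_of_real (sqrt (real (n choose i)))"
  have "(\<Sum>i\<le>n. (c i * ?s i) * x ^ i) = (\<Sum>i\<le>n. (d i * ?s i) * x ^ i)" for x
    using assms(1)[of "vector [x, 1]"] by (simp add: V_basis_def vector_2 mult_ac)
  then have "c i * ?s i = d i * ?s i"
    using polyfun_eq_coeffs[of "\<lambda>i. c i * ?s i" n "\<lambda>i. d i * ?s i"] assms(2) by blast
  moreover have "?s i \<noteq> 0" using assms(2) by simp
  ultimately show ?thesis by simp
qed

lemma ex1_represents_tau_op: "\<exists>!M. represents n M (tau_op k)"
proof -
  have "\<forall>j. \<exists>c. j \<le> n \<longrightarrow> tau_op k (V_basis n j) = (\<lambda>z. \<Sum>i\<le>n. c i * V_basis n i z)"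
    using V_basis_spans[OF tau_op_V_basis_in_V] by blast
  from choice[OF this] obtain c
    where c: "\<forall>j\<le>n. tau_op k (V_basis n j) = (\<lambda>z. \<Sum>i\<le>n. c j i * V_basis n i z)"
    by blast
  then have "represents n (Matrix.mat (n + 1) (n + 1) (\<lambda>(i, j). c j i)) (tau_op k)"
    by (auto simp: represents_def intro!: sum.cong)
  moreover have "M = M'" if "represents n M (tau_op k)" "represents n M' (tau_op k)" for M M'
  proof (rule eq_matI)
    fix i j assume "i < dim_row M'" "j < dim_col M'"
    then have "i \<le> n" "j \<le> n" using that by (auto simp: represents_def)
    moreover from this have "(\<lambda>z. \<Sum>i\<le>n. M $$ (i, j) * V_basis n i z) =
        (\<lambda>z. \<Sum>i\<le>n. M' $$ (i, j) * V_basis n i z)"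
      using that by (simp add: represents_def)
    from fun_cong[OF this] have "(\<Sum>i\<le>n. M $$ (i, j) * V_basis n i z) =
        (\<Sum>i\<le>n. M' $$ (i, j) * V_basis n i z)" for z .
    ultimately show "M $$ (i, j) = M' $$ (i, j)"
      using V_basis_independent[of "\<lambda>i. M $$ (i, j)" n "\<lambda>i. M' $$ (i, j)" i] by blast
  qed (use that in \<open>auto simp: represents_def\<close>)
  ultimately show ?thesis by blast
qed

lemma represents_tau: "represents n (tau n k) (tau_op k)"
  unfolding tau_def by (rule theI'[OF ex1_represents_tau_op])

end

theory Submission
  imports Defs "HOL-Probability.Probability"
begin

text \<open>
  By Fubini and equivariance, the transform of \<open>F\<close> at \<open>(\<xi>, (2j - n) \<xi>)\<close> is the \<open>j\<close>-th diagonal entry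
  of the Fourier transform of \<open>F\<close> at the point \<open>(0, sqrt \<xi>)\<close>, where that Fourier transform is
  diagonal.  Both directions rest on Newton interpolation in \<open>j\<close>, along the rays of the spectrum:
  \<open>f\<^sub>j(\<xi>) = \<Sum>\<^sub>m (j choose m) \<xi>\<^sup>m h\<^sub>m(\<xi>)\<close>.

  From a Schwartz function on the plane, averaged shear derivatives give Schwartz coefficients \<open>h\<^sub>m\<close>;
  multiplying \<open>h\<^sub>m(\<bar>z\<bar>\<^sup>2)\<close> by equivariant matrix polynomials whose values at \<open>(0, r)\<close> are
  \<open>r\<^sup>2\<^sup>m (j choose m)\<close> on the diagonal and applying the inverse Fourier transform yields an equivariant
  preimage.  Conversely, for an equivariant \<open>F\<close> the coefficient \<open>h\<^sub>m\<close> is the leading term of the entry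
  \<open>(m, 0)\<close> of the Fourier transform near the pole, hence an explicit integral of \<open>F\<^sub>m\<^sub>0\<close> that is smooth in
  \<open>\<xi>\<close> up to \<open>\<xi> = 0\<close>; replacing \<open>(j choose m) \<xi>\<^sup>m\<close> by the corresponding polynomial in \<open>(\<xi>, \<eta>)\<close>, cut off
  away from the spectrum, extends the transform to a Schwartz function.  All these operators are
  bounded by seminorms, so the transform is continuous and open.
\<close>

no_notation scalar_prod (infix \<open>\<bullet>\<close> 70)

section \<open>Schwartz and tempered functions\<close>

text \<open>The difficulty sits at the origin, where the n + 1 rays meet: smoothness of every f_j up
  to \<xi> = 0 does not make the family the restriction of a smooth function of two variables. The
  m-th difference in j must also be divisible by \<xi>^m with a smooth quotient. Near the origin
  neither direction obtains this quotient by dividing. For a function on the plane it is an average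
  of \<eta>-derivatives over the segment joining neighbouring rays. For an equivariant F the powers
  come from symmetry: the entry (m, 0) has angular frequency -m in w_1 and m in w_2, so its moments
  of order below m vanish in each of the two variables. Each variable contributes a factor r^m,
  where r = sqrt \<xi>, and r^(2m) = \<xi>^m. What remains is even in r, and an even entire kernel
  in r is a smooth function of r^2 = \<xi>.\<close>

lemma iterated_partial_Nil [simp]: "iterated_partial [] f = f"
  by (simp add: iterated_partial_def)

lemma iterated_partial_Cons:
  "iterated_partial (b # bs) f = (\<lambda>x. frechet_derivative (iterated_partial bs f) (at x) b)"
  by (simp add: iterated_partial_def)

lemma iterated_partial_append:
  "iterated_partial (bs @ cs) f = iterated_partial bs (iterated_partial cs f)"
  by (simp add: iterated_partial_def)

lemma smooth_iterated_partial:
  assumes "smooth f" "bs \<in> lists Basis"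
  shows "smooth (iterated_partial bs f)"
  using assms by (simp add: smooth_def iterated_partial_append[symmetric])

lemma smooth_has_derivative:
  assumes "smooth f" "bs \<in> lists Basis"
  shows "(iterated_partial bs f has_derivative frechet_derivative (iterated_partial bs f) (at x)) (at x)"
  using assms frechet_derivative_works by (auto simp: smooth_def differentiable_on_def)

lemma smooth_has_derivative0:
  "smooth f \<Longrightarrow> (f has_derivative frechet_derivative f (at x)) (at x)"
  using smooth_has_derivative[of f "[]"] by simp

lemma smooth_continuous:
  "smooth f \<Longrightarrow> bs \<in> lists Basis \<Longrightarrow> continuous_on UNIV (iterated_partial bs f)"
  using smooth_def differentiable_imp_continuous_on by blast

lemma derivative_basis_expansion:
  assumes "(f has_derivative D) F"
  shows "D h = (\<Sum>b\<in>Basis. (h \<bullet> b) *\<^sub>R D b)"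
proof -
  interpret D: linear D using assms has_derivative_linear by blast
  have "D h = D (\<Sum>b\<in>Basis. (h \<bullet> b) *\<^sub>R b)" by (simp add: euclidean_representation)
  then show ?thesis by (simp add: D.sum D.scale)
qed

text \<open>To control all iterated partial derivatives of a function it suffices to place it in a class
  that partial differentiation maps to finite sums of members; \<open>S\<close> is a parameter space, so that
  the same expansion serves all functions depending on a parameter.\<close>

lemma iterated_partial_class:
  fixes \<G> :: "('s \<Rightarrow> 'a::euclidean_space \<Rightarrow> complex) set"
  assumes der: "\<And>T. T \<in> \<G> \<Longrightarrow> \<exists>Ts. (\<forall>b\<in>Basis. set (Ts b) \<subseteq> \<G>) \<and>
      (\<forall>f\<in>S. \<forall>x. \<exists>D. (T f has_derivative D) (at x) \<and> (\<forall>b\<in>Basis. D b = (\<Sum>T'\<leftarrow>Ts b. T' f x)))"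
    and T: "T \<in> \<G>" and bs: "bs \<in> lists Basis"
  shows "\<exists>Ts. set Ts \<subseteq> \<G> \<and> (\<forall>f\<in>S. iterated_partial bs (T f) = (\<lambda>x. \<Sum>T'\<leftarrow>Ts. T' f x) \<and>
           iterated_partial bs (T f) differentiable_on UNIV)"
proof -
  have list: "\<exists>Us. set Us \<subseteq> \<G> \<and> (\<forall>f\<in>S. \<forall>x. \<exists>D.
      ((\<lambda>x. \<Sum>T'\<leftarrow>Ts. T' f x) has_derivative D) (at x) \<and> D b = (\<Sum>T'\<leftarrow>Us. T' f x))"
    if "set Ts \<subseteq> \<G>" "b \<in> Basis" for Ts b
    using that(1)
  proof (induction Ts)
    case Nil
    have "\<exists>D. ((\<lambda>x. 0::complex) has_derivative D) (at x) \<and> D b = 0" for x :: 'a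
      by (rule exI[of _ "\<lambda>h. 0"]) simp
    then show ?case by (intro exI[of _ "[]"]) simp
  next
    case (Cons T Ts)
    then have TG: "T \<in> \<G>" "set Ts \<subseteq> \<G>" by simp_all
    from Cons.IH[OF TG(2)] obtain Us where Us: "set Us \<subseteq> \<G>" "\<forall>f\<in>S. \<forall>x. \<exists>D.
      ((\<lambda>x. \<Sum>T'\<leftarrow>Ts. T' f x) has_derivative D) (at x) \<and> D b = (\<Sum>T'\<leftarrow>Us. T' f x)" by (elim exE conjE)
    from der[OF TG(1)] obtain Vs where Vs: "\<forall>b\<in>Basis. set (Vs b) \<subseteq> \<G>"
      "\<forall>f\<in>S. \<forall>x. \<exists>D. (T f has_derivative D) (at x) \<and> (\<forall>b\<in>Basis. D b = (\<Sum>T'\<leftarrow>Vs b. T' f x))"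
      by (elim exE conjE)
    show ?case
    proof (intro exI[of _ "Vs b @ Us"] conjI ballI allI)
      show "set (Vs b @ Us) \<subseteq> \<G>" using Us Vs that by auto
      fix f and x :: 'a assume f: "f \<in> S"
      obtain D where D: "((\<lambda>x. \<Sum>T'\<leftarrow>Ts. T' f x) has_derivative D) (at x)" "D b = (\<Sum>T'\<leftarrow>Us. T' f x)"
        using bspec[OF Us(2) f] by blast
      from spec[OF bspec[OF Vs(2) f], of x] obtain E where E: "(T f has_derivative E) (at x)"
        and E': "\<forall>b\<in>Basis. E b = (\<Sum>T'\<leftarrow>Vs b. T' f x)" by (elim exE conjE)
      show "\<exists>D. ((\<lambda>x. \<Sum>T'\<leftarrow>T # Ts. T' f x) has_derivative D) (at x) \<and> D b = (\<Sum>T'\<leftarrow>Vs b @ Us. T' f x)"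
        using has_derivative_add[OF E D(1)] D(2) bspec[OF E' that(2)]
        by (intro exI[of _ "\<lambda>h. E h + D h"]) simp
    qed
  qed
  obtain b0 :: 'a where b0: "b0 \<in> Basis" using nonempty_Basis by blast
  have diff: "(\<lambda>x. \<Sum>T'\<leftarrow>Ts. T' f x) differentiable_on UNIV" if "set Ts \<subseteq> \<G>" "f \<in> S" for Ts f
  proof -
    from list[OF that(1) b0]
    obtain Us where "\<forall>f\<in>S. \<forall>x. \<exists>D. ((\<lambda>x. \<Sum>T'\<leftarrow>Ts. T' f x) has_derivative D) (at x) \<and> D b0 = (\<Sum>T'\<leftarrow>Us. T' f x)"
      by (elim exE conjE)
    from bspec[OF this that(2)]
    have "\<exists>D. ((\<lambda>x. \<Sum>T'\<leftarrow>Ts. T' f x) has_derivative D) (at x)" for x by blast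
    then show ?thesis by (simp add: differentiable_on_def differentiable_def)
  qed
  have "\<exists>Ts. set Ts \<subseteq> \<G> \<and> (\<forall>f\<in>S. iterated_partial bs (T f) = (\<lambda>x. \<Sum>T'\<leftarrow>Ts. T' f x))"
    using bs
  proof (induction bs)
    case Nil
    show ?case using T by (intro exI[of _ "[T]"]) simp
  next
    case (Cons b bs)
    then have bs: "b \<in> Basis" "bs \<in> lists Basis" by simp_all
    from Cons.IH obtain Ts where
      Ts: "set Ts \<subseteq> \<G>" "\<forall>f\<in>S. iterated_partial bs (T f) = (\<lambda>x. \<Sum>T'\<leftarrow>Ts. T' f x)"
      by (elim exE conjE)
    obtain Us where Us: "set Us \<subseteq> \<G>" "\<forall>f\<in>S. \<forall>x. \<exists>D.
      ((\<lambda>x. \<Sum>T'\<leftarrow>Ts. T' f x) has_derivative D) (at x) \<and> D b = (\<Sum>T'\<leftarrow>Us. T' f x)"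
      using list[OF Ts(1) bs(1)] by (elim exE conjE)
    show ?case
    proof (intro exI[of _ Us] conjI ballI ext)
      show "set Us \<subseteq> \<G>" by fact
      fix f x assume f: "f \<in> S"
      obtain D where D: "((\<lambda>x. \<Sum>T'\<leftarrow>Ts. T' f x) has_derivative D) (at x)" "D b = (\<Sum>T'\<leftarrow>Us. T' f x)"
        using bspec[OF Us(2) f] by blast
      show "iterated_partial (b # bs) (T f) x = (\<Sum>T'\<leftarrow>Us. T' f x)"
        using D frechet_derivative_at[OF D(1)] Ts(2) f by (simp add: iterated_partial_Cons)
    qed
  qed
  then obtain Ts where Ts: "set Ts \<subseteq> \<G>" "\<forall>f\<in>S. iterated_partial bs (T f) = (\<lambda>x. \<Sum>T'\<leftarrow>Ts. T' f x)"
    by (elim exE conjE)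
  show ?thesis by (rule exI[of _ Ts]) (simp add: Ts diff[OF Ts(1)])
qed

text \<open>These are the multipliers of the Schwartz space, often written O_M. Cutoffs, phases,
  matrix polynomials and real powers away from zero all enter the construction as such factors, so
  their smoothness and growth are settled by closure rules.\<close>

definition tempered :: "('a::euclidean_space \<Rightarrow> complex) \<Rightarrow> bool" where
  "tempered f \<longleftrightarrow> smooth f \<and>
     (\<forall>bs\<in>lists Basis. \<exists>N C. \<forall>x. norm (iterated_partial bs f x) \<le> C * (1 + norm x) ^ N)"

lemma bound_weaken:
  assumes "(y::real) \<le> C * (1 + norm x) ^ N" "N \<le> N'" "C \<le> C'" "0 \<le> C'"
  shows "y \<le> C' * (1 + norm x) ^ N'"
proof -
  have "C * (1 + norm x) ^ N \<le> C' * (1 + norm x) ^ N'"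
    using assms by (intro order_trans[OF mult_right_mono mult_left_mono]) (auto intro: power_increasing)
  then show ?thesis using assms by linarith
qed

lemma bound_sum_list:
  fixes f :: "'i \<Rightarrow> 'a::real_normed_vector \<Rightarrow> 'b::real_normed_vector"
  assumes "\<And>i. i \<in> set is \<Longrightarrow> \<exists>N C. \<forall>x. norm (f i x) \<le> C * (1 + norm x) ^ N"
  shows "\<exists>N C. \<forall>x. norm (\<Sum>i\<leftarrow>is. f i x) \<le> C * (1 + norm x) ^ N"
  using assms
proof (induction "is")
  case (Cons i "is")
  then obtain N C where 1: "\<forall>x. norm (\<Sum>i\<leftarrow>is. f i x) \<le> C * (1 + norm x) ^ N" by auto
  obtain N' C' where 2: "\<forall>x. norm (f i x) \<le> C' * (1 + norm x) ^ N'" using Cons.prems[of i] by auto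
  show ?case
  proof (intro exI allI)
    fix x
    have "norm (\<Sum>i\<leftarrow>is. f i x) \<le> \<bar>C\<bar> * (1 + norm x) ^ max N N'"
      "norm (f i x) \<le> \<bar>C'\<bar> * (1 + norm x) ^ max N N'"
      using 1 2 by (auto elim!: allE[of _ x] intro: bound_weaken)
    then show "norm (\<Sum>i\<leftarrow>i # is. f i x) \<le> (\<bar>C\<bar> + \<bar>C'\<bar>) * (1 + norm x) ^ max N N'"
      using norm_triangle_ineq[of "f i x" "\<Sum>i\<leftarrow>is. f i x"] by (simp add: distrib_right)
  qed
next
  case Nil
  show ?case by (intro exI[of _ 0] exI[of _ "0::real"]) simp
qed

lemma temperedI:
  fixes \<G> :: "('a::euclidean_space \<Rightarrow> complex) set"
  assumes der: "\<And>f. f \<in> \<G> \<Longrightarrow> \<exists>fs. (\<forall>b\<in>Basis. set (fs b) \<subseteq> \<G>) \<and>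
      (\<forall>x. \<exists>D. (f has_derivative D) (at x) \<and> (\<forall>b\<in>Basis. D b = (\<Sum>g\<leftarrow>fs b. g x)))"
    and bound: "\<And>f. f \<in> \<G> \<Longrightarrow> \<exists>N C. \<forall>x. norm (f x) \<le> C * (1 + norm x) ^ N"
    and f: "f \<in> \<G>"
  shows "tempered f"
proof -
  \<comment> \<open>A one-point parameter space turns the class argument for operators into one for
    single functions.\<close>
  let ?G = "(\<lambda>f (u::unit). f) ` \<G>"
  have *: "\<exists>fs. set fs \<subseteq> \<G> \<and> iterated_partial bs f = (\<lambda>x. \<Sum>g\<leftarrow>fs. g x) \<and>
           iterated_partial bs f differentiable_on UNIV" if bs: "bs \<in> lists Basis" for bs
  proof -
    have "\<exists>Ts. set Ts \<subseteq> ?G \<and> (\<forall>u\<in>UNIV. iterated_partial bs ((\<lambda>u. f) u) = (\<lambda>x. \<Sum>T'\<leftarrow>Ts. T' u x) \<and>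
           iterated_partial bs ((\<lambda>u. f) u) differentiable_on UNIV)"
    proof (rule iterated_partial_class[OF _ _ bs, of ?G])
      fix T assume "T \<in> ?G"
      then obtain g where g: "g \<in> \<G>" "T = (\<lambda>u. g)" by auto
      obtain fs where fs: "\<forall>b\<in>Basis. set (fs b) \<subseteq> \<G>"
        "\<forall>x. \<exists>D. (g has_derivative D) (at x) \<and> (\<forall>b\<in>Basis. D b = (\<Sum>g\<leftarrow>fs b. g x))"
        using der[OF g(1)] by blast
      show "\<exists>Ts. (\<forall>b\<in>Basis. set (Ts b) \<subseteq> ?G) \<and> (\<forall>u\<in>UNIV. \<forall>x. \<exists>D. (T u has_derivative D) (at x) \<and>
            (\<forall>b\<in>Basis. D b = (\<Sum>T'\<leftarrow>Ts b. T' u x)))"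
        using fs g by (intro exI[of _ "\<lambda>b. map (\<lambda>g u. g) (fs b)"]) (auto simp: o_def)
    qed (use f in auto)
    then obtain Ts where Ts: "set Ts \<subseteq> ?G" "iterated_partial bs f = (\<lambda>x. \<Sum>T'\<leftarrow>Ts. T' () x)"
       "iterated_partial bs f differentiable_on UNIV" by auto
    then show ?thesis by (intro exI[of _ "map (\<lambda>T. T ()) Ts"]) (auto simp: o_def)
  qed
  show ?thesis unfolding tempered_def smooth_def
  proof (intro conjI ballI)
    fix bs assume "bs \<in> lists (Basis::'a set)"
    from *[OF this] obtain fs where fs: "set fs \<subseteq> \<G>" "iterated_partial bs f = (\<lambda>x. \<Sum>g\<leftarrow>fs. g x)"
      "iterated_partial bs f differentiable_on UNIV" by blast
    show "iterated_partial bs f differentiable_on UNIV" by fact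
    show "\<exists>N C. \<forall>x. norm (iterated_partial bs f x) \<le> C * (1 + norm x) ^ N"
      unfolding fs(2) by (rule bound_sum_list) (use fs(1) bound in blast)
  qed
qed

lemma tempered_smooth: "tempered f \<Longrightarrow> smooth f" by (simp add: tempered_def)

lemma tempered_bound: "tempered f \<Longrightarrow> \<exists>N C. \<forall>x. norm (f x) \<le> C * (1 + norm x) ^ N"
  unfolding tempered_def by (metis iterated_partial_Nil lists.Nil)

lemma tempered_iterated_partial:
  "tempered f \<Longrightarrow> bs \<in> lists Basis \<Longrightarrow> tempered (iterated_partial bs f)"
  by (simp add: tempered_def smooth_iterated_partial iterated_partial_append[symmetric])

lemma tempered_partial:
  "tempered f \<Longrightarrow> b \<in> Basis \<Longrightarrow> tempered (\<lambda>x. frechet_derivative f (at x) b)"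
  using tempered_iterated_partial[of f "[b]"] by (simp add: iterated_partial_Cons)

lemma tempered_const [simp]: "tempered (\<lambda>x. c)"
proof (rule temperedI[of "range (\<lambda>c x. c)"])
  fix f assume "f \<in> range (\<lambda>c (x::'a). c::complex)"
  then obtain c where c: "f = (\<lambda>x. c)" by auto
  show "\<exists>fs. (\<forall>b\<in>Basis. set (fs b) \<subseteq> range (\<lambda>c x. c)) \<and>
      (\<forall>x. \<exists>D. (f has_derivative D) (at x) \<and> (\<forall>b\<in>Basis. D b = (\<Sum>g\<leftarrow>fs b. g x)))"
    unfolding c by (intro exI[of _ "\<lambda>b. []"] conjI allI exI[of _ "\<lambda>h. 0"]) simp_all
  show "\<exists>N C. \<forall>x. norm (f x) \<le> C * (1 + norm x) ^ N"
    unfolding c by (intro exI[of _ 0] exI[of _ "norm c"]) simp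
qed auto

text \<open>Adding this one function to the class of tempered functions keeps the class closed under
  differentiation, because its partial derivatives are constants.\<close>

lemma tempered_inner: "tempered (\<lambda>x. of_real (x \<bullet> v))"
proof (rule temperedI[of "insert (\<lambda>x. of_real (x \<bullet> v)) {f. tempered f}"])
  fix f :: "'a \<Rightarrow> complex" assume f: "f \<in> insert (\<lambda>x. of_real (x \<bullet> v)) {f. tempered f}"
  show "\<exists>fs. (\<forall>b\<in>Basis. set (fs b) \<subseteq> insert (\<lambda>x. of_real (x \<bullet> v)) {f. tempered f}) \<and>
      (\<forall>x. \<exists>D. (f has_derivative D) (at x) \<and> (\<forall>b\<in>Basis. D b = (\<Sum>g\<leftarrow>fs b. g x)))"
  proof (cases "tempered f")
    case True
    then show ?thesis using smooth_has_derivative0[OF tempered_smooth[OF True]] tempered_partial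
      by (intro exI[of _ "\<lambda>b. [\<lambda>x. frechet_derivative f (at x) b]"] conjI allI ballI) fastforce+
  next
    case False
    then have "f = (\<lambda>x. of_real (x \<bullet> v))" using f by auto
    moreover have "((\<lambda>x. complex_of_real (x \<bullet> v)) has_derivative (\<lambda>h. of_real (h \<bullet> v))) (at x)" for x :: 'a
      by (auto intro!: derivative_eq_intros)
    ultimately show ?thesis
      by (intro exI[of _ "\<lambda>b. [\<lambda>x. of_real (b \<bullet> v)]"]) fastforce
  qed
  show "\<exists>N C. \<forall>x. norm (f x) \<le> C * (1 + norm x) ^ N"
  proof (cases "tempered f")
    case False
    then have f: "f = (\<lambda>x. of_real (x \<bullet> v))" using f by auto
    have "\<bar>x \<bullet> v\<bar> \<le> norm v * (1 + norm x) ^ 1" for x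
      using Cauchy_Schwarz_ineq2[of x v] norm_ge_zero[of v]
      by (simp add: algebra_simps del: norm_ge_zero)
    then show ?thesis unfolding f by (intro exI[of _ 1] exI[of _ "norm v"]) simp
  qed (rule tempered_bound)
qed auto

lemma bound_mult:
  fixes f g :: "'a::real_normed_vector \<Rightarrow> 'b::real_normed_algebra"
  assumes "\<exists>N C. \<forall>x. norm (f x) \<le> C * (1 + norm x) ^ N" "\<exists>N C. \<forall>x. norm (g x) \<le> C * (1 + norm x) ^ N"
  shows "\<exists>N C. \<forall>x. norm (f x * g x) \<le> C * (1 + norm x) ^ N"
proof -
  obtain N C N' C' where *: "\<forall>x. norm (f x) \<le> C * (1 + norm x) ^ N" "\<forall>x. norm (g x) \<le> C' * (1 + norm x) ^ N'"
    using assms by blast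
  have "norm (f x * g x) \<le> (C * C') * (1 + norm x) ^ (N + N')" for x
  proof -
    have "norm (f x * g x) \<le> norm (f x) * norm (g x)" by (rule norm_mult_ineq)
    also have "\<dots> \<le> (C * (1 + norm x) ^ N) * (C' * (1 + norm x) ^ N')"
      using * by (intro mult_mono) (auto intro: order_trans[OF norm_ge_zero])
    finally show ?thesis by (simp add: power_add mult_ac)
  qed
  then show ?thesis by blast
qed

text \<open>By Leibniz's rule the products of two tempered functions form a class closed under
  differentiation up to finite sums.\<close>

lemma tempered_mult:
  assumes "tempered f" "tempered g"
  shows "tempered (\<lambda>x. f x * g x)"
proof -
  define G where "G = {\<lambda>x. u x * v x | u v :: 'a \<Rightarrow> complex. tempered u \<and> tempered v}"
  show ?thesis
  proof (rule temperedI[of G])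
    fix w assume "w \<in> G"
    then obtain u v where w: "w = (\<lambda>x. u x * v x)" and uv: "tempered u" "tempered v" by (auto simp: G_def)
    show "\<exists>N C. \<forall>x. norm (w x) \<le> C * (1 + norm x) ^ N" unfolding w
      by (intro bound_mult tempered_bound uv)
    let ?fs = "\<lambda>b. [\<lambda>x. u x * frechet_derivative v (at x) b, \<lambda>x. frechet_derivative u (at x) b * v x]"
    have "\<forall>b\<in>Basis. set (?fs b) \<subseteq> G"
    proof
      fix b :: 'a assume b: "b \<in> Basis"
      have "(\<lambda>x. u x * frechet_derivative v (at x) b) \<in> G" unfolding G_def
        by (intro CollectI exI[of _ u] exI[of _ "\<lambda>x. frechet_derivative v (at x) b"])
          (simp add: uv tempered_partial b)
      moreover have "(\<lambda>x. frechet_derivative u (at x) b * v x) \<in> G" unfolding G_def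
        by (intro CollectI exI[of _ v] exI[of _ "\<lambda>x. frechet_derivative u (at x) b"])
          (simp add: uv tempered_partial b)
      ultimately show "set (?fs b) \<subseteq> G" by simp
    qed
    moreover have dw: "(w has_derivative (\<lambda>h. u x * frechet_derivative v (at x) h +
        frechet_derivative u (at x) h * v x)) (at x)" for x
      unfolding w using uv by (intro has_derivative_mult smooth_has_derivative0 tempered_smooth)
    have "\<exists>D. (w has_derivative D) (at x) \<and> (\<forall>b\<in>Basis. D b = (\<Sum>g\<leftarrow>?fs b. g x))" for x
      by (rule exI, rule conjI, rule dw) simp
    ultimately show "\<exists>fs. (\<forall>b\<in>Basis. set (fs b) \<subseteq> G) \<and>
      (\<forall>x. \<exists>D. (w has_derivative D) (at x) \<and> (\<forall>b\<in>Basis. D b = (\<Sum>g\<leftarrow>fs b. g x)))"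
      by (intro exI[of _ ?fs] conjI allI)
  next
    show "(\<lambda>x. f x * g x) \<in> G" unfolding G_def
      by (intro CollectI exI[of _ f] exI[of _ g]) (simp add: assms)
  qed
qed

lemma iterated_partial_add:
  assumes "smooth f" "smooth g" "bs \<in> lists Basis"
  shows "iterated_partial bs (\<lambda>x. f x + g x) = (\<lambda>x. iterated_partial bs f x + iterated_partial bs g x)"
  using assms(3)
proof (induction bs)
  case (Cons b bs)
  then have bs: "bs \<in> lists Basis" by auto
  show ?case
  proof
    fix x
    have "((\<lambda>x. iterated_partial bs f x + iterated_partial bs g x) has_derivative
      (\<lambda>h. frechet_derivative (iterated_partial bs f) (at x) h + frechet_derivative (iterated_partial bs g) (at x) h)) (at x)"
      by (intro has_derivative_add smooth_has_derivative assms bs)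
    from fun_cong[OF frechet_derivative_at[OF this], of b]
    show "iterated_partial (b # bs) (\<lambda>x. f x + g x) x =
        iterated_partial (b # bs) f x + iterated_partial (b # bs) g x"
      using Cons.IH by (simp add: iterated_partial_Cons)
  qed
qed simp

lemma smooth_add: "smooth f \<Longrightarrow> smooth g \<Longrightarrow> smooth (\<lambda>x. f x + g x)"
  unfolding smooth_def[of "\<lambda>x. f x + g x"]
  by (auto simp: iterated_partial_add smooth_def intro: differentiable_on_add)

lemma tempered_add:
  assumes "tempered f" "tempered g"
  shows "tempered (\<lambda>x. f x + g x)"
  unfolding tempered_def
proof (intro conjI ballI)
  show "smooth (\<lambda>x. f x + g x)" by (intro smooth_add assms[THEN tempered_smooth])
  fix bs assume bs: "bs \<in> lists (Basis::'a set)"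
  have "\<exists>N C. \<forall>x. norm (\<Sum>h\<leftarrow>[f, g]. iterated_partial bs h x) \<le> C * (1 + norm x) ^ N"
  proof (rule bound_sum_list)
    fix h assume "h \<in> set [f, g]"
    then have "tempered h" using assms by auto
    then show "\<exists>N C. \<forall>x. norm (iterated_partial bs h x) \<le> C * (1 + norm x) ^ N"
      using bs unfolding tempered_def by blast
  qed
  then show "\<exists>N C. \<forall>x. norm (iterated_partial bs (\<lambda>x. f x + g x) x) \<le> C * (1 + norm x) ^ N"
    by (simp add: iterated_partial_add[OF assms[THEN tempered_smooth] bs])
qed

lemma tempered_sum: "(\<And>i. i \<in> I \<Longrightarrow> tempered (f i)) \<Longrightarrow> tempered (\<lambda>x. \<Sum>i\<in>I. f i x)"
  by (induction I rule: infinite_finite_induct) (auto intro: tempered_add)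

lemma tempered_prod: "(\<And>i. i \<in> I \<Longrightarrow> tempered (f i)) \<Longrightarrow> tempered (\<lambda>x. \<Prod>i\<in>I. f i x)"
  by (induction I rule: infinite_finite_induct) (auto intro: tempered_mult)

lemma tempered_power: "tempered f \<Longrightarrow> tempered (\<lambda>x. f x ^ m)"
  by (induction m) (auto intro: tempered_mult)

lemma tempered_uminus: "tempered f \<Longrightarrow> tempered (\<lambda>x. - f x)"
  using tempered_mult[OF tempered_const[of "-1"]] by fastforce

lemma tempered_diff: "tempered f \<Longrightarrow> tempered g \<Longrightarrow> tempered (\<lambda>x. f x - g x)"
  using tempered_add[OF _ tempered_uminus] by fastforce

text \<open>The closed class consists of a tempered factor times a derivative of \<open>f\<close>
  evaluated at \<open>q\<close>: the chain rule raises the order of that derivative and puts a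
  derivative of \<open>q\<close> into the factor.\<close>

lemma tempered_compose:
  fixes f :: "real \<Rightarrow> complex"
  assumes f: "tempered f" and q: "tempered (\<lambda>x. of_real (q x))"
  shows "tempered (\<lambda>x. f (q x))"
proof -
  define \<phi> where "\<phi> l = iterated_partial (replicate l 1) f" for l
  have ones: "replicate l 1 \<in> lists (Basis :: real set)" for l by auto
  have der: "(\<phi> l has_derivative (\<lambda>h. h *\<^sub>R \<phi> (Suc l) t)) (at t)" for l t
  proof -
    have d: "(\<phi> l has_derivative frechet_derivative (\<phi> l) (at t)) (at t)"
      unfolding \<phi>_def by (rule smooth_has_derivative[OF tempered_smooth[OF f] ones])
    interpret linear "frechet_derivative (\<phi> l) (at t)" using d has_derivative_linear by blast
    have "frechet_derivative (\<phi> l) (at t) h = h *\<^sub>R \<phi> (Suc l) t" for h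
      using scale[of h 1] by (simp add: \<phi>_def iterated_partial_Cons)
    then have "frechet_derivative (\<phi> l) (at t) = (\<lambda>h. h *\<^sub>R \<phi> (Suc l) t)" by (rule ext)
    with d show ?thesis by (simp only:)
  qed
  have bdd: "\<exists>N B. \<forall>t. norm (\<phi> l t) \<le> B * (1 + norm t) ^ N" for l
    using f ones unfolding tempered_def \<phi>_def by blast
  define G where "G = {\<lambda>x. u x * \<phi> l (q x) | u l. tempered u}"
  let ?q = "\<lambda>x. frechet_derivative (\<lambda>x. complex_of_real (q x)) (at x)"
  have dq: "((\<lambda>x. complex_of_real (q x)) has_derivative ?q x) (at x)" for x
    using smooth_has_derivative0[OF tempered_smooth[OF q]] .
  have dq': "(q has_derivative (\<lambda>h. Re (?q x h))) (at x)" for x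
    using has_derivative_Re[OF dq[of x]] by simp
  \<comment> \<open>\<open>q\<close> is real but is differentiated as a complex function; uniqueness
    of derivatives shows that the result is real-valued.\<close>
  have Re_q: "of_real (Re (?q x h)) = ?q x h" for x h
  proof -
    have "((\<lambda>x. complex_of_real (q x)) has_derivative (\<lambda>h. of_real (Re (?q x h)))) (at x)"
      using dq'[of x] by (rule has_derivative_of_real)
    from fun_cong[OF has_derivative_unique[OF this dq[of x]], of h] show ?thesis .
  qed
  have "tempered (\<lambda>x. (\<lambda>x. 1) x * \<phi> 0 (q x))"
  proof (rule temperedI[of G])
    fix w assume "w \<in> G"
    then obtain u l where w: "w = (\<lambda>x. u x * \<phi> l (q x))" and u: "tempered u" by (auto simp: G_def)
    obtain N B where B: "\<forall>t. norm (\<phi> l t) \<le> B * (1 + norm t) ^ N" using bdd by blast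
    obtain N' C where C: "\<forall>x. norm (complex_of_real (q x)) \<le> C * (1 + norm x) ^ N'" using tempered_bound[OF q] by blast
    have "norm (\<phi> l (q x)) \<le> (\<bar>B\<bar> * (1 + \<bar>C\<bar>) ^ N) * (1 + norm x) ^ (N' * N)" for x
    proof -
      have "norm (q x) \<le> \<bar>C\<bar> * (1 + norm x) ^ N'"
        by (rule bound_weaken[of _ C _ N']) (use C in auto)
      moreover have "1 \<le> (1 + norm x) ^ N'" by simp
      ultimately have "1 + norm (q x) \<le> (1 + \<bar>C\<bar>) * (1 + norm x) ^ N'"
        unfolding distrib_right mult_1_left by (intro add_mono)
      then have "(1 + norm (q x)) ^ N \<le> ((1 + \<bar>C\<bar>) * (1 + norm x) ^ N') ^ N" by (intro power_mono) auto
      then have "\<bar>B\<bar> * (1 + norm (q x)) ^ N \<le> \<bar>B\<bar> * ((1 + \<bar>C\<bar>) * (1 + norm x) ^ N') ^ N"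
        by (intro mult_left_mono) auto
      moreover have "norm (\<phi> l (q x)) \<le> \<bar>B\<bar> * (1 + norm (q x)) ^ N"
        by (rule bound_weaken[of _ B _ N]) (use B in auto)
      ultimately show ?thesis by (simp add: power_mult_distrib power_mult mult.assoc)
    qed
    then have "\<exists>N C. \<forall>x. norm (\<phi> l (q x)) \<le> C * (1 + norm x) ^ N" by blast
    then show "\<exists>N C. \<forall>x. norm (w x) \<le> C * (1 + norm x) ^ N" unfolding w
      by (rule bound_mult[OF tempered_bound[OF u]])
    let ?fs = "\<lambda>b. [\<lambda>x. (u x * ?q x b) * \<phi> (Suc l) (q x), \<lambda>x. frechet_derivative u (at x) b * \<phi> l (q x)]"
    have "\<forall>b\<in>Basis. set (?fs b) \<subseteq> G"
    proof
      fix b :: 'a assume b: "b \<in> Basis"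
      have "tempered (\<lambda>x. u x * ?q x b)" "tempered (\<lambda>x. frechet_derivative u (at x) b)"
        using u q b by (auto intro!: tempered_mult tempered_partial)
      then have "(\<lambda>x. (u x * ?q x b) * \<phi> (Suc l) (q x)) \<in> G" "(\<lambda>x. frechet_derivative u (at x) b * \<phi> l (q x)) \<in> G"
        unfolding G_def by - (intro CollectI, intro exI conjI, rule refl, assumption)+
      then show "set (?fs b) \<subseteq> G" by simp
    qed
    moreover have dw: "(w has_derivative (\<lambda>h. u x * (Re (?q x h) *\<^sub>R \<phi> (Suc l) (q x)) +
        frechet_derivative u (at x) h * \<phi> l (q x))) (at x)" for x
      unfolding w
      by (intro has_derivative_mult smooth_has_derivative0 tempered_smooth u has_derivative_compose[OF dq' der])
    have "\<exists>D. (w has_derivative D) (at x) \<and> (\<forall>b\<in>Basis. D b = (\<Sum>g\<leftarrow>?fs b. g x))" for x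
      by (rule exI, rule conjI, rule dw) (simp add: scaleR_conv_of_real Re_q mult.assoc)
    ultimately show "\<exists>fs. (\<forall>b\<in>Basis. set (fs b) \<subseteq> G) \<and>
      (\<forall>x. \<exists>D. (w has_derivative D) (at x) \<and> (\<forall>b\<in>Basis. D b = (\<Sum>g\<leftarrow>fs b. g x)))"
      by (intro exI[of _ ?fs] conjI allI)
  next
    show "(\<lambda>x. 1 * \<phi> 0 (q x)) \<in> G" unfolding G_def
      by (intro CollectI exI[of _ "\<lambda>x. 1"] exI[of _ 0]) simp
  qed
  then show ?thesis by (simp add: \<phi>_def)
qed

lemma temperedI_real:
  fixes \<G> :: "(real \<Rightarrow> complex) set"
  assumes der: "\<And>f. f \<in> \<G> \<Longrightarrow> \<exists>fs. set fs \<subseteq> \<G> \<and> (\<forall>x. (f has_vector_derivative (\<Sum>g\<leftarrow>fs. g x)) (at x))"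
    and bound: "\<And>f. f \<in> \<G> \<Longrightarrow> \<exists>N C. \<forall>x. norm (f x) \<le> C * (1 + norm x) ^ N"
    and f: "f \<in> \<G>"
  shows "tempered f"
proof (rule temperedI[OF _ bound f])
  fix f assume "f \<in> \<G>"
  from der[OF this] obtain fs where fs: "set fs \<subseteq> \<G>" "\<forall>x. (f has_vector_derivative (\<Sum>g\<leftarrow>fs. g x)) (at x)"
    by blast
  have "\<exists>D. (f has_derivative D) (at x) \<and> (\<forall>b\<in>Basis. D b = (\<Sum>g\<leftarrow>fs. g x))" for x
    by (rule exI, rule conjI, rule fs(2)[rule_format, unfolded has_vector_derivative_def]) simp
  then show "\<exists>fs. (\<forall>b\<in>Basis. set (fs b) \<subseteq> \<G>) \<and>
      (\<forall>x. \<exists>D. (f has_derivative D) (at x) \<and> (\<forall>b\<in>Basis. D b = (\<Sum>g\<leftarrow>fs b. g x)))"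
    using fs(1) by (intro exI[of _ "\<lambda>_. fs"] conjI allI ballI)
qed

lemma tempered_has_vector_derivative:
  assumes "tempered f"
  shows "(f has_vector_derivative frechet_derivative f (at x) 1) (at x)"
proof -
  have d: "(f has_derivative frechet_derivative f (at x)) (at x)"
    by (rule smooth_has_derivative0[OF tempered_smooth[OF assms]])
  interpret linear "frechet_derivative f (at x)" using d has_derivative_linear by blast
  have "frechet_derivative f (at x) h = h *\<^sub>R frechet_derivative f (at x) 1" for h
    using scale[of h 1] by simp
  then have "frechet_derivative f (at x) = (\<lambda>h. h *\<^sub>R frechet_derivative f (at x) 1)" by (rule ext)
  with d show ?thesis unfolding has_vector_derivative_def by (simp only:)
qed

lemma tempered_deriv:
  fixes f :: "real \<Rightarrow> complex"
  shows "tempered f \<Longrightarrow> tempered (\<lambda>x. frechet_derivative f (at x) 1)"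
  by (rule tempered_partial) simp_all
section \<open>Continuous operators between Schwartz spaces\<close>

lemma schwartz_smooth: "f \<in> schwartz \<Longrightarrow> smooth f" by (simp add: schwartz_def)

lemma schwartz_bdd:
  assumes "f \<in> schwartz" "bs \<in> lists Basis"
  shows "bdd_above (range (\<lambda>x. (1 + norm x) ^ N * norm (iterated_partial bs f x)))"
proof -
  have "bounded (range (\<lambda>x. (1 + norm x) ^ N *\<^sub>R iterated_partial bs f x))"
    using assms by (auto simp: schwartz_def)
  then obtain B where "\<forall>x. norm ((1 + norm x) ^ N *\<^sub>R iterated_partial bs f x) \<le> B"
    by (auto simp: bounded_iff)
  then show ?thesis by (intro bdd_aboveI[of _ B]) auto
qed

lemma schwartz_seminorm_upper:
  assumes "f \<in> schwartz" "bs \<in> lists Basis"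
  shows "(1 + norm x) ^ N * norm (iterated_partial bs f x) \<le> schwartz_seminorm N bs f"
  unfolding schwartz_seminorm_def by (rule cSUP_upper[OF UNIV_I schwartz_bdd[OF assms]])

lemma schwartz_seminorm_least:
  assumes "\<And>x. (1 + norm x) ^ N * norm (iterated_partial bs f x) \<le> B"
  shows "schwartz_seminorm N bs f \<le> B"
  unfolding schwartz_seminorm_def by (rule cSUP_least) (use assms in auto)

lemma schwartz_seminorm_nonneg:
  fixes f :: "'a::euclidean_space \<Rightarrow> complex"
  assumes "f \<in> schwartz" "bs \<in> lists Basis"
  shows "0 \<le> schwartz_seminorm N bs f"
proof -
  have "0 \<le> (1 + norm (0::'a)) ^ N * norm (iterated_partial bs f 0)" by simp
  also have "\<dots> \<le> schwartz_seminorm N bs f" by (rule schwartz_seminorm_upper[OF assms])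
  finally show ?thesis .
qed

lemma schwartz_seminorm_mono:
  assumes "f \<in> schwartz" "bs \<in> lists Basis" "N \<le> M"
  shows "schwartz_seminorm N bs f \<le> schwartz_seminorm M bs f"
proof (rule schwartz_seminorm_least)
  fix x
  have "(1 + norm x) ^ N * norm (iterated_partial bs f x) \<le> (1 + norm x) ^ M * norm (iterated_partial bs f x)"
    using assms by (intro mult_right_mono power_increasing) auto
  also have "\<dots> \<le> schwartz_seminorm M bs f" by (rule schwartz_seminorm_upper[OF assms(1,2)])
  finally show "(1 + norm x) ^ N * norm (iterated_partial bs f x) \<le> schwartz_seminorm M bs f" .
qed

text \<open>An increasing family of seminorms equivalent to the given one. With it, continuity of a
  linear map is a single inequality for each target seminorm.\<close>

definition pnorm :: "nat \<Rightarrow> ('a::euclidean_space \<Rightarrow> complex) \<Rightarrow> real" where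
  "pnorm M f = (\<Sum>bs\<in>{bs. set bs \<subseteq> Basis \<and> length bs \<le> M}. schwartz_seminorm M bs f)"

lemma finite_bs: "finite {bs. set bs \<subseteq> (Basis :: 'a::euclidean_space set) \<and> length bs \<le> M}"
  by (rule finite_lists_length_le) simp

lemma seminorm_le_pnorm:
  assumes "f \<in> schwartz" "bs \<in> lists Basis" "N \<le> M" "length bs \<le> M"
  shows "schwartz_seminorm N bs f \<le> pnorm M f"
proof -
  have "schwartz_seminorm M bs f \<le> pnorm M f" unfolding pnorm_def
    by (rule member_le_sum[OF _ _ finite_bs])
      (use assms in \<open>auto intro!: schwartz_seminorm_nonneg simp: lists_eq_set\<close>)
  then show ?thesis using schwartz_seminorm_mono[OF assms(1-3)] by linarith
qed

lemma pnorm_upper: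
  assumes "f \<in> schwartz" "bs \<in> lists Basis" "N \<le> M" "length bs \<le> M"
  shows "(1 + norm x) ^ N * norm (iterated_partial bs f x) \<le> pnorm M f"
  using schwartz_seminorm_upper[OF assms(1,2)] seminorm_le_pnorm[OF assms] order_trans by blast

lemma pnorm_nonneg: "f \<in> schwartz \<Longrightarrow> 0 \<le> pnorm M f"
  unfolding pnorm_def by (intro sum_nonneg schwartz_seminorm_nonneg) (auto simp: lists_eq_set)

lemma pnorm_mono:
  assumes "f \<in> schwartz" "M \<le> M'"
  shows "pnorm M f \<le> pnorm M' f"
proof -
  have "pnorm M f \<le> (\<Sum>bs\<in>{bs. set bs \<subseteq> Basis \<and> length bs \<le> M}. schwartz_seminorm M' bs f)"
    unfolding pnorm_def
    by (intro sum_mono schwartz_seminorm_mono) (use assms in \<open>auto simp: lists_eq_set\<close>)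
  also have "\<dots> \<le> pnorm M' f" unfolding pnorm_def
    by (intro sum_mono2 finite_bs) (use assms in \<open>auto intro!: schwartz_seminorm_nonneg simp: lists_eq_set\<close>)
  finally show ?thesis .
qed

text \<open>Continuous linear maps between Schwartz spaces. Of linearity only the compatibility with
  differences is recorded, as this is what the pseudometrics p (f - g) see.\<close>

definition schwartz_op :: "(('a::euclidean_space \<Rightarrow> complex) \<Rightarrow> 'b::euclidean_space \<Rightarrow> complex) \<Rightarrow> bool" where
  "schwartz_op \<Phi> \<longleftrightarrow> (\<forall>f\<in>schwartz. \<Phi> f \<in> schwartz) \<and>
     (\<forall>f\<in>schwartz. \<forall>g\<in>schwartz. \<forall>x. \<Phi> (\<lambda>x. f x - g x) x = \<Phi> f x - \<Phi> g x) \<and>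
     (\<forall>N. \<forall>bs\<in>lists Basis. \<exists>M C. \<forall>f\<in>schwartz. schwartz_seminorm N bs (\<Phi> f) \<le> C * pnorm M f)"

lemma schwartz_op_in: "schwartz_op \<Phi> \<Longrightarrow> f \<in> schwartz \<Longrightarrow> \<Phi> f \<in> schwartz"
  by (simp add: schwartz_op_def)

lemma schwartz_op_diff:
  "schwartz_op \<Phi> \<Longrightarrow> f \<in> schwartz \<Longrightarrow> g \<in> schwartz \<Longrightarrow> \<Phi> (\<lambda>x. f x - g x) x = \<Phi> f x - \<Phi> g x"
  by (simp add: schwartz_op_def)

lemma pbound_weaken:
  assumes "y \<le> C * pnorm M f" "M \<le> M'" "C \<le> C'" "0 \<le> C'" "f \<in> schwartz"
  shows "y \<le> C' * pnorm M' f"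
proof -
  have "C * pnorm M f \<le> C' * pnorm M' f"
    using assms pnorm_mono[OF assms(5,2)] pnorm_nonneg[OF assms(5)]
    by (intro order_trans[OF mult_right_mono mult_left_mono]) auto
  then show ?thesis using assms by linarith
qed

lemma pbound_sum:
  fixes q :: "'i \<Rightarrow> ('a::euclidean_space \<Rightarrow> complex) \<Rightarrow> 'x \<Rightarrow> real"
  assumes "finite I" "\<And>i. i \<in> I \<Longrightarrow> \<exists>M C. \<forall>f\<in>schwartz. \<forall>x. q i f x \<le> C * pnorm M f"
  shows "\<exists>M C. 0 \<le> C \<and> (\<forall>f\<in>schwartz. \<forall>x. (\<Sum>i\<in>I. q i f x) \<le> C * pnorm M f)"
  using assms
proof (induction I rule: finite_induct)
  case empty
  show ?case by (intro exI[of _ 0] exI[of _ "0::real"]) simp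
next
  case (insert i I)
  then obtain M C where 1: "0 \<le> C" "\<forall>f\<in>schwartz. \<forall>x. (\<Sum>i\<in>I. q i f x) \<le> C * pnorm M f" by auto
  obtain M' C' where 2: "\<forall>f\<in>schwartz. \<forall>x. q i f x \<le> C' * pnorm M' f" using insert.prems[of i] by auto
  show ?case
  proof (intro exI conjI ballI allI)
    show "0 \<le> C + \<bar>C'\<bar>" using 1 by simp
    fix f :: "'a \<Rightarrow> complex" and x assume f: "f \<in> schwartz"
    have "(\<Sum>i\<in>I. q i f x) \<le> C * pnorm (max M M') f"
      by (rule pbound_weaken[OF _ _ _ _ f, of _ C M]) (use 1 f in auto)
    moreover have "q i f x \<le> \<bar>C'\<bar> * pnorm (max M M') f"
      by (rule pbound_weaken[OF _ _ _ _ f, of _ C' M']) (use 2 f in auto)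
    ultimately show "(\<Sum>i\<in>insert i I. q i f x) \<le> (C + \<bar>C'\<bar>) * pnorm (max M M') f"
      using insert.hyps by (simp add: distrib_right)
  qed
qed

lemma schwartz_op_seminorm:
  "schwartz_op \<Phi> \<Longrightarrow> bs \<in> lists Basis \<Longrightarrow> \<exists>M C. \<forall>f\<in>schwartz. schwartz_seminorm N bs (\<Phi> f) \<le> C * pnorm M f"
  by (simp add: schwartz_op_def)

lemma schwartz_op_pnorm:
  fixes \<Phi> :: "('a::euclidean_space \<Rightarrow> complex) \<Rightarrow> 'b::euclidean_space \<Rightarrow> complex"
  assumes "schwartz_op \<Phi>"
  shows "\<exists>M' C. 0 \<le> C \<and> (\<forall>f\<in>schwartz. pnorm M (\<Phi> f) \<le> C * pnorm M' f)"
proof -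
  \<comment> \<open>The point variable of \<open>pbound_sum\<close> is filled with a dummy of type
    unit, since seminorms depend on no point.\<close>
  have "\<exists>M' C. 0 \<le> C \<and> (\<forall>f\<in>schwartz. \<forall>x::unit.
      (\<Sum>bs\<in>{bs. set bs \<subseteq> Basis \<and> length bs \<le> M}. schwartz_seminorm M bs (\<Phi> f)) \<le> C * pnorm M' f)"
  proof (rule pbound_sum[OF finite_bs])
    fix bs assume "bs \<in> {bs. set bs \<subseteq> (Basis :: 'b set) \<and> length bs \<le> M}"
    then have "bs \<in> lists Basis" by (auto simp: lists_eq_set)
    from schwartz_op_seminorm[OF assms this]
    show "\<exists>M' C. \<forall>f\<in>schwartz. \<forall>x::unit. schwartz_seminorm M bs (\<Phi> f) \<le> C * pnorm M' f" by simp
  qed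
  then show ?thesis by (simp add: pnorm_def)
qed

lemma schwartz_op_compose:
  fixes \<Phi> :: "('b::euclidean_space \<Rightarrow> complex) \<Rightarrow> 'c::euclidean_space \<Rightarrow> complex"
    and \<Psi> :: "('a::euclidean_space \<Rightarrow> complex) \<Rightarrow> 'b \<Rightarrow> complex"
  assumes "schwartz_op \<Phi>" "schwartz_op \<Psi>"
  shows "schwartz_op (\<lambda>f. \<Phi> (\<Psi> f))"
  unfolding schwartz_op_def
proof (intro conjI ballI allI)
  fix f g :: "'a \<Rightarrow> complex" and x assume f: "f \<in> schwartz"
  show "\<Phi> (\<Psi> f) \<in> schwartz" using f assms by (simp add: schwartz_op_in)
  assume g: "g \<in> schwartz"
  have "\<Psi> (\<lambda>x. f x - g x) = (\<lambda>x. \<Psi> f x - \<Psi> g x)"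
    by (rule ext) (rule schwartz_op_diff[OF assms(2) f g])
  then show "\<Phi> (\<Psi> (\<lambda>x. f x - g x)) x = \<Phi> (\<Psi> f) x - \<Phi> (\<Psi> g) x"
    using schwartz_op_diff[OF assms(1) schwartz_op_in[OF assms(2) f] schwartz_op_in[OF assms(2) g]] by simp
next
  fix N :: nat and bs assume bs: "bs \<in> lists (Basis::'c set)"
  obtain M C where 1: "\<forall>f\<in>schwartz. schwartz_seminorm N bs (\<Phi> f) \<le> C * pnorm M f"
    using schwartz_op_seminorm[OF assms(1) bs] by blast
  obtain M' C' where 2: "0 \<le> C'" "\<forall>f\<in>schwartz. pnorm M (\<Psi> f) \<le> C' * pnorm M' f"
    using schwartz_op_pnorm[OF assms(2)] by blast
  show "\<exists>M C. \<forall>f\<in>schwartz. schwartz_seminorm N bs (\<Phi> (\<Psi> f)) \<le> C * pnorm M f"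
  proof (intro exI ballI)
    fix f :: "'a \<Rightarrow> complex" assume f: "f \<in> schwartz"
    have s: "\<Psi> f \<in> schwartz" using schwartz_op_in[OF assms(2) f] .
    have "schwartz_seminorm N bs (\<Phi> (\<Psi> f)) \<le> \<bar>C\<bar> * pnorm M (\<Psi> f)"
      by (rule pbound_weaken[OF _ _ _ _ s, of _ C M]) (use 1 s in auto)
    also have "\<dots> \<le> \<bar>C\<bar> * (C' * pnorm M' f)" using 2 f by (intro mult_left_mono) auto
    finally show "schwartz_seminorm N bs (\<Phi> (\<Psi> f)) \<le> (\<bar>C\<bar> * C') * pnorm M' f" by simp
  qed
qed

lemma schwartzI:
  fixes f :: "'a::euclidean_space \<Rightarrow> complex"
  assumes "smooth f" "\<And>N bs. bs \<in> lists Basis \<Longrightarrow> \<exists>B. \<forall>x. (1 + norm x) ^ N * norm (iterated_partial bs f x) \<le> B"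
  shows "f \<in> schwartz"
  unfolding schwartz_def
proof (intro CollectI conjI allI ballI assms(1))
  fix N bs assume "bs \<in> lists (Basis :: 'a set)"
  from assms(2)[OF this, of N] obtain B where "\<forall>x. (1 + norm x) ^ N * norm (iterated_partial bs f x) \<le> B" by blast
  then show "bounded (range (\<lambda>x. (1 + norm x) ^ N *\<^sub>R iterated_partial bs f x))"
    unfolding bounded_iff by (intro exI[of _ B]) simp
qed

lemma schwartz_op_criterion:
  fixes T :: "('a::euclidean_space \<Rightarrow> complex) \<Rightarrow> 'b::euclidean_space \<Rightarrow> complex"
  assumes sm: "\<And>f. f \<in> schwartz \<Longrightarrow> smooth (T f)"
    and lin: "\<And>f g x. f \<in> schwartz \<Longrightarrow> g \<in> schwartz \<Longrightarrow> T (\<lambda>x. f x - g x) x = T f x - T g x"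
    and bound: "\<And>N bs. bs \<in> lists Basis \<Longrightarrow>
      \<exists>M C. \<forall>f\<in>schwartz. \<forall>x. (1 + norm x) ^ N * norm (iterated_partial bs (T f) x) \<le> C * pnorm M f"
  shows "schwartz_op T"
proof -
  show ?thesis unfolding schwartz_op_def
  proof (intro conjI ballI allI lin)
    fix f :: "'a \<Rightarrow> complex" assume f: "f \<in> schwartz"
    show "T f \<in> schwartz"
    proof (rule schwartzI)
      show "smooth (T f)" by (rule sm[OF f])
      fix N and bs assume "bs \<in> lists (Basis :: 'b set)"
      from bound[OF this, of N] obtain M C where
        "\<forall>f\<in>schwartz. \<forall>x. (1 + norm x) ^ N * norm (iterated_partial bs (T f) x) \<le> C * pnorm M f"
        by (elim exE)
      from bspec[OF this f] show "\<exists>B. \<forall>x. (1 + norm x) ^ N * norm (iterated_partial bs (T f) x) \<le> B"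
        by (rule exI)
    qed
  next
    fix N and bs assume "bs \<in> lists (Basis :: 'b set)"
    from bound[OF this, of N] obtain M C where
      "\<forall>f\<in>schwartz. \<forall>x. (1 + norm x) ^ N * norm (iterated_partial bs (T f) x) \<le> C * pnorm M f" by (elim exE)
    then show "\<exists>M C. \<forall>f\<in>schwartz. schwartz_seminorm N bs (T f) \<le> C * pnorm M f"
      by (intro exI[of _ M] exI[of _ C] ballI schwartz_seminorm_least) simp
  qed
qed

text \<open>The counterpart of \<open>temperedI\<close> for operators: if differentiation in the
  target variable turns members into finite sums of members, then every iterated partial derivative
  is such a sum, and weighted sup bounds on the members control all seminorms.\<close>

lemma schwartz_opI:
  fixes \<G> :: "(('a::euclidean_space \<Rightarrow> complex) \<Rightarrow> 'b::euclidean_space \<Rightarrow> complex) set"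
  assumes der: "\<And>T. T \<in> \<G> \<Longrightarrow> \<exists>Ts. (\<forall>b\<in>Basis. set (Ts b) \<subseteq> \<G>) \<and>
      (\<forall>f\<in>schwartz. \<forall>x. \<exists>D. (T f has_derivative D) (at x) \<and> (\<forall>b\<in>Basis. D b = (\<Sum>T'\<leftarrow>Ts b. T' f x)))"
    and bound: "\<And>T N. T \<in> \<G> \<Longrightarrow> \<exists>M C. \<forall>f\<in>schwartz. \<forall>x. (1 + norm x) ^ N * norm (T f x) \<le> C * pnorm M f"
    and T: "T \<in> \<G>"
    and lin: "\<And>f g x. f \<in> schwartz \<Longrightarrow> g \<in> schwartz \<Longrightarrow> T (\<lambda>x. f x - g x) x = T f x - T g x"
  shows "schwartz_op T"
proof -
  have *: "\<exists>M C. \<forall>f\<in>schwartz. \<forall>x. (1 + norm x) ^ N * norm (iterated_partial bs (T f) x) \<le> C * pnorm M f"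
    "\<forall>f\<in>schwartz. iterated_partial bs (T f) differentiable_on UNIV"
    if bs: "bs \<in> lists Basis" for N :: nat and bs
  proof -
    have "\<exists>Ts. set Ts \<subseteq> \<G> \<and> (\<forall>f\<in>schwartz. iterated_partial bs (T f) = (\<lambda>x. \<Sum>T'\<leftarrow>Ts. T' f x) \<and>
           iterated_partial bs (T f) differentiable_on UNIV)"
      by (rule iterated_partial_class[OF _ T bs]) (rule der)
    then obtain Ts where Ts: "set Ts \<subseteq> \<G>" "\<forall>f\<in>schwartz. iterated_partial bs (T f) = (\<lambda>x. \<Sum>T'\<leftarrow>Ts. T' f x) \<and>
           iterated_partial bs (T f) differentiable_on UNIV"
      by (elim exE conjE)
    show "\<forall>f\<in>schwartz. iterated_partial bs (T f) differentiable_on UNIV" using Ts by blast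
    have "\<exists>M C. 0 \<le> C \<and> (\<forall>f\<in>schwartz. \<forall>x::'b. (\<Sum>i<length Ts. (1 + norm x) ^ N * norm ((Ts ! i) f x)) \<le> C * pnorm M f)"
    proof (rule pbound_sum)
      fix i assume "i \<in> {..<length Ts}"
      then have "Ts ! i \<in> \<G>" using Ts(1) nth_mem by auto
      from bound[OF this] show "\<exists>M C. \<forall>f\<in>schwartz. \<forall>x. (1 + norm x) ^ N * norm ((Ts ! i) f x) \<le> C * pnorm M f" .
    qed simp
    then obtain M C where MC: "\<forall>f\<in>schwartz. \<forall>x::'b. (\<Sum>i<length Ts. (1 + norm x) ^ N * norm ((Ts ! i) f x)) \<le> C * pnorm M f"
      by blast
    show "\<exists>M C. \<forall>f\<in>schwartz. \<forall>x. (1 + norm x) ^ N * norm (iterated_partial bs (T f) x) \<le> C * pnorm M f"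
    proof (intro exI ballI allI)
      fix f :: "'a \<Rightarrow> complex" and x :: 'b assume f: "f \<in> schwartz"
      have "norm (iterated_partial bs (T f) x) = norm (\<Sum>i<length Ts. (Ts ! i) f x)"
        using Ts(2) f by (simp add: sum_list_sum_nth atLeast0LessThan)
      also have "\<dots> \<le> (\<Sum>i<length Ts. norm ((Ts ! i) f x))" by (rule norm_sum)
      finally have "(1 + norm x) ^ N * norm (iterated_partial bs (T f) x) \<le>
          (1 + norm x) ^ N * (\<Sum>i<length Ts. norm ((Ts ! i) f x))"
        by (rule mult_left_mono) simp
      also have "\<dots> \<le> C * pnorm M f" using MC f by (simp add: sum_distrib_left)
      finally show "(1 + norm x) ^ N * norm (iterated_partial bs (T f) x) \<le> C * pnorm M f" .
    qed
  qed
  show ?thesis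
  proof (rule schwartz_op_criterion)
    show "smooth (T f)" if "f \<in> schwartz" for f using *(2) that by (auto simp: smooth_def)
  qed (rule lin *(1); assumption)+
qed

lemma iterated_partial_diff:
  assumes "smooth f" "smooth g" "bs \<in> lists Basis"
  shows "iterated_partial bs (\<lambda>x. f x - g x) = (\<lambda>x. iterated_partial bs f x - iterated_partial bs g x)"
  using assms(3)
proof (induction bs)
  case (Cons b bs)
  then have bs: "bs \<in> lists Basis" by auto
  show ?case
  proof
    fix x
    have "((\<lambda>x. iterated_partial bs f x - iterated_partial bs g x) has_derivative
      (\<lambda>h. frechet_derivative (iterated_partial bs f) (at x) h - frechet_derivative (iterated_partial bs g) (at x) h)) (at x)"
      by (intro has_derivative_diff smooth_has_derivative assms bs)
    from fun_cong[OF frechet_derivative_at[OF this], of b] show "iterated_partial (b # bs) (\<lambda>x. f x - g x) x =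
        iterated_partial (b # bs) f x - iterated_partial (b # bs) g x"
      using Cons.IH by (simp add: iterated_partial_Cons)
  qed
qed simp

lemma schwartz_op_add:
  fixes \<Phi> \<Psi> :: "('a::euclidean_space \<Rightarrow> complex) \<Rightarrow> 'b::euclidean_space \<Rightarrow> complex"
  assumes "schwartz_op \<Phi>" "schwartz_op \<Psi>"
  shows "schwartz_op (\<lambda>f x. \<Phi> f x + \<Psi> f x)"
proof -
  have sm: "smooth (\<Phi> f)" "smooth (\<Psi> f)" if "f \<in> schwartz" for f
    by (rule schwartz_smooth[OF schwartz_op_in[OF assms(1) that]], rule schwartz_smooth[OF schwartz_op_in[OF assms(2) that]])
  have *: "\<exists>M C. \<forall>f\<in>schwartz. \<forall>x. (1 + norm x) ^ N * norm (iterated_partial bs (\<lambda>x. \<Phi> f x + \<Psi> f x) x) \<le> C * pnorm M f"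
    if bs: "bs \<in> lists Basis" for N :: nat and bs
  proof -
    obtain M C where "\<forall>f\<in>schwartz. schwartz_seminorm N bs (\<Phi> f) \<le> C * pnorm M f"
      using schwartz_op_seminorm[OF assms(1) bs] by blast
    moreover obtain M' C' where "\<forall>f\<in>schwartz. schwartz_seminorm N bs (\<Psi> f) \<le> C' * pnorm M' f"
      using schwartz_op_seminorm[OF assms(2) bs] by blast
    ultimately have MC: "\<forall>f\<in>schwartz. schwartz_seminorm N bs (\<Phi> f) \<le> C * pnorm M f"
      "\<forall>f\<in>schwartz. schwartz_seminorm N bs (\<Psi> f) \<le> C' * pnorm M' f" by simp_all
    show ?thesis
    proof (intro exI ballI allI)
      fix f :: "'a \<Rightarrow> complex" and x assume f: "f \<in> schwartz"
      have "(1 + norm x) ^ N * norm (iterated_partial bs (\<lambda>x. \<Phi> f x + \<Psi> f x) x) \<le>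
        (1 + norm x) ^ N * (norm (iterated_partial bs (\<Phi> f) x) + norm (iterated_partial bs (\<Psi> f) x))"
        unfolding iterated_partial_add[OF sm(1)[OF f] sm(2)[OF f] bs]
        by (intro mult_left_mono norm_triangle_ineq) simp
      also have "\<dots> \<le> schwartz_seminorm N bs (\<Phi> f) + schwartz_seminorm N bs (\<Psi> f)"
        using schwartz_seminorm_upper[OF schwartz_op_in[OF assms(1) f] bs, of x N]
         schwartz_seminorm_upper[OF schwartz_op_in[OF assms(2) f] bs, of x N] by (simp add: distrib_left)
      also have "\<dots> \<le> \<bar>C\<bar> * pnorm (max M M') f + \<bar>C'\<bar> * pnorm (max M M') f"
        by (rule add_mono; rule pbound_weaken[OF _ _ _ _ f])
          (rule bspec[OF MC(1) f], simp_all, rule bspec[OF MC(2) f], simp_all)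
      finally show "(1 + norm x) ^ N * norm (iterated_partial bs (\<lambda>x. \<Phi> f x + \<Psi> f x) x) \<le> (\<bar>C\<bar> + \<bar>C'\<bar>) * pnorm (max M M') f"
        by (simp add: distrib_right)
    qed
  qed
  show ?thesis
  proof (rule schwartz_op_criterion)
    fix f assume f: "f \<in> (schwartz :: ('a \<Rightarrow> complex) set)"
    show "smooth (\<lambda>x. \<Phi> f x + \<Psi> f x)" by (rule smooth_add[OF sm(1)[OF f] sm(2)[OF f]])
    fix g x assume g: "g \<in> (schwartz :: ('a \<Rightarrow> complex) set)"
    show "\<Phi> (\<lambda>x. f x - g x) x + \<Psi> (\<lambda>x. f x - g x) x = \<Phi> f x + \<Psi> f x - (\<Phi> g x + \<Psi> g x)"
      unfolding schwartz_op_diff[OF assms(1) f g] schwartz_op_diff[OF assms(2) f g] by simp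
  qed (rule *)
qed

lemma schwartz_zero: "(\<lambda>x. 0) \<in> schwartz"
  by (auto simp: schwartz_def smooth_def iterated_partial_zero)

lemma schwartz_op_zero: "schwartz_op (\<lambda>f x. 0)"
  unfolding schwartz_op_def
  by (intro conjI allI ballI exI[of _ 0] exI[of _ "0::real"]) (simp_all add: schwartz_zero schwartz_seminorm_zero)

lemma schwartz_op_sum:
  "(\<And>i. i \<in> I \<Longrightarrow> schwartz_op (\<Phi> i)) \<Longrightarrow> schwartz_op (\<lambda>f x. \<Sum>i\<in>I. \<Phi> i f x)"
proof (induction I rule: infinite_finite_induct)
  case (insert i I)
  then have "schwartz_op (\<lambda>f x. \<Phi> i f x + (\<Sum>i\<in>I. \<Phi> i f x))"
    by (intro schwartz_op_add) simp_all
  then show ?case using insert by simp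
qed (simp_all add: schwartz_op_zero)

text \<open>Composition with a tempered map \<open>q\<close> preserves decay only where \<open>q\<close> dominates a power of the
  norm; the factor \<open>g\<close> localizes to that region.\<close>

lemma schwartz_op_pullback:
  fixes q :: "'b::euclidean_space \<Rightarrow> 'a::euclidean_space"
  assumes g: "tempered g"
    and q: "\<And>b. b \<in> Basis \<Longrightarrow> tempered (\<lambda>x. of_real (q x \<bullet> b))"
    and supp: "\<And>x. C0 * (1 + norm (q x)) ^ N0 < 1 + norm x \<Longrightarrow> g x = 0"
  shows "schwartz_op (\<lambda>h x. g x * h (q x))"
proof -
  \<comment> \<open>Off \<open>U\<close> a power of 1 + norm (q x) dominates 1 + norm x, so decay of
    \<open>h\<close> at \<open>q x\<close> becomes decay in \<open>x\<close>. On \<open>U\<close>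
    all coefficients vanish, and since \<open>U\<close> is open, so do their derivatives.\<close>
  define U where "U = {x. C0 * (1 + norm (q x)) ^ N0 < 1 + norm x}"
  define dq where "dq b' x h = frechet_derivative (\<lambda>x. complex_of_real (q x \<bullet> b')) (at x) h" for b' x h
  have dq': "((\<lambda>x. complex_of_real (q x \<bullet> b')) has_derivative dq b' x) (at x)" if "b' \<in> Basis" for b' x
    unfolding dq_def by (rule smooth_has_derivative0[OF tempered_smooth[OF q[OF that]]])
  have q': "((\<lambda>x. q x \<bullet> b') has_derivative (\<lambda>h. Re (dq b' x h))) (at x)" if "b' \<in> Basis" for b' x
    using has_derivative_Re[OF dq'[OF that], of x] by simp
  have Re_dq: "of_real (Re (dq b' x h)) = dq b' x h" if "b' \<in> Basis" for b' x h
    using fun_cong[OF has_derivative_unique[OF has_derivative_of_real[OF q'[OF that]] dq'[OF that]]] .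
  have Dq: "(q has_derivative (\<lambda>h. \<Sum>b'\<in>Basis. Re (dq b' x h) *\<^sub>R b')) (at x)" for x
  proof -
    have "((\<lambda>x. \<Sum>b'\<in>Basis. (q x \<bullet> b') *\<^sub>R b') has_derivative (\<lambda>h. \<Sum>b'\<in>Basis. Re (dq b' x h) *\<^sub>R b')) (at x)"
      by (intro has_derivative_sum has_derivative_scaleR_left q')
    then show ?thesis by (simp add: euclidean_representation)
  qed
  have cq: "continuous_on UNIV q"
    by (intro continuous_at_imp_continuous_on ballI has_derivative_continuous[OF Dq])
  have "open U" unfolding U_def by (intro open_Collect_less continuous_intros cq)
  define \<G> where "\<G> = {\<lambda>h x. u x * iterated_partial cs h (q x) | u cs. tempered u \<and> cs \<in> lists Basis \<and> (\<forall>x\<in>U. u x = 0)}"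
  obtain Bs where Bs: "set Bs = (Basis :: 'a set)" "distinct Bs" using finite_distinct_list[OF finite_Basis] by blast
  have "schwartz_op (\<lambda>h x. g x * iterated_partial [] h (q x))"
  proof (rule schwartz_opI[of \<G>])
    fix T assume "T \<in> \<G>"
    then obtain u cs where T: "T = (\<lambda>h x. u x * iterated_partial cs h (q x))" and u: "tempered u" "\<forall>x\<in>U. u x = 0"
      and cs: "cs \<in> lists Basis" by (auto simp: \<G>_def)
    let ?du = "\<lambda>b x. frechet_derivative u (at x) b"
    define Ts where "Ts b = (\<lambda>h x. ?du b x * iterated_partial cs h (q x)) #
       map (\<lambda>b' h x. (u x * dq b' x b) * iterated_partial (b' # cs) h (q x)) Bs" for b
    have A: "set (Ts b) \<subseteq> \<G>" if b: "b \<in> Basis" for b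
    proof -
      have du0: "?du b x = 0" if "x \<in> U" for x
      proof -
        have "(u has_derivative (\<lambda>h. 0)) (at x)"
          by (rule has_derivative_transform_within_open[OF has_derivative_const[of 0] \<open>open U\<close> that])
            (use u in auto)
        from fun_cong[OF frechet_derivative_at[OF this], of b] show ?thesis by simp
      qed
      have "(\<lambda>h x. ?du b x * iterated_partial cs h (q x)) \<in> \<G>" unfolding \<G>_def
        by (intro CollectI exI[of _ "?du b"] exI[of _ cs]) (simp add: tempered_partial[OF u(1) b] cs du0)
      moreover have "(\<lambda>h x. (u x * dq b' x b) * iterated_partial (b' # cs) h (q x)) \<in> \<G>" if b': "b' \<in> Basis" for b'
      proof -
        have "tempered (\<lambda>x. u x * dq b' x b)" unfolding dq_def
          by (intro tempered_mult u(1) tempered_partial q b b')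
        moreover have "b' # cs \<in> lists Basis" "\<forall>x\<in>U. u x * dq b' x b = 0" using b' cs u by auto
        ultimately show ?thesis unfolding \<G>_def
          by (intro CollectI exI[of _ "\<lambda>x. u x * dq b' x b"] exI[of _ "b' # cs"]) simp
      qed
      ultimately show ?thesis using Bs by (auto simp: Ts_def)
    qed
    have B: "\<exists>D. (T h has_derivative D) (at x) \<and> (\<forall>b\<in>Basis. D b = (\<Sum>T'\<leftarrow>Ts b. T' h x))"
      if h: "h \<in> schwartz" for h x
    proof -
      let ?h = "iterated_partial cs h"
      let ?dh = "frechet_derivative ?h (at (q x))"
      have dh: "(?h has_derivative ?dh) (at (q x))" by (rule smooth_has_derivative[OF schwartz_smooth[OF h] cs])
      have eq: "?dh (\<Sum>b'\<in>Basis. Re (dq b' x k) *\<^sub>R b') = (\<Sum>b'\<in>Basis. dq b' x k * iterated_partial (b' # cs) h (q x))" for k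
      proof -
        interpret linear ?dh using dh has_derivative_linear by blast
        show ?thesis by (simp add: sum scale iterated_partial_Cons scaleR_conv_of_real Re_dq)
      qed
      have "(T h has_derivative (\<lambda>k. u x * ?dh (\<Sum>b'\<in>Basis. Re (dq b' x k) *\<^sub>R b') + frechet_derivative u (at x) k * ?h (q x))) (at x)"
        unfolding T by (intro has_derivative_mult smooth_has_derivative0 tempered_smooth u has_derivative_compose[OF Dq dh])
      then show ?thesis
        by - (rule exI, rule conjI, assumption, simp add: Ts_def o_def eq sum_list_distinct_conv_sum_set Bs sum_distrib_left mult.assoc)
    qed
    show "\<exists>Ts. (\<forall>b\<in>Basis. set (Ts b) \<subseteq> \<G>) \<and>
      (\<forall>f\<in>schwartz. \<forall>x. \<exists>D. (T f has_derivative D) (at x) \<and> (\<forall>b\<in>Basis. D b = (\<Sum>T'\<leftarrow>Ts b. T' f x)))"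
      by (rule exI[of _ Ts], intro conjI ballI allI, erule A, erule B)
  next
    fix T N assume "T \<in> \<G>"
    then obtain u cs where T: "T = (\<lambda>h x. u x * iterated_partial cs h (q x))" and u: "tempered u" "\<forall>x\<in>U. u x = 0"
      and cs: "cs \<in> lists Basis" by (auto simp: \<G>_def)
    obtain N1 C1 where NC: "\<forall>x. norm (u x) \<le> C1 * (1 + norm x) ^ N1" using tempered_bound[OF u(1)] by blast
    define M where "M = max (length cs) (N0 * (N + N1))"
    show "\<exists>M C. \<forall>h\<in>schwartz. \<forall>x. (1 + norm x) ^ N * norm (T h x) \<le> C * pnorm M h"
    proof (intro exI ballI allI)
      fix h :: "'a \<Rightarrow> complex" and x assume h: "h \<in> schwartz"
      show "(1 + norm x) ^ N * norm (T h x) \<le> (\<bar>C1\<bar> * \<bar>C0\<bar> ^ (N + N1)) * pnorm M h"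
      proof (cases "x \<in> U")
        case True
        then have "T h x = 0" using u(2) by (simp add: T)
        moreover have "0 \<le> (\<bar>C1\<bar> * \<bar>C0\<bar> ^ (N + N1)) * pnorm M h"
          by (intro mult_nonneg_nonneg pnorm_nonneg[OF h]) simp_all
        ultimately show ?thesis by (simp only: norm_zero mult_zero_right)
      next
        case False
        then have "1 + norm x \<le> C0 * (1 + norm (q x)) ^ N0" by (simp add: U_def not_less)
        also have "\<dots> \<le> \<bar>C0\<bar> * (1 + norm (q x)) ^ N0" by (intro mult_right_mono) auto
        finally have "(1 + norm x) ^ (N + N1) \<le> (\<bar>C0\<bar> * (1 + norm (q x)) ^ N0) ^ (N + N1)"
          by (intro power_mono) auto
        then have 1: "(1 + norm x) ^ (N + N1) \<le> \<bar>C0\<bar> ^ (N + N1) * (1 + norm (q x)) ^ (N0 * (N + N1))"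
          by (simp add: power_mult_distrib power_mult)
        have "norm (u x) \<le> \<bar>C1\<bar> * (1 + norm x) ^ N1" by (rule bound_weaken[of _ C1 _ N1]) (use NC in auto)
        then have "(1 + norm x) ^ N * norm (T h x) \<le>
            (1 + norm x) ^ N * ((\<bar>C1\<bar> * (1 + norm x) ^ N1) * norm (iterated_partial cs h (q x)))"
          unfolding T norm_mult by (intro mult_left_mono mult_right_mono) auto
        also have "\<dots> = \<bar>C1\<bar> * ((1 + norm x) ^ (N + N1) * norm (iterated_partial cs h (q x)))"
          by (simp add: power_add mult_ac)
        also have "\<dots> \<le> \<bar>C1\<bar> * ((\<bar>C0\<bar> ^ (N + N1) * (1 + norm (q x)) ^ (N0 * (N + N1))) * norm (iterated_partial cs h (q x)))"
          by (intro mult_left_mono mult_right_mono 1) auto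
        also have "\<dots> = (\<bar>C1\<bar> * \<bar>C0\<bar> ^ (N + N1)) * ((1 + norm (q x)) ^ (N0 * (N + N1)) * norm (iterated_partial cs h (q x)))"
          by (simp add: mult_ac)
        also have "\<dots> \<le> (\<bar>C1\<bar> * \<bar>C0\<bar> ^ (N + N1)) * pnorm M h"
          by (intro mult_left_mono pnorm_upper[OF h cs]) (auto simp: M_def)
        finally show ?thesis .
      qed
    qed
  next
    show "(\<lambda>h x. g x * iterated_partial [] h (q x)) \<in> \<G>"
      unfolding \<G>_def using g supp by (intro CollectI exI[of _ g] exI[of _ "[]"]) (auto simp: U_def)
  qed (simp add: right_diff_distrib)
  then show ?thesis by simp
qed

lemma schwartz_op_mult:
  assumes "tempered g"
  shows "schwartz_op (\<lambda>h x. g x * h x)"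
  by (rule schwartz_op_pullback[where q = "\<lambda>x. x" and ?C0.0 = 1 and ?N0.0 = 1])
    (simp_all add: assms tempered_inner)

lemma schwartz_op_id: "schwartz_op (\<lambda>f. f)"
  using schwartz_op_mult[of "\<lambda>x. 1"] by simp

lemma schwartz_op_iterated_partial:
  fixes cs :: "'a::euclidean_space list"
  assumes cs: "cs \<in> lists Basis"
  shows "schwartz_op (iterated_partial cs)"
proof (rule schwartz_op_criterion)
  fix f assume f: "f \<in> (schwartz :: ('a \<Rightarrow> complex) set)"
  show "smooth (iterated_partial cs f)" by (rule smooth_iterated_partial[OF schwartz_smooth[OF f] cs])
  fix g x assume g: "g \<in> (schwartz :: ('a \<Rightarrow> complex) set)"
  show "iterated_partial cs (\<lambda>x. f x - g x) x = iterated_partial cs f x - iterated_partial cs g x"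
    by (rule fun_cong[OF iterated_partial_diff[OF schwartz_smooth[OF f] schwartz_smooth[OF g] cs]])
next
  fix N bs assume "bs \<in> lists (Basis :: 'a set)"
  then have bc: "bs @ cs \<in> lists Basis" using cs by simp
  have "(1 + norm x) ^ N * norm (iterated_partial bs (iterated_partial cs f) x) \<le> 1 * pnorm (max N (length (bs @ cs))) f"
    if f: "f \<in> schwartz" for f :: "'a \<Rightarrow> complex" and x
    using pnorm_upper[OF f bc, of N "max N (length (bs @ cs))" x] by (simp add: iterated_partial_append)
  then show "\<exists>M C. \<forall>f\<in>schwartz. \<forall>x. (1 + norm x) ^ N * norm (iterated_partial bs (iterated_partial cs f) x) \<le> C * pnorm M f"
    by (intro exI ballI allI)
qed

lemma schwartz_op_partial:
  fixes b :: "'a::euclidean_space"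
  assumes "b \<in> Basis"
  shows "schwartz_op (\<lambda>f x. frechet_derivative f (at x) b)"
proof -
  have "[b] \<in> lists Basis" using assms by simp
  then have "schwartz_op (iterated_partial [b])" by (rule schwartz_op_iterated_partial)
  moreover have "iterated_partial [b] = (\<lambda>f x. frechet_derivative f (at x) b)"
    by (intro ext) (simp only: iterated_partial_Cons iterated_partial_Nil)
  ultimately show ?thesis by (simp only:)
qed
section \<open>Integrals of Schwartz functions and differentiation under the integral\<close>

lemma integral_lborel_prod:
  fixes f :: "'a::euclidean_space \<Rightarrow> real \<Rightarrow> 'c::{real_normed_field,banach,second_countable_topology}"
  assumes f: "\<And>b. b \<in> Basis \<Longrightarrow> integrable lborel (f b)"
  shows "integrable lborel (\<lambda>x. \<Prod>b\<in>Basis. f b (x \<bullet> b))"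
    and "(LINT x|lborel. (\<Prod>b\<in>Basis. f b (x \<bullet> b))) = (\<Prod>b\<in>Basis. LINT t|lborel. f b t)"
proof -
  interpret product_sigma_finite "\<lambda>b::'a. lborel :: real measure" by standard
  let ?\<phi> = "\<lambda>u. \<Sum>b\<in>Basis. u b *\<^sub>R (b::'a)"
  have m: "f b \<in> borel_measurable borel" if "b \<in> Basis" for b
    using borel_measurable_integrable[OF f[OF that]] by simp
  have m': "(\<lambda>x::'a. \<Prod>b\<in>Basis. f b (x \<bullet> b)) \<in> borel_measurable borel"
    by (intro borel_measurable_prod) (rule measurable_compose[OF _ m], simp_all)
  have \<phi>: "?\<phi> \<in> measurable (\<Pi>\<^sub>M b\<in>Basis. lborel) borel" by measurable
  have eq: "(\<lambda>u. \<Prod>b\<in>Basis. f b (?\<phi> u \<bullet> b)) = (\<lambda>u. \<Prod>b\<in>Basis. f b (u b))"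
    by (intro ext prod.cong) (simp_all add: inner_sum_left inner_Basis if_distrib cong: if_cong)
  show "integrable lborel (\<lambda>x. \<Prod>b\<in>Basis. f b (x \<bullet> b))"
    unfolding lborel_eq[where 'a = 'a] integrable_distr_eq[OF \<phi> m'] eq
    by (rule product_integrable_prod) (simp_all add: f)
  show "(LINT x|lborel. (\<Prod>b\<in>Basis. f b (x \<bullet> b))) = (\<Prod>b\<in>Basis. LINT t|lborel. f b t)"
    unfolding lborel_eq[where 'a = 'a] integral_distr[OF \<phi> m'] eq
    by (rule product_integral_prod) (simp_all add: f)
qed

text \<open>The exponent \<open>2 * DIM('a)\<close> lets the product over the coordinates of 1 / (1
  + t^2) serve as an integrable majorant.\<close>

definition weight :: "'a::euclidean_space \<Rightarrow> real" where
  "weight x = 1 / (1 + norm x) ^ (2 * DIM('a))"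

lemma weight_measurable [measurable]: "weight \<in> borel_measurable borel"
  unfolding weight_def by measurable

lemma weight_nonneg: "0 \<le> weight x" by (simp add: weight_def)

lemma weight_integrable: "integrable lborel (weight :: 'a::euclidean_space \<Rightarrow> real)"
proof (rule Bochner_Integration.integrable_bound)
  have "integrable lborel (\<lambda>t::real. inverse (1 + t\<^sup>2))"
    using integrable_inverse_1_plus_square by (simp add: set_integrable_def)
  then show "integrable lborel (\<lambda>x::'a. \<Prod>b\<in>Basis. inverse (1 + (x \<bullet> b)\<^sup>2))"
    by (intro integral_lborel_prod)
  have "weight x \<le> (\<Prod>b\<in>Basis. inverse (1 + (x \<bullet> b)\<^sup>2))" for x :: 'a
  proof -
    have "(\<Prod>b\<in>Basis. 1 + (x \<bullet> b)\<^sup>2) \<le> (\<Prod>b\<in>(Basis::'a set). (1 + norm x)\<^sup>2)"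
    proof (intro prod_mono conjI)
      fix b :: 'a assume "b \<in> Basis"
      then have "(x \<bullet> b)\<^sup>2 \<le> (norm x)\<^sup>2"
        using Basis_le_norm[of b x] by (metis abs_ge_zero power2_abs power_mono)
      then show "1 + (x \<bullet> b)\<^sup>2 \<le> (1 + norm x)\<^sup>2"
        using norm_ge_zero[of x] by (simp add: power2_sum del: norm_ge_zero)
    qed simp
    also have "\<dots> = (1 + norm x) ^ (2 * DIM('a))" by (simp add: power_mult)
    finally have "(\<Prod>b\<in>Basis. 1 + (x \<bullet> b)\<^sup>2) \<le> (1 + norm x) ^ (2 * DIM('a))" .
    moreover have "0 < (\<Prod>b\<in>Basis. 1 + (x \<bullet> b)\<^sup>2)" by (intro prod_pos) (simp add: add_pos_nonneg)
    ultimately have "inverse ((1 + norm x) ^ (2 * DIM('a))) \<le> inverse (\<Prod>b\<in>Basis. 1 + (x \<bullet> b)\<^sup>2)"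
      by (rule le_imp_inverse_le)
    also have "\<dots> = (\<Prod>b\<in>Basis. inverse (1 + (x \<bullet> b)\<^sup>2))"
      using prod_inversef[of "\<lambda>b. 1 + (x \<bullet> b)\<^sup>2" Basis] by (simp add: o_def)
    finally show ?thesis by (simp add: weight_def inverse_eq_divide)
  qed
  note * = this
  show "AE x in lborel. norm (weight x) \<le> norm (\<Prod>b\<in>Basis. inverse (1 + ((x::'a) \<bullet> b)\<^sup>2))"
  proof (rule AE_I2)
    fix x :: 'a
    have "norm (weight x) = weight x" by (simp add: weight_nonneg)
    also have "\<dots> \<le> (\<Prod>b\<in>Basis. inverse (1 + (x \<bullet> b)\<^sup>2))" by (rule *)
    also have "\<dots> \<le> norm (\<Prod>b\<in>Basis. inverse (1 + (x \<bullet> b)\<^sup>2))" by simp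
    finally show "norm (weight x) \<le> norm (\<Prod>b\<in>Basis. inverse (1 + (x \<bullet> b)\<^sup>2))" .
  qed
qed simp

lemma weighted_bound:
  fixes f :: "'a::euclidean_space \<Rightarrow> complex"
  assumes m: "f \<in> borel_measurable borel"
    and bound: "\<And>x. (1 + norm x) ^ (2 * DIM('a)) * norm (f x) \<le> B"
  shows "integrable lborel f" and "norm (LINT x|lborel. f x) \<le> B * (LINT x|lborel. weight (x::'a))"
proof -
  have le: "norm (f x) \<le> B * weight x" for x
    using bound[of x] by (simp add: weight_def field_simps add_pos_nonneg)
  have i: "integrable lborel (\<lambda>x::'a. B * weight x)" by (rule integrable_mult_right[OF weight_integrable])
  show f: "integrable lborel f"
    by (rule Bochner_Integration.integrable_bound[OF i]) (use m le in \<open>auto intro!: AE_I2 order_trans[OF le]\<close>)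
  have "norm (LINT x|lborel. f x) \<le> (LINT x|lborel. norm (f x))" by (rule integral_norm_bound)
  also have "\<dots> \<le> (LINT x|lborel. B * weight (x::'a))"
    by (rule integral_mono[OF integrable_norm[OF f] i]) (rule le)
  finally show "norm (LINT x|lborel. f x) \<le> B * (LINT x|lborel. weight (x::'a))" by simp
qed

lemma schwartz_measurable [measurable_dest]: "f \<in> schwartz \<Longrightarrow> f \<in> borel_measurable borel"
  using smooth_continuous[OF schwartz_smooth, of f "[]"] by (intro borel_measurable_continuous_onI) simp

lemma tempered_measurable: "tempered f \<Longrightarrow> f \<in> borel_measurable borel"
  using smooth_continuous[OF tempered_smooth, of f "[]"] by (intro borel_measurable_continuous_onI) simp

lemma schwartz_integrable_bound:
  fixes f :: "'a::euclidean_space \<Rightarrow> complex"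
  assumes f: "f \<in> schwartz" and u: "u \<in> borel_measurable borel" "\<And>x. norm (u x) \<le> C * (1 + norm x) ^ N"
  shows "integrable lborel (\<lambda>x. f x * u x)"
    and "norm (LINT x|lborel. f x * u x) \<le> (\<bar>C\<bar> * (LINT x|lborel. weight (x::'a))) * pnorm (2 * DIM('a) + N) f"
proof -
  have b: "(1 + norm x) ^ (2 * DIM('a)) * norm (f x * u x) \<le> \<bar>C\<bar> * pnorm (2 * DIM('a) + N) f" for x
  proof -
    have "norm (u x) \<le> \<bar>C\<bar> * (1 + norm x) ^ N" by (rule bound_weaken[OF u(2)[of x]]) simp_all
    then have "(1 + norm x) ^ (2 * DIM('a)) * norm (f x * u x) \<le>
        (1 + norm x) ^ (2 * DIM('a)) * (norm (f x) * (\<bar>C\<bar> * (1 + norm x) ^ N))"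
      unfolding norm_mult by (intro mult_left_mono) simp_all
    also have "\<dots> = \<bar>C\<bar> * ((1 + norm x) ^ (2 * DIM('a) + N) * norm (iterated_partial [] f x))"
      by (simp add: power_add mult_ac)
    also have "\<dots> \<le> \<bar>C\<bar> * pnorm (2 * DIM('a) + N) f"
      by (intro mult_left_mono pnorm_upper[OF f]) simp_all
    finally show ?thesis .
  qed
  have m: "(\<lambda>x. f x * u x) \<in> borel_measurable borel" using schwartz_measurable[OF f] u(1) by simp
  show "integrable lborel (\<lambda>x. f x * u x)" by (rule weighted_bound(1)[OF m b])
  show "norm (LINT x|lborel. f x * u x) \<le> (\<bar>C\<bar> * (LINT x|lborel. weight (x::'a))) * pnorm (2 * DIM('a) + N) f"
    using weighted_bound(2)[OF m b] by (simp add: mult_ac)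
qed

lemma schwartz_integrable: "f \<in> schwartz \<Longrightarrow> integrable lborel f"
  using schwartz_integrable_bound(1)[of f "\<lambda>x. 1" 1 0] by simp

text \<open>The mean value inequality on the convex set \<open>S\<close> bounds the increment of the
  integrand by \<open>B w\<close> times the norm of the step. The normalised remainder is then
  dominated by \<open>2 * B w\<close>, and dominated convergence applies along every sequence
  tending to 0.\<close>

lemma has_derivative_integral:
  fixes k :: "'a::euclidean_space \<Rightarrow> 'b \<Rightarrow> complex"
  assumes S: "open S" "convex S" "x \<in> S"
    and der: "\<And>y w. y \<in> S \<Longrightarrow> ((\<lambda>y. k y w) has_derivative k' y w) (at y)"
    and bound: "\<And>y w h. y \<in> S \<Longrightarrow> norm (k' y w h) \<le> B w * norm h"
    and B: "integrable M B"
    and int: "\<And>y. y \<in> S \<Longrightarrow> integrable M (k y)"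
    and meas: "\<And>h. (\<lambda>w. k' x w h) \<in> borel_measurable M"
  shows "((\<lambda>y. LINT w|M. k y w) has_derivative (\<lambda>h. LINT w|M. k' x w h)) (at x)"
proof -
  have bl: "bounded_linear (k' y w)" if "y \<in> S" for y w
    using der[OF that] has_derivative_bounded_linear by blast
  have B0: "0 \<le> B w" for w
  proof -
    obtain b :: 'a where "b \<in> Basis" using nonempty_Basis by blast
    then show ?thesis using order_trans[OF norm_ge_zero bound[OF S(3), of w b]] by simp
  qed
  have int': "integrable M (\<lambda>w. k' x w h)" for h
    by (rule Bochner_Integration.integrable_bound[of M "\<lambda>w. B w * norm h"])
      (use B meas bound[OF S(3)] B0 in \<open>auto intro!: AE_I2\<close>)
  show ?thesis unfolding has_derivative_at
  proof
    show "bounded_linear (\<lambda>h. LINT w|M. k' x w h)"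
    proof (rule bounded_linear_intro)
      fix g h r
      interpret bounded_linear "k' x w" for w by (rule bl[OF S(3)])
      show "(LINT w|M. k' x w (g + h)) = (LINT w|M. k' x w g) + (LINT w|M. k' x w h)"
        unfolding add by (rule Bochner_Integration.integral_add[OF int' int'])
      show "(LINT w|M. k' x w (r *\<^sub>R h)) = r *\<^sub>R (LINT w|M. k' x w h)"
        unfolding scaleR by simp
      have "norm (LINT w|M. k' x w h) \<le> (LINT w|M. norm (k' x w h))" by (rule integral_norm_bound)
      also have "\<dots> \<le> (LINT w|M. B w * norm h)"
        by (rule integral_mono[OF integrable_norm[OF int']]) (use B bound[OF S(3)] in auto)
      finally show "norm (LINT w|M. k' x w h) \<le> norm h * (LINT w|M. B w)" by (simp add: mult.commute)
    qed
    show "(\<lambda>h. norm ((LINT w|M. k (x + h) w) - (LINT w|M. k x w) - (LINT w|M. k' x w h)) / norm h) \<midarrow>0\<rightarrow> 0"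
      unfolding tendsto_at_iff_sequentially
    proof (intro allI impI)
      fix X :: "nat \<Rightarrow> 'a" assume X: "\<forall>i. X i \<in> UNIV - {0}" "X \<longlonglongrightarrow> 0"
      have "(\<lambda>i. x + X i) \<longlonglongrightarrow> x" using tendsto_add[OF tendsto_const X(2), of x] by simp
      then have "eventually (\<lambda>i. x + X i \<in> S) sequentially"
        using S(1,3) topological_tendstoD by blast
      \<comment> \<open>Indices are shifted by \<open>i0\<close> so that all points lie in
        \<open>S\<close>, where the bounds hold.\<close>
      then obtain i0 where i0: "\<And>i. i \<ge> i0 \<Longrightarrow> x + X i \<in> S" by (auto simp: eventually_sequentially)
      define q where "q i w = (k (x + X (i + i0)) w - k x w - k' x w (X (i + i0))) / of_real (norm (X (i + i0)))" for i w
      have iS: "x + X (i + i0) \<in> S" for i by (rule i0) simp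
      have "(\<lambda>i. LINT w|M. q i w) \<longlonglongrightarrow> (LINT w|M. 0)"
      proof (rule integral_dominated_convergence[where w = "\<lambda>w. 2 * B w"])
        show "q i \<in> borel_measurable M" for i unfolding q_def
          using borel_measurable_integrable[OF int[OF iS[of i]]] borel_measurable_integrable[OF int[OF S(3)]]
            meas[of "X (i + i0)"] by simp
        show "AE w in M. norm (q i w) \<le> 2 * B w" for i
        proof (rule AE_I2)
          fix w
          have "norm (k (x + X (i + i0)) w - k x w) \<le> B w * norm ((x + X (i + i0)) - x)"
          proof (rule differentiable_bound[OF S(2) _ _ iS S(3)])
            fix y assume y: "y \<in> S"
            show "((\<lambda>y. k y w) has_derivative k' y w) (at y within S)"
              using der[OF y] has_derivative_at_withinI by blast
            show "onorm (k' y w) \<le> B w" by (rule onorm_le) (rule bound[OF y])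
          qed
          then have "norm (k (x + X (i + i0)) w - k x w - k' x w (X (i + i0))) \<le> 2 * B w * norm (X (i + i0))"
            using bound[OF S(3), of w "X (i + i0)"]
              norm_triangle_ineq4[of "k (x + X (i + i0)) w - k x w" "k' x w (X (i + i0))"] by simp
          moreover have "norm (X (i + i0)) > 0" using X by simp
          ultimately show "norm (q i w) \<le> 2 * B w"
            unfolding q_def by (simp add: norm_divide divide_le_eq)
        qed
        show "AE w in M. (\<lambda>i. q i w) \<longlonglongrightarrow> 0"
        proof (rule AE_I2)
          fix w
          have "(\<lambda>h. norm (k (x + h) w - k x w - k' x w h) / norm h) \<midarrow>0\<rightarrow> 0"
            using der[OF S(3)] by (simp add: has_derivative_at)
          then have "((\<lambda>h. norm (k (x + h) w - k x w - k' x w h) / norm h) \<circ> X) \<longlonglongrightarrow> 0"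
            using X unfolding tendsto_at_iff_sequentially by blast
          then have "(\<lambda>i. norm (k (x + X (i + i0)) w - k x w - k' x w (X (i + i0))) / norm (X (i + i0))) \<longlonglongrightarrow> 0"
            unfolding o_def by (rule LIMSEQ_ignore_initial_segment)
          then show "(\<lambda>i. q i w) \<longlonglongrightarrow> 0"
            by (intro tendsto_norm_zero_cancel[of "\<lambda>i. q i w"]) (simp add: q_def norm_divide)
        qed
      qed (use B in auto)
      then have "(\<lambda>i. norm (LINT w|M. q i w)) \<longlonglongrightarrow> 0" by (simp add: tendsto_norm_zero)
      moreover have "norm (LINT w|M. q i w) = norm ((LINT w|M. k (x + X (i + i0)) w) - (LINT w|M. k x w) -
          (LINT w|M. k' x w (X (i + i0)))) / norm (X (i + i0))" for i
        unfolding q_def using int[OF iS[of i]] int[OF S(3)] int' by (simp add: norm_divide)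
      ultimately have "(\<lambda>i. ((\<lambda>h. norm ((LINT w|M. k (x + h) w) - (LINT w|M. k x w) - (LINT w|M. k' x w h)) / norm h) \<circ> X) (i + i0)) \<longlonglongrightarrow> 0"
        by simp
      then show "((\<lambda>h. norm ((LINT w|M. k (x + h) w) - (LINT w|M. k x w) - (LINT w|M. k' x w h)) / norm h) \<circ> X) \<longlonglongrightarrow> 0"
        by (rule LIMSEQ_offset)
    qed
  qed
qed

section \<open>The Fourier transform\<close>

lemma lborel_integral_translate:
  fixes f :: "'a::euclidean_space \<Rightarrow> complex"
  assumes "f \<in> borel_measurable borel"
  shows "(LINT x|lborel. f (x + c)) = (LINT x|lborel. f x)"
proof -
  have "(LINT x|lborel. f x) = (LINT x|distr lborel borel ((+) c). f x)" by (simp add: lborel_distr_plus)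
  also have "\<dots> = (LINT x|lborel. f (c + x))" by (rule integral_distr) (use assms in auto)
  finally show ?thesis by (simp add: add.commute)
qed

lemma lborel_integral_scale:
  fixes f :: "'a::euclidean_space \<Rightarrow> complex"
  assumes "f \<in> borel_measurable borel" "0 < c"
  shows "(LINT x|lborel. f x) = c ^ DIM('a) *\<^sub>R (LINT x|lborel. f (c *\<^sub>R x))"
proof -
  have "(LINT x|lborel. f x) = (LINT x|density (distr lborel borel (\<lambda>x. 0 + c *\<^sub>R x)) (\<lambda>_. ennreal (\<bar>c\<bar> ^ DIM('a))). f x)"
    using lborel_affine[of c "0::'a"] assms by (simp add: ennreal_power)
  also have "\<dots> = (LINT x|distr lborel borel (\<lambda>x. 0 + c *\<^sub>R x). \<bar>c\<bar> ^ DIM('a) *\<^sub>R f x)"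
    by (rule integral_density) (use assms in auto)
  also have "\<dots> = (LINT x|lborel. \<bar>c\<bar> ^ DIM('a) *\<^sub>R f (c *\<^sub>R x))"
    by (subst integral_distr) (use assms in auto)
  finally show ?thesis using assms by simp
qed

lemma lborel_integrable_scale:
  fixes f :: "'a::euclidean_space \<Rightarrow> complex"
  assumes f: "integrable lborel f" and c: "0 < c"
  shows "integrable lborel (\<lambda>x. f (c *\<^sub>R x))"
proof -
  have m: "f \<in> borel_measurable borel" using borel_measurable_integrable[OF f] by simp
  have "integrable (density (distr lborel borel (\<lambda>x. 0 + c *\<^sub>R x)) (\<lambda>_. ennreal (\<bar>c\<bar> ^ DIM('a)))) f"
    using lborel_affine[of c "0::'a"] f c by (simp add: ennreal_power)
  then have "integrable (distr lborel borel (\<lambda>x. 0 + c *\<^sub>R x)) (\<lambda>x. \<bar>c\<bar> ^ DIM('a) *\<^sub>R f x)"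
    by (subst (asm) integrable_density) (use m in auto)
  then have "integrable lborel (\<lambda>x. \<bar>c\<bar> ^ DIM('a) *\<^sub>R f (c *\<^sub>R x))"
    by (subst (asm) integrable_distr_eq) (use m in auto)
  from integrable_scaleR_right[OF this, of "1 / \<bar>c\<bar> ^ DIM('a)"] show ?thesis using c by simp
qed

lemma schwartz_translate: "f \<in> schwartz \<Longrightarrow> (\<lambda>x. f (x + c)) \<in> schwartz"
proof -
  assume f: "f \<in> schwartz"
  have "schwartz_op (\<lambda>h x. 1 * h (x + c))"
  proof (rule schwartz_op_pullback[where ?C0.0 = "2 + norm c" and ?N0.0 = 1])
    fix b :: 'a
    show "tempered (\<lambda>x. complex_of_real ((x + c) \<bullet> b))"
      by (simp add: inner_add_left tempered_add tempered_inner)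
  next
    fix x
    have "norm x \<le> norm (x + c) + norm c" using norm_triangle_ineq4[of "x + c" c] by simp
    moreover have "0 \<le> norm (x + c) + norm (x + c) * norm c" by simp
    ultimately have "1 + norm x \<le> (2 + norm c) * (1 + norm (x + c)) ^ 1"
      using norm_ge_zero[of "x + c"] by (simp add: algebra_simps del: norm_ge_zero)
    moreover assume "(2 + norm c) * (1 + norm (x + c)) ^ 1 < 1 + norm x"
    ultimately show "1 = (0::complex)" by linarith
  qed simp
  from schwartz_op_in[OF this f] show ?thesis by simp
qed

text \<open>The integral of \<open>f (w + t b)\<close> is constant in \<open>t\<close> by
  translation invariance, and its derivative at t = 0 is the integral of the partial
  derivative.\<close>

lemma integral_partial_zero:
  fixes f :: "'a::euclidean_space \<Rightarrow> complex"
  assumes f: "f \<in> schwartz" and b: "b \<in> Basis"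
  shows "(LINT x|lborel. frechet_derivative f (at x) b) = 0"
proof -
  let ?d = "\<lambda>x. frechet_derivative f (at x) b"
  have d: "?d \<in> schwartz" by (rule schwartz_op_in[OF schwartz_op_partial[OF b] f])
  define P where "P = pnorm (2 * DIM('a)) ?d"
  have df: "((\<lambda>t. f (w + t *\<^sub>R b)) has_derivative (\<lambda>h. h *\<^sub>R ?d (w + t *\<^sub>R b))) (at t)" for w t
  proof -
    have 1: "((\<lambda>t. w + t *\<^sub>R b) has_derivative (\<lambda>h. h *\<^sub>R b)) (at t)"
      by (auto intro!: derivative_eq_intros)
    have 2: "(f has_derivative frechet_derivative f (at (w + t *\<^sub>R b))) (at (w + t *\<^sub>R b))"
      by (rule smooth_has_derivative0[OF schwartz_smooth[OF f]])
    interpret linear "frechet_derivative f (at (w + t *\<^sub>R b))" using 2 has_derivative_linear by blast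
    show ?thesis using has_derivative_compose[OF 1 2] by (simp add: scale)
  qed
  have "((\<lambda>t. LINT w|lborel. f (w + t *\<^sub>R b)) has_derivative (\<lambda>h. LINT w|lborel. h *\<^sub>R ?d (w + 0 *\<^sub>R b))) (at 0)"
  proof (rule has_derivative_integral[where S = "ball 0 1" and B = "\<lambda>w. (2 ^ (2 * DIM('a)) * P) * weight w"])
    fix y h :: real and w :: 'a assume y: "y \<in> ball 0 1"
    show "((\<lambda>y. f (w + y *\<^sub>R b)) has_derivative (\<lambda>h. h *\<^sub>R ?d (w + y *\<^sub>R b))) (at y)" by (rule df)
    show "integrable lborel (\<lambda>w. f (w + y *\<^sub>R b))"
      by (rule schwartz_integrable[OF schwartz_translate[OF f]])
    \<comment> \<open>A shift by at most a unit vector changes 1 + norm w by at most a factor 2;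
      this gives a majorant independent of \<open>y\<close>.\<close>
    have "norm w \<le> norm (w + y *\<^sub>R b) + norm (y *\<^sub>R b)" using norm_triangle_ineq4[of "w + y *\<^sub>R b" "y *\<^sub>R b"] by simp
    also have "norm (y *\<^sub>R b) \<le> 1" using y b by simp
    finally have "norm w \<le> norm (w + y *\<^sub>R b) + 1" by simp
    then have "1 + norm w \<le> 2 * (1 + norm (w + y *\<^sub>R b))"
      using norm_ge_zero[of "w + y *\<^sub>R b"] by (simp del: norm_ge_zero)
    then have "(1 + norm w) ^ (2 * DIM('a)) \<le> (2 * (1 + norm (w + y *\<^sub>R b))) ^ (2 * DIM('a))"
      by (intro power_mono) auto
    from mult_right_mono[OF this norm_ge_zero[of "?d (w + y *\<^sub>R b)"]]
    have "(1 + norm w) ^ (2 * DIM('a)) * norm (?d (w + y *\<^sub>R b)) \<le>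
       2 ^ (2 * DIM('a)) * ((1 + norm (w + y *\<^sub>R b)) ^ (2 * DIM('a)) * norm (iterated_partial [] ?d (w + y *\<^sub>R b)))"
      unfolding power_mult_distrib by (simp only: mult.assoc iterated_partial_Nil)
    also have "\<dots> \<le> 2 ^ (2 * DIM('a)) * P" unfolding P_def
      by (intro mult_left_mono pnorm_upper[OF d]) simp_all
    finally have "norm (?d (w + y *\<^sub>R b)) \<le> (2 ^ (2 * DIM('a)) * P) * weight w"
      by (simp add: weight_def field_simps add_pos_nonneg)
    then have "norm h * norm (?d (w + y *\<^sub>R b)) \<le> norm h * ((2 ^ (2 * DIM('a)) * P) * weight w)"
      by (intro mult_left_mono) auto
    then show "norm (h *\<^sub>R ?d (w + y *\<^sub>R b)) \<le> (2 ^ (2 * DIM('a)) * P) * weight w * norm h"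
      by (simp add: mult_ac)
  next
    show "integrable lborel (\<lambda>w::'a. (2 ^ (2 * DIM('a)) * P) * weight w)"
      by (rule integrable_mult_right[OF weight_integrable])
    show "(\<lambda>w. h *\<^sub>R ?d (w + 0 *\<^sub>R b)) \<in> borel_measurable lborel" for h
      using schwartz_measurable[OF d] by simp
  qed simp_all
  moreover have "(\<lambda>t. LINT w|lborel. f (w + t *\<^sub>R b)) = (\<lambda>t. LINT w|lborel. f w)"
    by (intro ext lborel_integral_translate schwartz_measurable[OF f])
  ultimately have "((\<lambda>t::real. LINT w|lborel. f w) has_derivative (\<lambda>h. h *\<^sub>R (LINT w|lborel. ?d w))) (at 0)"
    by simp
  from fun_cong[OF has_derivative_unique[OF this has_derivative_const], of 1] show ?thesis by simp
qed

text \<open>The positive sign in the exponent is that of \<Phi> at - z, as it appears in the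
  spherical transform. No constant is included, so inversion carries the factor (2 pi)^d.\<close>

definition four :: "('a::euclidean_space \<Rightarrow> complex) \<Rightarrow> 'a \<Rightarrow> complex" where
  "four f z = (LINT w|lborel. f w * cis (w \<bullet> z))"

lemma measurable_cis_inner [measurable]: "(\<lambda>w. cis (w \<bullet> z)) \<in> borel_measurable borel"
  by (intro borel_measurable_continuous_onI continuous_intros)

lemma measurable_cis_inner' [measurable]: "(\<lambda>w. cis (z \<bullet> w)) \<in> borel_measurable borel"
  by (intro borel_measurable_continuous_onI continuous_intros)

lemma four_integrable: "f \<in> schwartz \<Longrightarrow> integrable lborel (\<lambda>w. f w * cis (w \<bullet> z))"
  by (rule schwartz_integrable_bound(1)[of _ _ 1 0]) simp_all

lemma four_bound:
  fixes f :: "'a::euclidean_space \<Rightarrow> complex"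
  assumes "f \<in> schwartz"
  shows "norm (four f z) \<le> (LINT x|lborel. weight (x::'a)) * pnorm (2 * DIM('a)) f"
  using schwartz_integrable_bound(2)[OF assms, of "\<lambda>w. cis (w \<bullet> z)" 1 0] by (simp add: four_def)

lemma cis_has_vector_derivative: "(cis has_vector_derivative \<i> * cis t) (at t)"
  unfolding has_vector_derivative_def
  by (rule has_derivative_eq_rhs[OF has_derivative_cis[OF has_derivative_ident]])
    (simp add: fun_eq_iff scaleR_conv_of_real mult_ac)

lemma tempered_cis:
  assumes "tempered (\<lambda>x. of_real (q x))"
  shows "tempered (\<lambda>x. cis (q x))"
proof (rule tempered_compose[OF _ assms])
  have "tempered (\<lambda>t. 1 * cis t)"
  proof (rule temperedI_real[of "range (\<lambda>c t. c * cis t)"])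
    fix f assume "f \<in> range (\<lambda>c t. c * cis t)"
    then obtain c where f: "f = (\<lambda>t. c * cis t)" by auto
    have "(f has_vector_derivative (\<Sum>g\<leftarrow>[\<lambda>t. (c * \<i>) * cis t]. g t)) (at t)" for t
      using has_vector_derivative_mult_right[OF cis_has_vector_derivative, of c t] by (simp add: f mult_ac)
    then show "\<exists>fs. set fs \<subseteq> range (\<lambda>c t. c * cis t) \<and> (\<forall>x. (f has_vector_derivative (\<Sum>g\<leftarrow>fs. g x)) (at x))"
      by (intro exI[of _ "[\<lambda>t. (c * \<i>) * cis t]"]) simp
    show "\<exists>N C. \<forall>x. norm (f x) \<le> C * (1 + norm x) ^ N"
      by (rule exI[of _ 0], rule exI[of _ "norm c"]) (simp add: f norm_mult)
  qed (rule rangeI)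
  then show "tempered cis" by simp
qed

text \<open>The integral of the partial derivative of \<open>cis (w \<bullet> z) * f w\<close>
  vanishes; expanding it by the product rule gives the identity.\<close>

lemma four_partial:
  fixes f :: "'a::euclidean_space \<Rightarrow> complex"
  assumes f: "f \<in> schwartz" and b: "b \<in> Basis"
  shows "of_real (z \<bullet> b) * four f z = \<i> * four (\<lambda>x. frechet_derivative f (at x) b) z"
proof -
  let ?g = "\<lambda>w. cis (w \<bullet> z) * f w"
  let ?d = "\<lambda>x. frechet_derivative f (at x) b"
  have d: "?d \<in> schwartz" by (rule schwartz_op_in[OF schwartz_op_partial[OF b] f])
  have "?g \<in> schwartz"
    by (rule schwartz_op_in[OF schwartz_op_mult[OF tempered_cis[OF tempered_inner]] f])
  moreover have "frechet_derivative ?g (at w) b = ?d w * cis (w \<bullet> z) + (\<i> * of_real (z \<bullet> b)) * (f w * cis (w \<bullet> z))" for w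
  proof -
    have "((\<lambda>w. cis (w \<bullet> z)) has_derivative (\<lambda>h. (h \<bullet> z) *\<^sub>R (\<i> * cis (w \<bullet> z)))) (at w)"
      by (rule has_derivative_compose[OF _ cis_has_vector_derivative[unfolded has_vector_derivative_def], where f = "\<lambda>w. w \<bullet> z"])
        (auto intro!: derivative_eq_intros)
    from has_derivative_mult[OF this smooth_has_derivative0[OF schwartz_smooth[OF f]]]
    have "(?g has_derivative (\<lambda>h. cis (w \<bullet> z) * frechet_derivative f (at w) h + (h \<bullet> z) *\<^sub>R (\<i> * cis (w \<bullet> z)) * f w)) (at w)" .
    from fun_cong[OF frechet_derivative_at[OF this], of b] show ?thesis
      by (simp add: scaleR_conv_of_real inner_commute algebra_simps)
  qed
  ultimately have "(LINT w|lborel. ?d w * cis (w \<bullet> z) + (\<i> * of_real (z \<bullet> b)) * (f w * cis (w \<bullet> z))) = 0"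
    using integral_partial_zero[of ?g b] b by simp
  then have "four ?d z + (\<i> * of_real (z \<bullet> b)) * four f z = 0"
    unfolding four_def using four_integrable[OF f] four_integrable[OF d] by simp
  then have "\<i> * (four ?d z + (\<i> * of_real (z \<bullet> b)) * four f z) = 0" by simp
  then show ?thesis by (simp add: algebra_simps)
qed

lemma four_decay:
  "\<exists>M C. \<forall>f\<in>schwartz. \<forall>z::'a::euclidean_space. (1 + norm z) ^ N * norm (four f z) \<le> C * pnorm M f"
proof (induction N)
  case 0
  show ?case by (intro exI ballI allI) (simp, erule four_bound)
next
  case (Suc N)
  then obtain M C where MC: "\<forall>f\<in>schwartz. \<forall>z::'a. (1 + norm z) ^ N * norm (four f z) \<le> C * pnorm M f" by blast
  \<comment> \<open>The index 0, which is not a basis vector, stands for the identity, so that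
    \<open>f\<close> and its first partial derivatives form one finite family.\<close>
  let ?\<Psi> = "\<lambda>b f. if b = 0 then f else (\<lambda>x. frechet_derivative f (at x) b)"
  have op: "schwartz_op (?\<Psi> b)" if "b \<in> insert 0 Basis" for b :: 'a
    using that schwartz_op_partial schwartz_op_id by (cases "b = 0") auto
  have "\<exists>M C. 0 \<le> C \<and> (\<forall>f\<in>schwartz. \<forall>z::'a.
     (\<Sum>b\<in>insert 0 Basis. (1 + norm z) ^ N * norm (four (?\<Psi> b f) z)) \<le> C * pnorm M f)"
  proof (rule pbound_sum)
    fix b :: 'a assume b: "b \<in> insert 0 Basis"
    obtain M' C' where 2: "0 \<le> C'" "\<forall>f\<in>schwartz. pnorm M (?\<Psi> b f) \<le> C' * pnorm M' f"
      using schwartz_op_pnorm[OF op[OF b]] by blast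
    have "(1 + norm z) ^ N * norm (four (?\<Psi> b f) z) \<le> (\<bar>C\<bar> * C') * pnorm M' f" if f: "f \<in> schwartz" for f and z :: 'a
    proof -
      have g: "?\<Psi> b f \<in> schwartz" by (rule schwartz_op_in[OF op[OF b] f])
      have "(1 + norm z) ^ N * norm (four (?\<Psi> b f) z) \<le> C * pnorm M (?\<Psi> b f)"
        using MC g by blast
      also have "\<dots> \<le> \<bar>C\<bar> * pnorm M (?\<Psi> b f)" using pnorm_nonneg[OF g] by (intro mult_right_mono) simp_all
      also have "\<dots> \<le> \<bar>C\<bar> * (C' * pnorm M' f)" using 2 f by (intro mult_left_mono) simp_all
      finally show ?thesis by simp
    qed
    then show "\<exists>M C. \<forall>f\<in>schwartz. \<forall>z::'a. (1 + norm z) ^ N * norm (four (?\<Psi> b f) z) \<le> C * pnorm M f"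
      by (intro exI ballI allI)
  qed simp
  then obtain M' C' where MC': "\<forall>f\<in>schwartz. \<forall>z::'a.
     (\<Sum>b\<in>insert 0 Basis. (1 + norm z) ^ N * norm (four (?\<Psi> b f) z)) \<le> C' * pnorm M' f" by blast
  have "(1 + norm z) ^ Suc N * norm (four f z) \<le> C' * pnorm M' f" if f: "f \<in> schwartz" for f and z :: 'a
  proof -
    have "norm z * norm (four f z) \<le> (\<Sum>b\<in>Basis. \<bar>z \<bullet> b\<bar>) * norm (four f z)"
      by (intro mult_right_mono norm_le_l1) simp
    also have "\<dots> = (\<Sum>b\<in>Basis. norm (four (?\<Psi> b f) z))"
      unfolding sum_distrib_right
    proof (rule sum.cong[OF refl])
      fix b :: 'a assume b: "b \<in> Basis"
      then have "b \<noteq> 0" by (simp add: nonzero_Basis)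
      then show "\<bar>z \<bullet> b\<bar> * norm (four f z) = norm (four (?\<Psi> b f) z)"
        using arg_cong[OF four_partial[OF f b, of z], of norm] by (simp add: norm_mult)
    qed
    finally have "(1 + norm z) * norm (four f z) \<le> (\<Sum>b\<in>insert 0 Basis. norm (four (?\<Psi> b f) z))"
      using nonzero_Basis by (subst sum.insert) (auto simp: distrib_right)
    then have "(1 + norm z) ^ N * ((1 + norm z) * norm (four f z)) \<le>
        (1 + norm z) ^ N * (\<Sum>b\<in>insert 0 Basis. norm (four (?\<Psi> b f) z))"
      by (rule mult_left_mono) simp
    also have "\<dots> \<le> C' * pnorm M' f" using MC' f unfolding sum_distrib_left[symmetric] by blast
    finally show ?thesis by (simp add: mult_ac)
  qed
  then show ?case by (intro exI ballI allI)
qed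

lemma four_has_derivative:
  fixes f :: "'a::euclidean_space \<Rightarrow> complex"
  assumes f: "f \<in> schwartz"
  shows "(four f has_derivative (\<lambda>h. LINT w|lborel. (h \<bullet> w) *\<^sub>R (\<i> * (f w * cis (w \<bullet> z))))) (at z)"
proof -
  have "((\<lambda>z. LINT w|lborel. f w * cis (w \<bullet> z)) has_derivative (\<lambda>h. LINT w|lborel. (h \<bullet> w) *\<^sub>R (\<i> * (f w * cis (w \<bullet> z))))) (at z)"
  proof (rule has_derivative_integral[where S = UNIV and B = "\<lambda>w. norm (f w * of_real (norm w))"])
    fix y w h :: 'a
    have "((\<lambda>y. cis (w \<bullet> y)) has_derivative (\<lambda>h. (w \<bullet> h) *\<^sub>R (\<i> * cis (w \<bullet> y)))) (at y)"
      by (rule has_derivative_compose[OF _ cis_has_vector_derivative[unfolded has_vector_derivative_def], where f = "\<lambda>y. w \<bullet> y"])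
        (auto intro!: derivative_eq_intros)
    then have "((\<lambda>y. f w * cis (w \<bullet> y)) has_derivative (\<lambda>h. f w * ((w \<bullet> h) *\<^sub>R (\<i> * cis (w \<bullet> y))))) (at y)"
      by (rule has_derivative_mult_right)
    then show "((\<lambda>y. f w * cis (w \<bullet> y)) has_derivative (\<lambda>h. (h \<bullet> w) *\<^sub>R (\<i> * (f w * cis (w \<bullet> y))))) (at y)"
      by (simp add: inner_commute mult_ac)
    show "norm ((h \<bullet> w) *\<^sub>R (\<i> * (f w * cis (w \<bullet> y)))) \<le> norm (f w * of_real (norm w)) * norm h"
      using mult_right_mono[OF Cauchy_Schwarz_ineq2[of h w], of "norm (f w)"] by (simp add: norm_mult mult_ac)
    show "integrable lborel (\<lambda>w. f w * cis (w \<bullet> y))" by (rule four_integrable[OF f])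
    show "integrable lborel (\<lambda>w. norm (f w * of_real (norm w)))"
      by (intro integrable_norm schwartz_integrable_bound(1)[OF f, of _ 1 1]) simp_all
    show "(\<lambda>w. (h \<bullet> w) *\<^sub>R (\<i> * (f w * cis (w \<bullet> z)))) \<in> borel_measurable lborel"
      using schwartz_measurable[OF f] by simp
  qed auto
  then show ?thesis by (simp add: four_def[abs_def])
qed

text \<open>The closed class consists of the Fourier transform composed with Schwartz operators:
  differentiating in \<open>z\<close> multiplies the integrand by i times a coordinate, which is
  again a Schwartz operator.\<close>

lemma schwartz_op_four: "schwartz_op (four :: ('a::euclidean_space \<Rightarrow> complex) \<Rightarrow> 'a \<Rightarrow> complex)"
proof -
  define \<G> where "\<G> = {\<lambda>f. four (T f) | T :: ('a \<Rightarrow> complex) \<Rightarrow> 'a \<Rightarrow> complex. schwartz_op T}"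
  show ?thesis
  proof (rule schwartz_opI[of \<G>])
    fix R assume "R \<in> \<G>"
    then obtain T where R: "R = (\<lambda>f. four (T f))" and T: "schwartz_op T" by (auto simp: \<G>_def)
    define Ts where "Ts b = [\<lambda>f. four (\<lambda>w. (\<i> * of_real (w \<bullet> b)) * T f w)]" for b :: 'a
    have A: "set (Ts b) \<subseteq> \<G>" if b: "b \<in> Basis" for b
    proof -
      have t: "tempered (\<lambda>w. \<i> * of_real (w \<bullet> b))" by (intro tempered_mult tempered_const tempered_inner)
      have "schwartz_op (\<lambda>f w. (\<i> * of_real (w \<bullet> b)) * T f w)"
        by (rule schwartz_op_compose[OF schwartz_op_mult[OF t] T])
      then show ?thesis unfolding \<G>_def Ts_def by auto
    qed
    have B: "\<exists>D. (R f has_derivative D) (at z) \<and> (\<forall>b\<in>Basis. D b = (\<Sum>T'\<leftarrow>Ts b. T' f z))" if f: "f \<in> schwartz" for f z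
    proof (rule exI, rule conjI)
      show "(R f has_derivative (\<lambda>h. LINT w|lborel. (h \<bullet> w) *\<^sub>R (\<i> * (T f w * cis (w \<bullet> z))))) (at z)"
        unfolding R by (rule four_has_derivative[OF schwartz_op_in[OF T f]])
      show "\<forall>b\<in>Basis. (LINT w|lborel. (b \<bullet> w) *\<^sub>R (\<i> * (T f w * cis (w \<bullet> z)))) = (\<Sum>T'\<leftarrow>Ts b. T' f z)"
        by (simp add: Ts_def four_def scaleR_conv_of_real inner_commute mult_ac)
    qed
    show "\<exists>Ts. (\<forall>b\<in>Basis. set (Ts b) \<subseteq> \<G>) \<and>
      (\<forall>f\<in>schwartz. \<forall>x. \<exists>D. (R f has_derivative D) (at x) \<and> (\<forall>b\<in>Basis. D b = (\<Sum>T'\<leftarrow>Ts b. T' f x)))"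
      by (rule exI[of _ Ts], intro conjI ballI allI, erule A, erule B)
  next
    fix R N assume "R \<in> \<G>"
    then obtain T where R: "R = (\<lambda>f. four (T f))" and T: "schwartz_op T" by (auto simp: \<G>_def)
    obtain M C where MC: "\<forall>f\<in>schwartz. \<forall>z::'a. (1 + norm z) ^ N * norm (four f z) \<le> C * pnorm M f"
      using four_decay by blast
    obtain M' C' where 2: "0 \<le> C'" "\<forall>f\<in>schwartz. pnorm M (T f) \<le> C' * pnorm M' f"
      using schwartz_op_pnorm[OF T] by blast
    have "(1 + norm z) ^ N * norm (R f z) \<le> (\<bar>C\<bar> * C') * pnorm M' f" if f: "f \<in> schwartz" for f z
    proof -
      have g: "T f \<in> schwartz" by (rule schwartz_op_in[OF T f])
      have "(1 + norm z) ^ N * norm (four (T f) z) \<le> C * pnorm M (T f)" using MC g by blast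
      also have "\<dots> \<le> \<bar>C\<bar> * pnorm M (T f)" using pnorm_nonneg[OF g] by (intro mult_right_mono) simp_all
      also have "\<dots> \<le> \<bar>C\<bar> * (C' * pnorm M' f)" using 2 f by (intro mult_left_mono) simp_all
      finally show ?thesis by (simp add: R)
    qed
    then show "\<exists>M C. \<forall>f\<in>schwartz. \<forall>x. (1 + norm x) ^ N * norm (R f x) \<le> C * pnorm M f"
      by (intro exI ballI allI)
  next
    show "four \<in> \<G>" unfolding \<G>_def using schwartz_op_id by auto
  next
    fix f g :: "'a \<Rightarrow> complex" and z assume "f \<in> schwartz" "g \<in> schwartz"
    from four_integrable[OF this(1)] four_integrable[OF this(2)]
    show "four (\<lambda>x. f x - g x) z = four f z - four g z" by (simp add: four_def left_diff_distrib)
  qed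
qed

section \<open>The Gaussian and Fourier inversion\<close>

definition gauss :: "'a::euclidean_space \<Rightarrow> complex" where
  "gauss x = (\<Prod>b\<in>Basis. of_real (exp (- (x \<bullet> b)\<^sup>2 / 2)))"

lemma gauss_measurable [measurable]: "gauss \<in> borel_measurable borel"
  unfolding gauss_def by measurable

lemma gauss_le_1: "norm (gauss x) \<le> 1"
  unfolding gauss_def prod_norm[symmetric] by (intro prod_le_1) simp

lemma gauss_continuous: "continuous_on UNIV gauss"
  unfolding gauss_def by (intro continuous_intros) simp

text \<open>Up to normalisation this is the characteristic function of the standard normal
  distribution.\<close>

lemma gauss_integral_1d:
  "integrable lborel (\<lambda>t. cis (s * t) * of_real (exp (- t\<^sup>2 / 2)))"
  "(LINT t|lborel. cis (s * t) * of_real (exp (- t\<^sup>2 / 2))) = of_real (sqrt (2 * pi) * exp (- s\<^sup>2 / 2))"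
proof -
  have [measurable]: "(\<lambda>t. cis (s * t)) \<in> borel_measurable borel"
    by (intro borel_measurable_continuous_onI continuous_intros)
  have "integrable lborel (\<lambda>t. sqrt (2 * pi) * (std_normal_density t * t ^ 0))"
    using integrable_std_normal_moment[of 0] by simp
  then have i: "integrable lborel (\<lambda>t::real. exp (- t\<^sup>2 / 2))" by (simp add: std_normal_density_def)
  show "integrable lborel (\<lambda>t. cis (s * t) * of_real (exp (- t\<^sup>2 / 2)))"
    by (rule Bochner_Integration.integrable_bound[OF i]) (simp_all add: norm_mult)
  have "(LINT t|lborel. cis (s * t) * of_real (exp (- t\<^sup>2 / 2))) =
      (LINT t|lborel. of_real (sqrt (2 * pi)) * (std_normal_density t *\<^sub>R cis (s * t)))"
    by (intro Bochner_Integration.integral_cong) (simp_all add: std_normal_density_def scaleR_conv_of_real)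
  also have "\<dots> = of_real (sqrt (2 * pi)) * (LINT t|lborel. std_normal_density t *\<^sub>R cis (s * t))"
    by (rule integral_mult_right_zero)
  also have "(LINT t|lborel. std_normal_density t *\<^sub>R cis (s * t)) = char std_normal_distribution s"
    unfolding char_def cis_conv_exp by (subst integral_density) (simp_all add: mult_ac)
  finally show "(LINT t|lborel. cis (s * t) * of_real (exp (- t\<^sup>2 / 2))) = of_real (sqrt (2 * pi) * exp (- s\<^sup>2 / 2))"
    by (simp add: char_std_normal_distribution)
qed

lemma cis_inner_prod: "cis (w \<bullet> z) = (\<Prod>b\<in>Basis. cis ((w \<bullet> b) * (z \<bullet> b)))"
proof -
  have "cis (\<Sum>b\<in>A. f b) = (\<Prod>b\<in>A. cis (f b))" for f and A :: "'a set"
    by (induction A rule: infinite_finite_induct) (simp_all add: cis_mult[symmetric])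
  then show ?thesis by (simp add: euclidean_inner[of w z])
qed

lemma gauss_integrable: "integrable lborel (\<lambda>z. cis (w \<bullet> z) * gauss z)"
  and gauss_integral: "(LINT z|lborel. cis (w \<bullet> z) * gauss z) = of_real (sqrt (2 * pi) ^ DIM('a)) * gauss (w :: 'a::euclidean_space)"
proof -
  let ?f = "\<lambda>b t. cis ((w \<bullet> b) * t) * of_real (exp (- t\<^sup>2 / 2))"
  have eq: "(\<lambda>z. cis (w \<bullet> z) * gauss z) = (\<lambda>z. \<Prod>b\<in>Basis. ?f b (z \<bullet> b))"
    by (simp only: cis_inner_prod gauss_def prod.distrib)
  show "integrable lborel (\<lambda>z. cis (w \<bullet> z) * gauss z)"
    unfolding eq by (rule integral_lborel_prod(1)) (rule gauss_integral_1d)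
  have "(LINT z|lborel. cis (w \<bullet> z) * gauss z) = (\<Prod>b\<in>Basis. LINT t|lborel. ?f b t)"
    unfolding eq by (rule integral_lborel_prod(2)) (rule gauss_integral_1d)
  also have "\<dots> = (\<Prod>b\<in>Basis. of_real (sqrt (2 * pi)) * of_real (exp (- (w \<bullet> b)\<^sup>2 / 2)))"
    by (simp only: gauss_integral_1d of_real_mult)
  finally show "(LINT z|lborel. cis (w \<bullet> z) * gauss z) = of_real (sqrt (2 * pi) ^ DIM('a)) * gauss w"
    by (simp add: gauss_def prod.distrib)
qed

text \<open>Integrating against the Gaussian of width \<open>1 / c\<close> justifies the exchange of integrals; then \<open>c\<close> tends to \<open>0\<close>.\<close>

lemma four_inversion_at_0:
  fixes f :: "'a::euclidean_space \<Rightarrow> complex"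
  assumes f: "f \<in> schwartz"
  shows "(LINT z|lborel. four f z) = of_real ((2 * pi) ^ DIM('a)) * f 0"
proof -
  let ?d = "DIM('a)"
  have ff: "four f \<in> schwartz" by (rule schwartz_op_in[OF schwartz_op_four f])
  note [measurable] = schwartz_measurable[OF f] schwartz_measurable[OF ff]
  have cisp: "(\<lambda>p. cis (snd p \<bullet> fst p)) \<in> borel_measurable (lborel \<Otimes>\<^sub>M (lborel :: 'a measure))"
    unfolding lborel_prod by (simp, intro borel_measurable_continuous_onI continuous_intros)
  have gi: "integrable lborel (gauss :: 'a \<Rightarrow> complex)" using gauss_integrable[of 0] by simp
  \<comment> \<open>Both sides evaluate the double integral of
    \<open>f w * cis (w \<bullet> z) * gauss (c z)\<close>. On the right the variable
    \<open>z\<close> is integrated before \<open>w\<close>, and the substitution w = c v cancels the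
    powers of \<open>c\<close>.\<close>
  have main: "(LINT z|lborel. four f z * gauss (c *\<^sub>R z)) = of_real (sqrt (2 * pi) ^ ?d) * (LINT v|lborel. f (c *\<^sub>R v) * gauss v)"
    if c: "0 < c" for c
  proof -
    have gci: "integrable lborel (\<lambda>z::'a. gauss (c *\<^sub>R z))"
      using lborel_integrable_scale[of gauss c] gi c by simp
    have int: "integrable (lborel \<Otimes>\<^sub>M lborel) (\<lambda>(z::'a, w). f w * cis (w \<bullet> z) * gauss (c *\<^sub>R z))"
    proof (rule lborel_pair.Fubini_integrable)
      show "(\<lambda>(z, w). f w * cis (w \<bullet> z) * gauss (c *\<^sub>R z)) \<in> borel_measurable (lborel \<Otimes>\<^sub>M lborel)"
        using cisp by (simp add: case_prod_beta')
      have "integrable lborel (\<lambda>z::'a. (LINT w|lborel. norm (f w)) * norm (gauss (c *\<^sub>R z)))"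
        by (intro integrable_mult_right integrable_norm gci)
      then show "integrable lborel (\<lambda>z. LINT w|lborel. norm (case (z, w) of (z, w) \<Rightarrow> f w * cis (w \<bullet> z) * gauss (c *\<^sub>R z)))"
        by (simp add: norm_mult)
      show "AE z in lborel. integrable lborel (\<lambda>w. case (z, w) of (z, w) \<Rightarrow> f w * cis (w \<bullet> z) * gauss (c *\<^sub>R z))"
        using four_integrable[OF f] by simp
    qed
    have inner: "(LINT z|lborel. f w * cis (w \<bullet> z) * gauss (c *\<^sub>R z)) =
        f w * ((1 / c) ^ ?d *\<^sub>R (of_real (sqrt (2 * pi) ^ ?d) * gauss ((1 / c) *\<^sub>R w)))" for w
    proof -
      have "(LINT z|lborel. f w * cis (w \<bullet> z) * gauss (c *\<^sub>R z)) = f w * (LINT z|lborel. cis (w \<bullet> z) * gauss (c *\<^sub>R z))"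
        by (simp add: mult.assoc)
      also have "(LINT z|lborel. cis (w \<bullet> z) * gauss (c *\<^sub>R z)) = (1 / c) ^ ?d *\<^sub>R (LINT z|lborel. cis (((1 / c) *\<^sub>R w) \<bullet> z) * gauss z)"
        by (subst lborel_integral_scale[where c = "1 / c"]) (use c in \<open>auto simp: field_simps\<close>)
      finally show ?thesis by (simp only: gauss_integral)
    qed
    have "(LINT z|lborel. four f z * gauss (c *\<^sub>R z)) = (LINT z|lborel. (LINT w|lborel. f w * cis (w \<bullet> z) * gauss (c *\<^sub>R z)))"
      by (simp add: four_def)
    also have "\<dots> = (LINT w|lborel. (LINT z|lborel. f w * cis (w \<bullet> z) * gauss (c *\<^sub>R z)))"
      using lborel_pair.Fubini_integral[OF int] by simp
    also have "\<dots> = (LINT w|lborel. ((1 / c) ^ ?d *\<^sub>R of_real (sqrt (2 * pi) ^ ?d)) * (f w * gauss ((1 / c) *\<^sub>R w)))"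
      unfolding inner by (simp add: mult_ac)
    also have "\<dots> = (1 / c) ^ ?d *\<^sub>R of_real (sqrt (2 * pi) ^ ?d) * (LINT w|lborel. f w * gauss ((1 / c) *\<^sub>R w))"
      by simp
    also have "(LINT w|lborel. f w * gauss ((1 / c) *\<^sub>R w)) = c ^ ?d *\<^sub>R (LINT v|lborel. f (c *\<^sub>R v) * gauss v)"
      by (subst lborel_integral_scale[where c = c]) (use c in auto)
    finally show ?thesis using c by (simp add: scaleR_conv_of_real power_divide)
  qed
  define c where "c i = 1 / real (Suc i)" for i
  have c0: "c \<longlonglongrightarrow> 0" unfolding c_def by (rule LIMSEQ_Suc[OF lim_1_over_n])
  have cx: "(\<lambda>i. c i *\<^sub>R x) \<longlonglongrightarrow> 0" for x :: 'a using tendsto_scaleR[OF c0 tendsto_const, of x] by simp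
  have g0: "gauss (0::'a) = 1" by (simp add: gauss_def)
  have lim1: "(\<lambda>i. LINT z|lborel. four f z * gauss (c i *\<^sub>R z)) \<longlonglongrightarrow> (LINT z|lborel. four f z)"
  proof (rule integral_dominated_convergence[where w = "\<lambda>z. norm (four f z)"])
    show "AE z in lborel. (\<lambda>i. four f z * gauss (c i *\<^sub>R z)) \<longlonglongrightarrow> four f z"
    proof (rule AE_I2)
      fix z :: 'a
      have "(\<lambda>i. gauss (c i *\<^sub>R z)) \<longlonglongrightarrow> gauss (0::'a)"
        by (rule continuous_on_tendsto_compose[OF gauss_continuous cx]) auto
      from tendsto_mult[OF tendsto_const this] show "(\<lambda>i. four f z * gauss (c i *\<^sub>R z)) \<longlonglongrightarrow> four f z" by (simp add: g0)
    qed
    show "AE z in lborel. norm (four f z * gauss (c i *\<^sub>R z)) \<le> norm (four f z)" for i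
      unfolding norm_mult by (intro AE_I2 mult_left_le gauss_le_1) simp
  qed (use schwartz_integrable[OF ff] in auto)
  have lim2: "(\<lambda>i. LINT v|lborel. f (c i *\<^sub>R v) * gauss v) \<longlonglongrightarrow> (LINT v|lborel. f 0 * gauss (v::'a))"
  proof (rule integral_dominated_convergence[where w = "\<lambda>v. pnorm 0 f * norm (gauss v)"])
    show "AE v in lborel. (\<lambda>i. f (c i *\<^sub>R v) * gauss v) \<longlonglongrightarrow> f 0 * gauss v"
    proof (intro AE_I2 tendsto_mult tendsto_const)
      fix v :: 'a
      show "(\<lambda>i. f (c i *\<^sub>R v)) \<longlonglongrightarrow> f 0"
        by (rule continuous_on_tendsto_compose[OF smooth_continuous[OF schwartz_smooth[OF f], of "[]", simplified] cx]) auto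
    qed
    show "AE v in lborel. norm (f (c i *\<^sub>R v) * gauss v) \<le> pnorm 0 f * norm (gauss v)" for i
      using pnorm_upper[OF f, of "[]" 0 0] by (intro AE_I2) (simp add: norm_mult mult_right_mono)
  qed (use gi in auto)
  have cpos: "0 < c i" for i by (simp add: c_def)
  have "(LINT z|lborel. four f z) = of_real (sqrt (2 * pi) ^ ?d) * (LINT v|lborel. f 0 * gauss (v::'a))"
    by (rule LIMSEQ_unique[OF lim1[unfolded main[OF cpos]] tendsto_mult[OF tendsto_const lim2]])
  also have "(LINT v|lborel. f 0 * gauss (v::'a)) = f 0 * of_real (sqrt (2 * pi) ^ ?d)"
    using gauss_integral[of "0::'a"] by (simp add: g0)
  also have "of_real (sqrt (2 * pi) ^ ?d) * (f 0 * of_real (sqrt (2 * pi) ^ ?d)) =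
      of_real (sqrt (2 * pi) ^ ?d * sqrt (2 * pi) ^ ?d) * f 0"
    by (simp only: of_real_mult mult_ac)
  also have "sqrt (2 * pi) ^ ?d * sqrt (2 * pi) ^ ?d = (2 * pi) ^ ?d"
    unfolding power_mult_distrib[symmetric] by simp
  finally show ?thesis .
qed

text \<open>Translating \<open>f\<close> by \<open>x\<close> multiplies its transform by
  \<open>cis (z \<bullet> x)\<close>, which reduces the claim to the value at 0.\<close>

lemma four_inversion:
  fixes f :: "'a::euclidean_space \<Rightarrow> complex"
  assumes f: "f \<in> schwartz"
  shows "four (four f) x = of_real ((2 * pi) ^ DIM('a)) * f (- x)"
proof -
  let ?g = "\<lambda>w. f (w + (- x))"
  have "four ?g z = four f z * cis (z \<bullet> x)" for z
  proof -
    have "four ?g z = (LINT w|lborel. (\<lambda>w. f w * cis ((w + x) \<bullet> z)) (w + (- x)))" by (simp add: four_def)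
    also have "\<dots> = (LINT w|lborel. f w * cis ((w + x) \<bullet> z))"
    proof (rule lborel_integral_translate)
      have "(\<lambda>w. f w * (cis (w \<bullet> z) * cis (x \<bullet> z))) \<in> borel_measurable borel"
        using schwartz_measurable[OF f] by simp
      then show "(\<lambda>w. f w * cis ((w + x) \<bullet> z)) \<in> borel_measurable borel"
        by (simp only: cis_mult inner_add_left)
    qed
    also have "\<dots> = (LINT w|lborel. (f w * cis (w \<bullet> z)) * cis (z \<bullet> x))"
      by (simp only: inner_add_left cis_mult[symmetric] inner_commute[of z x] mult.assoc)
    finally show ?thesis by (simp add: four_def)
  qed
  then have "four (four f) x = (LINT z|lborel. four ?g z)" by (simp only: four_def[of "four f"])
  also have "\<dots> = of_real ((2 * pi) ^ DIM('a)) * f (0 + (- x))"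
    by (rule four_inversion_at_0[OF schwartz_translate[OF f]])
  finally show ?thesis by simp
qed
section \<open>Rotation invariance\<close>

lemma gauss_radial: "gauss x = of_real (exp (- (norm x)\<^sup>2 / 2))"
proof -
  have "(norm x)\<^sup>2 = (\<Sum>b\<in>Basis. (x \<bullet> b)\<^sup>2)"
    unfolding power2_norm_eq_inner by (subst euclidean_inner) (simp add: power2_eq_square)
  then have "- (norm x)\<^sup>2 / 2 = (\<Sum>b\<in>Basis. - (x \<bullet> b)\<^sup>2 / 2)"
    by (simp add: sum_negf sum_divide_distrib)
  then have "exp (- (norm x)\<^sup>2 / 2) = (\<Prod>b\<in>Basis. exp (- (x \<bullet> b)\<^sup>2 / 2))"
    by (simp only: exp_sum[OF finite_Basis])
  then show ?thesis unfolding gauss_def by simp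
qed

lemma schwartz_rotate:
  fixes U :: "'a::euclidean_space \<Rightarrow> 'a"
  assumes U: "orthogonal_transformation U" and f: "f \<in> schwartz"
  shows "(\<lambda>x. f (U x)) \<in> schwartz"
proof -
  have "schwartz_op (\<lambda>h x. 1 * h (U x))"
  proof (rule schwartz_op_pullback[where ?C0.0 = 1 and ?N0.0 = 1])
    fix b :: 'a
    have "linear U" using U by (simp add: orthogonal_transformation_def)
    then have "U x \<bullet> b = x \<bullet> adjoint U b" for x by (simp add: adjoint_works)
    then show "tempered (\<lambda>x. complex_of_real (U x \<bullet> b))" by (simp add: tempered_inner)
  qed (use U in \<open>auto simp: orthogonal_transformation_norm\<close>)
  from schwartz_op_in[OF this f] show ?thesis by simp
qed

text \<open>Two translation invariant integrals are proportional; the rotation invariant Gaussian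
  shows that the constant is 1.\<close>

lemma integral_rotate:
  fixes U :: "'a::euclidean_space \<Rightarrow> 'a"
  assumes U: "orthogonal_transformation U" and f: "f \<in> schwartz"
  shows "(LINT x|lborel. f (U x)) = (LINT x|lborel. f x)"
proof -
  let ?g = "gauss :: 'a \<Rightarrow> complex"
  have lin: "linear U" using U by (simp add: orthogonal_transformation_def)
  have bij: "bij U" using orthogonal_transformation_bij[OF U] .
  have [measurable]: "U \<in> borel_measurable borel"
    by (intro borel_measurable_continuous_onI linear_continuous_on)
      (simp add: linear_conv_bounded_linear[symmetric] lin)
  note [measurable] = schwartz_measurable[OF f]
  have gi: "integrable lborel ?g" using gauss_integrable[of 0] by simp
  have fi: "integrable lborel f" by (rule schwartz_integrable[OF f])
  have fU: "(LINT x|lborel. f (U x + y)) = (LINT x|lborel. f (U x))" "integrable lborel (\<lambda>x. f (U x + y))" for y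
  proof -
    obtain z where z: "U z = y" using bij by (metis bij_pointE)
    have eq: "(\<lambda>x. f (U x + y)) = (\<lambda>x. f (U (x + z)))" by (simp add: linear_add[OF lin] z)
    show "(LINT x|lborel. f (U x + y)) = (LINT x|lborel. f (U x))"
      unfolding eq by (rule lborel_integral_translate) measurable
    show "integrable lborel (\<lambda>x. f (U x + y))"
      unfolding eq by (rule schwartz_integrable[OF schwartz_translate[OF schwartz_rotate[OF U f]]])
  qed
  have gU: "(LINT x|lborel. ?g (y - U x)) = (LINT x|lborel. ?g x)" for y
  proof -
    obtain z where z: "U z = y" using bij by (metis bij_pointE)
    have "?g (y - U x) = ?g (x + (- z))" for x
    proof -
      have "y - U x = U (- (x + (- z)))" by (simp add: linear_diff[OF lin] linear_add[OF lin] linear_neg[OF lin] z)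
      then show ?thesis using U by (simp only: gauss_radial orthogonal_transformation_norm norm_minus_cancel)
    qed
    then show ?thesis using lborel_integral_translate[of ?g "- z"] by simp
  qed
  have i1: "integrable (lborel \<Otimes>\<^sub>M lborel) (\<lambda>(y, x). ?g y * f (U x + y))"
  proof (rule lborel_pair.Fubini_integrable)
    show "(\<lambda>(y, x). ?g y * f (U x + y)) \<in> borel_measurable (lborel \<Otimes>\<^sub>M lborel)"
      by measurable
    have nf: "(LINT x|lborel. norm (f (U x + y))) = (LINT x|lborel. norm (f (U x)))" for y
    proof -
      obtain z where z: "U z = y" using bij by (metis bij_pointE)
      have "complex_of_real (LINT x|lborel. norm (f (U x + y))) = (LINT x|lborel. (\<lambda>x. of_real (norm (f (U x)))) (x + z))"
        by (simp add: linear_add[OF lin] z)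
      also have "\<dots> = (LINT x|lborel. of_real (norm (f (U x))))" by (rule lborel_integral_translate) measurable
      finally show ?thesis by (simp only: integral_complex_of_real of_real_eq_iff)
    qed
    have "integrable lborel (\<lambda>y. norm (?g y) * (LINT x|lborel. norm (f (U x))))"
      by (intro integrable_mult_left integrable_norm gi)
    then show "integrable lborel (\<lambda>y. LINT x|lborel. norm (case (y, x) of (y, x) \<Rightarrow> ?g y * f (U x + y)))"
      by (simp add: norm_mult nf)
    show "AE y in lborel. integrable lborel (\<lambda>x. case (y, x) of (y, x) \<Rightarrow> ?g y * f (U x + y))"
      using fU(2) by simp
  qed
  have i2: "integrable (lborel \<Otimes>\<^sub>M lborel) (\<lambda>(y, x). f y * ?g (y - U x))"
  proof (rule lborel_pair.Fubini_integrable)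
    show "(\<lambda>(y, x). f y * ?g (y - U x)) \<in> borel_measurable (lborel \<Otimes>\<^sub>M lborel)"
      by measurable
    have gx: "norm (?g (y - U x)) = Re (?g (y - U x))" for x y by (simp add: gauss_radial)
    have gg: "integrable lborel (\<lambda>x. ?g (y - U x))" for y
    proof -
      obtain z where z: "U z = y" using bij by (metis bij_pointE)
      have "?g (y - U x) = ?g ((- z) + 1 *\<^sub>R x)" for x
      proof -
        have "y - U x = U (- (x + (- z)))" by (simp add: linear_diff[OF lin] linear_add[OF lin] linear_neg[OF lin] z)
        then have "norm (y - U x) = norm ((- z) + 1 *\<^sub>R x)" using U
          by (simp add: orthogonal_transformation_norm norm_minus_commute)
        then show ?thesis by (simp only: gauss_radial)
      qed
      moreover have "integrable lborel (\<lambda>x. ?g ((- z) + x))"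
      proof -
        have "integrable (distr lborel borel ((+) (- z))) ?g" using gi by (simp add: lborel_distr_plus)
        then show ?thesis by (subst (asm) integrable_distr_eq) auto
      qed
      ultimately show ?thesis by simp
    qed
    have "(LINT x|lborel. norm (?g (y - U x))) = Re (LINT x|lborel. ?g x)" for y
      unfolding gx integral_Re[OF gg] gU ..
    then show "integrable lborel (\<lambda>y. LINT x|lborel. norm (case (y, x) of (y, x) \<Rightarrow> f y * ?g (y - U x)))"
      using fi by (simp add: norm_mult)
    show "AE y in lborel. integrable lborel (\<lambda>x. case (y, x) of (y, x) \<Rightarrow> f y * ?g (y - U x))"
      using gg by simp
  qed
  \<comment> \<open>The double integral of \<open>gauss y * f (U x + y)\<close> is computed in both
    orders. Integrating over \<open>x\<close> at fixed \<open>y\<close>, the shift \<open>y\<close>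
    is the image of some \<open>z\<close> under \<open>U\<close> and disappears by translation
    invariance. Integrating over \<open>y\<close> at fixed \<open>x\<close>, the shift moves to the
    Gaussian, and the remaining integral of \<open>gauss (y - U x)\<close> over \<open>x\<close>
    does not involve \<open>U\<close> because the Gaussian is radial.\<close>
  have "(LINT x|lborel. f (U x)) * (LINT y|lborel. ?g y) = (LINT y|lborel. (LINT x|lborel. ?g y * f (U x + y)))"
    by (simp add: fU mult.commute)
  also have "\<dots> = (LINT x|lborel. (LINT y|lborel. ?g y * f (U x + y)))"
    using lborel_pair.Fubini_integral[OF i1] by simp
  also have "\<dots> = (LINT x|lborel. (LINT y|lborel. f y * ?g (y - U x)))"
  proof (rule Bochner_Integration.integral_cong[OF refl])
    fix x
    have "(LINT y|lborel. (\<lambda>y. f y * ?g (y - U x)) (y + U x)) = (LINT y|lborel. f y * ?g (y - U x))"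
      by (rule lborel_integral_translate) measurable
    then show "(LINT y|lborel. ?g y * f (U x + y)) = (LINT y|lborel. f y * ?g (y - U x))"
      by (simp add: mult.commute add.commute)
  qed
  also have "\<dots> = (LINT y|lborel. (LINT x|lborel. f y * ?g (y - U x)))"
    using lborel_pair.Fubini_integral[OF i2] by simp
  also have "\<dots> = (LINT y|lborel. f y) * (LINT y|lborel. ?g y)" by (simp add: gU)
  finally show ?thesis using gauss_integral[of "0::'a"] by (simp add: gauss_def[of 0])
qed

lemma four_rotate:
  fixes U :: "'a::euclidean_space \<Rightarrow> 'a"
  assumes U: "orthogonal_transformation U" and f: "f \<in> schwartz"
  shows "four f (U z) = four (\<lambda>w. f (U w)) z"
proof -
  have s: "(\<lambda>w. cis (w \<bullet> U z) * f w) \<in> schwartz"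
    by (rule schwartz_op_in[OF schwartz_op_mult[OF tempered_cis[OF tempered_inner]] f])
  show ?thesis using integral_rotate[OF U s] U
    by (simp add: four_def mult.commute orthogonal_transformation_def)
qed

section \<open>Cutoff functions\<close>

text \<open>The function exp (-1/x) is the case k = 0; the powers of 1/x make the family closed
  under differentiation up to linear combinations.\<close>

definition flat :: "nat \<Rightarrow> real \<Rightarrow> real" where
  "flat k x = (if x \<le> 0 then 0 else (1 / x) ^ k * exp (- (1 / x)))"

lemma flat_nonneg: "0 \<le> flat k x" by (simp add: flat_def)

lemma flat_le: "flat k x \<le> fact k"
proof (cases "x \<le> 0")
  case False
  define y where "y = 1 / x"
  have y: "0 < y" using False by (simp add: y_def)
  have "(\<Sum>n\<in>{k}. y ^ n /\<^sub>R fact n) \<le> exp y"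
    unfolding exp_def by (rule sum_le_suminf[OF summable_exp_generic]) (use y in auto)
  then have "y ^ k \<le> fact k * exp y" by (simp add: field_simps)
  then have "y ^ k * exp (- y) \<le> fact k * exp y * exp (- y)"
    by (intro mult_right_mono) auto
  also have "\<dots> = fact k" by (simp add: exp_minus)
  finally show ?thesis using False by (simp add: flat_def y_def)
qed (simp add: flat_def)

text \<open>Taking x^2 out of \<open>flat (k + 2)\<close> makes the difference quotient at 0 of
  order x, so the derivative there exists and is 0.\<close>

lemma flat_le_square: "flat k x \<le> fact (k + 2) * x\<^sup>2"
proof (cases "x \<le> 0")
  case False
  have "flat k x = x\<^sup>2 * flat (k + 2) x" using False by (simp add: flat_def power_add field_simps power2_eq_square)
  also have "\<dots> \<le> x\<^sup>2 * fact (k + 2)" by (intro mult_left_mono flat_le) simp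
  finally show ?thesis by (simp add: mult.commute)
qed (simp add: flat_def)

lemma flat_derivative: "(flat k has_real_derivative flat (k + 2) x - real k * flat (k + 1) x) (at x)"
proof -
  consider "x < 0" | "x = 0" | "0 < x" by linarith
  then show ?thesis
  proof cases
    case 1
    have "((\<lambda>x. 0) has_real_derivative 0) (at x)" by simp
    then have "(flat k has_real_derivative 0) (at x)"
      by (rule has_field_derivative_transform_within_open[where S = "{..<0}"]) (use 1 in \<open>auto simp: flat_def\<close>)
    then show ?thesis using 1 by (simp add: flat_def)
  next
    case 2
    have "((\<lambda>h. (flat k (0 + h) - flat k 0) / h) \<longlongrightarrow> 0) (at 0)"
    proof (rule Lim_null_comparison)
      show "\<forall>\<^sub>F h in at 0. norm ((flat k (0 + h) - flat k 0) / h) \<le> fact (k + 2) * \<bar>h\<bar>"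
      proof (intro eventually_mono[OF eventually_at_ball'[of 1]])
        fix h :: real assume "h \<in> ball 0 1 \<and> h \<noteq> 0 \<and> h \<in> UNIV"
        then have h: "h \<noteq> 0" by simp
        have "\<bar>flat k h\<bar> / \<bar>h\<bar> \<le> fact (k + 2) * h\<^sup>2 / \<bar>h\<bar>"
          using flat_le_square[of k h] flat_nonneg[of k h] by (intro divide_right_mono) simp_all
        also have "\<dots> = fact (k + 2) * \<bar>h\<bar>"
        proof -
          have "h\<^sup>2 = \<bar>h\<bar> * \<bar>h\<bar>" by (simp add: power2_eq_square)
          then have "h\<^sup>2 / \<bar>h\<bar> = \<bar>h\<bar>" using h by (simp only: nonzero_mult_div_cancel_left abs_eq_0_iff not_False_eq_True)
          then show ?thesis by (simp only: times_divide_eq_right[symmetric])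
        qed
        finally show "norm ((flat k (0 + h) - flat k 0) / h) \<le> fact (k + 2) * \<bar>h\<bar>"
          by (simp add: flat_def)
      qed simp
      show "((\<lambda>h::real. fact (k + 2) * \<bar>h\<bar>) \<longlongrightarrow> 0) (at 0)"
        by (intro tendsto_mult_right_zero tendsto_rabs_zero tendsto_ident_at)
    qed
    then show ?thesis using 2 unfolding DERIV_def by (simp add: flat_def)
  next
    case 3
    have "((\<lambda>x. (1 / x) ^ k * exp (- (1 / x))) has_real_derivative flat (k + 2) x - real k * flat (k + 1) x) (at x)"
    proof -
      have d: "((\<lambda>x. 1 / x) has_real_derivative (- ((1 / x) ^ 2))) (at x)"
        using 3 by (auto intro!: derivative_eq_intros simp: power2_eq_square field_simps)
      have "((\<lambda>x. (1 / x) ^ k * exp (- (1 / x))) has_real_derivative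
        ((1 / x) ^ k * (exp (- (1 / x)) * (1 / x) ^ 2) + (real k * (- ((1 / x) ^ 2) * (1 / x) ^ (k - 1))) * exp (- (1 / x)))) (at x)"
        by (rule derivative_eq_intros d | simp)+
      then show ?thesis
        by (rule DERIV_cong) (use 3 in \<open>cases k; simp add: flat_def power2_eq_square field_simps\<close>)
    qed
    then show ?thesis
      by (rule has_field_derivative_transform_within_open[where S = "{0<..}"]) (use 3 in \<open>auto simp: flat_def\<close>)
  qed
qed

lemma tempered_flat: "tempered (\<lambda>x. of_real (flat 0 x))"
proof -
  define G where "G = {\<lambda>x. complex_of_real (c * flat k x) | c k. True}"
  have "tempered (\<lambda>x. of_real (1 * flat 0 x))"
  proof (rule temperedI_real[of G])
    fix f assume "f \<in> G"
    then obtain c k where f: "f = (\<lambda>x. of_real (c * flat k x))" by (auto simp: G_def)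
    have memb: "(\<lambda>x. complex_of_real (c * flat k x)) \<in> G" for c k unfolding G_def by blast
    have "(f has_vector_derivative complex_of_real (c * (flat (k + 2) x - real k * flat (k + 1) x))) (at x)" for x
      unfolding f by (rule has_vector_derivative_of_real[OF DERIV_cmult[OF flat_derivative]])
    then have "(f has_vector_derivative (\<Sum>g\<leftarrow>[\<lambda>x. of_real (c * flat (k + 2) x), \<lambda>x. of_real ((- c * real k) * flat (k + 1) x)]. g x)) (at x)" for x
      by (simp add: algebra_simps)
    moreover have "set [\<lambda>x. complex_of_real (c * flat (k + 2) x), \<lambda>x. of_real ((- c * real k) * flat (k + 1) x)] \<subseteq> G"
      by (simp only: set_simps insert_subset empty_subsetI memb simp_thms)
    ultimately show "\<exists>fs. set fs \<subseteq> G \<and> (\<forall>x. (f has_vector_derivative (\<Sum>g\<leftarrow>fs. g x)) (at x))" by blast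
    have "norm (f x) \<le> (\<bar>c\<bar> * fact k) * (1 + norm x) ^ 0" for x
      using flat_le[of k x] flat_nonneg[of k x] by (simp add: f norm_mult mult_left_mono)
    then show "\<exists>N C. \<forall>x. norm (f x) \<le> C * (1 + norm x) ^ N" by blast
  next
    show "(\<lambda>x. complex_of_real (1 * flat 0 x)) \<in> G" unfolding G_def by blast
  qed
  then show ?thesis by simp
qed

text \<open>The closed class consists of tempered functions times powers of 1 / D; the lower bound
  \<delta> keeps these powers bounded.\<close>

lemma tempered_inverse:
  fixes D :: "real \<Rightarrow> complex"
  assumes D: "tempered D" and \<delta>: "0 < \<delta>" "\<And>x. \<delta> \<le> norm (D x)"
  shows "tempered (\<lambda>x. inverse (D x))"
proof -
  define G where "G = {\<lambda>x. u x * (inverse (D x)) ^ j | u j. tempered u}"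
  let ?D = "\<lambda>x. frechet_derivative D (at x) 1"
  have D0: "D x \<noteq> 0" for x using \<delta>(2)[of x] \<delta>(1) by auto
  have "tempered (\<lambda>x. 1 * (inverse (D x)) ^ 1)"
  proof (rule temperedI_real[of G])
    fix f assume "f \<in> G"
    then obtain u j where f: "f = (\<lambda>x. u x * (inverse (D x)) ^ j)" and u: "tempered u" by (auto simp: G_def)
    let ?f1 = "\<lambda>x. frechet_derivative u (at x) 1 * (inverse (D x)) ^ j"
    let ?f2 = "\<lambda>x. (- of_nat j * u x * ?D x) * (inverse (D x)) ^ (j + 1)"
    have "(f has_vector_derivative (\<Sum>g\<leftarrow>[?f1, ?f2]. g x)) (at x)" for x
    proof -
      have "((\<lambda>x. inverse (D x)) has_derivative (\<lambda>h. - (inverse (D x) * (h *\<^sub>R ?D x) * inverse (D x)))) (at x)"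
        by (rule Deriv.has_derivative_inverse[OF D0 tempered_has_vector_derivative[OF D, unfolded has_vector_derivative_def]])
      from has_derivative_power[OF this, of j]
      have "((\<lambda>x. inverse (D x) ^ j) has_derivative (\<lambda>h. of_nat j * - (inverse (D x) * (h *\<^sub>R ?D x) * inverse (D x)) * inverse (D x) ^ (j - 1))) (at x)" .
      from has_derivative_mult[OF tempered_has_vector_derivative[OF u, unfolded has_vector_derivative_def] this]
      have "((\<lambda>x. u x * inverse (D x) ^ j) has_derivative (\<lambda>h. h *\<^sub>R (?f1 x + ?f2 x))) (at x)"
        by (rule has_derivative_eq_rhs) (cases j; simp add: fun_eq_iff scaleR_conv_of_real algebra_simps)
      then show ?thesis by (simp add: f has_vector_derivative_def)
    qed
    moreover have "set [?f1, ?f2] \<subseteq> G"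
    proof -
      have "?f1 \<in> G" unfolding G_def
        by (intro CollectI exI conjI, rule refl) (rule tempered_deriv[OF u])
      moreover have "?f2 \<in> G" unfolding G_def
        by (intro CollectI exI conjI, rule refl) (intro tempered_mult tempered_deriv u D tempered_const)
      ultimately show ?thesis by simp
    qed
    ultimately show "\<exists>fs. set fs \<subseteq> G \<and> (\<forall>x. (f has_vector_derivative (\<Sum>g\<leftarrow>fs. g x)) (at x))" by blast
    have "norm ((inverse (D x)) ^ j) \<le> (1 / \<delta>) ^ j * (1 + norm x) ^ 0" for x
    proof -
      have "norm (inverse (D x)) \<le> 1 / \<delta>"
        unfolding norm_inverse using le_imp_inverse_le[OF \<delta>(2)[of x] \<delta>(1)] by (simp add: inverse_eq_divide)
      then show ?thesis unfolding norm_power by (simp add: power_mono)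
    qed
    then have "\<exists>N C. \<forall>x. norm ((inverse (D x)) ^ j) \<le> C * (1 + norm x) ^ N" by blast
    then show "\<exists>N C. \<forall>x. norm (f x) \<le> C * (1 + norm x) ^ N" unfolding f
      by (rule bound_mult[OF tempered_bound[OF u]])
  next
    show "(\<lambda>x. 1 * (inverse (D x)) ^ 1) \<in> G" unfolding G_def
      by (intro CollectI exI[of _ "\<lambda>x. 1"] exI[of _ 1]) simp
  qed
  then show ?thesis by simp
qed

definition step :: "real \<Rightarrow> real" where
  "step x = flat 0 x / (flat 0 x + flat 0 (1 - x))"

lemma step_eq_0: "x \<le> 0 \<Longrightarrow> step x = 0" by (simp add: step_def flat_def)

lemma step_eq_1: "1 \<le> x \<Longrightarrow> step x = 1" by (simp add: step_def flat_def)

lemma flat_mono: "x \<le> y \<Longrightarrow> flat 0 x \<le> flat 0 y"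
  by (auto simp: flat_def frac_le)

lemma tempered_real_affine: "tempered (\<lambda>x. of_real (a * x + b))"
  using tempered_add[OF tempered_mult[OF tempered_const[of "of_real a"] tempered_inner[of "1::real"]] tempered_const[of "of_real b"]]
  by simp

lemma tempered_step: "tempered (\<lambda>x. of_real (step x))"
proof -
  have "(\<lambda>x. complex_of_real (1 - x)) = (\<lambda>x. of_real ((- 1) * x + 1))" by auto
  then have t: "tempered (\<lambda>x. complex_of_real (1 - x))" by (simp only: tempered_real_affine)
  have a: "tempered (\<lambda>x. complex_of_real (flat 0 x) + of_real (flat 0 (1 - x)))"
    by (intro tempered_add tempered_flat tempered_compose[OF tempered_flat t])
  \<comment> \<open>At least one of x and 1 - x is \<ge> 1/2, which keeps the denominator of
    \<open>step\<close> away from 0.\<close>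
  have b: "flat 0 (1/2) \<le> norm (complex_of_real (flat 0 x) + of_real (flat 0 (1 - x)))" for x
  proof -
    have "flat 0 (1/2) \<le> flat 0 x + flat 0 (1 - x)"
      using flat_mono[of "1/2" x] flat_mono[of "1/2" "1 - x"] flat_nonneg[of 0 x] flat_nonneg[of 0 "1 - x"]
      by (cases "1/2 \<le> x") auto
    also have "\<dots> = norm (complex_of_real (flat 0 x + flat 0 (1 - x)))"
      using flat_nonneg[of 0 x] flat_nonneg[of 0 "1 - x"] by (simp only: norm_of_real)
    finally show ?thesis by simp
  qed
  have "0 < flat 0 (1/2)" by (simp add: flat_def)
  from tempered_mult[OF tempered_flat tempered_inverse[OF a this b]]
  show ?thesis unfolding step_def by (simp only: of_real_add divide_inverse of_real_mult of_real_inverse)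
qed

lemma tempered_step_compose:
  "tempered (\<lambda>x. of_real (q x)) \<Longrightarrow> tempered (\<lambda>x. of_real (step (q x)))"
  by (rule tempered_compose[OF tempered_step])

text \<open>The two classes below consist of products of an elementary function, singular or of rapid
  growth on the left half line, with a tempered factor that vanishes there.\<close>

lemma frechet_derivative_vanishes_open:
  fixes g :: "real \<Rightarrow> complex"
  assumes "open U" "\<And>x. x \<in> U \<Longrightarrow> g x = 0" "x \<in> U"
  shows "frechet_derivative g (at x) 1 = 0"
proof -
  have "(g has_derivative (\<lambda>h. 0)) (at x)"
    by (rule has_derivative_transform_within_open[OF has_derivative_const[of 0] assms(1,3)])
      (use assms in auto)
  from fun_cong[OF frechet_derivative_at[OF this], of 1] show ?thesis by simp
qed

lemma frechet_derivative_vanishes: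
  fixes g :: "real \<Rightarrow> complex"
  assumes "\<And>x. x < a \<Longrightarrow> g x = 0" "x < a"
  shows "frechet_derivative g (at x) 1 = 0"
  by (rule frechet_derivative_vanishes_open[OF open_lessThan[of a]]) (use assms in auto)

lemma tempered_powr:
  assumes g: "tempered g" "\<And>x. x < 1/2 \<Longrightarrow> g x = 0"
  shows "tempered (\<lambda>x. g x * of_real (x powr s))"
proof -
  define G where "G = {\<lambda>x. u x * complex_of_real (x powr s) | u s. tempered u \<and> (\<forall>x<1/2. u x = 0)}"
  show ?thesis
  proof (rule temperedI_real[of G])
    fix f assume "f \<in> G"
    then obtain u s where f: "f = (\<lambda>x. u x * of_real (x powr s))" and u: "tempered u" "\<And>x. x < 1/2 \<Longrightarrow> u x = 0"
      by (auto simp: G_def)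
    let ?f1 = "\<lambda>x. frechet_derivative u (at x) 1 * of_real (x powr s)"
    let ?f2 = "\<lambda>x. (of_real s * u x) * of_real (x powr (s - 1))"
    have "(f has_vector_derivative (\<Sum>g\<leftarrow>[?f1, ?f2]. g x)) (at x)" for x
    proof (cases "x < 1/2")
      case True
      have "(f has_vector_derivative 0) (at x)"
        by (rule has_vector_derivative_transform_within_open[OF has_vector_derivative_const[of 0], where S = "{..<1/2}"])
          (use True u in \<open>auto simp: f\<close>)
      moreover have "u x = 0" "frechet_derivative u (at x) 1 = 0"
        using u(2)[OF True] frechet_derivative_vanishes[OF u(2) True] by simp_all
      ultimately show ?thesis by (simp only: list.map sum_list.Cons sum_list.Nil mult_zero_left mult_zero_right add_0)
    next
      case False
      then have "((\<lambda>x. x powr s) has_real_derivative s * x powr (s - 1)) (at x)"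
        by (intro has_real_derivative_powr) simp
      from has_vector_derivative_mult[OF tempered_has_vector_derivative[OF u(1)] has_vector_derivative_of_real[OF this]]
      show ?thesis by (simp add: f algebra_simps)
    qed
    moreover have "set [?f1, ?f2] \<subseteq> G"
    proof -
      have "tempered (\<lambda>x. frechet_derivative u (at x) 1) \<and> (\<forall>x<1/2. frechet_derivative u (at x) 1 = 0)"
        by (intro conjI allI impI tempered_deriv[OF u(1)] frechet_derivative_vanishes[OF u(2)])
      then have "?f1 \<in> G" unfolding G_def by - (intro CollectI exI conjI, rule refl, auto)
      moreover have "tempered (\<lambda>x. of_real s * u x) \<and> (\<forall>x<1/2. of_real s * u x = 0)"
        by (intro conjI allI impI tempered_mult[OF tempered_const u(1)]) (simp add: u(2))
      then have "?f2 \<in> G" unfolding G_def by - (intro CollectI exI conjI, rule refl, auto)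
      ultimately show ?thesis by simp
    qed
    ultimately show "\<exists>fs. set fs \<subseteq> G \<and> (\<forall>x. (f has_vector_derivative (\<Sum>g\<leftarrow>fs. g x)) (at x))" by blast
    obtain N C where NC: "\<forall>x. norm (u x) \<le> C * (1 + norm x) ^ N" using tempered_bound[OF u(1)] by blast
    define k where "k = nat \<lceil>\<bar>s\<bar>\<rceil>"
    have "norm (f x) \<le> (\<bar>C\<bar> * 2 ^ k) * (1 + norm x) ^ (N + k)" for x
    proof (cases "x < 1/2")
      case True
      then show ?thesis by (simp add: f u(2))
    next
      case False
      have k: "\<bar>s\<bar> \<le> real k" unfolding k_def by linarith
      \<comment> \<open>Here x \<ge> 1/2, so both x and 1/x are at most 2 (1 + x); this treats both
        signs of the exponent.\<close>
      have "x powr s \<le> (2 * (1 + x)) powr \<bar>s\<bar>"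
      proof (cases "0 \<le> s")
        case True
        then show ?thesis using False by (simp add: powr_mono2)
      next
        case neg: False
        have "x powr s = (1 / x) powr \<bar>s\<bar>" using neg False by (simp add: powr_minus powr_divide field_simps abs_if)
        also have "\<dots> \<le> (2 * (1 + x)) powr \<bar>s\<bar>"
        proof (rule powr_mono2)
          have "1 / x \<le> 2" using False by (simp add: divide_le_eq)
          then show "1 / x \<le> 2 * (1 + x)" using False by simp
        qed (use False in auto)
        finally show ?thesis .
      qed
      also have "\<dots> \<le> (2 * (1 + x)) powr (real k)" using False k by (intro powr_mono) auto
      also have "\<dots> = 2 ^ k * (1 + norm x) ^ k" using False by (simp add: powr_realpow power_mult_distrib[symmetric] algebra_simps)
      finally have 1: "x powr s \<le> 2 ^ k * (1 + norm x) ^ k" .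
      have "norm (u x) \<le> \<bar>C\<bar> * (1 + norm x) ^ N" by (rule bound_weaken[of _ C _ N]) (use NC in auto)
      from mult_mono[OF this 1] have "norm (u x) * (x powr s) \<le> (\<bar>C\<bar> * (1 + norm x) ^ N) * (2 ^ k * (1 + norm x) ^ k)" by simp
      then show ?thesis by (simp add: f norm_mult power_add mult_ac)
    qed
    then show "\<exists>N C. \<forall>x. norm (f x) \<le> C * (1 + norm x) ^ N" by blast
  next
    show "(\<lambda>x. g x * of_real (x powr s)) \<in> G" unfolding G_def
      by (intro CollectI exI[of _ g] exI[of _ s]) (simp add: g)
  qed
qed
section \<open>Taylor remainders of the exponential\<close>

text \<open>An entire function: at x = t^2 it is cos t for m = 0 and sin t / t for m = 1. In general
  it is the even part of the m-th Taylor remainder of exp (i t) after division by (i t)^m, expressed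
  through t^2.\<close>

definition Cm :: "nat \<Rightarrow> real \<Rightarrow> real" where
  "Cm m x = (\<Sum>l. (- 1) ^ l / fact (2 * l + m) * x ^ l)"

lemma Cm_term_le: "norm ((- 1) ^ l / fact (2 * l + m) * x ^ l :: real) \<le> \<bar>x\<bar> ^ l /\<^sub>R fact l"
proof -
  have "(fact l :: real) \<le> fact (2 * l + m)" by (rule fact_mono) simp
  then have "\<bar>x\<bar> ^ l / fact (2 * l + m) \<le> \<bar>x\<bar> ^ l / fact l" by (intro divide_left_mono) auto
  then show ?thesis by (simp add: abs_mult power_abs divide_inverse mult_ac)
qed

lemma Cm_summable: "summable (\<lambda>l. (- 1) ^ l / fact (2 * l + m) * x ^ l :: real)"
  by (rule summable_comparison_test'[OF summable_exp_generic[of "\<bar>x\<bar>"] Cm_term_le])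

text \<open>Writing l + 1 as ((2 l + m + 2) - m) / 2 splits the differentiated coefficient into
  those of \<open>Cm (m + 1)\<close> and \<open>Cm (m + 2)\<close>. The family is thus closed under
  differentiation.\<close>

lemma Cm_derivative:
  "(Cm m has_real_derivative (- (Cm (m + 1) x - real m * Cm (m + 2) x) / 2)) (at x)"
proof -
  let ?c = "\<lambda>m l. (- 1) ^ l / fact (2 * l + m) :: real"
  have eq: "diffs (?c m) l * x ^ l = (- 1 / 2) * (?c (m + 1) l * x ^ l - real m * (?c (m + 2) l * x ^ l))" for l
  proof -
    define F :: real where "F = fact (2 * l + (m + 1))"
    define q where "q = (- 1) ^ l / (real (2 * l + m + 2) * F)"
    have F: "F \<noteq> 0" by (simp add: F_def)
    have "2 * Suc l + m = Suc (2 * l + (m + 1))" "2 * l + (m + 2) = Suc (2 * l + (m + 1))" by simp_all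
    then have f: "fact (2 * Suc l + m) = real (2 * l + m + 2) * F" "fact (2 * l + (m + 2)) = real (2 * l + m + 2) * F"
      unfolding F_def by (simp_all only: fact_Suc) (simp_all add: algebra_simps)
    have 1: "?c m (Suc l) = - q" unfolding f q_def by simp
    have 2: "?c (m + 2) l = q" unfolding f q_def by simp
    have 3: "?c (m + 1) l = real (2 * l + m + 2) * q" using F unfolding q_def F_def[symmetric] by simp
    show ?thesis unfolding diffs_def 1 2 3 by (simp add: algebra_simps)
  qed
  let ?A = "\<lambda>l. ?c (m + 1) l * x ^ l" and ?B = "\<lambda>l. ?c (m + 2) l * x ^ l"
  have sA: "summable ?A" and sB: "summable ?B" by (rule Cm_summable)+
  have "(\<Sum>l. diffs (?c m) l * x ^ l) = (- 1 / 2) * (\<Sum>l. ?A l - real m * ?B l)"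
    unfolding eq by (rule suminf_mult[OF summable_diff[OF sA summable_mult[OF sB]]])
  also have "(\<Sum>l. ?A l - real m * ?B l) = Cm (m + 1) x - real m * Cm (m + 2) x"
    unfolding Cm_def suminf_diff[OF sA summable_mult[OF sB], symmetric] suminf_mult[OF sB] ..
  also have "(- 1 / 2) * a = - a / 2" for a :: real by simp
  finally have "(\<Sum>l. diffs (?c m) l * x ^ l) = - (Cm (m + 1) x - real m * Cm (m + 2) x) / 2" .
  moreover have "((\<lambda>x. \<Sum>l. ?c m l * x ^ l) has_field_derivative (\<Sum>l. diffs (?c m) l * x ^ l)) (at x)"
    by (rule termdiffs_strong_converges_everywhere[OF Cm_summable])
  ultimately show ?thesis by (simp only: Cm_def[abs_def])
qed

text \<open>The m-th Taylor remainder of exp (i t) divided by (i t)^m, given by its series so that t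
  = 0 is no exception.\<close>

definition cistail :: "nat \<Rightarrow> real \<Rightarrow> complex" where
  "cistail m t = (\<Sum>l. (\<i> * of_real t) ^ l / fact (l + m))"

lemma cistail_summable: "summable (\<lambda>l. (\<i> * of_real t) ^ l / fact (l + m) :: complex)"
proof (rule summable_comparison_test'[OF summable_exp_generic[of "\<bar>t\<bar>"]])
  fix l
  have "(fact l :: real) \<le> fact (l + m)" by (rule fact_mono) simp
  then have "\<bar>t\<bar> ^ l / fact (l + m) \<le> \<bar>t\<bar> ^ l / fact l" by (intro divide_left_mono) auto
  then show "norm ((\<i> * of_real t) ^ l / fact (l + m) :: complex) \<le> \<bar>t\<bar> ^ l /\<^sub>R fact l"
    by (simp add: norm_divide norm_power norm_mult norm_inverse divide_inverse mult_ac)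
qed

lemma cis_taylor: "cis t = (\<Sum>l<m. (\<i> * of_real t) ^ l / fact l) + (\<i> * of_real t) ^ m * cistail m t"
proof -
  let ?f = "\<lambda>l. (\<i> * of_real t) ^ l /\<^sub>R fact l :: complex"
  have f: "?f l = (\<i> * of_real t) ^ l / fact l" for l
    by (simp add: scaleR_conv_of_real divide_inverse)
  have "cis t = suminf ?f" by (simp add: cis_conv_exp exp_def)
  also have "\<dots> = (\<Sum>l. ?f (l + m)) + (\<Sum>l<m. ?f l)"
    by (rule suminf_split_initial_segment[OF summable_exp_generic])
  also have "(\<Sum>l. ?f (l + m)) = (\<Sum>l. (\<i> * of_real t) ^ m * ((\<i> * of_real t) ^ l / fact (l + m)))"
    unfolding f by (simp add: power_add mult_ac)
  also have "\<dots> = (\<i> * of_real t) ^ m * cistail m t"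
    unfolding cistail_def by (rule suminf_mult[OF cistail_summable])
  finally show ?thesis unfolding f by simp
qed

text \<open>For m > 0 and t \<noteq> 0 this is the estimate |t|^m / m! of the Taylor remainder,
  divided by |t|^m.\<close>

lemma norm_cistail: "norm (cistail m t) \<le> 1"
proof (cases m)
  case 0
  have "cistail 0 t = cis t" using cis_taylor[of t 0] by simp
  then show ?thesis using 0 by (simp only: norm_cis order_refl)
next
  case (Suc n)
  show ?thesis
  proof (cases "t = 0")
    case True
    have "cistail m 0 = (\<Sum>l. (1 / fact (l + m)) * 0 ^ l :: complex)" by (simp add: cistail_def)
    also have "\<dots> = 1 / fact m" by (subst powser_zero) simp
    finally show ?thesis using True fact_ge_1[of m, where 'a = real] by (simp add: norm_divide)
  next
    case False
    have "norm ((\<i> * of_real t) ^ m * cistail m t) = norm (cis t - (\<Sum>k\<le>n. (\<i> * t) ^ k / fact k))"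
      using cis_taylor[of t m] by (simp add: Suc lessThan_Suc_atMost)
    also have "\<dots> \<le> \<bar>t\<bar> ^ Suc n / fact (Suc n)" using iexp_approx1[of t n] by (simp add: cis_conv_exp)
    also have "\<dots> \<le> \<bar>t\<bar> ^ Suc n / 1" by (rule divide_left_mono) (simp_all only: fact_ge_1, simp_all)
    finally have "\<bar>t\<bar> ^ m * norm (cistail m t) \<le> \<bar>t\<bar> ^ m * 1" by (simp add: norm_mult norm_power Suc)
    then show ?thesis by (rule mult_left_le_imp_le) (simp add: False)
  qed
qed

text \<open>Odd powers of t cancel in the symmetrisation. This is how a function of t = sqrt \<xi>
  times a coordinate becomes a smooth function of \<xi>.\<close>

lemma Cm_even: "of_real (Cm m (t\<^sup>2)) = (cistail m t + cistail m (- t)) / 2"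
proof -
  let ?a = "\<lambda>l. ((\<i> * of_real t) ^ l / fact (l + m) + (\<i> * of_real (- t)) ^ l / fact (l + m)) / 2 :: complex"
  have "(cistail m t + cistail m (- t)) / 2 = suminf ?a"
    unfolding cistail_def using cistail_summable[of t m] cistail_summable[of "- t" m]
    by (simp only: suminf_add suminf_divide[OF summable_add])
  also have "\<dots> = (\<Sum>j. ?a (2 * j))"
  proof (rule suminf_mono_reindex[symmetric])
    show "strict_mono (\<lambda>j::nat. 2 * j)" by (auto simp: strict_mono_def)
    fix l :: nat assume "l \<notin> range (\<lambda>j. 2 * j)"
    then have "odd l" by (auto elim!: evenE)
    then show "?a l = 0" by (simp add: power_minus_odd)
  qed
  finally have "(cistail m t + cistail m (- t)) / 2 = (\<Sum>j. ?a (2 * j))" .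
  moreover have "?a (2 * j) = of_real ((- 1) ^ j / fact (2 * j + m) * (t\<^sup>2) ^ j)" for j
  proof -
    have "(\<i> * complex_of_real s) ^ (2 * j) = of_real ((- 1) ^ j * (s\<^sup>2) ^ j)" for s
      by (simp add: power_mult power_mult_distrib power_minus[of "(complex_of_real s)\<^sup>2"])
    from this[of t] this[of "- t"] show ?thesis by simp
  qed
  ultimately show ?thesis unfolding Cm_def by (simp only: suminf_of_real[OF Cm_summable])
qed

lemma Cm_bound_nonneg: "0 \<le> x \<Longrightarrow> \<bar>Cm m x\<bar> \<le> 1"
proof -
  assume x: "0 \<le> x"
  have "norm (complex_of_real (Cm m ((sqrt x)\<^sup>2))) \<le> (1 + 1) / 2"
    unfolding Cm_even norm_divide using norm_triangle_ineq[of "cistail m (sqrt x)" "cistail m (- sqrt x)"]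
      norm_cistail[of m "sqrt x"] norm_cistail[of m "- sqrt x"] by simp
  then show ?thesis using x by simp
qed

text \<open>For x \<rightarrow> -\<infinity> the signs no longer alternate and \<open>Cm m\<close>
  outgrows every power, so a bound can only be uniform on a half line bounded below.\<close>

lemma Cm_bound: "- 1 \<le> x \<Longrightarrow> \<bar>Cm m x\<bar> \<le> exp 1"
proof (cases "0 \<le> x")
  case True
  then show ?thesis using Cm_bound_nonneg[of x m] exp_ge_add_one_self[of "1::real"] by simp
next
  case False
  assume "- 1 \<le> x"
  with False have x: "\<bar>x\<bar> \<le> 1" by simp
  have "norm (Cm m x) \<le> (\<Sum>l. \<bar>x\<bar> ^ l /\<^sub>R fact l)" unfolding Cm_def
    by (rule norm_suminf_le[OF Cm_term_le summable_exp_generic])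
  also have "\<dots> = exp \<bar>x\<bar>" by (simp add: exp_def)
  also have "\<dots> \<le> exp 1" using x by simp
  finally show ?thesis by simp
qed

lemma tempered_Cm:
  assumes g: "tempered g" "\<And>x. x < - 1 \<Longrightarrow> g x = 0"
  shows "tempered (\<lambda>x. g x * of_real (Cm m x))"
proof -
  define G where "G = {\<lambda>x. u x * complex_of_real (Cm m x) | u m. tempered u \<and> (\<forall>x. x < - 1 \<longrightarrow> u x = 0)}"
  have memb: "(\<lambda>x. u x * complex_of_real (Cm m x)) \<in> G" if "tempered u" "\<And>x. x < - 1 \<Longrightarrow> u x = 0" for u m
    unfolding G_def by (intro CollectI exI[of _ u] exI[of _ m]) (simp add: that)
  show ?thesis
  proof (rule temperedI_real[of G])
    fix f assume "f \<in> G"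
    then obtain u m where f: "f = (\<lambda>x. u x * of_real (Cm m x))" and u: "tempered u" "\<And>x. x < - 1 \<Longrightarrow> u x = 0"
      by (auto simp: G_def)
    let ?f1 = "\<lambda>x. frechet_derivative u (at x) 1 * of_real (Cm m x)"
    let ?f2 = "\<lambda>x. (- (1 / 2) * u x) * of_real (Cm (m + 1) x)"
    let ?f3 = "\<lambda>x. (of_nat m / 2 * u x) * of_real (Cm (m + 2) x)"
    have "(f has_vector_derivative (\<Sum>g\<leftarrow>[?f1, ?f2, ?f3]. g x)) (at x)" for x
    proof -
      have "(f has_vector_derivative u x * of_real (- (Cm (m + 1) x - real m * Cm (m + 2) x) / 2) +
          frechet_derivative u (at x) 1 * of_real (Cm m x)) (at x)"
        unfolding f by (rule has_vector_derivative_mult[OF tempered_has_vector_derivative[OF u(1)]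
           has_vector_derivative_of_real[OF Cm_derivative]])
      then show ?thesis by (rule has_vector_derivative_eq_rhs) (simp add: field_simps)
    qed
    moreover have "set [?f1, ?f2, ?f3] \<subseteq> G"
    proof -
      have "?f1 \<in> G" by (rule memb[OF tempered_deriv[OF u(1)] frechet_derivative_vanishes[OF u(2)]])
      moreover have "?f2 \<in> G" by (rule memb[OF tempered_mult[OF tempered_const u(1)]]) (simp add: u(2))
      moreover have "?f3 \<in> G" by (rule memb[OF tempered_mult[OF tempered_const u(1)]]) (simp add: u(2))
      ultimately show ?thesis by (simp only: set_simps insert_subset empty_subsetI simp_thms)
    qed
    ultimately show "\<exists>fs. set fs \<subseteq> G \<and> (\<forall>x. (f has_vector_derivative (\<Sum>g\<leftarrow>fs. g x)) (at x))" by blast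
    obtain N C where NC: "\<forall>x. norm (u x) \<le> C * (1 + norm x) ^ N" using tempered_bound[OF u(1)] by blast
    have "norm (f x) \<le> (\<bar>C\<bar> * exp 1) * (1 + norm x) ^ N" for x
    proof (cases "x < - 1")
      case True
      then show ?thesis by (simp add: f u(2))
    next
      case False
      have "norm (u x) \<le> \<bar>C\<bar> * (1 + norm x) ^ N" by (rule bound_weaken[of _ C _ N]) (use NC in auto)
      from mult_mono[OF this Cm_bound[of x m]] False show ?thesis by (simp add: f norm_mult mult_ac)
    qed
    then show "\<exists>N C. \<forall>x. norm (f x) \<le> C * (1 + norm x) ^ N" by blast
  qed (rule memb[OF g])
qed

text \<open>A tempered replacement for \<open>Cm m\<close>, equal to it for x \<ge> 0 and zero for x
  \<le> -1. Negative arguments occur because the coefficient functions are constructed for all real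
  \<xi>, including \<xi> < 0.\<close>

definition Km :: "nat \<Rightarrow> real \<Rightarrow> complex" where
  "Km m x = of_real (step (x + 1)) * of_real (Cm m x)"

lemma Km_tempered: "tempered (Km m)"
proof -
  have "tempered (\<lambda>x. complex_of_real (step (1 * x + 1)))"
    by (rule tempered_step_compose[OF tempered_real_affine])
  then have "tempered (\<lambda>x. complex_of_real (step (x + 1)) * of_real (Cm m x))"
    by (intro tempered_Cm) (simp_all add: step_eq_0)
  then show ?thesis by (simp add: Km_def[abs_def])
qed

lemma Km_nonneg: "0 \<le> x \<Longrightarrow> Km m x = of_real (Cm m x)"
  by (simp add: Km_def step_eq_1)

section \<open>Two parametric integral operators\<close>

lemma kernel_bound:
  fixes e :: "'a::euclidean_space"
  assumes "tempered K"
  shows "\<exists>N C. \<forall>\<xi> w. \<bar>\<xi>\<bar> \<le> R \<longrightarrow> norm (K (\<xi> * (w \<bullet> e)\<^sup>2)) \<le> C * (1 + norm w) ^ N"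
proof -
  obtain N C where NC: "\<forall>x. norm (K x) \<le> C * (1 + norm x) ^ N" using tempered_bound[OF assms] by blast
  have "norm (K (\<xi> * (w \<bullet> e)\<^sup>2)) \<le> (\<bar>C\<bar> * (1 + \<bar>R\<bar> * (norm e)\<^sup>2) ^ N) * (1 + norm w) ^ (2 * N)" if \<xi>: "\<bar>\<xi>\<bar> \<le> R" for \<xi> w
  proof -
    have "(w \<bullet> e)\<^sup>2 \<le> (norm e)\<^sup>2 * (norm w)\<^sup>2"
      using Cauchy_Schwarz_ineq[of w e] by (simp add: power2_norm_eq_inner mult.commute)
    also have "\<dots> \<le> (norm e)\<^sup>2 * (1 + norm w)\<^sup>2" by (intro mult_left_mono power_mono) auto
    finally have "\<bar>\<xi>\<bar> * (w \<bullet> e)\<^sup>2 \<le> \<bar>R\<bar> * ((norm e)\<^sup>2 * (1 + norm w)\<^sup>2)" using \<xi> by (intro mult_mono) auto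
    moreover have "1 \<le> (1 + norm w)\<^sup>2" by simp
    ultimately have "1 + \<bar>\<xi>\<bar> * (w \<bullet> e)\<^sup>2 \<le> (1 + \<bar>R\<bar> * (norm e)\<^sup>2) * (1 + norm w)\<^sup>2"
      unfolding distrib_right mult_1_left mult.assoc by (intro add_mono)
    then have "(1 + norm (\<xi> * (w \<bullet> e)\<^sup>2)) ^ N \<le> ((1 + \<bar>R\<bar> * (norm e)\<^sup>2) * (1 + norm w)\<^sup>2) ^ N"
      by (intro power_mono) (auto simp: abs_mult)
    then have "\<bar>C\<bar> * (1 + norm (\<xi> * (w \<bullet> e)\<^sup>2)) ^ N \<le> \<bar>C\<bar> * ((1 + \<bar>R\<bar> * (norm e)\<^sup>2) * (1 + norm w)\<^sup>2) ^ N"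
      by (intro mult_left_mono) auto
    moreover have "norm (K (\<xi> * (w \<bullet> e)\<^sup>2)) \<le> \<bar>C\<bar> * (1 + norm (\<xi> * (w \<bullet> e)\<^sup>2)) ^ N"
      by (rule bound_weaken[of _ C _ N]) (use NC in auto)
    ultimately show ?thesis by (simp add: power_mult_distrib power_mult mult.assoc)
  qed
  then show ?thesis by blast
qed

lemma kernel_measurable:
  fixes e :: "'a::euclidean_space"
  assumes "tempered K"
  shows "(\<lambda>w. K (\<xi> * (w \<bullet> e)\<^sup>2)) \<in> borel_measurable borel"
proof -
  note [measurable] = tempered_measurable[OF assms]
  show ?thesis by measurable
qed

lemma kernel_has_derivative:
  fixes e :: "'a::euclidean_space"
  assumes f: "f \<in> schwartz" and K: "tempered K"
  shows "((\<lambda>\<xi>. LINT w|lborel. f w * K (\<xi> * (w \<bullet> e)\<^sup>2)) has_derivative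
     (\<lambda>h. LINT w|lborel. h *\<^sub>R (of_real ((w \<bullet> e)\<^sup>2) * f w * frechet_derivative K (at (\<xi> * (w \<bullet> e)\<^sup>2)) 1))) (at \<xi>)"
proof -
  let ?K' = "\<lambda>x. frechet_derivative K (at x) 1"
  define R where "R = \<bar>\<xi>\<bar> + 1"
  obtain N C where NC: "\<forall>\<xi> w. \<bar>\<xi>\<bar> \<le> R \<longrightarrow> norm (?K' (\<xi> * (w \<bullet> e)\<^sup>2)) \<le> C * (1 + norm w) ^ N"
    using kernel_bound[OF tempered_deriv[OF K]] by blast
  obtain N' C' where NC': "\<forall>\<xi> w. \<bar>\<xi>\<bar> \<le> R \<longrightarrow> norm (K (\<xi> * (w \<bullet> e)\<^sup>2)) \<le> C' * (1 + norm w) ^ N'"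
    using kernel_bound[OF K] by blast
  let ?B = "\<lambda>w. norm (f w * of_real ((w \<bullet> e)\<^sup>2 * (\<bar>C\<bar> * (1 + norm w) ^ N)))"
  have nn: "0 \<le> (w \<bullet> e)\<^sup>2 * (\<bar>C\<bar> * (1 + norm w) ^ N)" for w by simp
  have B: "?B w = norm (f w) * ((w \<bullet> e)\<^sup>2 * (\<bar>C\<bar> * (1 + norm w) ^ N))" for w
    by (simp only: norm_mult norm_of_real abs_of_nonneg[OF nn])
  show ?thesis
  proof (rule has_derivative_integral[where S = "ball 0 R" and B = ?B])
    show "\<xi> \<in> ball 0 R" by (simp add: R_def)
    show "integrable lborel ?B"
    proof (intro integrable_norm schwartz_integrable_bound(1)[OF f])
      fix w :: 'a
      have "(w \<bullet> e)\<^sup>2 \<le> (norm e)\<^sup>2 * (norm w)\<^sup>2"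
        using Cauchy_Schwarz_ineq[of w e] by (simp add: power2_norm_eq_inner mult.commute)
      also have "\<dots> \<le> (norm e)\<^sup>2 * (1 + norm w)\<^sup>2" by (intro mult_left_mono power_mono) auto
      finally have "(w \<bullet> e)\<^sup>2 * (\<bar>C\<bar> * (1 + norm w) ^ N) \<le> (norm e)\<^sup>2 * (1 + norm w)\<^sup>2 * (\<bar>C\<bar> * (1 + norm w) ^ N)"
        by (intro mult_right_mono) auto
      then show "norm (complex_of_real ((w \<bullet> e)\<^sup>2 * (\<bar>C\<bar> * (1 + norm w) ^ N))) \<le> ((norm e)\<^sup>2 * \<bar>C\<bar>) * (1 + norm w) ^ (2 + N)"
        unfolding norm_of_real abs_of_nonneg[OF nn] by (simp only: power_add mult_ac)
    qed simp
    show "(\<lambda>w. h *\<^sub>R (of_real ((w \<bullet> e)\<^sup>2) * f w * ?K' (\<xi> * (w \<bullet> e)\<^sup>2))) \<in> borel_measurable lborel" for h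
      using schwartz_measurable[OF f] kernel_measurable[OF tempered_deriv[OF K], of \<xi> e] by simp
    fix y :: real and w :: 'a and h :: real assume y: "y \<in> ball 0 R"
    show "integrable lborel (\<lambda>w. f w * K (y * (w \<bullet> e)\<^sup>2))"
      by (rule schwartz_integrable_bound(1)[OF f kernel_measurable[OF K], where C = C' and N = N']) (use NC' y in auto)
    have "((\<lambda>y. y * (w \<bullet> e)\<^sup>2) has_derivative (\<lambda>h. h * (w \<bullet> e)\<^sup>2)) (at y)"
      by (auto intro!: derivative_eq_intros)
    from has_derivative_mult_right[OF has_derivative_compose[OF this tempered_has_vector_derivative[OF K, unfolded has_vector_derivative_def]], of "f w"]
    show "((\<lambda>y. f w * K (y * (w \<bullet> e)\<^sup>2)) has_derivative (\<lambda>h. h *\<^sub>R (of_real ((w \<bullet> e)\<^sup>2) * f w * ?K' (y * (w \<bullet> e)\<^sup>2)))) (at y)"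
      by (rule has_derivative_eq_rhs) (simp add: fun_eq_iff scaleR_conv_of_real mult_ac)
    have "norm (?K' (y * (w \<bullet> e)\<^sup>2)) \<le> \<bar>C\<bar> * (1 + norm w) ^ N"
      by (rule bound_weaken[of _ C _ N]) (use NC y in auto)
    then have "norm h * ((w \<bullet> e)\<^sup>2 * norm (f w) * norm (?K' (y * (w \<bullet> e)\<^sup>2))) \<le> norm h * ((w \<bullet> e)\<^sup>2 * norm (f w) * (\<bar>C\<bar> * (1 + norm w) ^ N))"
      by (intro mult_left_mono) auto
    then show "norm (h *\<^sub>R (of_real ((w \<bullet> e)\<^sup>2) * f w * ?K' (y * (w \<bullet> e)\<^sup>2))) \<le> ?B w * norm h"
      unfolding B by (simp add: norm_mult abs_mult norm_power mult_ac)
  qed auto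
qed

text \<open>Differentiation in \<xi> replaces \<open>K\<close> by its derivative and multiplies the
  integrand by the square of a coordinate of \<open>w\<close>, which is absorbed into the operator
  \<open>T\<close>. Decay in \<xi> comes from the compact support of \<phi>.\<close>

lemma schwartz_op_kernel:
  fixes e :: "'a::euclidean_space"
  assumes \<phi>: "tempered \<phi>" "\<And>\<xi>. 2 < \<bar>\<xi>\<bar> \<Longrightarrow> \<phi> \<xi> = 0" and K: "tempered K"
  shows "schwartz_op (\<lambda>f \<xi>. \<phi> \<xi> * (LINT w|lborel. f w * K (\<xi> * (w \<bullet> e)\<^sup>2)))"
proof -
  define I where "I T K f \<xi> = (LINT w|lborel. T f w * K (\<xi> * (w \<bullet> e)\<^sup>2))"
    for T :: "('a \<Rightarrow> complex) \<Rightarrow> 'a \<Rightarrow> complex" and K :: "real \<Rightarrow> complex" and f \<xi>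
  define \<G> where "\<G> = {\<lambda>f \<xi>. u \<xi> * I T K f \<xi> | u T K.
     tempered u \<and> (\<forall>\<xi>. 2 < \<bar>\<xi>\<bar> \<longrightarrow> u \<xi> = 0) \<and> schwartz_op T \<and> tempered K}"
  have memb: "(\<lambda>f \<xi>. u \<xi> * I T K f \<xi>) \<in> \<G>"
    if "tempered u" "\<And>\<xi>. 2 < \<bar>\<xi>\<bar> \<Longrightarrow> u \<xi> = 0" "schwartz_op T" "tempered K" for u T K
    unfolding \<G>_def by (intro CollectI exI[of _ u] exI[of _ T] exI[of _ K]) (simp add: that)
  have "schwartz_op (\<lambda>f \<xi>. \<phi> \<xi> * I (\<lambda>f. f) K f \<xi>)"
  proof (rule schwartz_opI[of \<G>])
    fix R assume "R \<in> \<G>"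
    then obtain u T K where R: "R = (\<lambda>f \<xi>. u \<xi> * I T K f \<xi>)" and u: "tempered u" "\<And>\<xi>. 2 < \<bar>\<xi>\<bar> \<Longrightarrow> u \<xi> = 0"
      and T: "schwartz_op T" and K: "tempered K" by (auto simp: \<G>_def)
    let ?R1 = "\<lambda>f \<xi>. frechet_derivative u (at \<xi>) 1 * I T K f \<xi>"
    let ?R2 = "\<lambda>f \<xi>. u \<xi> * I (\<lambda>f w. of_real ((w \<bullet> e)\<^sup>2) * T f w) (\<lambda>x. frechet_derivative K (at x) 1) f \<xi>"
    have t: "tempered (\<lambda>w. complex_of_real ((w \<bullet> e)\<^sup>2))" unfolding of_real_power
      by (rule tempered_power[OF tempered_inner])
    have "?R1 \<in> \<G>"
    proof (rule memb[OF tempered_deriv[OF u(1)] _ T K])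
      fix \<xi> :: real assume \<xi>: "2 < \<bar>\<xi>\<bar>"
      have "open {\<xi>::real. 2 < \<bar>\<xi>\<bar>}" by (intro open_Collect_less continuous_intros)
      from frechet_derivative_vanishes_open[OF this] show "frechet_derivative u (at \<xi>) 1 = 0" using u(2) \<xi> by simp
    qed
    moreover have "?R2 \<in> \<G>"
      by (rule memb[OF u schwartz_op_compose[OF schwartz_op_mult[OF t] T] tempered_deriv[OF K]])
    ultimately have A: "set [?R1, ?R2] \<subseteq> \<G>" by simp
    have B: "\<exists>D. (R f has_derivative D) (at \<xi>) \<and> (\<forall>b\<in>Basis. D b = (\<Sum>T'\<leftarrow>[?R1, ?R2]. T' f \<xi>))"
      if f: "f \<in> schwartz" for f \<xi>
    proof (rule exI, rule conjI)
      show "(R f has_derivative (\<lambda>h. u \<xi> * (LINT w|lborel. h *\<^sub>R (of_real ((w \<bullet> e)\<^sup>2) * T f w * frechet_derivative K (at (\<xi> * (w \<bullet> e)\<^sup>2)) 1)) +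
           (h *\<^sub>R frechet_derivative u (at \<xi>) 1) * I T K f \<xi>)) (at \<xi>)"
        unfolding R I_def
        by (rule has_derivative_mult[OF tempered_has_vector_derivative[OF u(1), unfolded has_vector_derivative_def]
              kernel_has_derivative[OF schwartz_op_in[OF T f] K]])
    qed (simp add: I_def add.commute)
    show "\<exists>Ts. (\<forall>b\<in>Basis. set (Ts b) \<subseteq> \<G>) \<and>
      (\<forall>f\<in>schwartz. \<forall>x. \<exists>D. (R f has_derivative D) (at x) \<and> (\<forall>b\<in>Basis. D b = (\<Sum>T'\<leftarrow>Ts b. T' f x)))"
      by (rule exI[of _ "\<lambda>_. [?R1, ?R2]"], intro conjI ballI allI, rule A, erule B)
  next
    fix R N assume "R \<in> \<G>"
    then obtain u T K where R: "R = (\<lambda>f \<xi>. u \<xi> * I T K f \<xi>)" and u: "tempered u" "\<And>\<xi>. 2 < \<bar>\<xi>\<bar> \<Longrightarrow> u \<xi> = 0"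
      and T: "schwartz_op T" and K: "tempered K" by (auto simp: \<G>_def)
    obtain N1 C1 where 1: "\<forall>x. norm (u x) \<le> C1 * (1 + norm x) ^ N1" using tempered_bound[OF u(1)] by blast
    obtain N2 C2 where 2: "\<forall>\<xi> w. \<bar>\<xi>\<bar> \<le> 2 \<longrightarrow> norm (K (\<xi> * (w \<bullet> e)\<^sup>2)) \<le> C2 * (1 + norm w) ^ N2"
      using kernel_bound[OF K] by blast
    define W where "W = \<bar>C2\<bar> * (LINT x|lborel. weight (x::'a))"
    have W: "0 \<le> W" unfolding W_def
      by (intro mult_nonneg_nonneg Bochner_Integration.integral_nonneg) (simp_all add: weight_nonneg)
    obtain M C where 3: "0 \<le> C" "\<forall>f\<in>schwartz. pnorm (2 * DIM('a) + N2) (T f) \<le> C * pnorm M f"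
      using schwartz_op_pnorm[OF T] by blast
    have "(1 + norm \<xi>) ^ N * norm (R f \<xi>) \<le> (3 ^ N * (\<bar>C1\<bar> * 3 ^ N1) * (W * C)) * pnorm M f" if f: "f \<in> schwartz" for f \<xi>
    proof (cases "2 < \<bar>\<xi>\<bar>")
      case True
      have "0 \<le> (3 ^ N * (\<bar>C1\<bar> * 3 ^ N1) * (W * C)) * pnorm M f"
        using W 3 pnorm_nonneg[OF f] by (intro mult_nonneg_nonneg) auto
      with True show ?thesis by (simp add: R u(2))
    next
      case False
      then have \<xi>: "\<bar>\<xi>\<bar> \<le> 2" by simp
      have "norm (I T K f \<xi>) \<le> W * pnorm (2 * DIM('a) + N2) (T f)" unfolding I_def W_def
        by (rule schwartz_integrable_bound(2)[OF schwartz_op_in[OF T f] kernel_measurable[OF K]]) (use 2 \<xi> in blast)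
      also have "\<dots> \<le> W * (C * pnorm M f)" using 3 f W by (intro mult_left_mono) auto
      finally have i: "norm (I T K f \<xi>) \<le> (W * C) * pnorm M f" by simp
      have "norm (u \<xi>) \<le> \<bar>C1\<bar> * (1 + norm \<xi>) ^ N1" by (rule bound_weaken[of _ C1 _ N1]) (use 1 in auto)
      also have "\<dots> \<le> \<bar>C1\<bar> * 3 ^ N1" using \<xi> by (intro mult_left_mono power_mono) auto
      finally have "norm (R f \<xi>) \<le> (\<bar>C1\<bar> * 3 ^ N1) * ((W * C) * pnorm M f)"
        unfolding R norm_mult by (intro mult_mono i) auto
      moreover have "(1 + norm \<xi>) ^ N \<le> 3 ^ N" using \<xi> by (intro power_mono) auto
      ultimately have "(1 + norm \<xi>) ^ N * norm (R f \<xi>) \<le> 3 ^ N * ((\<bar>C1\<bar> * 3 ^ N1) * ((W * C) * pnorm M f))"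
        by (intro mult_mono) auto
      then show ?thesis by (simp add: mult_ac)
    qed
    then show "\<exists>M C. \<forall>f\<in>schwartz. \<forall>x. (1 + norm x) ^ N * norm (R f x) \<le> C * pnorm M f"
      by (intro exI ballI allI)
  next
    show "(\<lambda>f \<xi>. \<phi> \<xi> * I (\<lambda>f. f) K f \<xi>) \<in> \<G>" by (rule memb[OF \<phi> schwartz_op_id K])
  next
    fix f g :: "'a \<Rightarrow> complex" and \<xi> :: real assume f: "f \<in> schwartz" and g: "g \<in> schwartz"
    obtain N C where NC: "\<forall>\<xi>' w. \<bar>\<xi>'\<bar> \<le> \<bar>\<xi>\<bar> \<longrightarrow> norm (K (\<xi>' * (w \<bullet> e)\<^sup>2)) \<le> C * (1 + norm w) ^ N"
      using kernel_bound[OF K] by blast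
    have "integrable lborel (\<lambda>w. h w * K (\<xi> * (w \<bullet> e)\<^sup>2))" if "h \<in> schwartz" for h
      by (rule schwartz_integrable_bound(1)[OF that kernel_measurable[OF K], where C = C and N = N]) (use NC in auto)
    from this[OF f] this[OF g]
    show "\<phi> \<xi> * I (\<lambda>f. f) K (\<lambda>x. f x - g x) \<xi> = \<phi> \<xi> * I (\<lambda>f. f) K f \<xi> - \<phi> \<xi> * I (\<lambda>f. f) K g \<xi>"
      by (simp add: I_def left_diff_distrib right_diff_distrib)
  qed
  then show ?thesis by (simp add: I_def)
qed

section \<open>Averaged shear derivatives and Newton's forward formula\<close>

definition shear_int :: "nat \<Rightarrow> (real \<times> real) list \<Rightarrow> (real \<times> real \<Rightarrow> complex) \<Rightarrow> real \<times> real \<Rightarrow> complex" where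
  "shear_int a cs u p = (LINT t|lborel. indicator {0..1} t *\<^sub>R
     (of_real (t ^ a) * iterated_partial cs u (fst p, snd p + 2 * t * fst p)))"

lemma Basis_real_prod: "(Basis :: (real \<times> real) set) = {(1, 0), (0, 1)}"
  by (auto simp: Basis_prod_def)

lemma has_derivative_real_prod:
  fixes u :: "real \<times> real \<Rightarrow> complex"
  assumes u: "smooth u" and cs: "cs \<in> lists Basis"
  shows "(iterated_partial cs u has_derivative (\<lambda>h. fst h *\<^sub>R iterated_partial ((1, 0) # cs) u q +
     snd h *\<^sub>R iterated_partial ((0, 1) # cs) u q)) (at q)"
proof -
  have d: "(iterated_partial cs u has_derivative frechet_derivative (iterated_partial cs u) (at q)) (at q)"
    by (rule smooth_has_derivative[OF u cs])
  have "frechet_derivative (iterated_partial cs u) (at q) h = fst h *\<^sub>R iterated_partial ((1, 0) # cs) u q +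
     snd h *\<^sub>R iterated_partial ((0, 1) # cs) u q" for h
    by (subst derivative_basis_expansion[OF d]) (simp add: Basis_real_prod iterated_partial_Cons inner_prod_def)
  then have "frechet_derivative (iterated_partial cs u) (at q) = (\<lambda>h. fst h *\<^sub>R iterated_partial ((1, 0) # cs) u q +
     snd h *\<^sub>R iterated_partial ((0, 1) # cs) u q)" by (rule ext)
  with d show ?thesis by (simp only:)
qed

lemma shear_continuous:
  assumes "u \<in> schwartz" "cs \<in> lists Basis"
  shows "continuous_on A (\<lambda>t. of_real (t ^ a) * iterated_partial cs u (fst p, snd p + 2 * t * fst p))"
  by (intro continuous_intros continuous_on_compose2[OF smooth_continuous[OF schwartz_smooth[OF assms(1)] assms(2)]]) auto

lemma shear_integrable:
  assumes "u \<in> schwartz" "cs \<in> lists Basis"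
  shows "integrable lborel (\<lambda>t. indicator {0..1} t *\<^sub>R (of_real (t ^ a) * iterated_partial cs u (fst p, snd p + 2 * t * fst p)))"
  by (rule borel_integrable_compact[OF compact_Icc shear_continuous[OF assms]])

text \<open>Differentiating \<eta> + 2 t \<xi> in \<xi> produces a factor 2 t. The power t^a in the
  definition absorbs it, so the family over all \<open>a\<close> and \<open>cs\<close> is closed
  under differentiation.\<close>

lemma shear_int_has_derivative:
  assumes u: "u \<in> schwartz" and cs: "cs \<in> lists Basis"
  shows "(shear_int a cs u has_derivative (\<lambda>h. fst h *\<^sub>R shear_int a ((1, 0) # cs) u p +
     (snd h *\<^sub>R shear_int a ((0, 1) # cs) u p + (2 * fst h) *\<^sub>R shear_int (a + 1) ((0, 1) # cs) u p))) (at p)"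
proof -
  let ?L = "\<lambda>t p. (fst p, snd p + 2 * t * fst p) :: real \<times> real"
  let ?i = "\<lambda>t. indicator {0..1} t :: real"
  let ?k' = "\<lambda>p t h. ?i t *\<^sub>R (of_real (t ^ a) * (fst h *\<^sub>R iterated_partial ((1, 0) # cs) u (?L t p) +
     (snd h + 2 * t * fst h) *\<^sub>R iterated_partial ((0, 1) # cs) u (?L t p)))"
  define P where "P = pnorm (Suc (length cs)) u"
  have cs': "(1, 0) # cs \<in> lists Basis" "(0, 1) # cs \<in> lists Basis" using cs by (simp_all add: Basis_real_prod)
  have eq: "?k' p t h = fst h *\<^sub>R (?i t *\<^sub>R (of_real (t ^ a) * iterated_partial ((1, 0) # cs) u (?L t p))) +
     (snd h *\<^sub>R (?i t *\<^sub>R (of_real (t ^ a) * iterated_partial ((0, 1) # cs) u (?L t p))) +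
      (2 * fst h) *\<^sub>R (?i t *\<^sub>R (of_real (t ^ (a + 1)) * iterated_partial ((0, 1) # cs) u (?L t p))))" for p t and h :: "real \<times> real"
    by (simp add: scaleR_conv_of_real algebra_simps)
  have i': "integrable lborel (\<lambda>t. ?k' p t h)" for p and h :: "real \<times> real" unfolding eq
    by (intro Bochner_Integration.integrable_add integrable_scaleR_right shear_integrable[OF u] cs')
  have "((\<lambda>p. LINT t|lborel. ?i t *\<^sub>R (of_real (t ^ a) * iterated_partial cs u (?L t p))) has_derivative
      (\<lambda>h. LINT t|lborel. ?k' p t h)) (at p)"
  proof (rule has_derivative_integral[where S = UNIV and B = "\<lambda>t::real. ?i t *\<^sub>R (4 * P)"])
    fix y h :: "real \<times> real" and t :: real
    have "((\<lambda>p. ?L t p) has_derivative (\<lambda>h. (fst h, snd h + 2 * t * fst h))) (at y)"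
      by (auto intro!: derivative_eq_intros)
    from has_derivative_compose[OF this has_derivative_real_prod[OF schwartz_smooth[OF u] cs]]
    show "((\<lambda>y. ?i t *\<^sub>R (of_real (t ^ a) * iterated_partial cs u (?L t y))) has_derivative ?k' y t) (at y)"
      by (intro has_derivative_scaleR_right has_derivative_mult_right) simp
    show "norm (?k' y t h) \<le> ?i t *\<^sub>R (4 * P) * norm h"
    proof (cases "t \<in> {0..1}")
      case True
      have b: "norm (iterated_partial (c # cs) u q) \<le> P" if "c # cs \<in> lists Basis" for c q
        using pnorm_upper[OF u that, of 0 "Suc (length cs)" q] by (simp add: P_def)
      have f: "\<bar>fst h\<bar> \<le> norm h" "\<bar>snd h\<bar> \<le> norm h" using norm_fst_le[of "fst h" "snd h"] norm_snd_le[of "snd h" "fst h"] by simp_all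
      have "\<bar>t * fst h\<bar> \<le> 1 * norm h" unfolding abs_mult using True f by (intro mult_mono) auto
      then have s: "\<bar>snd h + 2 * t * fst h\<bar> \<le> 3 * norm h" using f by simp
      have P0: "0 \<le> P" using pnorm_nonneg[OF u] by (simp add: P_def)
      have "norm (fst h *\<^sub>R iterated_partial ((1, 0) # cs) u (?L t y)) \<le> norm h * P"
        unfolding norm_scaleR by (intro mult_mono f b cs') auto
      moreover have "norm ((snd h + 2 * t * fst h) *\<^sub>R iterated_partial ((0, 1) # cs) u (?L t y)) \<le> (3 * norm h) * P"
        unfolding norm_scaleR by (intro mult_mono s b cs') auto
      ultimately have "norm (fst h *\<^sub>R iterated_partial ((1, 0) # cs) u (?L t y) +
        (snd h + 2 * t * fst h) *\<^sub>R iterated_partial ((0, 1) # cs) u (?L t y)) \<le> norm h * P + (3 * norm h) * P"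
        by (rule norm_triangle_mono)
      moreover have "\<bar>t ^ a\<bar> \<le> 1" using True by (simp add: power_abs power_le_one)
      ultimately have "\<bar>t ^ a\<bar> * norm (fst h *\<^sub>R iterated_partial ((1, 0) # cs) u (?L t y) +
        (snd h + 2 * t * fst h) *\<^sub>R iterated_partial ((0, 1) # cs) u (?L t y)) \<le> 1 * (norm h * P + (3 * norm h) * P)"
        by (intro mult_mono) auto
      then show ?thesis using True unfolding norm_scaleR norm_mult norm_of_real by (simp add: algebra_simps)
    qed simp
    show "integrable lborel (\<lambda>t. ?i t *\<^sub>R (of_real (t ^ a) * iterated_partial cs u (?L t y)))"
      by (rule shear_integrable[OF u cs])
    show "integrable lborel (\<lambda>t::real. ?i t *\<^sub>R (4 * P))"
      by (rule borel_integrable_compact[OF compact_Icc continuous_on_const])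
    show "(\<lambda>t. ?k' p t h) \<in> borel_measurable lborel" by (rule borel_measurable_integrable[OF i'])
  qed auto
  moreover have "(LINT t|lborel. ?k' p t h) = fst h *\<^sub>R shear_int a ((1, 0) # cs) u p +
     (snd h *\<^sub>R shear_int a ((0, 1) # cs) u p + (2 * fst h) *\<^sub>R shear_int (a + 1) ((0, 1) # cs) u p)" for h
    unfolding eq shear_int_def
      Bochner_Integration.integral_add[OF integrable_scaleR_right[OF shear_integrable[OF u cs'(1)]]
        Bochner_Integration.integrable_add[OF integrable_scaleR_right[OF shear_integrable[OF u cs'(2)]]
          integrable_scaleR_right[OF shear_integrable[OF u cs'(2)]]]]
      Bochner_Integration.integral_add[OF integrable_scaleR_right[OF shear_integrable[OF u cs'(2)]]
          integrable_scaleR_right[OF shear_integrable[OF u cs'(2)]]]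
      integral_scaleR_right ..
  ultimately show ?thesis unfolding shear_int_def[abs_def] by simp
qed

lemma schwartz_op_shear_int:
  assumes cs: "cs \<in> lists Basis"
  shows "schwartz_op (shear_int a cs)"
proof -
  define \<G> where "\<G> = {shear_int a cs | a cs. cs \<in> lists Basis}"
  have memb: "shear_int a cs \<in> \<G>" if "cs \<in> lists Basis" for a cs using that by (auto simp: \<G>_def)
  show ?thesis
  proof (rule schwartz_opI[of \<G>])
    fix R assume "R \<in> \<G>"
    then obtain a cs where R: "R = shear_int a cs" and cs: "cs \<in> lists Basis" by (auto simp: \<G>_def)
    have cs': "(1, 0) # cs \<in> lists Basis" "(0, 1) # cs \<in> lists Basis" using cs by (simp_all add: Basis_real_prod)
    \<comment> \<open>The repeated entry encodes the coefficient 2, as derivatives are expressed by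
      plain sums over lists.\<close>
    define Ts where "Ts b = (if b = (1, 0) then [shear_int a ((1, 0) # cs), shear_int (a + 1) ((0, 1) # cs), shear_int (a + 1) ((0, 1) # cs)]
      else [shear_int a ((0, 1) # cs)])" for b :: "real \<times> real"
    have A: "set (Ts b) \<subseteq> \<G>" for b using memb cs' by (simp add: Ts_def)
    have B: "\<exists>D. (R u has_derivative D) (at p) \<and> (\<forall>b\<in>Basis. D b = (\<Sum>T'\<leftarrow>Ts b. T' u p))" if u: "u \<in> schwartz" for u p
      by (rule exI, rule conjI, unfold R, rule shear_int_has_derivative[OF u cs])
        (simp add: Basis_real_prod Ts_def scaleR_conv_of_real)
    show "\<exists>Ts. (\<forall>b\<in>Basis. set (Ts b) \<subseteq> \<G>) \<and>
      (\<forall>f\<in>schwartz. \<forall>x. \<exists>D. (R f has_derivative D) (at x) \<and> (\<forall>b\<in>Basis. D b = (\<Sum>T'\<leftarrow>Ts b. T' f x)))"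
      by (rule exI[of _ Ts], intro conjI ballI allI, rule A, erule B)
  next
    fix R N assume "R \<in> \<G>"
    then obtain a cs where R: "R = shear_int a cs" and cs: "cs \<in> lists Basis" by (auto simp: \<G>_def)
    define M where "M = max N (length cs)"
    have "(1 + norm p) ^ N * norm (R u p) \<le> 3 ^ N * pnorm M u" if u: "u \<in> schwartz" for u p
    proof -
      define c where "c = 3 ^ N * pnorm M u / (1 + norm p) ^ N"
      let ?q = "\<lambda>t. (fst p, snd p + 2 * t * fst p)"
      have b: "norm (indicator {0..1} t *\<^sub>R (of_real (t ^ a) * iterated_partial cs u (?q t))) \<le> indicator {0..1} t *\<^sub>R c" for t :: real
      proof (cases "t \<in> {0..1}")
        case True
        \<comment> \<open>For t in [0, 1] the shear displaces \<open>p\<close> by at most 2 |fst p|,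
          and fst p is also a coordinate of the sheared point; hence the factor 3.\<close>
        have "norm p \<le> norm (?q t) + norm (0 :: real, 2 * t * fst p)"
          using norm_triangle_ineq4[of "?q t" "(0, 2 * t * fst p)"] by (simp add: prod_eq_iff)
        also have "norm (0 :: real, 2 * t * fst p) = 2 * (t * \<bar>fst p\<bar>)" using True by (simp add: norm_Pair abs_mult)
        also have "\<dots> \<le> 2 * (1 * norm (?q t))"
          using True norm_fst_le[of "fst p" "snd p + 2 * t * fst p"] by (intro mult_left_mono mult_mono) auto
        finally have "1 + norm p \<le> 3 * (1 + norm (?q t))" by simp
        then have "(1 + norm p) ^ N \<le> (3 * (1 + norm (?q t))) ^ N" by (intro power_mono) auto
        then have "(1 + norm p) ^ N * norm (iterated_partial cs u (?q t)) \<le>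
           (3 * (1 + norm (?q t))) ^ N * norm (iterated_partial cs u (?q t))" by (intro mult_right_mono) auto
        also have "\<dots> = 3 ^ N * ((1 + norm (?q t)) ^ N * norm (iterated_partial cs u (?q t)))"
          by (simp only: power_mult_distrib mult.assoc)
        also have "\<dots> \<le> 3 ^ N * pnorm M u" by (intro mult_left_mono pnorm_upper[OF u cs]) (simp_all add: M_def)
        finally have c: "norm (iterated_partial cs u (?q t)) \<le> c"
          by (simp add: c_def pos_le_divide_eq add_pos_nonneg mult.commute)
        have "\<bar>t ^ a\<bar> \<le> 1" using True by (simp add: power_abs power_le_one)
        then have "\<bar>t ^ a\<bar> * norm (iterated_partial cs u (?q t)) \<le> 1 * c" using c by (intro mult_mono) auto
        then show ?thesis using True unfolding norm_scaleR norm_mult norm_of_real by simp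
      qed simp
      have ic: "integrable lborel (\<lambda>t. indicator {0..1::real} t *\<^sub>R c)" by (rule borel_integrable_compact[OF compact_Icc continuous_on_const])
      have "norm (shear_int a cs u p) \<le> (LINT t|lborel. norm (indicator {0..1} t *\<^sub>R (of_real (t ^ a) * iterated_partial cs u (?q t))))"
        unfolding shear_int_def by (rule integral_norm_bound)
      also have "\<dots> \<le> (LINT t|lborel. indicator {0..1::real} t *\<^sub>R c)"
        by (rule integral_mono[OF integrable_norm[OF shear_integrable[OF u cs]] ic b])
      also have "\<dots> = c" by simp
      finally show ?thesis unfolding R by (simp add: c_def pos_le_divide_eq add_pos_nonneg mult.commute)
    qed
    then show "\<exists>M C. \<forall>f\<in>schwartz. \<forall>x. (1 + norm x) ^ N * norm (R f x) \<le> C * pnorm M f"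
      by (intro exI ballI allI)
  next
    show "shear_int a cs \<in> \<G>" by (rule memb[OF cs])
  next
    fix f g :: "real \<times> real \<Rightarrow> complex" and p assume f: "f \<in> schwartz" and g: "g \<in> schwartz"
    show "shear_int a cs (\<lambda>x. f x - g x) p = shear_int a cs f p - shear_int a cs g p"
      unfolding shear_int_def iterated_partial_diff[OF schwartz_smooth[OF f] schwartz_smooth[OF g] cs]
        right_diff_distrib scaleR_diff_right
      by (rule Bochner_Integration.integral_diff[OF shear_integrable[OF f cs] shear_integrable[OF g cs]])
  qed
qed

text \<open>The divided difference operator: \<open>shear_diff u (\<xi>, \<eta>)\<close> is the quotient
  \<open>(u (\<xi>, \<eta> + 2 * \<xi>) - u (\<xi>, \<eta>)) / \<xi>\<close>, extended smoothly to \<open>\<xi> = 0\<close>.\<close>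

definition shear_diff :: "(real \<times> real \<Rightarrow> complex) \<Rightarrow> real \<times> real \<Rightarrow> complex" where
  "shear_diff u p = 2 * shear_int 0 [(0, 1)] u p"

lemma schwartz_op_shear_diff: "schwartz_op shear_diff"
proof -
  have "[(0, 1)] \<in> lists (Basis :: (real \<times> real) set)" by (simp add: Basis_real_prod)
  from schwartz_op_compose[OF schwartz_op_mult[OF tempered_const[of 2]] schwartz_op_shear_int[OF this, of 0]]
  show ?thesis by (simp add: shear_diff_def[abs_def])
qed

lemma shear_diff_pow: "schwartz_op (shear_diff ^^ m)"
proof (induction m)
  case (Suc m)
  from schwartz_op_compose[OF schwartz_op_shear_diff Suc] show ?case by (simp add: o_def)
qed (simp add: id_def schwartz_op_id)

lemma shear_diff:
  assumes u: "u \<in> schwartz"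
  shows "u (\<xi>, \<eta> + 2 * \<xi>) = u (\<xi>, \<eta>) + of_real \<xi> * shear_diff u (\<xi>, \<eta>)"
proof -
  let ?d = "iterated_partial [(0, 1)] u"
  have cs: "[(0, 1)] \<in> lists (Basis :: (real \<times> real) set)" by (simp add: Basis_real_prod)
  have pull: "indicator {0..1} t *\<^sub>R (of_real (2 * \<xi>) * x) = of_real (2 * \<xi>) * (indicator {0..1} t *\<^sub>R x)"
    for t :: real and x :: complex by simp
  \<comment> \<open>The fundamental theorem of calculus along the segment from (\<xi>, \<eta>) to
    (\<xi>, \<eta> + 2 \<xi>), traversed with velocity (0, 2 \<xi>).\<close>
  have "(LINT t|lborel. indicator {0..1} t *\<^sub>R (of_real (2 * \<xi>) * (of_real (t ^ 0) * ?d (fst (\<xi>, \<eta>), snd (\<xi>, \<eta>) + 2 * t * fst (\<xi>, \<eta>))))) =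
     u (\<xi>, \<eta> + 2 * 1 * \<xi>) - u (\<xi>, \<eta> + 2 * 0 * \<xi>)"
  proof (rule integral_FTC_atLeastAtMost)
    show "continuous_on {0..1} (\<lambda>t. of_real (2 * \<xi>) * (of_real (t ^ 0) * ?d (fst (\<xi>, \<eta>), snd (\<xi>, \<eta>) + 2 * t * fst (\<xi>, \<eta>))))"
      by (intro continuous_on_mult continuous_on_const shear_continuous[OF u cs])
    fix t :: real
    have "((\<lambda>t. (\<xi>, \<eta> + 2 * t * \<xi>)) has_derivative (\<lambda>h. (0, 2 * h * \<xi>))) (at t within {0..1})"
      by (auto intro!: derivative_eq_intros)
    from has_derivative_compose[OF this has_derivative_real_prod[OF schwartz_smooth[OF u] lists.Nil]]
    have "((\<lambda>t. u (\<xi>, \<eta> + 2 * t * \<xi>)) has_derivative (\<lambda>h. (2 * h * \<xi>) *\<^sub>R ?d (\<xi>, \<eta> + 2 * t * \<xi>))) (at t within {0..1})"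
      by simp
    then show "((\<lambda>t. u (\<xi>, \<eta> + 2 * t * \<xi>)) has_vector_derivative
       of_real (2 * \<xi>) * (of_real (t ^ 0) * ?d (fst (\<xi>, \<eta>), snd (\<xi>, \<eta>) + 2 * t * fst (\<xi>, \<eta>)))) (at t within {0..1})"
      unfolding has_vector_derivative_def
      by (rule has_derivative_eq_rhs) (simp add: fun_eq_iff scaleR_conv_of_real mult_ac)
  qed simp
  then have "of_real (2 * \<xi>) * shear_int 0 [(0, 1)] u (\<xi>, \<eta>) = u (\<xi>, \<eta> + 2 * \<xi>) - u (\<xi>, \<eta>)"
    unfolding shear_int_def pull integral_mult_right_zero by simp
  then show ?thesis by (simp add: shear_diff_def algebra_simps)
qed

text \<open>The shift by 2 \<xi> leads from one ray of the spectrum to the next. It replaces the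
  m-th term a_m by a_m + a_(m+1), and Pascal's rule collects the binomial coefficients.\<close>

lemma newton_forward:
  assumes u: "u \<in> schwartz"
  shows "u (\<xi>, \<eta> + 2 * real j * \<xi>) = (\<Sum>m\<le>j. of_nat (j choose m) * (of_real \<xi> ^ m * (shear_diff ^^ m) u (\<xi>, \<eta>)))"
proof (induction j arbitrary: \<eta>)
  case (Suc j)
  define a where "a m = of_real \<xi> ^ m * (shear_diff ^^ m) u (\<xi>, \<eta>)" for m
  have shift: "of_real \<xi> ^ m * (shear_diff ^^ m) u (\<xi>, \<eta> + 2 * \<xi>) = a m + a (Suc m)" for m
    using shear_diff[OF schwartz_op_in[OF shear_diff_pow u], of m \<xi> \<eta>] by (simp add: a_def algebra_simps)
  have "u (\<xi>, \<eta> + 2 * real (Suc j) * \<xi>) = u (\<xi>, (\<eta> + 2 * \<xi>) + 2 * real j * \<xi>)" by (simp add: algebra_simps)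
  also have "\<dots> = (\<Sum>m\<le>j. of_nat (j choose m) * (a m + a (Suc m)))"
    unfolding Suc shift ..
  also have "\<dots> = (\<Sum>m\<le>Suc j. of_nat (j choose m) * a m) + (\<Sum>m\<le>j. of_nat (j choose m) * a (Suc m))"
    by (simp add: distrib_left sum.distrib binomial_eq_0)
  also have "(\<Sum>m\<le>Suc j. of_nat (j choose m) * a m) = a 0 + (\<Sum>m\<le>j. of_nat (j choose Suc m) * a (Suc m))"
    unfolding sum.atMost_Suc_shift by simp
  also have "a 0 + (\<Sum>m\<le>j. of_nat (j choose Suc m) * a (Suc m)) + (\<Sum>m\<le>j. of_nat (j choose m) * a (Suc m)) =
      (\<Sum>m\<le>Suc j. of_nat (Suc j choose m) * a m)"
    unfolding sum.atMost_Suc_shift[of _ j] by (simp add: distrib_right sum.distrib)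
  finally show ?case by (simp add: a_def)
qed simp
section \<open>The representation matrices\<close>

lemma vec2_eq: "(x :: complex ^ 2) = y \<longleftrightarrow> x $ 1 = y $ 1 \<and> x $ 2 = y $ 2"
  by (simp add: Finite_Cartesian_Product.vec_eq_iff forall_2)

lemma norm2_sq: "(norm (z :: complex ^ 2))\<^sup>2 = (cmod (z $ 1))\<^sup>2 + (cmod (z $ 2))\<^sup>2"
  by (simp add: norm_vec_def L2_set_def sum_2)

lemma norm2_cnj: "of_real ((norm (z :: complex ^ 2))\<^sup>2) = z $ 1 * cnj (z $ 1) + z $ 2 * cnj (z $ 2)"
  by (simp only: norm2_sq of_real_add complex_norm_square)

lemma unit_cnj: "norm (z :: complex ^ 2) = 1 \<Longrightarrow> z $ 1 * cnj (z $ 1) + z $ 2 * cnj (z $ 2) = 1"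
  using norm2_cnj[of z] by simp

text \<open>\<open>rotv\<close> and \<open>adjv\<close> are the matrix k_\<zeta> and its conjugate
  transpose in coordinates, for arbitrary \<zeta>. For norm \<zeta> = 1 they are inverse to each
  other.\<close>

definition rotv :: "complex ^ 2 \<Rightarrow> complex ^ 2 \<Rightarrow> complex ^ 2" where
  "rotv \<zeta> x = vector [cnj (\<zeta> $ 2) * x $ 1 + \<zeta> $ 1 * x $ 2, - cnj (\<zeta> $ 1) * x $ 1 + \<zeta> $ 2 * x $ 2]"

definition adjv :: "complex ^ 2 \<Rightarrow> complex ^ 2 \<Rightarrow> complex ^ 2" where
  "adjv \<zeta> x = vector [\<zeta> $ 2 * x $ 1 - \<zeta> $ 1 * x $ 2, cnj (\<zeta> $ 1) * x $ 1 + cnj (\<zeta> $ 2) * x $ 2]"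

text \<open>The parameter of the adjoint: k at \<open>flipz \<zeta>\<close> is the conjugate
  transpose of k at \<zeta>.\<close>

definition flipz :: "complex ^ 2 \<Rightarrow> complex ^ 2" where
  "flipz \<zeta> = vector [- \<zeta> $ 1, cnj (\<zeta> $ 2)]"

lemma rotv_nth [simp]:
  "rotv \<zeta> x $ 1 = cnj (\<zeta> $ 2) * x $ 1 + \<zeta> $ 1 * x $ 2"
  "rotv \<zeta> x $ 2 = - cnj (\<zeta> $ 1) * x $ 1 + \<zeta> $ 2 * x $ 2"
  by (simp_all add: rotv_def vector_2)

lemma adjv_nth [simp]:
  "adjv \<zeta> x $ 1 = \<zeta> $ 2 * x $ 1 - \<zeta> $ 1 * x $ 2"
  "adjv \<zeta> x $ 2 = cnj (\<zeta> $ 1) * x $ 1 + cnj (\<zeta> $ 2) * x $ 2"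
  by (simp_all add: adjv_def vector_2)

lemma flipz_nth [simp]: "flipz \<zeta> $ 1 = - \<zeta> $ 1" "flipz \<zeta> $ 2 = cnj (\<zeta> $ 2)"
  by (simp_all add: flipz_def vector_2)

lemma norm_flipz: "norm (flipz \<zeta>) = norm \<zeta>"
proof -
  have "(norm (flipz \<zeta>))\<^sup>2 = (norm \<zeta>)\<^sup>2" by (simp add: norm2_sq)
  then show ?thesis by (rule power2_eq_imp_eq) simp_all
qed

lemma adjv_flipz: "adjv (flipz \<zeta>) x = rotv \<zeta> x"
  by (simp add: vec2_eq)

lemma k_rot_nth [simp]:
  "k_rot \<zeta> $ 1 $ 1 = cnj (\<zeta> $ 2)" "k_rot \<zeta> $ 1 $ 2 = \<zeta> $ 1"
  "k_rot \<zeta> $ 2 $ 1 = - cnj (\<zeta> $ 1)" "k_rot \<zeta> $ 2 $ 2 = \<zeta> $ 2"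
  by (simp_all add: k_rot_def vector_2)

lemma k_rot_mult: "k_rot \<zeta> *v x = rotv \<zeta> x"
  by (simp add: vec2_eq matrix_vector_mult_def sum_2)

lemma adjv_rotv: "adjv \<zeta> (rotv \<zeta> x) = of_real ((norm \<zeta>)\<^sup>2) *s x"
  unfolding norm2_cnj by (simp add: vec2_eq algebra_simps)

text \<open>Covering all \<zeta> \<noteq> 0 rather than unit vectors matters for measurability:
  \<open>sphere_measure\<close> is a measure on the whole space, so the entries of \<tau> need a
  formula off the sphere as well.\<close>

lemma k_rot_inv:
  assumes "\<zeta> \<noteq> 0"
  shows "matrix_inv (k_rot \<zeta>) *v x = of_real (1 / (norm \<zeta>)\<^sup>2) *s adjv \<zeta> x"
proof -
  let ?s = "of_real (1 / (norm \<zeta>)\<^sup>2) :: complex"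
  let ?A = "\<chi> i j. ?s * adjv \<zeta> (axis j 1) $ i"
  have A: "?A *v x = ?s *s adjv \<zeta> x" for x
    by (simp add: vec2_eq matrix_vector_mult_def sum_2 axis_def algebra_simps)
  have s: "?s * of_real ((norm \<zeta>)\<^sup>2) = 1" using assms by (simp del: of_real_power flip: of_real_mult)
  have "(?A ** k_rot \<zeta>) *v x = x" for x
    by (simp only: matrix_vector_mul_assoc[symmetric] A k_rot_mult adjv_rotv vector_smult_assoc s vector_smult_lid)
  then have AK: "?A ** k_rot \<zeta> = Finite_Cartesian_Product.mat 1" by (simp add: matrix_eq)
  then have A': "k_rot \<zeta> ** ?A = Finite_Cartesian_Product.mat 1" by (rule matrix_left_right_inverse[THEN iffD1])
  have ex: "\<exists>B. k_rot \<zeta> ** B = Finite_Cartesian_Product.mat 1 \<and> B ** k_rot \<zeta> = Finite_Cartesian_Product.mat 1"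
    by (intro exI[of _ ?A] conjI A' AK)
  from someI_ex[OF ex] have M: "matrix_inv (k_rot \<zeta>) ** k_rot \<zeta> = Finite_Cartesian_Product.mat 1"
    unfolding matrix_inv_def by (rule conjunct2)
  have "matrix_inv (k_rot \<zeta>) = matrix_inv (k_rot \<zeta>) ** (k_rot \<zeta> ** ?A)" by (simp only: A' matrix_mul_rid)
  also have "\<dots> = ?A" by (simp only: matrix_mul_assoc M matrix_mul_lid)
  finally have "matrix_inv (k_rot \<zeta>) = ?A" .
  then show ?thesis by (simp only: A)
qed

lemma SU2_k_rot: "norm \<zeta> = 1 \<Longrightarrow> k_rot \<zeta> \<in> SU2"
  using unit_cnj[of \<zeta>]
  by (simp add: SU2_def Finite_Cartesian_Product.vec_eq_iff forall_2 matrix_matrix_mult_def sum_2 det_2 Finite_Cartesian_Product.mat_def algebra_simps)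

text \<open>\<zeta> is the second column of \<open>k\<close>; unitarity and determinant 1 determine
  the first column from it.\<close>

lemma SU2_cases:
  assumes "k \<in> SU2"
  obtains \<zeta> where "norm \<zeta> = 1" "k = k_rot \<zeta>"
proof -
  let ?a = "k $ 1 $ 1" and ?b = "k $ 1 $ 2" and ?c = "k $ 2 $ 1" and ?d = "k $ 2 $ 2"
  have u: "?a * cnj ?a + ?b * cnj ?b = 1" "?c * cnj ?a + ?d * cnj ?b = 0" and det: "?a * ?d - ?b * ?c = 1"
    using assms by (simp_all add: SU2_def Finite_Cartesian_Product.vec_eq_iff forall_2 matrix_matrix_mult_def sum_2 det_2 Finite_Cartesian_Product.mat_def)
  have "?d = ?d * (?a * cnj ?a + ?b * cnj ?b)" using u by simp
  also have "\<dots> = (?a * ?d - ?b * ?c) * cnj ?a + ?b * (?c * cnj ?a + ?d * cnj ?b)" by (simp add: algebra_simps)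
  finally have d: "?d = cnj ?a" using u det by simp
  have "?c = ?c * (?a * cnj ?a + ?b * cnj ?b)" using u by simp
  also have "\<dots> = ?a * (?c * cnj ?a + ?d * cnj ?b) - (?a * ?d - ?b * ?c) * cnj ?b" by (simp add: algebra_simps)
  finally have c: "?c = - cnj ?b" using u det by simp
  let ?z = "vector [?b, ?d] :: complex ^ 2"
  have "of_real ((norm ?z)\<^sup>2) = (1 :: complex)" unfolding norm2_cnj using u(1) d by (simp add: vector_2 mult.commute add.commute)
  then have "(norm ?z)\<^sup>2 = 1" by (simp only: of_real_eq_1_iff)
  then have "norm ?z = 1" using norm_ge_zero[of ?z] by (simp add: power2_eq_1_iff)
  moreover have "k = k_rot ?z" using c d by (simp add: Finite_Cartesian_Product.vec_eq_iff forall_2 vector_2)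
  ultimately show ?thesis by (rule that)
qed

abbreviation tt :: "nat \<Rightarrow> complex ^ 2 \<Rightarrow> nat \<Rightarrow> nat \<Rightarrow> complex" where
  "tt n \<zeta> a b \<equiv> tau n (k_rot \<zeta>) $$ (a, b)"

lemma tau_carrier: "tau n k \<in> carrier_mat (n + 1) (n + 1)"
  using represents_tau[of n k] by (simp add: represents_def)

lemma V_basis_scale: "b \<le> n \<Longrightarrow> V_basis n b (c *s x) = c ^ n * V_basis n b x"
  by (simp add: V_basis_def power_mult_distrib mult_ac) (metis le_add_diff_inverse power_add mult.left_commute)

lemma tt_adjv_general:
  assumes "b \<le> n" "\<zeta> \<noteq> 0"
  shows "of_real (1 / (norm \<zeta>)\<^sup>2) ^ n * V_basis n b (adjv \<zeta> x) = (\<Sum>a\<le>n. tt n \<zeta> a b * V_basis n a x)"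
proof -
  have "tau_op (k_rot \<zeta>) (V_basis n b) = (\<lambda>z. \<Sum>i\<le>n. tt n \<zeta> i b * V_basis n i z)"
    using represents_tau[of n "k_rot \<zeta>"] assms by (simp add: represents_def)
  from fun_cong[OF this, of x] show ?thesis
    by (simp only: tau_op_def k_rot_inv[OF assms(2)] V_basis_scale[OF assms(1)])
qed

lemma tt_adjv:
  assumes "b \<le> n" "norm \<zeta> = 1"
  shows "V_basis n b (adjv \<zeta> x) = (\<Sum>a\<le>n. tt n \<zeta> a b * V_basis n a x)"
proof -
  have "\<zeta> \<noteq> 0" using assms by auto
  from tt_adjv_general[OF assms(1) this, of x] assms(2) show ?thesis by simp
qed



text \<open>The product of the two matrices acts on basis polynomials by composing the substitutions
  \<open>adjv\<close> and \<open>rotv\<close>, which cancel.\<close>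

lemma tt_inverse:
  assumes \<zeta>: "norm \<zeta> = 1" and "b \<le> n" "c \<le> n"
  shows "(\<Sum>a\<le>n. tt n (flipz \<zeta>) c a * tt n \<zeta> a b) = (if c = b then 1 else 0)"
proof (rule V_basis_independent[where c = "\<lambda>c. \<Sum>a\<le>n. tt n (flipz \<zeta>) c a * tt n \<zeta> a b" and d = "\<lambda>c. if c = b then 1 else 0", OF _ assms(3)])
  fix x
  have "(\<Sum>c\<le>n. (\<Sum>a\<le>n. tt n (flipz \<zeta>) c a * tt n \<zeta> a b) * V_basis n c x) =
      (\<Sum>a\<le>n. tt n \<zeta> a b * (\<Sum>c\<le>n. tt n (flipz \<zeta>) c a * V_basis n c x))"
    unfolding sum_distrib_right sum_distrib_left by (subst sum.swap) (simp add: mult_ac)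
  also have "\<dots> = (\<Sum>a\<le>n. tt n \<zeta> a b * V_basis n a (rotv \<zeta> x))"
    by (intro sum.cong refl) (simp add: tt_adjv[symmetric] norm_flipz \<zeta> adjv_flipz)
  also have "\<dots> = V_basis n b (adjv \<zeta> (rotv \<zeta> x))" by (simp only: tt_adjv[OF assms(2) \<zeta>])
  also have "\<dots> = V_basis n b x" by (simp add: adjv_rotv \<zeta>)
  also have "\<dots> = (\<Sum>c\<le>n. (if c = b then 1 else 0) * V_basis n c x)"
    using assms(2) by (simp add: if_distrib[of "\<lambda>y. y * _"] cong: if_cong)
  finally show "(\<Sum>c\<le>n. (\<Sum>a\<le>n. tt n (flipz \<zeta>) c a * tt n \<zeta> a b) * V_basis n c x) =
     (\<Sum>c\<le>n. (if c = b then 1 else 0) * V_basis n c x)" .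
qed

text \<open>The bilinear kernel \<open>(x\<^sub>1 y\<^sub>1 + x\<^sub>2 y\<^sub>2) ^ n\<close> reproduces the basis; moving a matrix
  from one argument to the other transposes it, which gives unitarity.\<close>

lemma V_basis_kernel: "(\<Sum>b\<le>n. V_basis n b x * V_basis n b y) = (x $ 1 * y $ 1 + x $ 2 * y $ 2) ^ n"
proof -
  have "V_basis n b x * V_basis n b y = of_nat (n choose b) * (x $ 1 * y $ 1) ^ b * (x $ 2 * y $ 2) ^ (n - b)" for b
  proof -
    have "complex_of_real (sqrt (real (n choose b))) * complex_of_real (sqrt (real (n choose b))) = of_nat (n choose b)"
      by (simp flip: of_real_mult)
    then show ?thesis by (simp add: V_basis_def power_mult_distrib algebra_simps)
  qed
  then show ?thesis by (simp add: binomial_ring)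
qed

lemma tt_adjoint:
  assumes \<zeta>: "norm \<zeta> = 1" and "a \<le> n" "c \<le> n"
  shows "tt n (flipz \<zeta>) c a = cnj (tt n \<zeta> a c)"
proof -
  \<comment> \<open>Coordinatewise conjugation \<open>cv\<close> turns the conjugate transpose into
    the transpose, which is the adjoint for the bilinear kernel.\<close>
  define cv :: "complex ^ 2 \<Rightarrow> complex ^ 2" where "cv x = vector [cnj (x $ 1), cnj (x $ 2)]" for x
  have cv [simp]: "cv x $ 1 = cnj (x $ 1)" "cv x $ 2 = cnj (x $ 2)" for x by (simp_all add: cv_def vector_2)
  have e_cv: "cnj (V_basis n b x) = V_basis n b (cv x)" for b x by (simp add: V_basis_def)
  have conj: "V_basis n c (cv (adjv \<zeta> (cv x))) = (\<Sum>a\<le>n. cnj (tt n \<zeta> a c) * V_basis n a x)" if "c \<le> n" for c x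
  proof -
    have cc: "cv (cv x) = x" by (simp add: vec2_eq)
    have "V_basis n c (cv (adjv \<zeta> (cv x))) = cnj (\<Sum>a\<le>n. tt n \<zeta> a c * V_basis n a (cv x))"
      using tt_adjv[OF that \<zeta>, of "cv x"] by (simp add: e_cv[symmetric])
    then show ?thesis by (simp add: e_cv cc)
  qed
  have main: "(\<Sum>c\<le>n. (\<Sum>a\<le>n. cnj (tt n \<zeta> a c) * V_basis n a x) * V_basis n c y) =
      (\<Sum>c\<le>n. (\<Sum>a\<le>n. tt n (flipz \<zeta>) c a * V_basis n a x) * V_basis n c y)" for x y
  proof -
    have "(\<Sum>c\<le>n. (\<Sum>a\<le>n. cnj (tt n \<zeta> a c) * V_basis n a x) * V_basis n c y) =
        (\<Sum>c\<le>n. V_basis n c (cv (adjv \<zeta> (cv x))) * V_basis n c y)"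
      by (intro sum.cong refl) (simp add: conj)
    also have "\<dots> = (\<Sum>a\<le>n. V_basis n a x * V_basis n a (rotv \<zeta> y))"
      unfolding V_basis_kernel by (simp add: algebra_simps)
    also have "\<dots> = (\<Sum>a\<le>n. V_basis n a x * (\<Sum>c\<le>n. tt n (flipz \<zeta>) c a * V_basis n c y))"
      by (intro sum.cong refl) (simp add: tt_adjv[symmetric] norm_flipz \<zeta> adjv_flipz)
    also have "\<dots> = (\<Sum>c\<le>n. (\<Sum>a\<le>n. tt n (flipz \<zeta>) c a * V_basis n a x) * V_basis n c y)"
      unfolding sum_distrib_right sum_distrib_left by (subst sum.swap) (simp add: mult_ac)
    finally show ?thesis .
  qed
  have "(\<Sum>a\<le>n. cnj (tt n \<zeta> a c) * V_basis n a x) = (\<Sum>a\<le>n. tt n (flipz \<zeta>) c a * V_basis n a x)" for x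
    by (rule V_basis_independent[OF main assms(3)])
  from V_basis_independent[OF this assms(2)] show ?thesis by simp
qed

lemma tt_unitary:
  assumes \<zeta>: "norm \<zeta> = 1" and "b \<le> n" "c \<le> n"
  shows "(\<Sum>a\<le>n. cnj (tt n \<zeta> a c) * tt n \<zeta> a b) = (if c = b then 1 else 0)"
proof -
  have "(\<Sum>a\<le>n. cnj (tt n \<zeta> a c) * tt n \<zeta> a b) = (\<Sum>a\<le>n. tt n (flipz \<zeta>) c a * tt n \<zeta> a b)"
    by (intro sum.cong refl) (simp add: tt_adjoint[OF \<zeta> _ assms(3)])
  then show ?thesis by (simp only: tt_inverse[OF assms])
qed

lemma tt_unitary':
  assumes \<zeta>: "norm \<zeta> = 1" and "b \<le> n" "c \<le> n"
  shows "(\<Sum>a\<le>n. tt n \<zeta> c a * cnj (tt n \<zeta> b a)) = (if c = b then 1 else 0)"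
proof -
  have f: "norm (flipz \<zeta>) = 1" using \<zeta> by (simp add: norm_flipz)
  have ff: "flipz (flipz \<zeta>) = \<zeta>" by (simp add: vec2_eq)
  have "(\<Sum>a\<le>n. tt n \<zeta> c a * cnj (tt n \<zeta> b a)) = (\<Sum>a\<le>n. tt n (flipz (flipz \<zeta>)) c a * tt n (flipz \<zeta>) a b)"
    unfolding ff by (intro sum.cong refl) (simp add: tt_adjoint[OF \<zeta> assms(2)])
  then show ?thesis by (simp only: tt_inverse[OF f assms(2,3)])
qed

lemma mat_sum_index:
  assumes "A \<in> carrier_mat (n + 1) (n + 1)" "B \<in> carrier_mat (n + 1) (n + 1)" "i \<le> n" "j \<le> n"
  shows "(A * B) $$ (i, j) = (\<Sum>k\<le>n. A $$ (i, k) * B $$ (k, j))"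
proof -
  have "(A * B) $$ (i, j) = (\<Sum>k\<in>{0..<n + 1}. A $$ (i, k) * B $$ (k, j))"
    using assms by (simp add: scalar_prod_def)
  also have "{0..<n + 1} = {..n}" by auto
  finally show ?thesis .
qed

lemma mat_adjoint_index:
  assumes "A \<in> carrier_mat (n + 1) (n + 1)" "i \<le> n" "j \<le> n"
  shows "mat_adjoint A $$ (i, j) = cnj (A $$ (j, i))"
  using assms by (simp add: mat_adjoint_def mat_of_rows_def)

lemma mat_adjoint_carrier: "A \<in> carrier_mat n m \<Longrightarrow> mat_adjoint A \<in> carrier_mat m n"
  by (auto simp: mat_adjoint_def)

lemma tau_inverse:
  assumes "norm \<zeta> = 1"
  shows "the (mat_inverse (tau n (k_rot \<zeta>))) = mat_adjoint (tau n (k_rot \<zeta>))"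
proof -
  let ?A = "tau n (k_rot \<zeta>)" and ?B = "mat_adjoint (tau n (k_rot \<zeta>))"
  have A: "?A \<in> carrier_mat (n + 1) (n + 1)" by (rule tau_carrier)
  have B: "?B \<in> carrier_mat (n + 1) (n + 1)" by (rule mat_adjoint_carrier[OF A])
  have AB: "?A * ?B = 1\<^sub>m (n + 1)"
  proof (rule eq_matI)
    fix i j assume "i < dim_row (1\<^sub>m (n + 1) :: complex mat)" "j < dim_col (1\<^sub>m (n + 1) :: complex mat)"
    then have "i \<le> n" "j \<le> n" by auto
    then show "(?A * ?B) $$ (i, j) = 1\<^sub>m (n + 1) $$ (i, j)"
      using tt_unitary'[OF assms, of j n i] by (simp add: mat_sum_index[OF A B] mat_adjoint_index[OF A] del: index_mult_mat)
  qed (use A B in auto)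
  then have BA: "?B * ?A = 1\<^sub>m (n + 1)" using mat_mult_left_right_inverse[OF A B] by simp
  show ?thesis
  proof (cases "mat_inverse ?A")
    \<comment> \<open>\<open>None\<close> says that the matrix is not a unit of the matrix ring,
      which the inverse found above refutes.\<close>
    case None
    then show ?thesis using mat_inverse(1)[OF A, where b = "()"] AB BA A B by (auto simp: Units_def ring_mat_def)
  next
    case (Some C)
    then have C: "?A * C = 1\<^sub>m (n + 1)" "C * ?A = 1\<^sub>m (n + 1)" "C \<in> carrier_mat (n + 1) (n + 1)"
      using mat_inverse(2)[OF A] by auto
    have "C = C * (?A * ?B)" using C AB by simp
    also have "\<dots> = (C * ?A) * ?B" using C(3) A B by simp
    also have "\<dots> = ?B" using C B by simp
    finally show ?thesis using Some by simp
  qed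
qed

text \<open>Conjugation by \<tau> on families of entries, with the inverse replaced by the adjoint.
  Covariance then becomes a statement about finite sums of scalar functions, to which integrals and
  limits apply directly.\<close>

definition conjm :: "nat \<Rightarrow> complex ^ 2 \<Rightarrow> (nat \<Rightarrow> nat \<Rightarrow> complex) \<Rightarrow> nat \<Rightarrow> nat \<Rightarrow> complex" where
  "conjm n \<zeta> X a b = (\<Sum>c\<le>n. \<Sum>d\<le>n. tt n \<zeta> a c * X c d * cnj (tt n \<zeta> b d))"

lemma conj_index:
  assumes X: "X \<in> carrier_mat (n + 1) (n + 1)" and ab: "a \<le> n" "b \<le> n"
  shows "(tau n (k_rot \<zeta>) * X * mat_adjoint (tau n (k_rot \<zeta>))) $$ (a, b) = conjm n \<zeta> (\<lambda>c d. X $$ (c, d)) a b"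
proof -
  let ?A = "tau n (k_rot \<zeta>)"
  have A: "?A \<in> carrier_mat (n + 1) (n + 1)" by (rule tau_carrier)
  have B: "mat_adjoint ?A \<in> carrier_mat (n + 1) (n + 1)" by (rule mat_adjoint_carrier[OF A])
  have AX: "?A * X \<in> carrier_mat (n + 1) (n + 1)" using A X by simp
  have "(?A * X * mat_adjoint ?A) $$ (a, b) = (\<Sum>d\<le>n. (\<Sum>c\<le>n. ?A $$ (a, c) * X $$ (c, d)) * cnj (?A $$ (b, d)))"
    unfolding mat_sum_index[OF AX B ab]
    by (intro sum.cong refl) (simp add: mat_sum_index[OF A X] mat_adjoint_index[OF A] ab del: index_mult_mat)
  also have "\<dots> = conjm n \<zeta> (\<lambda>c d. X $$ (c, d)) a b"
    unfolding conjm_def sum_distrib_right by (rule sum.swap)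
  finally show ?thesis .
qed

lemma equivariant_iff:
  assumes F: "\<And>z. F z \<in> carrier_mat (n + 1) (n + 1)"
  shows "equivariant n F \<longleftrightarrow> (\<forall>\<theta> \<zeta> z. norm \<zeta> = 1 \<longrightarrow> (\<forall>a\<le>n. \<forall>b\<le>n.
     F (cis \<theta> *s rotv \<zeta> z) $$ (a, b) = conjm n \<zeta> (\<lambda>c d. F z $$ (c, d)) a b))"
proof -
  have *: "F (cis \<theta> *s (k_rot \<zeta> *v z)) = tau n (k_rot \<zeta>) * F z * the (mat_inverse (tau n (k_rot \<zeta>))) \<longleftrightarrow>
     (\<forall>a\<le>n. \<forall>b\<le>n. F (cis \<theta> *s rotv \<zeta> z) $$ (a, b) = conjm n \<zeta> (\<lambda>c d. F z $$ (c, d)) a b)"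
    if \<zeta>: "norm (\<zeta> :: complex ^ 2) = 1" for \<theta> \<zeta> z
  proof -
    let ?R = "tau n (k_rot \<zeta>) * F z * mat_adjoint (tau n (k_rot \<zeta>))"
    have R: "?R \<in> carrier_mat (n + 1) (n + 1)"
      using tau_carrier[of n "k_rot \<zeta>"] F[of z] mat_adjoint_carrier[OF tau_carrier[of n "k_rot \<zeta>"]] by simp
    have mat_eq: "A = B \<longleftrightarrow> (\<forall>a\<le>n. \<forall>b\<le>n. A $$ (a, b) = B $$ (a, b))"
      if "A \<in> carrier_mat (n + 1) (n + 1)" "B \<in> carrier_mat (n + 1) (n + 1)" for A B :: "complex mat"
      using that by (intro iffI eq_matI) (auto simp: less_Suc_eq_le)
    show ?thesis unfolding tau_inverse[OF \<zeta>] k_rot_mult mat_eq[OF F[of "cis \<theta> *s rotv \<zeta> z"] R]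
      by (intro all_cong) (simp only: conj_index[OF F])
  qed
  show ?thesis unfolding equivariant_def
  proof (intro iffI allI ballI impI)
    fix \<theta> and \<zeta> z :: "complex ^ 2" and a b assume "\<forall>\<theta>. \<forall>k\<in>SU2. \<forall>z. F (cis \<theta> *s (k *v z)) = tau n k * F z * the (mat_inverse (tau n k))"
      and \<zeta>: "norm \<zeta> = 1" and ab: "a \<le> n" "b \<le> n"
    then have "F (cis \<theta> *s (k_rot \<zeta> *v z)) = tau n (k_rot \<zeta>) * F z * the (mat_inverse (tau n (k_rot \<zeta>)))"
      using SU2_k_rot[OF \<zeta>] by blast
    then show "F (cis \<theta> *s rotv \<zeta> z) $$ (a, b) = conjm n \<zeta> (\<lambda>c d. F z $$ (c, d)) a b"
      using *[OF \<zeta>] ab by blast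
  next
    fix \<theta> k and z :: "complex ^ 2" assume H: "\<forall>\<theta> \<zeta> z. norm \<zeta> = 1 \<longrightarrow> (\<forall>a\<le>n. \<forall>b\<le>n.
       F (cis \<theta> *s rotv \<zeta> z) $$ (a, b) = conjm n \<zeta> (\<lambda>c d. F z $$ (c, d)) a b)" and "k \<in> SU2"
    from SU2_cases[OF this(2)] obtain \<zeta> where \<zeta>: "norm \<zeta> = 1" "k = k_rot \<zeta>" by blast
    show "F (cis \<theta> *s (k *v z)) = tau n k * F z * the (mat_inverse (tau n k))"
      unfolding \<zeta>(2) *[OF \<zeta>(1)] using H \<zeta>(1) by blast
  qed
qed

section \<open>Matrix entries of the representation\<close>

lemma poly_eq_sum:
  fixes p :: "complex poly"
  shows "degree p \<le> n \<Longrightarrow> poly p y = (\<Sum>i\<le>n. coeff p i * y ^ i)"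
  unfolding poly_altdef by (rule sum.mono_neutral_left) (auto simp: coeff_eq_0)

text \<open>The matrix by which the substitution \<open>(x\<^sub>1, x\<^sub>2) \<mapsto> (\<alpha> x\<^sub>1 + \<beta> x\<^sub>2, \<gamma> x\<^sub>1 + \<delta> x\<^sub>2)\<close> acts on \<open>V\<^sub>n\<close>.\<close>

definition subst_mat :: "nat \<Rightarrow> complex \<Rightarrow> complex \<Rightarrow> complex \<Rightarrow> complex \<Rightarrow> nat \<Rightarrow> nat \<Rightarrow> complex" where
  "subst_mat n \<alpha> \<beta> \<gamma> \<delta> a b = of_real (sqrt (real (n choose b)) / sqrt (real (n choose a))) *
     coeff ([:\<beta>, \<alpha>:] ^ b * [:\<delta>, \<gamma>:] ^ (n - b)) a"

lemma V_basis_subst: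
  assumes "b \<le> n"
  shows "V_basis n b (vector [\<alpha> * x $ 1 + \<beta> * x $ 2, \<gamma> * x $ 1 + \<delta> * x $ 2]) =
    (\<Sum>a\<le>n. subst_mat n \<alpha> \<beta> \<gamma> \<delta> a b * V_basis n a x)"
proof -
  let ?p = "[:\<beta>, \<alpha>:] ^ b * [:\<delta>, \<gamma>:] ^ (n - b)"
  let ?s = "\<lambda>i. complex_of_real (sqrt (real (n choose i)))"
  have "(\<lambda>x. (\<alpha> * x $ 1 + \<beta> * x $ 2) ^ b * (\<gamma> * x $ 1 + \<delta> * x $ 2) ^ (n - b)) \<in> V_space (b + (n - b))"
    by (rule linear_forms_in_V)
  then have "(\<lambda>x. (\<alpha> * x $ 1 + \<beta> * x $ 2) ^ b * (\<gamma> * x $ 1 + \<delta> * x $ 2) ^ (n - b)) \<in> V_space n"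
    using assms by simp
  from V_basis_spans[OF this] obtain c where
    c: "(\<lambda>x. (\<alpha> * x $ 1 + \<beta> * x $ 2) ^ b * (\<gamma> * x $ 1 + \<delta> * x $ 2) ^ (n - b)) = (\<lambda>x. \<Sum>i\<le>n. c i * V_basis n i x)"
    by blast
  have "degree ?p \<le> b + (n - b)"
    by (intro order_trans[OF degree_mult_le] add_mono order_trans[OF degree_power_le]) auto
  then have deg: "degree ?p \<le> n" using assms by simp
  \<comment> \<open>Setting x = (y, 1) reduces the comparison to coefficients of polynomials in one
    variable.\<close>
  have "(\<Sum>i\<le>n. (c i * ?s i) * y ^ i) = (\<Sum>i\<le>n. coeff ?p i * y ^ i)" for y
  proof -
    have "(\<Sum>i\<le>n. coeff ?p i * y ^ i) = (\<alpha> * y + \<beta>) ^ b * (\<gamma> * y + \<delta>) ^ (n - b)"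
      unfolding poly_eq_sum[OF deg, symmetric] by (simp add: mult.commute add.commute)
    then show ?thesis using fun_cong[OF c, of "vector [y, 1]"] by (simp add: V_basis_def vector_2 mult_ac)
  qed
  then have cs: "c i * ?s i = coeff ?p i" if "i \<le> n" for i
    using polyfun_eq_coeffs[of "\<lambda>i. c i * ?s i" n "coeff ?p"] that by blast
  have c_eq: "?s b * c i = subst_mat n \<alpha> \<beta> \<gamma> \<delta> i b" if "i \<le> n" for i
  proof -
    have "?s i \<noteq> 0" using that by simp
    then have "c i = c i * ?s i / ?s i" by (rule nonzero_mult_div_cancel_right[symmetric])
    then have "c i = coeff ?p i / ?s i" by (simp only: cs[OF that])
    then show ?thesis by (simp add: subst_mat_def)
  qed
  have "V_basis n b (vector [\<alpha> * x $ 1 + \<beta> * x $ 2, \<gamma> * x $ 1 + \<delta> * x $ 2]) = ?s b * (\<Sum>i\<le>n. c i * V_basis n i x)"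
    unfolding fun_cong[OF c, of x, symmetric] by (simp add: V_basis_def vector_2)
  also have "\<dots> = (\<Sum>a\<le>n. subst_mat n \<alpha> \<beta> \<gamma> \<delta> a b * V_basis n a x)"
    unfolding sum_distrib_left by (intro sum.cong refl) (simp add: c_eq[symmetric])
  finally show ?thesis .
qed

lemma subst_mat_unique:
  assumes "b \<le> n" "a \<le> n"
    and "\<And>x. V_basis n b (vector [\<alpha> * x $ 1 + \<beta> * x $ 2, \<gamma> * x $ 1 + \<delta> * x $ 2]) = (\<Sum>a\<le>n. c a * V_basis n a x)"
  shows "subst_mat n \<alpha> \<beta> \<gamma> \<delta> a b = c a"
  by (rule V_basis_independent[where c = "\<lambda>a. subst_mat n \<alpha> \<beta> \<gamma> \<delta> a b" and d = c, OF _ assms(2)])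
    (simp only: V_basis_subst[OF assms(1), symmetric] assms(3))

lemma tt_eq_subst_mat:
  assumes ab: "a \<le> n" "b \<le> n" and \<zeta>: "\<zeta> \<noteq> 0"
  shows "tt n \<zeta> a b = of_real (1 / (norm \<zeta>)\<^sup>2) ^ n * subst_mat n (\<zeta> $ 2) (- \<zeta> $ 1) (cnj (\<zeta> $ 1)) (cnj (\<zeta> $ 2)) a b"
proof (rule V_basis_independent[where c = "\<lambda>a. tt n \<zeta> a b" and d = "\<lambda>a. of_real (1 / (norm \<zeta>)\<^sup>2) ^ n * subst_mat n (\<zeta> $ 2) (- \<zeta> $ 1) (cnj (\<zeta> $ 1)) (cnj (\<zeta> $ 2)) a b", OF _ ab(1)])
  fix x
  have "adjv \<zeta> x = vector [\<zeta> $ 2 * x $ 1 + - \<zeta> $ 1 * x $ 2, cnj (\<zeta> $ 1) * x $ 1 + cnj (\<zeta> $ 2) * x $ 2]"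
    by (simp add: vec2_eq vector_2)
  then show "(\<Sum>a\<le>n. tt n \<zeta> a b * V_basis n a x) =
      (\<Sum>a\<le>n. of_real (1 / (norm \<zeta>)\<^sup>2) ^ n * subst_mat n (\<zeta> $ 2) (- \<zeta> $ 1) (cnj (\<zeta> $ 1)) (cnj (\<zeta> $ 2)) a b * V_basis n a x)"
    unfolding tt_adjv_general[OF ab(2) \<zeta>, symmetric] mult.assoc sum_distrib_left[symmetric] V_basis_subst[OF ab(2), symmetric] by (simp only:)
qed

lemma tempered_subst_mat:
  fixes \<alpha> \<beta> \<gamma> \<delta> :: "'a :: euclidean_space \<Rightarrow> complex"
  assumes "tempered \<alpha>" "tempered \<beta>" "tempered \<gamma>" "tempered \<delta>"
  shows "tempered (\<lambda>z. subst_mat n (\<alpha> z) (\<beta> z) (\<gamma> z) (\<delta> z) a b)"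
proof -
  have mult: "\<forall>i. tempered (\<lambda>z. coeff (P z * Q z) i)"
    if "\<forall>i. tempered (\<lambda>z. coeff (P z) i)" "\<forall>i. tempered (\<lambda>z. coeff (Q z) i)"
    for P Q :: "'a \<Rightarrow> complex poly"
    unfolding coeff_mult using that by (auto intro!: tempered_sum tempered_mult)
  have pow: "\<forall>i. tempered (\<lambda>z. coeff (P z ^ m) i)"
    if P: "\<forall>i. tempered (\<lambda>z. coeff (P z) i)" for P :: "'a \<Rightarrow> complex poly" and m
  proof (induction m)
    case 0
    show ?case by (auto simp: coeff_1 tempered_const)
  next
    case (Suc m)
    from mult[OF P Suc] show ?case by simp
  qed
  have lin: "\<forall>i. tempered (\<lambda>z. coeff [:u z, v z:] i)"
    if "tempered u" "tempered v" for u v :: "'a \<Rightarrow> complex"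
  proof
    fix i
    consider "i = 0" | "i = 1" | j where "i = Suc (Suc j)" by (metis One_nat_def not0_implies_Suc)
    then show "tempered (\<lambda>z. coeff [:u z, v z:] i)" using that by cases (simp_all add: tempered_const)
  qed
  have "\<forall>i. tempered (\<lambda>z. coeff ([:\<beta> z, \<alpha> z:] ^ b * [:\<delta> z, \<gamma> z:] ^ (n - b)) i)"
    by (intro mult pow lin assms)
  then show ?thesis unfolding subst_mat_def by (intro tempered_mult tempered_const) blast
qed

lemma tempered_nth: "tempered (\<lambda>z :: complex ^ 2. z $ i)"
proof -
  have "(\<lambda>z :: complex ^ 2. z $ i) = (\<lambda>z. of_real (z \<bullet> axis i 1) + \<i> * of_real (z \<bullet> axis i \<i>))"
    by (rule ext) (simp add: inner_axis complex_eq_iff inner_complex_def)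
  then show ?thesis by (simp only:) (intro tempered_add tempered_mult tempered_const tempered_inner)
qed

lemma tempered_cnj_nth: "tempered (\<lambda>z :: complex ^ 2. cnj (z $ i))"
proof -
  have "(\<lambda>z :: complex ^ 2. cnj (z $ i)) = (\<lambda>z. of_real (z \<bullet> axis i 1) - \<i> * of_real (z \<bullet> axis i \<i>))"
    by (rule ext) (simp add: inner_axis complex_eq_iff inner_complex_def)
  then show ?thesis by (simp only:) (intro tempered_diff tempered_mult tempered_const tempered_inner)
qed

section \<open>Equivariant matrix polynomials\<close>

text \<open>For \<open>z \<in> \<complex>\<^sup>2\<close> let \<open>\<ell>(x) = z\<^sub>2 x\<^sub>1 - z\<^sub>1 x\<^sub>2\<close> and \<open>v = (cnj z\<^sub>2, - cnj z\<^sub>1)\<close>.  The substitution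
  \<open>x \<mapsto> x + s \<ell>(x) v\<close> depends on \<open>z\<close> in an equivariant way.\<close>

definition shift_mat :: "nat \<Rightarrow> complex \<Rightarrow> complex ^ 2 \<Rightarrow> nat \<Rightarrow> nat \<Rightarrow> complex" where
  "shift_mat n s z = subst_mat n (1 + s * (z $ 2 * cnj (z $ 2))) (- s * (z $ 1 * cnj (z $ 2)))
     (- s * (z $ 2 * cnj (z $ 1))) (1 + s * (z $ 1 * cnj (z $ 1)))"

lemma V_basis_shift:
  assumes "b \<le> n"
  shows "V_basis n b (x + (s * (z $ 2 * x $ 1 - z $ 1 * x $ 2)) *s vector [cnj (z $ 2), - cnj (z $ 1)]) =
    (\<Sum>a\<le>n. shift_mat n s z a b * V_basis n a x)"
proof -
  have "x + (s * (z $ 2 * x $ 1 - z $ 1 * x $ 2)) *s vector [cnj (z $ 2), - cnj (z $ 1)] =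
    vector [(1 + s * (z $ 2 * cnj (z $ 2))) * x $ 1 + (- s * (z $ 1 * cnj (z $ 2))) * x $ 2,
      (- s * (z $ 2 * cnj (z $ 1))) * x $ 1 + (1 + s * (z $ 1 * cnj (z $ 1))) * x $ 2]"
    by (simp add: vec2_eq vector_2 algebra_simps)
  then show ?thesis by (simp only: V_basis_subst[OF assms] shift_mat_def)
qed

lemma tempered_shift_mat: "tempered (\<lambda>z. shift_mat n s z a b)"
  unfolding shift_mat_def
  by (intro tempered_subst_mat tempered_add tempered_mult tempered_const tempered_nth tempered_cnj_nth)

lemma shift_mat_phase:
  assumes "cmod c = 1" shows "shift_mat n s (c *s z) = shift_mat n s z"
proof -
  have "c * cnj c = 1" using assms by (simp add: complex_norm_square[symmetric])
  moreover have "(c * p) * (cnj c * q) = (c * cnj c) * (p * q)" for p q by (simp only: mult_ac)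
  ultimately have "(c * p) * (cnj c * q) = p * q" for p q by simp
  then show ?thesis by (simp only: shift_mat_def vector_smult_component complex_cnj_mult)
qed

text \<open>The form \<ell>(x) is the determinant of the pair (x, z), hence unchanged when SU(2)
  acts on both, and v transforms in the same way as z. So the shift for the rotated z, followed by
  the inverse rotation, equals the inverse rotation followed by the shift for z; both sides expand
  this one substitution in the basis.\<close>

lemma shift_mat_intertwine:
  assumes \<zeta>: "norm \<zeta> = 1" and ab: "a \<le> n" "b \<le> n"
  shows "(\<Sum>c\<le>n. shift_mat n s (rotv \<zeta> z) a c * tt n \<zeta> c b) = (\<Sum>c\<le>n. tt n \<zeta> a c * shift_mat n s z c b)"
proof (rule V_basis_independent[where c = "\<lambda>a. \<Sum>c\<le>n. shift_mat n s (rotv \<zeta> z) a c * tt n \<zeta> c b"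
      and d = "\<lambda>a. \<Sum>c\<le>n. tt n \<zeta> a c * shift_mat n s z c b", OF _ ab(1)])
  fix x :: "complex ^ 2"
  let ?z = "rotv \<zeta> z"
  let ?x = "x + (s * (?z $ 2 * x $ 1 - ?z $ 1 * x $ 2)) *s vector [cnj (?z $ 2), - cnj (?z $ 1)]"
  let ?y = "adjv \<zeta> x"
  have u: "cnj (\<zeta> $ 1) * \<zeta> $ 1 + cnj (\<zeta> $ 2) * \<zeta> $ 2 = 1" using unit_cnj[OF \<zeta>] by (simp add: mult.commute)
  have l: "?z $ 2 * x $ 1 - ?z $ 1 * x $ 2 = z $ 2 * ?y $ 1 - z $ 1 * ?y $ 2"
    by (simp add: algebra_simps)
  have v: "adjv \<zeta> (vector [cnj (?z $ 2), - cnj (?z $ 1)]) = vector [cnj (z $ 2), - cnj (z $ 1)]"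
  proof -
    have "adjv \<zeta> (vector [cnj (?z $ 2), - cnj (?z $ 1)]) =
      (cnj (\<zeta> $ 1) * \<zeta> $ 1 + cnj (\<zeta> $ 2) * \<zeta> $ 2) *s vector [cnj (z $ 2), - cnj (z $ 1)]"
      by (simp add: vec2_eq vector_2 algebra_simps)
    then show ?thesis by (simp add: u)
  qed
  have lin: "adjv \<zeta> (p + k *s q) = adjv \<zeta> p + k *s adjv \<zeta> q" for p q k
    by (simp add: vec2_eq algebra_simps)
  have "(\<Sum>a\<le>n. (\<Sum>c\<le>n. shift_mat n s ?z a c * tt n \<zeta> c b) * V_basis n a x) =
      (\<Sum>c\<le>n. tt n \<zeta> c b * (\<Sum>a\<le>n. shift_mat n s ?z a c * V_basis n a x))"
    unfolding sum_distrib_right sum_distrib_left by (subst sum.swap) (simp add: mult_ac)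
  also have "\<dots> = (\<Sum>c\<le>n. tt n \<zeta> c b * V_basis n c ?x)"
    by (intro sum.cong refl) (simp only: V_basis_shift atMost_iff)
  also have "\<dots> = V_basis n b (adjv \<zeta> ?x)" by (simp only: tt_adjv[OF ab(2) \<zeta>])
  also have "adjv \<zeta> ?x = ?y + (s * (z $ 2 * ?y $ 1 - z $ 1 * ?y $ 2)) *s vector [cnj (z $ 2), - cnj (z $ 1)]"
    by (simp only: lin v l)
  also have "V_basis n b \<dots> = (\<Sum>c\<le>n. shift_mat n s z c b * V_basis n c ?y)"
    by (rule V_basis_shift[OF ab(2)])
  also have "\<dots> = (\<Sum>c\<le>n. shift_mat n s z c b * (\<Sum>a\<le>n. tt n \<zeta> a c * V_basis n a x))"
    by (intro sum.cong refl) (simp only: tt_adjv[OF _ \<zeta>] atMost_iff)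
  also have "\<dots> = (\<Sum>a\<le>n. (\<Sum>c\<le>n. tt n \<zeta> a c * shift_mat n s z c b) * V_basis n a x)"
    unfolding sum_distrib_right sum_distrib_left by (subst sum.swap) (simp add: mult_ac)
  finally show "(\<Sum>a\<le>n. (\<Sum>c\<le>n. shift_mat n s ?z a c * tt n \<zeta> c b) * V_basis n a x) =
    (\<Sum>a\<le>n. (\<Sum>c\<le>n. tt n \<zeta> a c * shift_mat n s z c b) * V_basis n a x)" .
qed

lemma shift_mat_conj:
  assumes \<zeta>: "norm \<zeta> = 1" and ab: "a \<le> n" "b \<le> n"
  shows "shift_mat n s (cis \<theta> *s rotv \<zeta> z) a b = conjm n \<zeta> (shift_mat n s z) a b"
proof -
  have "conjm n \<zeta> (shift_mat n s z) a b = (\<Sum>d\<le>n. (\<Sum>c\<le>n. tt n \<zeta> a c * shift_mat n s z c d) * cnj (tt n \<zeta> b d))"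
    unfolding conjm_def sum_distrib_right by (rule sum.swap)
  also have "\<dots> = (\<Sum>d\<le>n. (\<Sum>c\<le>n. shift_mat n s (rotv \<zeta> z) a c * tt n \<zeta> c d) * cnj (tt n \<zeta> b d))"
    by (intro sum.cong refl) (simp only: shift_mat_intertwine[OF \<zeta> ab(1)] atMost_iff)
  also have "\<dots> = (\<Sum>c\<le>n. shift_mat n s (rotv \<zeta> z) a c * (\<Sum>d\<le>n. tt n \<zeta> c d * cnj (tt n \<zeta> b d)))"
    unfolding sum_distrib_right sum_distrib_left by (subst sum.swap) (simp add: mult_ac)
  also have "\<dots> = (\<Sum>c\<le>n. shift_mat n s (rotv \<zeta> z) a c * (if c = b then 1 else 0))"
    by (intro sum.cong refl) (simp only: tt_unitary'[OF \<zeta> ab(2)] atMost_iff)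
  also have "\<dots> = shift_mat n s (rotv \<zeta> z) a b"
    using ab(2) by (simp add: if_distrib[of "\<lambda>y. _ * y"] cong: if_cong)
  finally show ?thesis by (simp add: shift_mat_phase)
qed

text \<open>At the pole the substitution only scales x_1, by 1 + s r^2. The coefficient of s^m in (1
  + s r^2)^b is (b choose m) r^(2m), the m-th Newton basis function at b.\<close>

lemma shift_mat_diag:
  assumes "a \<le> n" "b \<le> n"
  shows "shift_mat n s (vector [0, of_real r]) a b = (if a = b then (1 + s * of_real (r\<^sup>2)) ^ b else 0)"
proof -
  have "subst_mat n (1 + s * of_real (r\<^sup>2)) 0 0 1 a b = (if a = b then (1 + s * of_real (r\<^sup>2)) ^ b else 0)"
  proof (rule subst_mat_unique[OF assms(2,1)])
    fix x :: "complex ^ 2"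
    have "(\<Sum>a\<le>n. (if a = b then (1 + s * of_real (r\<^sup>2)) ^ b else 0) * V_basis n a x) = (1 + s * of_real (r\<^sup>2)) ^ b * V_basis n b x"
      using assms(2) by (simp add: if_distrib[of "\<lambda>y. y * _"] cong: if_cong)
    then show "V_basis n b (vector [(1 + s * of_real (r\<^sup>2)) * x $ 1 + 0 * x $ 2, 0 * x $ 1 + 1 * x $ 2]) =
        (\<Sum>a\<le>n. (if a = b then (1 + s * of_real (r\<^sup>2)) ^ b else 0) * V_basis n a x)"
      by (simp add: V_basis_def vector_2 power_mult_distrib mult_ac)
  qed
  then show ?thesis by (simp add: shift_mat_def vector_2 power2_eq_square)
qed

text \<open>The basis vector of index 0 is x_2^n, so this column expands the n-th power of one
  linear form. The factor (z_2 cnj z_1)^a vanishes to order a at the pole; this is what singles out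
  one Newton coefficient per row.\<close>

lemma shift_mat_column:
  assumes "a \<le> n"
  shows "shift_mat n s z a 0 =
    of_real (sqrt (real (n choose a))) * (- s * (z $ 2 * cnj (z $ 1))) ^ a * (1 + s * (z $ 1 * cnj (z $ 1))) ^ (n - a)"
  unfolding shift_mat_def
proof (rule subst_mat_unique[OF le0 assms])
  fix x :: "complex ^ 2" let ?\<gamma> = "- s * (z $ 2 * cnj (z $ 1))" and ?\<delta> = "1 + s * (z $ 1 * cnj (z $ 1))"
  have "complex_of_real (sqrt (real (n choose a))) * complex_of_real (sqrt (real (n choose a))) = of_nat (n choose a)" for a
    by (simp flip: of_real_mult)
  then have sq: "complex_of_real (sqrt (real (n choose a))) * (complex_of_real (sqrt (real (n choose a))) * c) = of_nat (n choose a) * c" for a c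
    by (simp only: mult.assoc[symmetric])
  have "V_basis n 0 (vector [(1 + s * (z $ 2 * cnj (z $ 2))) * x $ 1 + (- s * (z $ 1 * cnj (z $ 2))) * x $ 2, ?\<gamma> * x $ 1 + ?\<delta> * x $ 2])
     = (?\<gamma> * x $ 1 + ?\<delta> * x $ 2) ^ n" by (simp add: V_basis_def vector_2)
  also have "\<dots> = (\<Sum>a\<le>n. of_nat (n choose a) * (?\<gamma> * x $ 1) ^ a * (?\<delta> * x $ 2) ^ (n - a))"
    by (rule binomial_ring)
  also have "\<dots> = (\<Sum>a\<le>n. of_real (sqrt (real (n choose a))) * ?\<gamma> ^ a * ?\<delta> ^ (n - a) * V_basis n a x)"
    unfolding V_basis_def power_mult_distrib by (intro sum.cong refl) (simp only: mult_ac sq)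
  finally show "V_basis n 0 (vector [(1 + s * (z $ 2 * cnj (z $ 2))) * x $ 1 + (- s * (z $ 1 * cnj (z $ 2))) * x $ 2, ?\<gamma> * x $ 1 + ?\<delta> * x $ 2])
     = (\<Sum>a\<le>n. of_real (sqrt (real (n choose a))) * ?\<gamma> ^ a * ?\<delta> ^ (n - a) * V_basis n a x)" .
qed

text \<open>The coefficient of \<open>s\<^sup>m\<close>, extracted by averaging over roots of unity.\<close>

definition unit_root :: "nat \<Rightarrow> nat \<Rightarrow> complex" where
  "unit_root n k = cis (2 * pi * real k / real (Suc n))"

text \<open>The entries of \<open>shift_mat\<close> are polynomials of degree at most n in s, so n +
  1 roots of unity separate the coefficients. As a finite linear combination of shift matrices it
  inherits temperedness and covariance from them.\<close>

definition newton_mat :: "nat \<Rightarrow> nat \<Rightarrow> complex ^ 2 \<Rightarrow> nat \<Rightarrow> nat \<Rightarrow> complex" where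
  "newton_mat n m z a b = (\<Sum>k\<le>n. cnj (unit_root n k) ^ m / of_nat (Suc n) * shift_mat n (unit_root n k) z a b)"

lemma unit_root_orthogonal:
  assumes "l \<le> n" "m \<le> n"
  shows "(\<Sum>k\<le>n. cnj (unit_root n k) ^ m / of_nat (Suc n) * unit_root n k ^ l) = (if l = m then 1 else 0)"
proof -
  let ?w = "unit_root n"
  have pw: "?w k ^ l = ?w l ^ k" for k l
    unfolding unit_root_def Complex.DeMoivre by (simp add: mult_ac)
  have uu: "cnj (?w k) * ?w k = 1" for k by (simp add: unit_root_def cis_cnj cis_mult)
  \<comment> \<open>The average is a geometric sum in q, an (n + 1)-st root of unity that equals 1
    exactly when l = m.\<close>
  define q where "q = cnj (?w m) * ?w l"
  have "(\<Sum>k\<le>n. cnj (?w k) ^ m / of_nat (Suc n) * ?w k ^ l) = (\<Sum>k\<le>n. q ^ k) / of_nat (Suc n)"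
    unfolding sum_divide_distrib q_def power_mult_distrib
    by (intro sum.cong refl) (simp add: pw[of _ l] pw[of _ m] flip: complex_cnj_power)
  moreover have "(\<Sum>k\<le>n. q ^ k) = (if l = m then of_nat (Suc n) else 0)"
  proof (cases "l = m")
    case True
    then show ?thesis by (simp add: q_def uu)
  next
    case False
    have wN: "?w k ^ Suc n = 1" for k
    proof -
      have "?w k ^ Suc n = cis (real (Suc n) * (2 * pi * real k / real (Suc n)))" by (simp only: unit_root_def Complex.DeMoivre)
      also have "real (Suc n) * (2 * pi * real k / real (Suc n)) = 2 * pi * real k" by (simp del: of_nat_Suc)
      finally show ?thesis by (simp only: cis_multiple_2pi[OF Ints_of_nat])
    qed
    have "q ^ Suc n = 1" unfolding q_def power_mult_distrib wN complex_cnj_power[symmetric] by simp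
    moreover have "q \<noteq> 1"
    proof
      assume "q = 1"
      then have "?w m * (cnj (?w m) * ?w l) = ?w m" by (simp add: q_def)
      then have "?w l = ?w m" using uu[of m] by (simp only: mult.assoc[symmetric] mult.commute[of "?w m"]) simp
      moreover have "?w k = exp (2 * of_real pi * \<i> * of_nat k / of_nat (Suc n))" for k
        by (simp add: unit_root_def cis_conv_exp mult_ac)
      ultimately have "l mod Suc n = m mod Suc n"
        using complex_root_unity_eq[of "Suc n" l m] by (simp del: of_nat_Suc)
      then show False using assms False by simp
    qed
    ultimately have "(\<Sum>k<Suc n. q ^ k) = 0"
      using power_diff_1_eq[of q "Suc n"] by simp
    then show ?thesis using False by (simp add: lessThan_Suc_atMost)
  qed
  ultimately show ?thesis by (simp del: of_nat_Suc)
qed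

lemma tempered_newton_mat: "tempered (\<lambda>z. newton_mat n m z a b)"
  unfolding newton_mat_def by (intro tempered_sum tempered_mult tempered_const tempered_shift_mat)

lemma conjm_sum:
  assumes "finite K"
  shows "conjm n \<zeta> (\<lambda>a b. \<Sum>k\<in>K. c k * X k a b) a b = (\<Sum>k\<in>K. c k * conjm n \<zeta> (X k) a b)"
proof -
  have "conjm n \<zeta> (\<lambda>a b. \<Sum>k\<in>K. c k * X k a b) a b = (\<Sum>d\<le>n. \<Sum>e\<le>n. \<Sum>k\<in>K. c k * (tt n \<zeta> a d * X k d e * cnj (tt n \<zeta> b e)))"
    unfolding conjm_def sum_distrib_left sum_distrib_right by (simp add: mult_ac)
  also have "\<dots> = (\<Sum>k\<in>K. \<Sum>d\<le>n. \<Sum>e\<le>n. c k * (tt n \<zeta> a d * X k d e * cnj (tt n \<zeta> b e)))"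
    by (simp only: sum.swap[of _ K])
  finally show ?thesis unfolding conjm_def sum_distrib_left .
qed

lemma newton_mat_conj:
  assumes "norm \<zeta> = 1" "a \<le> n" "b \<le> n"
  shows "newton_mat n m (cis \<theta> *s rotv \<zeta> z) a b = conjm n \<zeta> (newton_mat n m z) a b"
proof -
  have "newton_mat n m z = (\<lambda>a b. \<Sum>k\<le>n. cnj (unit_root n k) ^ m / of_nat (Suc n) * shift_mat n (unit_root n k) z a b)"
    by (intro ext) (rule newton_mat_def)
  then show ?thesis by (simp only: conjm_sum[OF finite_atMost]) (simp only: newton_mat_def shift_mat_conj[OF assms])
qed

lemma newton_mat_diag:
  assumes "a \<le> n" "b \<le> n" "m \<le> n"
  shows "newton_mat n m (vector [0, of_real r]) a b = (if a = b then of_nat (b choose m) * of_real (r\<^sup>2) ^ m else 0)"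
proof (cases "a = b")
  case True
  let ?x = "complex_of_real (r\<^sup>2)" and ?w = "unit_root n"
  have "newton_mat n m (vector [0, of_real r]) a b = (\<Sum>k\<le>n. cnj (?w k) ^ m / of_nat (Suc n) * (?w k * ?x + 1) ^ b)"
    unfolding newton_mat_def by (intro sum.cong refl) (simp add: shift_mat_diag assms True add.commute)
  also have "\<dots> = (\<Sum>k\<le>n. \<Sum>l\<le>b. of_nat (b choose l) * ?x ^ l * (cnj (?w k) ^ m / of_nat (Suc n) * ?w k ^ l))"
    unfolding binomial_ring power_mult_distrib sum_distrib_left by (intro sum.cong refl) simp
  also have "\<dots> = (\<Sum>l\<le>b. of_nat (b choose l) * ?x ^ l * (\<Sum>k\<le>n. cnj (?w k) ^ m / of_nat (Suc n) * ?w k ^ l))"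
    unfolding sum_distrib_left by (rule sum.swap)
  also have "\<dots> = (\<Sum>l\<le>b. of_nat (b choose l) * ?x ^ l * (if l = m then 1 else 0))"
    using assms by (intro sum.cong refl) (simp only: unit_root_orthogonal order_trans[OF _ assms(2)] atMost_iff)
  also have "\<dots> = of_nat (b choose m) * ?x ^ m"
    by (cases "m \<le> b") (simp_all add: if_distrib[of "\<lambda>y. _ * y"] binomial_eq_0 cong: if_cong)
  finally show ?thesis using True by simp
next
  case False
  then show ?thesis unfolding newton_mat_def by (simp add: shift_mat_diag[OF assms(1,2)])
qed
section \<open>Covariance and the Fourier transform\<close>

definition covariant :: "nat \<Rightarrow> (complex ^ 2 \<Rightarrow> nat \<Rightarrow> nat \<Rightarrow> complex) \<Rightarrow> bool" where
  "covariant n X \<longleftrightarrow> (\<forall>\<theta> \<zeta> z. norm \<zeta> = 1 \<longrightarrow> (\<forall>a\<le>n. \<forall>b\<le>n. X (cis \<theta> *s rotv \<zeta> z) a b = conjm n \<zeta> (X z) a b))"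

lemma covariantD:
  "covariant n X \<Longrightarrow> norm \<zeta> = 1 \<Longrightarrow> a \<le> n \<Longrightarrow> b \<le> n \<Longrightarrow> X (cis \<theta> *s rotv \<zeta> z) a b = conjm n \<zeta> (X z) a b"
  unfolding covariant_def by blast

lemma equivariant_covariant:
  assumes "\<And>z. F z \<in> carrier_mat (n + 1) (n + 1)"
  shows "equivariant n F \<longleftrightarrow> covariant n (\<lambda>z a b. F z $$ (a, b))"
  unfolding covariant_def by (rule equivariant_iff[OF assms])

lemma norm_rot:
  assumes "norm \<zeta> = 1" shows "norm (cis \<theta> *s rotv \<zeta> z) = norm z"
proof -
  have "complex_of_real ((norm (rotv \<zeta> z))\<^sup>2) = of_real ((norm \<zeta>)\<^sup>2) * of_real ((norm z)\<^sup>2)"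
    unfolding norm2_cnj by (simp add: algebra_simps)
  then have "(norm (rotv \<zeta> z))\<^sup>2 = (norm z)\<^sup>2" by (simp only: assms flip: of_real_mult) (simp add: of_real_eq_iff del: of_real_power)
  moreover have "(norm (cis \<theta> *s rotv \<zeta> z))\<^sup>2 = (norm (rotv \<zeta> z))\<^sup>2"
    by (simp add: norm2_sq norm_mult del: rotv_nth)
  ultimately have "(norm (cis \<theta> *s rotv \<zeta> z))\<^sup>2 = (norm z)\<^sup>2" by simp
  then show ?thesis by (rule power2_eq_imp_eq) simp_all
qed

lemma orthogonal_rot:
  assumes "norm \<zeta> = 1" shows "orthogonal_transformation (\<lambda>z. cis \<theta> *s rotv \<zeta> z)"
  unfolding orthogonal_transformation
proof (intro conjI allI)
  show "linear (\<lambda>z. cis \<theta> *s rotv \<zeta> z)"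
    by (rule linearI) (simp_all add: vec2_eq algebra_simps scaleR_right_distrib scaleR_diff_right)
qed (rule norm_rot[OF assms])

lemma orthogonal_uminus: "orthogonal_transformation (\<lambda>z :: 'a :: euclidean_space. - z)"
  unfolding orthogonal_transformation by (auto intro!: linearI)

lemma four_sum:
  assumes f: "\<And>i. i \<in> I \<Longrightarrow> f i \<in> schwartz"
  shows "four (\<lambda>w. \<Sum>i\<in>I. c i * f i w) z = (\<Sum>i\<in>I. c i * four (f i) z)"
proof -
  have "four (\<lambda>w. \<Sum>i\<in>I. c i * f i w) z = (LINT w|lborel. (\<Sum>i\<in>I. c i * (f i w * cis (w \<bullet> z))))"
    unfolding four_def by (simp add: sum_distrib_right mult.assoc)
  also have "\<dots> = (\<Sum>i\<in>I. (LINT w|lborel. c i * (f i w * cis (w \<bullet> z))))"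
    by (rule Bochner_Integration.integral_sum) (intro integrable_mult_right four_integrable f)
  finally show ?thesis by (simp add: four_def)
qed

lemma four_cmult: "f \<in> schwartz \<Longrightarrow> four (\<lambda>w. c * f w) z = c * four f z"
  using four_sum[of "{()}" "\<lambda>_. f" "\<lambda>_. c" z] by simp

lemma four_reflect: "f \<in> schwartz \<Longrightarrow> four (\<lambda>w. f (- w)) z = four f (- z)"
  using four_rotate[OF orthogonal_uminus, of f z] by simp

lemma schwartz_reflect: "f \<in> schwartz \<Longrightarrow> (\<lambda>w. f (- w)) \<in> schwartz"
  by (rule schwartz_rotate[OF orthogonal_uminus])

lemma schwartz_cmult: "f \<in> schwartz \<Longrightarrow> (\<lambda>w. c * f w) \<in> schwartz"
  by (rule schwartz_op_in[OF schwartz_op_mult[OF tempered_const]])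

lemma conjm_cartesian:
  "conjm n \<zeta> X a b = (\<Sum>p\<in>{..n} \<times> {..n}. (tt n \<zeta> a (fst p) * cnj (tt n \<zeta> b (snd p))) * X (fst p) (snd p))"
  unfolding conjm_def sum.cartesian_product by (intro sum.cong refl) (auto simp: mult_ac)

lemma conjm_cong:
  "(\<And>c d. c \<le> n \<Longrightarrow> d \<le> n \<Longrightarrow> X c d = Y c d) \<Longrightarrow> conjm n \<zeta> X a b = conjm n \<zeta> Y a b"
  unfolding conjm_def by (intro sum.cong refl) simp

lemma four_covariant:
  assumes X: "\<And>a b. a \<le> n \<Longrightarrow> b \<le> n \<Longrightarrow> (\<lambda>w. X w a b) \<in> schwartz" and cov: "covariant n X"
  shows "covariant n (\<lambda>z a b. four (\<lambda>w. X w a b) z)"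
  unfolding covariant_def
proof (intro allI impI)
  fix \<theta> \<zeta> z a b assume \<zeta>: "norm (\<zeta> :: complex ^ 2) = 1" and ab: "a \<le> n" "b \<le> n"
  have "four (\<lambda>w. X w a b) (cis \<theta> *s rotv \<zeta> z) = four (\<lambda>w. X (cis \<theta> *s rotv \<zeta> w) a b) z"
    by (rule four_rotate[OF orthogonal_rot[OF \<zeta>] X[OF ab]])
  also have "\<dots> = four (\<lambda>w. conjm n \<zeta> (X w) a b) z" by (simp only: covariantD[OF cov \<zeta> ab])
  also have "\<dots> = conjm n \<zeta> (\<lambda>a b. four (\<lambda>w. X w a b) z) a b"
    unfolding conjm_cartesian by (rule four_sum) (auto intro: X)
  finally show "four (\<lambda>w. X w a b) (cis \<theta> *s rotv \<zeta> z) = conjm n \<zeta> (\<lambda>a b. four (\<lambda>w. X w a b) z) a b" .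
qed

lemma sum_swap3: "(\<Sum>b\<in>B. \<Sum>c\<in>C. \<Sum>d\<in>D. G b c d) = (\<Sum>c\<in>C. \<Sum>d\<in>D. \<Sum>b\<in>B. G b c d)"
  by (rule trans[OF sum.swap]) (intro sum.cong refl, rule sum.swap)

text \<open>This is the trace of the conjugate of Y against the conjugate of the matrix unit at (j,
  j); unitarity removes both conjugations. It makes the integrand over the sphere constant in the
  spherical transform.\<close>

lemma conjm_inverse:
  assumes \<zeta>: "norm \<zeta> = 1" and j: "j \<le> n"
  shows "(\<Sum>a\<le>n. \<Sum>b\<le>n. conjm n \<zeta> Y a b * (tt n \<zeta> b j * cnj (tt n \<zeta> a j))) = Y j j"
proof -
  have 1: "(\<Sum>b\<le>n. conjm n \<zeta> Y a b * tt n \<zeta> b j) = (\<Sum>c\<le>n. tt n \<zeta> a c * Y c j)" for a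
  proof -
    have "(\<Sum>b\<le>n. conjm n \<zeta> Y a b * tt n \<zeta> b j) =
        (\<Sum>c\<le>n. \<Sum>d\<le>n. tt n \<zeta> a c * Y c d * (\<Sum>b\<le>n. cnj (tt n \<zeta> b d) * tt n \<zeta> b j))"
      unfolding conjm_def sum_distrib_right sum_distrib_left
      by (subst sum_swap3) (simp only: mult_ac)
    also have "\<dots> = (\<Sum>c\<le>n. \<Sum>d\<le>n. tt n \<zeta> a c * Y c d * (if d = j then 1 else 0))"
      by (intro sum.cong refl) (simp only: tt_unitary[OF \<zeta> j] atMost_iff)
    also have "\<dots> = (\<Sum>c\<le>n. tt n \<zeta> a c * Y c j)"
      using j by (simp add: if_distrib[of "\<lambda>y. _ * y"] cong: if_cong)
    finally show ?thesis .
  qed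
  have "(\<Sum>a\<le>n. \<Sum>b\<le>n. conjm n \<zeta> Y a b * (tt n \<zeta> b j * cnj (tt n \<zeta> a j))) =
      (\<Sum>a\<le>n. cnj (tt n \<zeta> a j) * (\<Sum>b\<le>n. conjm n \<zeta> Y a b * tt n \<zeta> b j))"
    unfolding sum_distrib_left by (simp only: mult_ac)
  also have "\<dots> = (\<Sum>c\<le>n. (\<Sum>a\<le>n. cnj (tt n \<zeta> a j) * tt n \<zeta> a c) * Y c j)"
    unfolding 1 sum_distrib_left sum_distrib_right by (subst sum.swap) (simp only: mult_ac)
  also have "\<dots> = (\<Sum>c\<le>n. (if j = c then 1 else 0) * Y c j)"
    by (intro sum.cong refl) (simp only: tt_unitary[OF \<zeta> _ j] atMost_iff)
  also have "\<dots> = Y j j" using j by (simp add: if_distrib[of "\<lambda>y. y * _"] cong: if_cong)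
  finally show ?thesis .
qed

abbreviation pole :: "real \<Rightarrow> complex ^ 2" where "pole r \<equiv> vector [0, of_real r]"

lemma rotv_pole: "rotv \<zeta> (pole r) = of_real r *s \<zeta>"
  by (simp add: vec2_eq vector_2)

lemma norm_pole: "norm (pole r) = \<bar>r\<bar>"
proof -
  have "(norm (pole r))\<^sup>2 = \<bar>r\<bar>\<^sup>2" by (simp add: norm2_sq vector_2)
  then show ?thesis by (rule power2_eq_imp_eq) simp_all
qed

text \<open>For \<zeta> = (0, cis \<beta>) the rotation is diagonal, and \<tau> is diagonal with
  entries cis (\<beta> (2 b - n)). Conjugation multiplies entry (a, b) by the quotient of two of
  these weights.\<close>

lemma covariant_torus:
  assumes cov: "covariant n X" and ab: "a \<le> n" "b \<le> n"
  shows "X (vector [cis (\<theta> - \<beta>) * z $ 1, cis (\<theta> + \<beta>) * z $ 2]) a b = cis (2 * \<beta> * (real a - real b)) * X z a b"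
proof -
  let ?\<zeta> = "vector [0, cis \<beta>] :: complex ^ 2"
  have "(norm ?\<zeta>)\<^sup>2 = 1" by (simp add: norm2_sq vector_2)
  then have \<zeta>: "norm ?\<zeta> = 1" by (metis norm_ge_zero power2_eq_1_iff neg_0_le_iff_le not_one_le_zero)
  then have nz: "?\<zeta> \<noteq> 0" by auto
  have tt: "tt n ?\<zeta> a b = (if a = b then cis (\<beta> * (2 * real b - real n)) else 0)" if ab: "a \<le> n" "b \<le> n" for a b
  proof -
    have "cis \<beta> ^ b * cis (- \<beta>) ^ (n - b) = cis (\<beta> * (2 * real b - real n))"
      using ab by (simp add: Complex.DeMoivre cis_mult of_nat_diff algebra_simps)
    moreover have "subst_mat n (cis \<beta>) (- 0) (cnj 0) (cnj (cis \<beta>)) a b = (if a = b then cis \<beta> ^ b * cis (- \<beta>) ^ (n - b) else 0)"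
    proof (rule subst_mat_unique[OF ab(2,1)])
      fix x :: "complex ^ 2"
      have "(\<Sum>a\<le>n. (if a = b then cis \<beta> ^ b * cis (- \<beta>) ^ (n - b) else 0) * V_basis n a x) = cis \<beta> ^ b * cis (- \<beta>) ^ (n - b) * V_basis n b x"
        using ab(2) by (simp add: if_distrib[of "\<lambda>y. y * _"] cong: if_cong)
      then show "V_basis n b (vector [cis \<beta> * x $ 1 + - 0 * x $ 2, cnj 0 * x $ 1 + cnj (cis \<beta>) * x $ 2]) =
          (\<Sum>a\<le>n. (if a = b then cis \<beta> ^ b * cis (- \<beta>) ^ (n - b) else 0) * V_basis n a x)"
        by (simp add: V_basis_def vector_2 power_mult_distrib mult_ac cis_cnj)
    qed
    ultimately show ?thesis using tt_eq_subst_mat[OF ab nz] \<zeta> by (simp add: vector_2)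
  qed
  have "cis \<theta> *s rotv ?\<zeta> z = vector [cis (\<theta> - \<beta>) * z $ 1, cis (\<theta> + \<beta>) * z $ 2]"
    by (simp add: vec2_eq vector_2 cis_cnj cis_mult mult.assoc[symmetric])
  then have "X (vector [cis (\<theta> - \<beta>) * z $ 1, cis (\<theta> + \<beta>) * z $ 2]) a b = conjm n ?\<zeta> (X z) a b"
    using covariantD[OF cov \<zeta> ab, of \<theta> z] by simp
  also have "\<dots> = (\<Sum>c\<le>n. \<Sum>d\<le>n. if c = a then (if d = b then cis (\<beta> * (2 * real a - real n)) * X z a b * cnj (cis (\<beta> * (2 * real b - real n))) else 0) else 0)"
    unfolding conjm_def by (rule sum.cong[OF refl], rule sum.cong[OF refl]) (auto simp: tt ab)
  also have "\<dots> = cis (\<beta> * (2 * real a - real n)) * X z a b * cnj (cis (\<beta> * (2 * real b - real n)))"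
    using ab by (subst sum.swap) (simp only: sum.delta finite_atMost atMost_iff if_True)
  also have "\<dots> = cis (2 * \<beta> * (real a - real b)) * X z a b"
    by (simp add: cis_cnj cis_mult mult.commute mult.left_commute) (simp add: algebra_simps)
  finally show ?thesis .
qed

lemma covariant_diagonal:
  assumes cov: "covariant n X" and ab: "a \<le> n" "b \<le> n" "a \<noteq> b"
  shows "X (pole r) a b = 0"
proof -
  \<comment> \<open>With this \<beta> the entry acquires the phase cis pi = -1, while the choice
    \<theta> = -\<beta> fixes the second coordinate and hence the pole.\<close>
  let ?\<beta> = "pi / (2 * (real a - real b))"
  have "vector [cis (- ?\<beta> - ?\<beta>) * pole r $ 1, cis (- ?\<beta> + ?\<beta>) * pole r $ 2] = pole r"
    by (simp add: vec2_eq vector_2)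
  then have "X (pole r) a b = cis (2 * ?\<beta> * (real a - real b)) * X (pole r) a b"
    using covariant_torus[OF cov ab(1,2), of "- ?\<beta>" ?\<beta> "pole r"] by simp
  moreover have "2 * ?\<beta> * (real a - real b) = pi" using ab(3) by (simp add: field_simps)
  ultimately have "X (pole r) a b = - X (pole r) a b" by simp
  then show ?thesis by simp
qed

text \<open>Every point is a rotation of a pole of the same norm, and at the poles a covariant
  function is diagonal.\<close>

lemma covariant_eq:
  assumes X: "covariant n X" and Y: "covariant n Y"
    and eq: "\<And>r j. 0 \<le> r \<Longrightarrow> j \<le> n \<Longrightarrow> X (pole r) j j = Y (pole r) j j" and ab: "a \<le> n" "b \<le> n"
  shows "X z a b = Y z a b"
proof -
  obtain \<zeta> where \<zeta>: "norm \<zeta> = 1" "of_real (norm z) *s \<zeta> = z"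
  proof (cases "z = 0")
    case True
    have "norm (pole 1) = 1" by (simp only: norm_pole)
    then show ?thesis using True by (intro that[of "pole 1"]) (simp_all add: vec2_eq)
  next
    case False
    have "sgn z $ i = z $ i / of_real (norm z)" for i
      unfolding sgn_div_norm vector_scaleR_component by (simp add: scaleR_conv_of_real divide_inverse)
    then show ?thesis
      using False by (intro that[of "sgn z"]) (simp_all add: norm_sgn vec2_eq)
  qed
  have z: "z = cis 0 *s rotv \<zeta> (pole (norm z))" by (simp add: rotv_pole \<zeta>(2))
  have "conjm n \<zeta> (X (pole (norm z))) a b = conjm n \<zeta> (Y (pole (norm z))) a b"
  proof (rule conjm_cong)
    fix c d assume "c \<le> n" "d \<le> n"
    then show "X (pole (norm z)) c d = Y (pole (norm z)) c d"
      using covariant_diagonal[OF X, of c d] covariant_diagonal[OF Y, of c d] eq[of "norm z" c] by (cases "c = d") simp_all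
  qed
  then show ?thesis using covariantD[OF X \<zeta>(1) ab, of 0 "pole (norm z)"] covariantD[OF Y \<zeta>(1) ab, of 0 "pole (norm z)"] z by metis
qed

section \<open>Equivariant functions with prescribed transform\<close>

text \<open>Newton interpolation based at the ray j = 0, that is \<eta> = - n \<xi> with \<xi> =
  norm z squared; the powers of \<xi> are contained in \<open>newton_mat\<close>.\<close>

definition newton_fun :: "nat \<Rightarrow> (real \<times> real \<Rightarrow> complex) \<Rightarrow> complex ^ 2 \<Rightarrow> nat \<Rightarrow> nat \<Rightarrow> complex" where
  "newton_fun n f z a b = (\<Sum>m\<le>n. newton_mat n m z a b * (shear_diff ^^ m) f ((norm z)\<^sup>2, - real n * (norm z)\<^sup>2))"

lemma tempered_norm2: "tempered (\<lambda>z :: complex ^ 2. of_real ((norm z)\<^sup>2))"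
  unfolding norm2_cnj by (intro tempered_add tempered_mult tempered_nth tempered_cnj_nth)

lemma schwartz_op_newton_fun: "schwartz_op (\<lambda>f z. newton_fun n f z a b)"
  unfolding newton_fun_def
proof (rule schwartz_op_sum)
  fix m
  let ?q = "\<lambda>z :: complex ^ 2. ((norm z)\<^sup>2, - real n * (norm z)\<^sup>2)"
  have "schwartz_op (\<lambda>h z. newton_mat n m z a b * h (?q z))"
  proof (rule schwartz_op_pullback[where ?C0.0 = 2 and ?N0.0 = 1])
    show "tempered (\<lambda>z. newton_mat n m z a b)" by (rule tempered_newton_mat)
    have "tempered (\<lambda>z :: complex ^ 2. of_real (- real n) * of_real ((norm z)\<^sup>2))"
      by (intro tempered_mult tempered_const tempered_norm2)
    then show "tempered (\<lambda>z. of_real (?q z \<bullet> b))" if "b \<in> Basis" for b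
      using that tempered_norm2 by (auto simp: Basis_real_prod)
    show "newton_mat n m z a b = 0" if "2 * (1 + norm (?q z)) ^ 1 < 1 + norm z" for z
    proof -
      have "(norm z)\<^sup>2 \<le> norm (?q z)" using norm_fst_le[of "(norm z)\<^sup>2"] by simp
      moreover have "0 \<le> (norm z - 1)\<^sup>2 + (norm z)\<^sup>2" by simp
      then have "2 * norm z \<le> 1 + 2 * (norm z)\<^sup>2" by (simp add: power2_eq_square algebra_simps)
      ultimately have "2 * norm z \<le> 1 + 2 * norm (?q z)" by (simp add: order_trans)
      moreover have "norm z \<le> 2 * norm z" by simp
      ultimately have "norm z \<le> 1 + 2 * norm (?q z)" by (rule order_trans[rotated])
      then have "1 + norm z \<le> 1 + (1 + 2 * norm (?q z))" by (rule add_left_mono)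
      also have "\<dots> = 2 * (1 + norm (?q z))" by simp
      finally have "1 + norm z \<le> 2 * (1 + norm (?q z))" .
      then show ?thesis using that unfolding power_one_right by linarith
    qed
  qed
  from schwartz_op_compose[OF this shear_diff_pow]
  show "schwartz_op (\<lambda>f z. newton_mat n m z a b * (shear_diff ^^ m) f (?q z))" .
qed

lemma newton_fun_covariant: "covariant n (newton_fun n f)"
  unfolding covariant_def
proof (intro allI impI)
  fix \<theta> and \<zeta> z :: "complex ^ 2" and a b assume \<zeta>: "norm \<zeta> = 1" and ab: "a \<le> n" "b \<le> n"
  let ?c = "\<lambda>m. (shear_diff ^^ m) f ((norm z)\<^sup>2, - real n * (norm z)\<^sup>2)"
  have "newton_fun n f z = (\<lambda>a b. \<Sum>m\<le>n. ?c m * newton_mat n m z a b)"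
    by (intro ext) (simp add: newton_fun_def mult.commute)
  then show "newton_fun n f (cis \<theta> *s rotv \<zeta> z) a b = conjm n \<zeta> (newton_fun n f z) a b"
    by (simp only: conjm_sum[OF finite_atMost])
      (simp only: newton_fun_def norm_rot[OF \<zeta>] newton_mat_conj[OF \<zeta> ab] mult.commute)
qed

lemma newton_fun_pole:
  assumes f: "f \<in> schwartz" and j: "j \<le> n"
  shows "newton_fun n f (pole r) j j = f (r\<^sup>2, (- real n + 2 * real j) * r\<^sup>2)"
proof -
  let ?h = "\<lambda>m. (shear_diff ^^ m) f (r\<^sup>2, - real n * r\<^sup>2)"
  have "newton_fun n f (pole r) j j = (\<Sum>m\<le>n. of_nat (j choose m) * (of_real (r\<^sup>2) ^ m * ?h m))"
    unfolding newton_fun_def norm_pole power2_abs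
    by (intro sum.cong refl) (simp add: newton_mat_diag[OF j j] mult.assoc)
  also have "\<dots> = (\<Sum>m\<le>j. of_nat (j choose m) * (of_real (r\<^sup>2) ^ m * ?h m))"
    by (rule sum.mono_neutral_right) (use j in auto)
  also have "\<dots> = f (r\<^sup>2, - real n * r\<^sup>2 + 2 * real j * r\<^sup>2)" by (rule newton_forward[OF f, symmetric])
  finally show ?thesis by (simp add: algebra_simps)
qed

text \<open>The inverse Fourier transform of \<open>newton_fun\<close>, written as the forward
  transform with reflection and the constant from \<open>four_inversion\<close>.\<close>

definition lift :: "nat \<Rightarrow> (real \<times> real \<Rightarrow> complex) \<Rightarrow> complex ^ 2 \<Rightarrow> complex mat" where
  "lift n f w = Matrix.mat (n + 1) (n + 1) (\<lambda>(a, b).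
     inverse (of_real ((2 * pi) ^ DIM(complex ^ 2))) * four (\<lambda>z. newton_fun n f z a b) (- w))"

lemma lift_index:
  "a \<le> n \<Longrightarrow> b \<le> n \<Longrightarrow> lift n f w $$ (a, b) =
     inverse (of_real ((2 * pi) ^ DIM(complex ^ 2))) * four (\<lambda>z. newton_fun n f z a b) (- w)"
  by (simp add: lift_def)

lemma newton_fun_schwartz: "f \<in> schwartz \<Longrightarrow> (\<lambda>z. newton_fun n f z a b) \<in> schwartz"
  by (rule schwartz_op_in[OF schwartz_op_newton_fun])

lemma schwartz_op_lift:
  assumes "a \<le> n" "b \<le> n" shows "schwartz_op (\<lambda>f w. lift n f w $$ (a, b))"
proof -
  let ?K = "inverse (of_real ((2 * pi) ^ DIM(complex ^ 2))) :: complex"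
  have "schwartz_op (\<lambda>h w :: complex ^ 2. ?K * h (- w))"
  proof (rule schwartz_op_pullback[where ?C0.0 = 1 and ?N0.0 = 1])
    show "tempered (\<lambda>x :: complex ^ 2. of_real (- x \<bullet> b))" for b
      using tempered_uminus[OF tempered_inner[of b]] by simp
  qed simp_all
  from schwartz_op_compose[OF this schwartz_op_compose[OF schwartz_op_four schwartz_op_newton_fun]]
  show ?thesis by (simp only: lift_index[OF assms])
qed

lemma four_lift:
  assumes f: "f \<in> schwartz" and ab: "a \<le> n" "b \<le> n"
  shows "four (\<lambda>w. lift n f w $$ (a, b)) z = newton_fun n f z a b"
proof -
  let ?G = "\<lambda>z. newton_fun n f z a b" and ?K = "of_real ((2 * pi) ^ DIM(complex ^ 2)) :: complex"
  have G: "?G \<in> schwartz" by (rule newton_fun_schwartz[OF f])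
  have fG: "four ?G \<in> schwartz" by (rule schwartz_op_in[OF schwartz_op_four G])
  have "four (\<lambda>w. lift n f w $$ (a, b)) z = inverse ?K * four (\<lambda>w. four ?G (- w)) z"
    unfolding lift_index[OF ab] by (rule four_cmult[OF schwartz_reflect[OF fG]])
  also have "\<dots> = inverse ?K * (?K * ?G z)" by (simp only: four_reflect[OF fG] four_inversion[OF G] minus_minus)
  finally show ?thesis by simp
qed

lemma covariant_reflect:
  assumes "covariant n X" shows "covariant n (\<lambda>z. X (- z))"
proof -
  have "- (cis \<theta> *s rotv \<zeta> z) = cis \<theta> *s rotv \<zeta> (- z)" for \<theta> \<zeta> z
    by (simp add: vec2_eq algebra_simps)
  then show ?thesis using assms unfolding covariant_def by presburger
qed

lemma covariant_cmult:
  assumes "covariant n X" shows "covariant n (\<lambda>z a b. c * X z a b)"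
proof -
  have "conjm n \<zeta> (\<lambda>a b. c * Y a b) a b = c * conjm n \<zeta> Y a b" for \<zeta> Y a b
    using conjm_sum[of "{()}" n \<zeta> "\<lambda>_. c" "\<lambda>_. Y"] by simp
  then show ?thesis using assms unfolding covariant_def by simp
qed

lemma covariant_cong:
  assumes "covariant n X" "\<And>z a b. a \<le> n \<Longrightarrow> b \<le> n \<Longrightarrow> X z a b = Y z a b" shows "covariant n Y"
  unfolding covariant_def
proof (intro allI impI)
  fix \<theta> \<zeta> z a b assume \<zeta>: "norm (\<zeta> :: complex ^ 2) = 1" and ab: "a \<le> n" "b \<le> n"
  have "conjm n \<zeta> (Y z) a b = conjm n \<zeta> (X z) a b" by (rule conjm_cong) (simp add: assms(2))
  then show "Y (cis \<theta> *s rotv \<zeta> z) a b = conjm n \<zeta> (Y z) a b"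
    using covariantD[OF assms(1) \<zeta> ab] assms(2)[OF ab] by simp
qed

lemma lift_in:
  assumes f: "f \<in> schwartz" shows "lift n f \<in> schwartz_equivariant n"
proof -
  have car: "lift n f z \<in> carrier_mat (n + 1) (n + 1)" for z by (simp add: lift_def)
  have "covariant n (\<lambda>z a b. four (\<lambda>w. newton_fun n f w a b) z)"
    by (rule four_covariant[OF newton_fun_schwartz[OF f] newton_fun_covariant])
  from covariant_cmult[OF covariant_reflect[OF this]]
  have "covariant n (\<lambda>z a b. lift n f z $$ (a, b))"
    by (rule covariant_cong) (rule lift_index[symmetric])
  then have "equivariant n (lift n f)" by (simp only: equivariant_covariant[OF car])
  then show ?thesis
    using car schwartz_op_in[OF schwartz_op_lift f] by (simp add: schwartz_equivariant_def schwartz_mat_def)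
qed

section \<open>The spherical transform as a Fourier transform\<close>

text \<open>The normalisation in \<open>sphere_measure\<close> divides by this volume, so a
  probability measure requires it to be positive and finite.\<close>

lemma emeasure_punctured_ball:
  "emeasure lborel (ball 0 1 - {0 :: complex ^ 2}) \<noteq> 0" "emeasure lborel (ball 0 1 - {0 :: complex ^ 2}) \<noteq> \<infinity>"
proof -
  have "emeasure lborel (ball 0 1 - {0 :: complex ^ 2}) = emeasure lborel (ball (0 :: complex ^ 2) 1)"
    by (rule emeasure_Diff_null_set) (auto simp: null_sets_def)
  moreover have "emeasure lborel (ball (0 :: complex ^ 2) 1) < \<infinity>" by (rule emeasure_lborel_ball_finite)
  moreover have "measure lborel (ball (0 :: complex ^ 2) 1) > 0" by (rule content_ball_pos) simp
  ultimately show "emeasure lborel (ball 0 1 - {0 :: complex ^ 2}) \<noteq> 0" "emeasure lborel (ball 0 1 - {0 :: complex ^ 2}) \<noteq> \<infinity>"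
    by (auto simp: measure_def)
qed

lemma sets_sphere_measure [measurable_cong, simp]: "sets sphere_measure = sets borel"
  by (simp add: sphere_measure_def)

lemma space_sphere_measure [simp]: "space sphere_measure = UNIV"
  by (simp add: sphere_measure_def)

lemma sgn_measurable: "(sgn :: complex ^ 2 \<Rightarrow> complex ^ 2) \<in> borel_measurable borel"
  unfolding sgn_div_norm by measurable

lemma prob_space_sphere_measure: "prob_space sphere_measure"
  unfolding sphere_measure_def
proof (rule prob_space.prob_space_distr)
  show "prob_space (uniform_measure lborel (ball 0 1 - {0 :: complex ^ 2}))"
    by (rule prob_space_uniform_measure) (fact emeasure_punctured_ball)+
  show "sgn \<in> uniform_measure lborel (ball 0 1 - {0}) \<rightarrow>\<^sub>M (borel :: (complex ^ 2) measure)"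
    using sgn_measurable by (simp add: measurable_def)
qed

lemma AE_sphere_measure: "AE \<zeta> in sphere_measure. norm \<zeta> = 1"
proof -
  have "AE z in uniform_measure lborel (ball 0 1 - {0 :: complex ^ 2}). norm (sgn z) = 1"
    by (rule AE_uniform_measureI) (auto simp: norm_sgn)
  then show ?thesis unfolding sphere_measure_def
    by (subst AE_distr_iff) (use sgn_measurable in \<open>simp_all add: measurable_def\<close>)
qed

text \<open>Off the origin the entries are given by an explicit formula; the single point 0, where
  \<open>k_rot\<close> is not invertible, is split off.\<close>

lemma tt_measurable:
  assumes "a \<le> n" "b \<le> n" shows "(\<lambda>\<zeta>. tt n \<zeta> a b) \<in> borel_measurable borel"
proof -
  have subst: "(\<lambda>\<zeta> :: complex ^ 2. subst_mat n (\<zeta> $ 2) (- \<zeta> $ 1) (cnj (\<zeta> $ 1)) (cnj (\<zeta> $ 2)) a b) \<in> borel_measurable borel"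
    by (intro tempered_measurable tempered_subst_mat tempered_nth tempered_cnj_nth tempered_uminus)
  have "(\<lambda>\<zeta>. tt n \<zeta> a b) = (\<lambda>\<zeta>. if \<zeta> = 0 then tt n 0 a b else
      of_real (1 / (norm \<zeta>)\<^sup>2) ^ n * subst_mat n (\<zeta> $ 2) (- \<zeta> $ 1) (cnj (\<zeta> $ 1)) (cnj (\<zeta> $ 2)) a b)"
  proof
    fix \<zeta>
    show "tt n \<zeta> a b = (if \<zeta> = 0 then tt n 0 a b else
      of_real (1 / (norm \<zeta>)\<^sup>2) ^ n * subst_mat n (\<zeta> $ 2) (- \<zeta> $ 1) (cnj (\<zeta> $ 1)) (cnj (\<zeta> $ 2)) a b)"
    proof (cases "\<zeta> = 0")
      case False
      then show ?thesis by (simp only: if_False tt_eq_subst_mat[OF assms False])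
    qed (simp only: simp_thms if_True)
  qed
  moreover have "(\<lambda>\<zeta> :: complex ^ 2. if \<zeta> = 0 then tt n 0 a b else
      of_real (1 / (norm \<zeta>)\<^sup>2) ^ n * subst_mat n (\<zeta> $ 2) (- \<zeta> $ 1) (cnj (\<zeta> $ 1)) (cnj (\<zeta> $ 2)) a b) \<in> borel_measurable borel"
  proof (rule measurable_If)
    have "(\<lambda>\<zeta> :: complex ^ 2. complex_of_real (1 / (norm \<zeta>)\<^sup>2) ^ n) \<in> borel_measurable borel" by measurable
    from borel_measurable_times[OF this subst]
    show "(\<lambda>\<zeta> :: complex ^ 2. of_real (1 / (norm \<zeta>)\<^sup>2) ^ n * subst_mat n (\<zeta> $ 2) (- \<zeta> $ 1) (cnj (\<zeta> $ 1)) (cnj (\<zeta> $ 2)) a b) \<in> borel_measurable borel" .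
  qed simp_all
  ultimately show ?thesis by (simp only:)
qed

lemma norm_tt_le:
  assumes "norm \<zeta> = 1" "a \<le> n" "b \<le> n" shows "norm (tt n \<zeta> a b) \<le> 1"
proof -
  have "complex_of_real (\<Sum>a\<le>n. (cmod (tt n \<zeta> a b))\<^sup>2) = (\<Sum>a\<le>n. cnj (tt n \<zeta> a b) * tt n \<zeta> a b)"
    unfolding of_real_sum by (intro sum.cong refl) (simp only: complex_norm_square mult.commute)
  also have "\<dots> = 1" using tt_unitary[OF assms(1,3,3)] by simp
  finally have "(\<Sum>a\<le>n. (cmod (tt n \<zeta> a b))\<^sup>2) = 1" by (simp only: of_real_eq_1_iff)
  moreover have "(cmod (tt n \<zeta> a b))\<^sup>2 \<le> (\<Sum>a\<le>n. (cmod (tt n \<zeta> a b))\<^sup>2)"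
    by (rule member_le_sum) (use assms(2) in auto)
  ultimately show ?thesis by (simp add: power_le_one_iff abs_le_square_iff[of _ 1, simplified])
qed

text \<open>The integrand of \<Phi> at - z, entry (b, a). The indicator of the sphere makes it
  bounded everywhere, since unitarity of \<tau>, and with it the bound, holds for unit
  \<zeta>.\<close>

definition sphere_kernel :: "nat \<Rightarrow> real \<Rightarrow> nat \<Rightarrow> nat \<Rightarrow> nat \<Rightarrow> complex ^ 2 \<Rightarrow> complex ^ 2 \<Rightarrow> complex" where
  "sphere_kernel n s j a b z \<zeta> = indicator (sphere 0 1) \<zeta> * cis (z \<bullet> (s *\<^sub>R \<zeta>)) * (tt n \<zeta> b j * cnj (tt n \<zeta> a j))"

lemma sphere_kernel_bound:
  assumes "a \<le> n" "b \<le> n" "j \<le> n" shows "norm (sphere_kernel n s j a b z \<zeta>) \<le> 1"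
proof (cases "norm \<zeta> = 1")
  case True
  then have "norm (tt n \<zeta> b j) * norm (tt n \<zeta> a j) \<le> 1 * 1"
    by (intro mult_mono norm_tt_le assms) auto
  then show ?thesis by (simp add: sphere_kernel_def norm_mult indicator_def)
qed (simp add: sphere_kernel_def)

lemma sphere_kernel_measurable:
  assumes "a \<le> n" "b \<le> n" "j \<le> n"
  shows "(\<lambda>(z, \<zeta>). sphere_kernel n s j a b z \<zeta>) \<in> borel_measurable (borel \<Otimes>\<^sub>M borel)"
proof -
  have cis: "cis \<in> borel_measurable borel" and cnj: "cnj \<in> borel_measurable borel"
    by (intro borel_measurable_continuous_onI continuous_intros)+
  have inner: "(\<lambda>p :: (complex ^ 2) \<times> (complex ^ 2). fst p \<bullet> (s *\<^sub>R snd p)) \<in> borel_measurable (borel \<Otimes>\<^sub>M borel)"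
    by measurable
  have "sphere 0 1 \<in> sets (borel :: (complex ^ 2) measure)" by (intro borel_closed closed_sphere)
  then have ind: "(indicator (sphere 0 1) :: complex ^ 2 \<Rightarrow> complex) \<in> borel_measurable borel"
    by (rule borel_measurable_indicator)
  show ?thesis unfolding sphere_kernel_def case_prod_unfold
    by (intro borel_measurable_times measurable_compose[OF measurable_snd ind] measurable_compose[OF inner cis]
        measurable_compose[OF measurable_snd tt_measurable] measurable_compose[OF measurable_compose[OF measurable_snd tt_measurable] cnj] assms)
qed

lemma Phi_index:
  assumes ab: "a \<le> n" "b \<le> n" and j: "j \<le> n"
  shows "Phi n \<xi> j (- z) $$ (b, a) = of_nat (n + 1) * (LINT \<zeta>|sphere_measure. sphere_kernel n (sqrt \<xi>) j a b z \<zeta>)"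
proof -
  have E: "E_unit n j \<in> carrier_mat (n + 1) (n + 1)" by (simp add: E_unit_def)
  have "(tau n (k_rot \<zeta>) * E_unit n j * mat_adjoint (tau n (k_rot \<zeta>))) $$ (b, a) = tt n \<zeta> b j * cnj (tt n \<zeta> a j)" for \<zeta>
  proof -
    have "conjm n \<zeta> (\<lambda>c d. E_unit n j $$ (c, d)) b a = (\<Sum>c\<le>n. \<Sum>d\<le>n. if c = j then (if d = j then tt n \<zeta> b j * cnj (tt n \<zeta> a j) else 0) else 0)"
      unfolding conjm_def by (rule sum.cong[OF refl], rule sum.cong[OF refl]) (auto simp: E_unit_def)
    also have "\<dots> = tt n \<zeta> b j * cnj (tt n \<zeta> a j)"
      using j by (subst sum.swap) (simp only: sum.delta finite_atMost atMost_iff if_True)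
    finally show ?thesis by (simp only: conj_index[OF E ab(2,1)])
  qed
  then have "Phi n \<xi> j (- z) $$ (b, a) = of_nat (n + 1) * (LINT \<zeta>|sphere_measure.
      exp (- \<i> * complex_of_real (sqrt \<xi> * inner (- z) \<zeta>)) * (tt n \<zeta> b j * cnj (tt n \<zeta> a j)))"
    using ab by (simp add: Phi_def del: index_mult_mat)
  also have "(LINT \<zeta>|sphere_measure. exp (- \<i> * complex_of_real (sqrt \<xi> * inner (- z) \<zeta>)) * (tt n \<zeta> b j * cnj (tt n \<zeta> a j))) =
      (LINT \<zeta>|sphere_measure. sphere_kernel n (sqrt \<xi>) j a b z \<zeta>)"
  proof (rule integral_cong_AE)
    have cnj: "cnj \<in> borel_measurable borel"
      by (intro borel_measurable_continuous_onI continuous_intros)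
    have exp: "(\<lambda>\<zeta>. exp (- \<i> * complex_of_real (sqrt \<xi> * inner (- z) \<zeta>))) \<in> borel_measurable borel"
      by measurable
    have eq: "borel_measurable sphere_measure = borel_measurable borel"
      by (rule measurable_cong_sets) simp_all
    show "(\<lambda>\<zeta>. exp (- \<i> * complex_of_real (sqrt \<xi> * inner (- z) \<zeta>)) * (tt n \<zeta> b j * cnj (tt n \<zeta> a j))) \<in> borel_measurable sphere_measure"
      unfolding eq by (intro borel_measurable_times exp tt_measurable ab j measurable_compose[OF tt_measurable cnj])
    note [measurable] = sphere_kernel_measurable[OF ab j]
    show "(\<lambda>\<zeta>. sphere_kernel n (sqrt \<xi>) j a b z \<zeta>) \<in> borel_measurable sphere_measure" by measurable
    show "AE \<zeta> in sphere_measure. exp (- \<i> * complex_of_real (sqrt \<xi> * inner (- z) \<zeta>)) * (tt n \<zeta> b j * cnj (tt n \<zeta> a j)) = sphere_kernel n (sqrt \<xi>) j a b z \<zeta>"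
      using AE_sphere_measure by eventually_elim (simp add: sphere_kernel_def cis_conv_exp)
  qed
  finally show ?thesis .
qed

lemma mat_trace_mult:
  assumes "A \<in> carrier_mat (n + 1) (n + 1)" "B \<in> carrier_mat (n + 1) (n + 1)"
  shows "mat_trace (A * B) = (\<Sum>a\<le>n. \<Sum>b\<le>n. A $$ (a, b) * B $$ (b, a))"
proof -
  have "mat_trace (A * B) = (\<Sum>a\<le>n. (A * B) $$ (a, a))"
    using assms by (simp add: mat_trace_def lessThan_Suc_atMost del: index_mult_mat(1))
  then show ?thesis by (simp add: mat_sum_index[OF assms] del: index_mult_mat)
qed

text \<open>After the exchange of integrals, each unit \<zeta> contributes the trace of the Fourier
  transform at sqrt \<xi> \<zeta> against the projection of index j conjugated by \<tau>. That point
  is the image of the pole under k_\<zeta>, so covariance makes the trace independent of \<zeta>,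
  and the sphere has total mass 1.\<close>

lemma transform_formula:
  assumes F: "F \<in> schwartz_equivariant n" and j: "j \<le> n"
  shows "1 / of_nat (n + 1) * (LINT z|lborel. mat_trace (F z * Phi n \<xi> j (- z))) =
    four (\<lambda>w. F w $$ (j, j)) (pole (sqrt \<xi>))"
proof -
  interpret S: prob_space sphere_measure by (rule prob_space_sphere_measure)
  interpret P: pair_sigma_finite lborel sphere_measure by standard
  let ?X = "\<lambda>z a b. F z $$ (a, b)" and ?k = "sphere_kernel n (sqrt \<xi>) j"
  have car: "F z \<in> carrier_mat (n + 1) (n + 1)" for z
    using F by (auto simp: schwartz_equivariant_def schwartz_mat_def)
  have X: "(\<lambda>z. F z $$ (a, b)) \<in> schwartz" if "a \<le> n" "b \<le> n" for a b
    using F that by (auto simp: schwartz_equivariant_def schwartz_mat_def)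
  have meas: "(\<lambda>p. ?X (fst p) a b) \<in> borel_measurable (lborel \<Otimes>\<^sub>M sphere_measure)"
    "(\<lambda>p. ?k a b (fst p) (snd p)) \<in> borel_measurable (lborel \<Otimes>\<^sub>M sphere_measure)" if ab: "a \<le> n" "b \<le> n" for a b
  proof -
    have "(\<lambda>z. F z $$ (a, b)) \<in> borel_measurable lborel" using schwartz_measurable[OF X[OF ab]] by simp
    then show "(\<lambda>p. ?X (fst p) a b) \<in> borel_measurable (lborel \<Otimes>\<^sub>M sphere_measure)"
      by (rule measurable_compose[OF measurable_fst])
    have "sets (lborel \<Otimes>\<^sub>M sphere_measure) = sets (borel \<Otimes>\<^sub>M (borel :: (complex ^ 2) measure))"
      by (rule sets_pair_measure_cong) simp_all
    then show "(\<lambda>p. ?k a b (fst p) (snd p)) \<in> borel_measurable (lborel \<Otimes>\<^sub>M sphere_measure)"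
      using sphere_kernel_measurable[OF ab j] unfolding case_prod_unfold by (subst measurable_cong_sets[OF _ refl]) auto
  qed
  have cov: "covariant n (\<lambda>z a b. four (\<lambda>w. F w $$ (a, b)) z)"
    using F by (intro four_covariant X) (simp_all add: schwartz_equivariant_def flip: equivariant_covariant[OF car])
  have int: "integrable (lborel \<Otimes>\<^sub>M sphere_measure) (\<lambda>(z, \<zeta>). ?X z a b * ?k a b z \<zeta>)" if ab: "a \<le> n" "b \<le> n" for a b
  proof -
    have "integrable (lborel \<Otimes>\<^sub>M sphere_measure) (\<lambda>(z, \<zeta>). ?X z a b)"
    proof (rule P.Fubini_integrable)
      show "(\<lambda>(z, \<zeta>). ?X z a b) \<in> borel_measurable (lborel \<Otimes>\<^sub>M sphere_measure)"
        using meas(1)[OF ab] by (simp only: case_prod_unfold)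
      have "integrable lborel (\<lambda>z. norm (?X z a b))" by (intro integrable_norm schwartz_integrable X ab)
      then show "integrable lborel (\<lambda>z. LINT \<zeta>|sphere_measure. norm (case (z, \<zeta>) of (z, \<zeta>) \<Rightarrow> ?X z a b))"
        using S.prob_space by simp
    qed simp
    then show ?thesis
    proof (rule Bochner_Integration.integrable_bound)
      show "(\<lambda>(z, \<zeta>). ?X z a b * ?k a b z \<zeta>) \<in> borel_measurable (lborel \<Otimes>\<^sub>M sphere_measure)"
        using borel_measurable_times[OF meas[OF ab]] by (simp only: case_prod_unfold)
      show "AE p in lborel \<Otimes>\<^sub>M sphere_measure. norm (case p of (z, \<zeta>) \<Rightarrow> ?X z a b * ?k a b z \<zeta>) \<le> norm (case p of (z, \<zeta>) \<Rightarrow> ?X z a b)"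
        using sphere_kernel_bound[OF ab j] by (auto simp: norm_mult intro!: AE_I2 mult_left_le)
    qed
  qed
  have int1: "integrable lborel (\<lambda>z. ?X z a b * ?k a b z \<zeta>)" if ab: "a \<le> n" "b \<le> n" for a b \<zeta>
  proof -
    have "integrable lborel (\<lambda>z. (?X z a b * cis (z \<bullet> (sqrt \<xi> *\<^sub>R \<zeta>))) * (indicator (sphere 0 1) \<zeta> * (tt n \<zeta> b j * cnj (tt n \<zeta> a j))))"
      by (intro integrable_mult_left four_integrable X ab)
    then show ?thesis by (simp add: sphere_kernel_def mult_ac)
  qed
  have int2: "integrable sphere_measure (?k a b z)" if ab: "a \<le> n" "b \<le> n" for a b z
  proof (rule S.integrable_const_bound[where B = 1])
    note [measurable] = sphere_kernel_measurable[OF ab j]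
    show "?k a b z \<in> borel_measurable sphere_measure" by measurable
  qed (simp add: sphere_kernel_bound[OF ab j])
  have "(LINT z|lborel. mat_trace (F z * Phi n \<xi> j (- z))) =
      (LINT z|lborel. of_nat (n + 1) * (LINT \<zeta>|sphere_measure. (\<Sum>a\<le>n. \<Sum>b\<le>n. ?X z a b * ?k a b z \<zeta>)))"
  proof (rule Bochner_Integration.integral_cong[OF refl])
    fix z
    have "Phi n \<xi> j (- z) \<in> carrier_mat (n + 1) (n + 1)" by (simp add: Phi_def)
    then have "mat_trace (F z * Phi n \<xi> j (- z)) = (\<Sum>a\<le>n. \<Sum>b\<le>n. ?X z a b * (of_nat (n + 1) * (LINT \<zeta>|sphere_measure. ?k a b z \<zeta>)))"
      unfolding mat_trace_mult[OF car \<open>Phi n \<xi> j (- z) \<in> _\<close>]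
      by (intro sum.cong refl) (simp only: Phi_index[OF _ _ j] atMost_iff)
    also have "\<dots> = of_nat (n + 1) * (\<Sum>a\<le>n. \<Sum>b\<le>n. LINT \<zeta>|sphere_measure. ?X z a b * ?k a b z \<zeta>)"
      unfolding sum_distrib_left integral_mult_right_zero by (simp only: mult_ac)
    also have "(\<Sum>a\<le>n. \<Sum>b\<le>n. LINT \<zeta>|sphere_measure. ?X z a b * ?k a b z \<zeta>) = (LINT \<zeta>|sphere_measure. (\<Sum>a\<le>n. \<Sum>b\<le>n. ?X z a b * ?k a b z \<zeta>))"
      by (subst Bochner_Integration.integral_sum, (auto intro!: Bochner_Integration.integrable_sum integrable_mult_right int2)[1],
          intro sum.cong refl, subst Bochner_Integration.integral_sum) (auto intro!: integrable_mult_right int2)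
    finally show "mat_trace (F z * Phi n \<xi> j (- z)) = of_nat (n + 1) * (LINT \<zeta>|sphere_measure. (\<Sum>a\<le>n. \<Sum>b\<le>n. ?X z a b * ?k a b z \<zeta>))" .
  qed
  also have "\<dots> = of_nat (n + 1) * (LINT z|lborel. LINT \<zeta>|sphere_measure. (\<Sum>a\<le>n. \<Sum>b\<le>n. ?X z a b * ?k a b z \<zeta>))"
    by (rule integral_mult_right_zero)
  also have "(LINT z|lborel. LINT \<zeta>|sphere_measure. (\<Sum>a\<le>n. \<Sum>b\<le>n. ?X z a b * ?k a b z \<zeta>)) =
      (LINT \<zeta>|sphere_measure. LINT z|lborel. (\<Sum>a\<le>n. \<Sum>b\<le>n. ?X z a b * ?k a b z \<zeta>))"
  proof (rule P.Fubini_integral[symmetric])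
    have "integrable (lborel \<Otimes>\<^sub>M sphere_measure) (\<lambda>p. \<Sum>a\<le>n. \<Sum>b\<le>n. case p of (z, \<zeta>) \<Rightarrow> ?X z a b * ?k a b z \<zeta>)"
      by (intro Bochner_Integration.integrable_sum int) auto
    then show "integrable (lborel \<Otimes>\<^sub>M sphere_measure) (\<lambda>(z, \<zeta>). \<Sum>a\<le>n. \<Sum>b\<le>n. ?X z a b * ?k a b z \<zeta>)"
      by (simp only: case_prod_unfold)
  qed
  also have "\<dots> = (LINT \<zeta>|sphere_measure. four (\<lambda>w. F w $$ (j, j)) (pole (sqrt \<xi>)))"
  proof (rule integral_cong_AE)
    show "(\<lambda>\<zeta>. LINT z|lborel. (\<Sum>a\<le>n. \<Sum>b\<le>n. ?X z a b * ?k a b z \<zeta>)) \<in> borel_measurable sphere_measure"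
    proof -
      have "(\<lambda>(\<zeta>, z). (\<Sum>a\<le>n. \<Sum>b\<le>n. ?X z a b * ?k a b z \<zeta>)) \<in> borel_measurable (sphere_measure \<Otimes>\<^sub>M lborel)"
      proof -
        have "(\<lambda>p. ?X (snd p) a b * ?k a b (snd p) (fst p)) \<in> borel_measurable (sphere_measure \<Otimes>\<^sub>M lborel)" if ab: "a \<le> n" "b \<le> n" for a b
          using measurable_compose[OF measurable_Pair[OF measurable_snd measurable_fst] borel_measurable_times[OF meas[OF ab]]] by simp
        then show ?thesis unfolding case_prod_unfold by (intro borel_measurable_sum) auto
      qed
      then show ?thesis by (rule lborel.borel_measurable_lebesgue_integral)
    qed
    show "AE \<zeta> in sphere_measure. (LINT z|lborel. (\<Sum>a\<le>n. \<Sum>b\<le>n. ?X z a b * ?k a b z \<zeta>)) = four (\<lambda>w. F w $$ (j, j)) (pole (sqrt \<xi>))"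
      using AE_sphere_measure
    proof eventually_elim
      case (elim \<zeta>)
      let ?Y = "\<lambda>a b. four (\<lambda>w. F w $$ (a, b)) (pole (sqrt \<xi>))"
      have pt: "sqrt \<xi> *\<^sub>R \<zeta> = cis 0 *s rotv \<zeta> (pole (sqrt \<xi>))"
        by (simp add: vec2_eq vector_2 scaleR_complex.code complex_eq_iff)
      have "(LINT z|lborel. (\<Sum>a\<le>n. \<Sum>b\<le>n. ?X z a b * ?k a b z \<zeta>)) = (\<Sum>a\<le>n. \<Sum>b\<le>n. LINT z|lborel. ?X z a b * ?k a b z \<zeta>)"
        by (subst Bochner_Integration.integral_sum, (auto intro!: Bochner_Integration.integrable_sum int1)[1],
          intro sum.cong refl, subst Bochner_Integration.integral_sum) (auto intro!: int1)
      also have "\<dots> = (\<Sum>a\<le>n. \<Sum>b\<le>n. conjm n \<zeta> ?Y a b * (tt n \<zeta> b j * cnj (tt n \<zeta> a j)))"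
      proof (intro sum.cong refl)
        fix a b assume "a \<in> {..n}" "b \<in> {..n}"
        then have ab: "a \<le> n" "b \<le> n" by auto
        have "(LINT z|lborel. ?X z a b * ?k a b z \<zeta>) = (LINT z|lborel. (?X z a b * cis (z \<bullet> (sqrt \<xi> *\<^sub>R \<zeta>))) * (tt n \<zeta> b j * cnj (tt n \<zeta> a j)))"
          using elim by (simp add: sphere_kernel_def mult.assoc)
        also have "\<dots> = four (\<lambda>w. F w $$ (a, b)) (sqrt \<xi> *\<^sub>R \<zeta>) * (tt n \<zeta> b j * cnj (tt n \<zeta> a j))"
          unfolding four_def by (rule integral_mult_left_zero)
        also have "four (\<lambda>w. F w $$ (a, b)) (sqrt \<xi> *\<^sub>R \<zeta>) = conjm n \<zeta> ?Y a b"
          unfolding pt by (rule covariantD[OF cov elim ab])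
        finally show "(LINT z|lborel. ?X z a b * ?k a b z \<zeta>) = conjm n \<zeta> ?Y a b * (tt n \<zeta> b j * cnj (tt n \<zeta> a j))" .
      qed
      also have "\<dots> = ?Y j j" by (rule conjm_inverse[OF elim j])
      finally show ?case .
    qed
  qed simp
  also have "\<dots> = four (\<lambda>w. F w $$ (j, j)) (pole (sqrt \<xi>))" using S.prob_space by simp
  finally show ?thesis by (simp del: of_nat_Suc)
qed
section \<open>Recovering the Newton coefficients of the transform\<close>

lemma schwartz_mult_right:
  assumes "u \<in> schwartz" "tempered g" shows "(\<lambda>w. u w * g w) \<in> schwartz"
  using schwartz_op_in[OF schwartz_op_mult[OF assms(2)] assms(1)] by (simp add: mult.commute)

lemma tempered_inner_power: "tempered (\<lambda>w. of_real (w \<bullet> p) ^ l)"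
  by (intro tempered_power tempered_inner)

text \<open>Taylor's formula for the transform in direction p, with the remainder kept inside the
  integral, where \<open>cistail\<close> is bounded. The remainder is integrable as a difference of
  integrable functions.\<close>

lemma four_taylor:
  fixes u :: "'a :: euclidean_space \<Rightarrow> complex"
  assumes u: "u \<in> schwartz"
  shows "integrable lborel (\<lambda>w. u w * ((\<i> * of_real (x * (w \<bullet> p))) ^ M * cistail M (x * (w \<bullet> p))) * cis (w \<bullet> q))"
    and "four u (x *\<^sub>R p + q) = (\<Sum>l<M. (\<i> * of_real x) ^ l / fact l * four (\<lambda>w. u w * of_real (w \<bullet> p) ^ l) q) +
      (LINT w|lborel. u w * ((\<i> * of_real (x * (w \<bullet> p))) ^ M * cistail M (x * (w \<bullet> p))) * cis (w \<bullet> q))"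
proof -
  let ?c = "\<lambda>l. (\<i> * of_real x) ^ l / fact l :: complex" and ?u = "\<lambda>l w. u w * of_real (w \<bullet> p) ^ l"
  let ?R = "\<lambda>w. u w * ((\<i> * of_real (x * (w \<bullet> p))) ^ M * cistail M (x * (w \<bullet> p))) * cis (w \<bullet> q)"
  have S: "?u l \<in> schwartz" for l by (rule schwartz_mult_right[OF u tempered_inner_power])
  have eq: "?R w = u w * cis (w \<bullet> (x *\<^sub>R p + q)) - (\<Sum>l<M. ?c l * ?u l w) * cis (w \<bullet> q)" for w
  proof -
    have "cis (w \<bullet> (x *\<^sub>R p + q)) = cis (x * (w \<bullet> p)) * cis (w \<bullet> q)"
      by (simp add: inner_add_right cis_mult)
    also have "cis (x * (w \<bullet> p)) = (\<Sum>l<M. ?c l * of_real (w \<bullet> p) ^ l) + (\<i> * of_real (x * (w \<bullet> p))) ^ M * cistail M (x * (w \<bullet> p))"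
      by (subst cis_taylor[of _ M]) (simp add: power_mult_distrib mult_ac)
    finally show ?thesis by (simp add: algebra_simps sum_distrib_left)
  qed
  have i1: "integrable lborel (\<lambda>w. u w * cis (w \<bullet> (x *\<^sub>R p + q)))" by (rule four_integrable[OF u])
  have "integrable lborel (\<lambda>w. \<Sum>l<M. ?c l * (?u l w * cis (w \<bullet> q)))"
    by (intro Bochner_Integration.integrable_sum integrable_mult_right four_integrable S)
  then have i2: "integrable lborel (\<lambda>w. (\<Sum>l<M. ?c l * ?u l w) * cis (w \<bullet> q))"
    by (simp only: sum_distrib_right mult.assoc)
  show "integrable lborel ?R" unfolding eq by (rule Bochner_Integration.integrable_diff[OF i1 i2])
  have "(LINT w|lborel. ?R w) = four u (x *\<^sub>R p + q) - four (\<lambda>w. \<Sum>l<M. ?c l * ?u l w) q"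
    unfolding eq four_def by (rule Bochner_Integration.integral_diff[OF i1 i2])
  also have "four (\<lambda>w. \<Sum>l<M. ?c l * ?u l w) q = (\<Sum>l<M. ?c l * four (?u l) q)"
    by (rule four_sum) (rule S)
  finally show "four u (x *\<^sub>R p + q) = (\<Sum>l<M. ?c l * four (?u l) q) + (LINT w|lborel. ?R w)" by simp
qed

section \<open>Angular frequencies and vanishing moments\<close>

definition rot_at :: "2 \<Rightarrow> real \<Rightarrow> complex ^ 2 \<Rightarrow> complex ^ 2" where
  "rot_at i \<psi> w = (\<chi> j. if j = i then cis \<psi> * w $ j else w $ j)"

lemma rot_at_nth [simp]: "rot_at i \<psi> w $ j = (if j = i then cis \<psi> * w $ j else w $ j)"
  by (simp add: rot_at_def)

lemma orthogonal_rot_at: "orthogonal_transformation (rot_at i \<psi>)"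
  unfolding orthogonal_transformation
proof (intro conjI allI)
  show "linear (rot_at i \<psi>)"
    by (rule linearI) (simp_all add: vec2_eq algebra_simps)
  fix v
  have "(norm (rot_at i \<psi> v))\<^sup>2 = (norm v)\<^sup>2" by (simp add: norm2_sq norm_mult)
  then show "norm (rot_at i \<psi> v) = norm v" by (rule power2_eq_imp_eq) simp_all
qed

text \<open>The moments of a function of angular frequency \<open>\<kappa>\<close> in \<open>w\<^sub>i\<close> vanish below order \<open>\<bar>\<kappa>\<bar>\<close>,
  since \<open>(Re w\<^sub>i)\<^sup>l\<close> only has frequencies of absolute value at most \<open>l\<close>.\<close>

lemma four_moment_vanishes:
  assumes u: "u \<in> schwartz" and freq: "\<And>\<psi> w. u (rot_at i \<psi> w) = cis (\<kappa> * \<psi>) * u w"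
    and z: "\<And>\<psi>. rot_at i \<psi> z = z" and l: "real l < \<bar>\<kappa>\<bar>"
  shows "four (\<lambda>w. u w * of_real (w \<bullet> axis i 1) ^ l) z = 0"
proof -
  let ?v = "\<lambda>p w. u w * (w $ i ^ p * cnj (w $ i) ^ (l - p))"
  have S: "?v p \<in> schwartz" for p
    by (intro schwartz_mult_right u tempered_mult tempered_power tempered_nth tempered_cnj_nth)
  have zero: "four (?v p) z = 0" if "p \<le> l" for p
  proof -
    \<comment> \<open>This is the frequency of \<open>?v p\<close>. Since p - (l - p) lies between
      -l and l, it cannot cancel \<kappa> when l < |\<kappa>|.\<close>
    let ?\<mu> = "\<kappa> + real p - real (l - p)"
    have \<mu>: "?\<mu> \<noteq> 0" using that l by (auto simp: of_nat_diff abs_if split: if_splits)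
    have rot: "?v p (rot_at i \<psi> w) = cis (?\<mu> * \<psi>) * ?v p w" for \<psi> w
    proof -
      have "cis (\<kappa> * \<psi>) * cis \<psi> ^ p * cis (- \<psi>) ^ (l - p) = cis (?\<mu> * \<psi>)"
        by (simp add: Complex.DeMoivre cis_mult algebra_simps)
      then have "cis (?\<mu> * \<psi>) * ?v p w = (cis (\<kappa> * \<psi>) * cis \<psi> ^ p * cis (- \<psi>) ^ (l - p)) * ?v p w" by (simp only:)
      then show ?thesis by (simp only: freq rot_at_nth if_True power_mult_distrib complex_cnj_mult cis_cnj simp_thms mult_ac)
    qed
    \<comment> \<open>Rotation by pi / \<mu> fixes \<open>z\<close> and changes the sign of
      \<open>?v p\<close>, so the transform at \<open>z\<close> equals its own negative.\<close>
    have "four (?v p) z = four (?v p) (rot_at i (pi / ?\<mu>) z)" by (simp only: z)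
    also have "\<dots> = four (\<lambda>w. ?v p (rot_at i (pi / ?\<mu>) w)) z" by (rule four_rotate[OF orthogonal_rot_at S])
    also have "\<dots> = cis (?\<mu> * (pi / ?\<mu>)) * four (?v p) z" by (simp only: rot four_cmult[OF S])
    also have "?\<mu> * (pi / ?\<mu>) = pi" using \<mu> by (metis nonzero_mult_div_cancel_left times_divide_eq_right)
    finally show ?thesis by simp
  qed
  have re: "of_real (w \<bullet> axis i 1) = (w $ i + cnj (w $ i)) / 2" for w
    by (simp add: inner_axis inner_complex_def complex_eq_iff)
  have "(\<lambda>w. u w * of_real (w \<bullet> axis i 1) ^ l) = (\<lambda>w. \<Sum>p\<le>l. (of_nat (l choose p) / 2 ^ l) * ?v p w)"
  proof
    fix w
    have "u w * of_real (w \<bullet> axis i 1) ^ l = u w * ((\<Sum>p\<le>l. of_nat (l choose p) * w $ i ^ p * cnj (w $ i) ^ (l - p)) / 2 ^ l)"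
      by (simp only: re power_divide binomial_ring)
    then show "u w * of_real (w \<bullet> axis i 1) ^ l = (\<Sum>p\<le>l. (of_nat (l choose p) / 2 ^ l) * ?v p w)"
      by (simp add: sum_divide_distrib sum_distrib_left mult_ac)
  qed
  then have "four (\<lambda>w. u w * of_real (w \<bullet> axis i 1) ^ l) z = (\<Sum>p\<le>l. (of_nat (l choose p) / 2 ^ l) * four (?v p) z)"
    by (simp only: four_sum[OF S])
  then show ?thesis using zero by simp
qed

text \<open>The torus elements with \<theta> = \<psi> / 2 and \<beta> = - \<psi> / 2 or \<psi> / 2
  rotate just one of the two coordinates.\<close>

lemma covariant_freq:
  assumes cov: "covariant n X" and m: "m \<le> n"
  shows "X (rot_at 1 \<psi> w) m 0 = cis (- real m * \<psi>) * X w m 0"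
    and "X (rot_at 2 \<psi> w) m 0 = cis (real m * \<psi>) * X w m 0"
proof -
  have "rot_at 1 \<psi> w = vector [cis (\<psi> / 2 - (- \<psi> / 2)) * w $ 1, cis (\<psi> / 2 + (- \<psi> / 2)) * w $ 2]"
    by (simp add: vec2_eq vector_2)
  then show "X (rot_at 1 \<psi> w) m 0 = cis (- real m * \<psi>) * X w m 0"
    using covariant_torus[OF cov m le0, of "\<psi> / 2" "- \<psi> / 2" w] by (simp add: mult.commute)
  have "rot_at 2 \<psi> w = vector [cis (\<psi> / 2 - \<psi> / 2) * w $ 1, cis (\<psi> / 2 + \<psi> / 2) * w $ 2]"
    by (simp add: vec2_eq vector_2)
  then show "X (rot_at 2 \<psi> w) m 0 = cis (real m * \<psi>) * X w m 0"
    using covariant_torus[OF cov m le0, of "\<psi> / 2" "\<psi> / 2" w] by (simp add: mult.commute)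
qed

text \<open>The system is triangular because j choose m is 0 for m > j; each new coefficient is
  found by dividing by a power of x.\<close>

lemma newton_exists:
  fixes x :: complex
  assumes "x \<noteq> 0" shows "\<exists>h. \<forall>j\<le>n. f j = (\<Sum>m\<le>n. of_nat (j choose m) * (x ^ m * h m))"
proof (induction n)
  case 0
  show ?case by (rule exI[of _ f]) simp
next
  case (Suc n)
  then obtain h where h: "\<And>j. j \<le> n \<Longrightarrow> f j = (\<Sum>m\<le>n. of_nat (j choose m) * (x ^ m * h m))" by blast
  let ?s = "\<Sum>m\<le>n. of_nat (Suc n choose m) * (x ^ m * h m)"
  let ?h = "h(Suc n := (f (Suc n) - ?s) / x ^ Suc n)"
  have s: "(\<Sum>m\<le>n. of_nat (j choose m) * (x ^ m * ?h m)) = (\<Sum>m\<le>n. of_nat (j choose m) * (x ^ m * h m))" for j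
    by (intro sum.cong refl) auto
  have "f j = (\<Sum>m\<le>Suc n. of_nat (j choose m) * (x ^ m * ?h m))" if "j \<le> Suc n" for j
  proof (cases "j = Suc n")
    case True
    have "x ^ Suc n * ((f (Suc n) - ?s) / x ^ Suc n) = f (Suc n) - ?s" using assms by simp
    then show ?thesis unfolding sum.atMost_Suc s using True by (simp del: power_Suc)
  next
    case False
    then have "j \<le> n" using that by simp
    then show ?thesis unfolding sum.atMost_Suc s by (simp add: h binomial_eq_0)
  qed
  then show ?case by blast
qed

text \<open>The curve \<open>s \<mapsto> r (s, sqrt (1 - s\<^sup>2))\<close> on the sphere of radius \<open>r\<close> approaches the pole as \<open>s \<rightarrow> 0\<close>;
  the entries \<open>(m, 0)\<close> vanish there to order \<open>m\<close>, and their leading terms isolate the coefficients.\<close>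

definition curve :: "real \<Rightarrow> real \<Rightarrow> complex ^ 2" where
  "curve r s = vector [of_real (r * s), of_real (r * sqrt (1 - s\<^sup>2))]"

lemma curve_nth [simp]: "curve r s $ 1 = of_real (r * s)" "curve r s $ 2 = of_real (r * sqrt (1 - s\<^sup>2))"
  by (simp_all add: curve_def vector_2)

lemma curve_eq: "curve r s = (r * s) *\<^sub>R axis 1 1 + pole (r * sqrt (1 - s\<^sup>2))"
  by (simp add: vec2_eq vector_2 axis_def of_real_def)

text \<open>After division by s^m the column formula tends to a constant times the m-th power of the
  root of unity. Averaging against the conjugate k-th powers leaves only k = m, so the limit picks
  out a single Newton coefficient.\<close>

lemma newton_mat_limit:
  assumes m: "m \<le> n" and k: "k \<le> n"
  shows "((\<lambda>s. newton_mat n k (curve r s) m 0 / of_real s ^ m) \<longlongrightarrow>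
    (if m = k then of_real (sqrt (real (n choose m))) * (- of_real (r\<^sup>2)) ^ m else 0)) (at_right 0)"
proof -
  let ?C = "complex_of_real (sqrt (real (n choose m)))" and ?w = "unit_root n"
  let ?g = "\<lambda>s. \<Sum>l\<le>n. cnj (?w l) ^ k / of_nat (Suc n) *
    (?C * (- ?w l * of_real (r\<^sup>2 * sqrt (1 - s\<^sup>2))) ^ m * (1 + ?w l * of_real (r\<^sup>2 * s\<^sup>2)) ^ (n - m))"
  have eq: "newton_mat n k (curve r s) m 0 / of_real s ^ m = ?g s" if "s > 0" for s
  proof -
    have sh: "shift_mat n \<sigma> (curve r s) m 0 = of_real s ^ m *
        (?C * (- \<sigma> * of_real (r\<^sup>2 * sqrt (1 - s\<^sup>2))) ^ m * (1 + \<sigma> * of_real (r\<^sup>2 * s\<^sup>2)) ^ (n - m))" for \<sigma>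
    proof -
      have "- \<sigma> * (curve r s $ 2 * cnj (curve r s $ 1)) = of_real s * (- \<sigma> * of_real (r\<^sup>2 * sqrt (1 - s\<^sup>2)))"
        by (simp add: power2_eq_square)
      moreover have "curve r s $ 1 * cnj (curve r s $ 1) = of_real (r\<^sup>2 * s\<^sup>2)" by (simp add: power2_eq_square)
      ultimately show ?thesis unfolding shift_mat_column[OF m] by (simp only: power_mult_distrib mult_ac)
    qed
    have "c * (of_real s ^ m * T) / of_real s ^ m = c * T" for c T :: complex using that by simp
    then show ?thesis unfolding newton_mat_def sum_divide_distrib sh by (simp only:)
  qed
  have "((\<lambda>s. ?g s) \<longlongrightarrow> ?g 0) (at_right 0)"
    by (intro tendsto_intros)
  then have lim: "(?g \<longlongrightarrow> ?g 0) (at_right 0)" .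
  have "?g 0 = ?C * (- of_real (r\<^sup>2)) ^ m * (\<Sum>l\<le>n. cnj (?w l) ^ k / of_nat (Suc n) * ?w l ^ m)"
  proof -
    have "(- ?w l * of_real (r\<^sup>2)) ^ m = ?w l ^ m * (- of_real (r\<^sup>2)) ^ m" for l
      by (simp only: mult_minus_left mult_minus_right[symmetric] power_mult_distrib)
    then show ?thesis unfolding sum_distrib_left
      by (intro sum.cong refl) (simp del: of_nat_Suc of_real_power add: mult_ac)
  qed
  also have "\<dots> = (if m = k then ?C * (- of_real (r\<^sup>2)) ^ m else 0)"
    by (simp only: unit_root_orthogonal[OF m k]) simp
  finally have "(?g \<longlongrightarrow> (if m = k then ?C * (- of_real (r\<^sup>2)) ^ m else 0)) (at_right 0)" using lim by (simp only:)
  then show ?thesis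
  proof (rule Lim_transform_eventually)
    show "\<forall>\<^sub>F s in at_right 0. ?g s = newton_mat n k (curve r s) m 0 / of_real s ^ m"
      by (rule eventually_at_rightI[of 0 1]) (simp_all only: eq greaterThanLessThan_iff zero_less_one)
  qed
qed

lemma four_continuous: "f \<in> schwartz \<Longrightarrow> isCont (four f) z"
  using smooth_has_derivative0[OF schwartz_smooth[OF schwartz_op_in[OF schwartz_op_four]]] has_derivative_continuous by blast

lemma isCont_pole: "isCont pole r"
proof -
  have "pole = (\<lambda>r. r *\<^sub>R axis 2 1)" by (rule ext) (simp add: vec2_eq vector_2 axis_def of_real_def)
  then show ?thesis by simp
qed

text \<open>Taylor expansion of order m + 1 in the direction of Re w_1, based at a pole that moves
  with s. The moments below order m are assumed to vanish at every pole because of this motion; the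
  remainder is of order s^(m+1).\<close>

lemma four_limit:
  assumes u: "u \<in> schwartz" and r: "0 < r"
    and van: "\<And>l y. l < m \<Longrightarrow> four (\<lambda>w. u w * of_real (w \<bullet> axis 1 1) ^ l) (pole y) = 0"
  shows "((\<lambda>s. four u (curve r s) / of_real s ^ m) \<longlongrightarrow>
    (\<i> * of_real r) ^ m / fact m * four (\<lambda>w. u w * of_real (w \<bullet> axis 1 1) ^ m) (pole r)) (at_right 0)"
proof -
  let ?A = "\<lambda>s. (\<i> * of_real r) ^ m / fact m * four (\<lambda>w. u w * of_real (w \<bullet> axis 1 1) ^ m) (pole (r * sqrt (1 - s\<^sup>2)))"
  let ?v = "\<lambda>w. u w * of_real (w \<bullet> axis 1 1) ^ Suc m"
  define B where "B = r ^ Suc m * (LINT w|lborel. norm (?v w))"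
  have S: "(\<lambda>w. u w * of_real (w \<bullet> axis 1 1) ^ l) \<in> schwartz" for l
    by (rule schwartz_mult_right[OF u tempered_inner_power])
  have bound: "norm (four u (curve r s) / of_real s ^ m - ?A s) \<le> B * s" if s: "0 < s" for s
  proof -
    let ?R = "\<lambda>w. u w * ((\<i> * of_real (r * s * (w \<bullet> axis 1 1))) ^ Suc m * cistail (Suc m) (r * s * (w \<bullet> axis 1 1))) * cis (w \<bullet> pole (r * sqrt (1 - s\<^sup>2)))"
    have "four u (curve r s) = (\<Sum>l<Suc m. (\<i> * of_real (r * s)) ^ l / fact l * four (\<lambda>w. u w * of_real (w \<bullet> axis 1 1) ^ l) (pole (r * sqrt (1 - s\<^sup>2)))) + (LINT w|lborel. ?R w)"
      unfolding curve_eq by (rule four_taylor(2)[OF u])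
    also have "(\<Sum>l<Suc m. (\<i> * of_real (r * s)) ^ l / fact l * four (\<lambda>w. u w * of_real (w \<bullet> axis 1 1) ^ l) (pole (r * sqrt (1 - s\<^sup>2)))) = of_real s ^ m * ?A s"
    proof -
      have "(\<Sum>l<m. (\<i> * of_real (r * s)) ^ l / fact l * four (\<lambda>w. u w * of_real (w \<bullet> axis 1 1) ^ l) (pole (r * sqrt (1 - s\<^sup>2)))) = 0"
        by (intro sum.neutral ballI) (simp only: van lessThan_iff mult_zero_right)
      moreover have "(\<i> * of_real (r * s)) ^ m = of_real s ^ m * (\<i> * of_real r) ^ m"
        by (simp only: of_real_mult power_mult_distrib mult_ac)
      ultimately show ?thesis unfolding sum.lessThan_Suc by (simp only: add_0 times_divide_eq_right times_divide_eq_left mult.assoc)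
    qed
    finally have "four u (curve r s) / of_real s ^ m - ?A s = (LINT w|lborel. ?R w) / of_real s ^ m"
      using s by (simp add: field_simps)
    then have "norm (four u (curve r s) / of_real s ^ m - ?A s) = norm (LINT w|lborel. ?R w) / s ^ m"
      using s by (simp only: norm_divide norm_power norm_of_real abs_of_pos)
    also have "norm (LINT w|lborel. ?R w) \<le> (LINT w|lborel. (r * s) ^ Suc m * norm (?v w))"
    proof (rule order_trans[OF Bochner_Integration.integral_norm_bound Bochner_Integration.integral_mono])
      show "integrable lborel (\<lambda>w. norm (?R w))" by (intro integrable_norm four_taylor(1)[OF u])
      show "integrable lborel (\<lambda>w. (r * s) ^ Suc m * norm (?v w))"
        by (intro integrable_mult_right integrable_norm schwartz_integrable S)
      fix w
      have "norm (?R w) = (r * s) ^ Suc m * norm (?v w) * norm (cistail (Suc m) (r * s * (w \<bullet> axis 1 1)))"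
        using r s by (simp add: norm_mult norm_power power_mult_distrib abs_mult del: power_Suc)
      also have "\<dots> \<le> (r * s) ^ Suc m * norm (?v w) * 1"
        using r s by (intro mult_left_mono norm_cistail) simp_all
      finally show "norm (?R w) \<le> (r * s) ^ Suc m * norm (?v w)" by simp
    qed
    also have "(LINT w|lborel. (r * s) ^ Suc m * norm (?v w)) = B * s * s ^ m"
      unfolding B_def by (simp add: power_mult_distrib)
    also have "B * s * s ^ m / s ^ m = B * s" using s by simp
    finally show ?thesis using s by (simp add: divide_right_mono)
  qed
  have "((\<lambda>s. four u (curve r s) / of_real s ^ m - ?A s) \<longlongrightarrow> 0) (at_right 0)"
  proof (rule Lim_null_comparison)
    show "eventually (\<lambda>s. norm (four u (curve r s) / of_real s ^ m - ?A s) \<le> B * s) (at_right 0)"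
      using bound by (auto intro!: eventually_at_rightI[of 0 1])
    show "((\<lambda>s. B * s) \<longlongrightarrow> 0) (at_right 0)" by (auto intro!: tendsto_eq_intros)
  qed
  moreover have "(?A \<longlongrightarrow> (\<i> * of_real r) ^ m / fact m * four (\<lambda>w. u w * of_real (w \<bullet> axis 1 1) ^ m) (pole r)) (at_right 0)"
  proof -
    have "((\<lambda>s. r * sqrt (1 - s\<^sup>2)) \<longlongrightarrow> r * sqrt (1 - 0\<^sup>2)) (at_right 0)" by (intro tendsto_intros)
    then have "((\<lambda>s. r * sqrt (1 - s\<^sup>2)) \<longlongrightarrow> r) (at_right 0)" by simp
    from isCont_tendsto_compose[OF four_continuous[OF S] isCont_tendsto_compose[OF isCont_pole this]]
    show ?thesis by (intro tendsto_mult tendsto_const)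
  qed
  ultimately show ?thesis using tendsto_add by fastforce
qed

text \<open>For fixed \<open>r\<close> the diagonal values have Newton coefficients for purely
  algebraic reasons, with no control in \<open>r\<close>. Covariance extends the interpolation to
  the whole sphere of radius \<open>r\<close>, and comparing leading terms of entry (m, 0) along the
  curve identifies the m-th coefficient with a Fourier integral of the entry (m, 0) of
  \<open>F\<close>.\<close>

lemma diag_expansion:
  assumes F: "F \<in> schwartz_equivariant n" and j: "j \<le> n" and r: "0 < r"
  shows "four (\<lambda>w. F w $$ (j, j)) (pole r) = (\<Sum>m\<le>n. of_nat (j choose m) *
    ((- \<i> * of_real r) ^ m / (fact m * of_real (sqrt (real (n choose m)))) *
      four (\<lambda>w. F w $$ (m, 0) * of_real (w \<bullet> axis 1 1) ^ m) (pole r)))"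
proof -
  let ?X = "\<lambda>z a b. F z $$ (a, b)" and ?Y = "\<lambda>z a b. four (\<lambda>w. F w $$ (a, b)) z"
  have car: "F z \<in> carrier_mat (n + 1) (n + 1)" for z
    using F by (auto simp: schwartz_equivariant_def schwartz_mat_def)
  have X: "(\<lambda>z. F z $$ (a, b)) \<in> schwartz" if "a \<le> n" "b \<le> n" for a b
    using F that by (auto simp: schwartz_equivariant_def schwartz_mat_def)
  have covX: "covariant n ?X"
    using F by (simp add: schwartz_equivariant_def flip: equivariant_covariant[OF car])
  have covY: "covariant n ?Y" by (rule four_covariant[OF X covX])
  let ?x = "complex_of_real (r\<^sup>2)"
  have "?x \<noteq> 0" using r by simp
  from newton_exists[OF this, of n "\<lambda>j. ?Y (pole r) j j"] obtain h
    where h: "\<And>j. j \<le> n \<Longrightarrow> ?Y (pole r) j j = (\<Sum>m\<le>n. of_nat (j choose m) * (?x ^ m * h m))" by blast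
  \<comment> \<open>The coefficients \<open>h\<close> belong to the fixed radius \<open>r\<close>,
    so agreement with the transform is claimed on the sphere of radius \<open>r\<close>, where the
    curve runs.\<close>
  let ?N = "\<lambda>z a b. \<Sum>m\<le>n. h m * newton_mat n m z a b"
  have N: "?Y (pole r) a b = ?N (pole r) a b" if ab: "a \<le> n" "b \<le> n" for a b
  proof (cases "a = b")
    case True
    show ?thesis unfolding True h[OF ab(2)]
      by (intro sum.cong refl) (simp add: newton_mat_diag[OF ab(2) ab(2)])
  next
    case False
    have "?N (pole r) a b = 0"
      by (intro sum.neutral ballI) (simp add: newton_mat_diag[OF ab] False)
    then show ?thesis using covariant_diagonal[OF covY ab False] by simp
  qed
  have coeff: "?x ^ m * h m = (- \<i> * of_real r) ^ m / (fact m * of_real (sqrt (real (n choose m)))) *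
      four (\<lambda>w. F w $$ (m, 0) * of_real (w \<bullet> axis 1 1) ^ m) (pole r)" if m: "m \<le> n" for m
  proof -
    let ?C = "complex_of_real (sqrt (real (n choose m)))" and ?A = "four (\<lambda>w. F w $$ (m, 0) * of_real (w \<bullet> axis 1 1) ^ m) (pole r)"
    have exp: "?Y (curve r s) m 0 = ?N (curve r s) m 0" if s: "0 < s" "s < 1" for s
    proof -
      let ?\<zeta> = "vector [of_real s, of_real (sqrt (1 - s\<^sup>2))] :: complex ^ 2"
      have "s\<^sup>2 \<le> 1" using s by (simp add: power_le_one)
      then have "(norm ?\<zeta>)\<^sup>2 = 1\<^sup>2" by (simp add: norm2_sq vector_2)
      then have \<zeta>: "norm ?\<zeta> = 1" by (rule power2_eq_imp_eq) simp_all
      have c: "curve r s = cis 0 *s rotv ?\<zeta> (pole r)" by (simp add: vec2_eq vector_2 mult.commute)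
      have "?Y (curve r s) m 0 = conjm n ?\<zeta> (?Y (pole r)) m 0"
        unfolding c by (rule covariantD[OF covY \<zeta> m le0])
      also have "\<dots> = conjm n ?\<zeta> (?N (pole r)) m 0" by (rule conjm_cong) (rule N)
      also have "\<dots> = ?N (curve r s) m 0"
        unfolding c conjm_sum[OF finite_atMost] by (simp only: newton_mat_conj[OF \<zeta> m le0])
      finally show ?thesis .
    qed
    \<comment> \<open>Entry (m, 0) has frequency - m in w_1, and rotations of w_1 fix every
      pole.\<close>
    have van: "four (\<lambda>w. F w $$ (m, 0) * of_real (w \<bullet> axis 1 1) ^ l) (pole y) = 0" if "l < m" for l y
      by (rule four_moment_vanishes[OF X[OF m le0] covariant_freq(1)[OF covX m]])
        (use that in \<open>simp_all add: vec2_eq vector_2\<close>)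
    have lim1: "((\<lambda>s. ?Y (curve r s) m 0 / of_real s ^ m) \<longlongrightarrow> (\<i> * of_real r) ^ m / fact m * ?A) (at_right 0)"
      by (rule four_limit[OF X[OF m le0] r van])
    have "((\<lambda>s. \<Sum>k\<le>n. h k * (newton_mat n k (curve r s) m 0 / of_real s ^ m)) \<longlongrightarrow>
        (\<Sum>k\<le>n. h k * (if m = k then ?C * (- ?x) ^ m else 0))) (at_right 0)"
      by (intro tendsto_sum tendsto_mult tendsto_const newton_mat_limit m) simp
    also have "(\<Sum>k\<le>n. h k * (if m = k then ?C * (- ?x) ^ m else 0)) = h m * (?C * (- ?x) ^ m)"
      using m by (simp add: if_distrib[of "\<lambda>y. _ * y"] cong: if_cong)
    finally have "((\<lambda>s. ?Y (curve r s) m 0 / of_real s ^ m) \<longlongrightarrow> h m * (?C * (- ?x) ^ m)) (at_right 0)"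
      by (rule Lim_transform_eventually)
        (auto simp: exp sum_divide_distrib intro!: eventually_at_rightI[of 0 1])
    with lim1 have eq: "h m * (?C * (- ?x) ^ m) = (\<i> * of_real r) ^ m / fact m * ?A"
      by (intro tendsto_unique[OF trivial_limit_at_right_real])
    have C: "?C \<noteq> 0" using m by simp
    have "?x ^ m * h m = (- 1) ^ m * (h m * (?C * (- ?x) ^ m)) / ?C"
      using C by (simp add: power_minus[of ?x] flip: power_mult_distrib)
    also have "\<dots> = (- \<i> * of_real r) ^ m / (fact m * ?C) * ?A"
      unfolding eq by (simp add: power_minus[of "\<i> * of_real r"])
    finally show ?thesis .
  qed
  show ?thesis unfolding h[OF j] by (intro sum.cong refl) (simp only: coeff atMost_iff)
qed

section \<open>Smooth extension of the transform\<close>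

text \<open>Frequency m in w_2 kills the moments at 0 below order m, so the Taylor remainder alone
  represents the transform and carries the factor (i r)^m. A half turn of w_2 gives the parity
  (-1)^m in r, and averaging over r and - r turns \<open>cistail\<close> into \<open>Cm\<close>, a
  function of r^2.\<close>

lemma four_even_kernel:
  assumes v: "v \<in> schwartz" and freq: "\<And>\<psi> w. v (rot_at 2 \<psi> w) = cis (real m * \<psi>) * v w"
  shows "four v (pole r) = (\<i> * of_real r) ^ m *
    (LINT w|lborel. v w * of_real (w \<bullet> axis 2 1) ^ m * of_real (Cm m (r\<^sup>2 * (w \<bullet> axis 2 1)\<^sup>2)))"
proof -
  let ?R = "\<lambda>r w. v w * ((\<i> * of_real (r * (w \<bullet> axis 2 1))) ^ m * cistail m (r * (w \<bullet> axis 2 1))) * cis (w \<bullet> 0)"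
  have p: "pole r = r *\<^sub>R axis 2 1 + 0" for r by (simp add: vec2_eq vector_2 axis_def of_real_def)
  have van: "four (\<lambda>w. v w * of_real (w \<bullet> axis 2 1) ^ l) 0 = 0" if "l < m" for l
    by (rule four_moment_vanishes[OF v freq]) (use that in \<open>simp_all add: vec2_eq\<close>)
  have J: "four v (pole r) = (LINT w|lborel. ?R r w)" for r
  proof -
    have "(\<Sum>l<m. (\<i> * of_real r) ^ l / fact l * four (\<lambda>w. v w * of_real (w \<bullet> axis 2 1) ^ l) 0) = 0"
      by (intro sum.neutral ballI) (simp only: van lessThan_iff mult_zero_right)
    then show ?thesis unfolding p four_taylor(2)[OF v, of r "axis 2 1" 0 m] by (simp only: add_0)
  qed
  have "rot_at 2 pi (pole r) = pole (- r)" by (simp add: vec2_eq vector_2)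
  then have "four v (pole (- r)) = four (\<lambda>w. v (rot_at 2 pi w)) (pole r)"
    using four_rotate[OF orthogonal_rot_at v, of 2 pi "pole r"] by simp
  also have "\<dots> = cis (real m * pi) * four v (pole r)" by (simp only: freq four_cmult[OF v])
  also have "cis (real m * pi) = (- 1) ^ m" by (simp flip: Complex.DeMoivre)
  finally have neg: "four v (pole (- r)) = (- 1) ^ m * four v (pole r)" .
  have sq: "(- 1) ^ m * ((- 1) ^ m * four v (pole r)) = four v (pole r)"
    by (simp flip: power_mult_distrib mult.assoc)
  have "four v (pole r) = (four v (pole r) + (- 1) ^ m * four v (pole (- r))) / 2"
    unfolding neg sq by simp
  also have "\<dots> = ((LINT w|lborel. ?R r w) + (LINT w|lborel. (- 1) ^ m * ?R (- r) w)) / 2"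
    by (simp only: J integral_mult_right_zero)
  also have "\<dots> = (LINT w|lborel. ?R r w + (- 1) ^ m * ?R (- r) w) / 2"
    by (subst Bochner_Integration.integral_add) (intro four_taylor(1)[OF v] integrable_mult_right refl)+
  also have "\<dots> = (LINT w|lborel. (?R r w + (- 1) ^ m * ?R (- r) w) / 2)"
    by (simp only: integral_divide_zero)
  also have "\<dots> = (LINT w|lborel. (\<i> * of_real r) ^ m * (v w * of_real (w \<bullet> axis 2 1) ^ m * of_real (Cm m (r\<^sup>2 * (w \<bullet> axis 2 1)\<^sup>2))))"
  proof (rule Bochner_Integration.integral_cong[OF refl])
    fix w :: "complex ^ 2"
    let ?t = "w \<bullet> axis 2 1"
    have "(- 1) ^ m * (\<i> * complex_of_real (- r * ?t)) ^ m = (\<i> * of_real (r * ?t)) ^ m"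
      by (simp flip: power_mult_distrib)
    then have "(?R r w + (- 1) ^ m * ?R (- r) w) / 2 = v w * (\<i> * of_real (r * ?t)) ^ m * ((cistail m (r * ?t) + cistail m (- (r * ?t))) / 2)"
      by (simp add: algebra_simps add_divide_distrib)
    also have "\<dots> = v w * (\<i> * of_real (r * ?t)) ^ m * of_real (Cm m ((r * ?t)\<^sup>2))" by (simp only: Cm_even)
    finally show "(?R r w + (- 1) ^ m * ?R (- r) w) / 2 = (\<i> * of_real r) ^ m * (v w * of_real ?t ^ m * of_real (Cm m (r\<^sup>2 * ?t\<^sup>2)))"
      by (simp add: power_mult_distrib mult_ac)
  qed
  finally show ?thesis by (simp only: integral_mult_right_zero)
qed

text \<open>Equal to 1 on [0, 1] and 0 outside [-1, 2]. For \<xi> \<ge> 0 the two cutoffs add up to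
  1.\<close>

definition low_cut :: "real \<Rightarrow> complex" where
  "low_cut \<xi> = of_real (step (\<xi> + 1)) * (1 - of_real (step (\<xi> - 1)))"

definition high_cut :: "real \<Rightarrow> complex" where
  "high_cut \<xi> = of_real (step (\<xi> - 1))"

text \<open>The \<open>m\<close>-th Newton coefficient as a smooth function of \<open>\<xi>\<close>: near \<open>0\<close> through the entire kernel,
  far away through the Fourier transform.\<close>

definition newton_coeff :: "nat \<Rightarrow> nat \<Rightarrow> (complex ^ 2 \<Rightarrow> complex) \<Rightarrow> real \<Rightarrow> complex" where
  "newton_coeff n m u \<xi> = 1 / (fact m * of_real (sqrt (real (n choose m)))) *
     (low_cut \<xi> * (LINT w|lborel. ((of_real (w \<bullet> axis 1 1) ^ m * of_real (w \<bullet> axis 2 1) ^ m) * u w) * Km m (\<xi> * (w \<bullet> axis 2 1)\<^sup>2)) +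
      (- \<i>) ^ m * ((high_cut \<xi> * of_real (\<xi> powr (- real m / 2))) *
        four (\<lambda>w. of_real (w \<bullet> axis 1 1) ^ m * u w) ((step (2 * \<xi> - 1) * sqrt \<xi>) *\<^sub>R axis 2 1)))"

lemma tempered_step_affine: "tempered (\<lambda>\<xi>. of_real (step (a * \<xi> + b)))"
  by (rule tempered_step_compose[OF tempered_real_affine])

lemma schwartz_op_newton_coeff: "schwartz_op (newton_coeff n m)"
proof -
  let ?c = "1 / (fact m * of_real (sqrt (real (n choose m)))) :: complex"
  let ?q = "\<lambda>\<xi>. (step (2 * \<xi> - 1) * sqrt \<xi>) *\<^sub>R axis 2 1 :: complex ^ 2"
  have st: "tempered (\<lambda>\<xi>. of_real (step (\<xi> + 1)))" "tempered (\<lambda>\<xi>. of_real (step (\<xi> - 1)))" "tempered (\<lambda>\<xi>. of_real (step (2 * \<xi> - 1)))"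
    using tempered_step_affine[of 1 1] tempered_step_affine[of 1 "- 1"] tempered_step_affine[of 2 "- 1"] by simp_all
  have "tempered low_cut" unfolding low_cut_def by (intro tempered_mult tempered_diff tempered_const st)
  moreover have "low_cut \<xi> = 0" if "2 < \<bar>\<xi>\<bar>" for \<xi>
    using that by (cases "\<xi> < 0") (simp_all add: low_cut_def step_eq_0 step_eq_1)
  ultimately have "schwartz_op (\<lambda>f \<xi>. low_cut \<xi> * (LINT w|lborel. f w * Km m (\<xi> * (w \<bullet> (axis 2 1 :: complex ^ 2))\<^sup>2)))"
    by (intro schwartz_op_kernel Km_tempered)
  moreover have "schwartz_op (\<lambda>u w. (of_real (w \<bullet> axis 1 1) ^ m * of_real (w \<bullet> axis 2 1) ^ m) * u (w :: complex ^ 2))"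
    by (intro schwartz_op_mult tempered_mult tempered_inner_power)
  ultimately have 1: "schwartz_op (\<lambda>u \<xi>. low_cut \<xi> * (LINT w|lborel. ((of_real (w \<bullet> axis 1 1) ^ m * of_real (w \<bullet> axis 2 1) ^ m) * u (w :: complex ^ 2)) * Km m (\<xi> * (w \<bullet> axis 2 1)\<^sup>2)))"
    by (rule schwartz_op_compose)
  have "schwartz_op (\<lambda>h \<xi>. (high_cut \<xi> * of_real (\<xi> powr (- real m / 2))) * h (?q \<xi>))"
  \<comment> \<open>The exponent 2 reflects that \<xi> is the square of the norm of the point at
    which the transform is evaluated.\<close>
  proof (rule schwartz_op_pullback[where ?C0.0 = 1 and ?N0.0 = 2])
    show "tempered (\<lambda>\<xi>. high_cut \<xi> * of_real (\<xi> powr (- real m / 2)))"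
      unfolding high_cut_def by (rule tempered_powr[OF st(2)]) (simp add: step_eq_0)
    \<comment> \<open>The square root is switched off below 1/2 to be smooth on the whole line; for
      \<xi> \<ge> 1, where \<open>high_cut\<close> lives, it is unchanged.\<close>
    have "tempered (\<lambda>\<xi>. of_real (step (2 * \<xi> - 1)) * of_real (\<xi> powr (1 / 2)))"
      by (rule tempered_powr[OF st(3)]) (simp add: step_eq_0)
    moreover have "of_real (step (2 * \<xi> - 1)) * of_real (\<xi> powr (1 / 2)) = complex_of_real (step (2 * \<xi> - 1) * sqrt \<xi>)" for \<xi>
      by (cases "0 \<le> \<xi>") (simp_all add: powr_half_sqrt step_eq_0)
    ultimately have sq: "tempered (\<lambda>\<xi>. complex_of_real (step (2 * \<xi> - 1) * sqrt \<xi>))" by simp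
    show "tempered (\<lambda>\<xi>. of_real (?q \<xi> \<bullet> b))" for b
      using tempered_mult[OF sq tempered_const[of "of_real (axis 2 1 \<bullet> b)"]] by (simp add: mult.assoc)
    show "high_cut \<xi> * of_real (\<xi> powr (- real m / 2)) = 0" if "1 * (1 + norm (?q \<xi>)) ^ 2 < 1 + norm \<xi>" for \<xi>
    proof (cases "1 \<le> \<xi>")
      case True
      then have "norm (?q \<xi>) = sqrt \<xi>" by (simp add: step_eq_1)
      then have "1 * (1 + norm (?q \<xi>)) ^ 2 = 1 + 2 * sqrt \<xi> + \<xi>" using True by (simp add: power2_sum)
      moreover have "0 \<le> sqrt \<xi>" using True by simp
      ultimately show ?thesis using that True by simp
    qed (simp add: high_cut_def step_eq_0)
  qed
  moreover have "schwartz_op (\<lambda>u. four (\<lambda>w. of_real (w \<bullet> (axis 1 1 :: complex ^ 2)) ^ m * u w))"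
    by (rule schwartz_op_compose[OF schwartz_op_four schwartz_op_mult[OF tempered_inner_power]])
  ultimately have "schwartz_op (\<lambda>u \<xi>. (high_cut \<xi> * of_real (\<xi> powr (- real m / 2))) * four (\<lambda>w. of_real (w \<bullet> axis 1 1) ^ m * u w) (?q \<xi>))"
    by (rule schwartz_op_compose)
  from schwartz_op_compose[OF schwartz_op_mult[OF tempered_const] this]
  have 2: "schwartz_op (\<lambda>u \<xi>. (- \<i>) ^ m * ((high_cut \<xi> * of_real (\<xi> powr (- real m / 2))) * four (\<lambda>w. of_real (w \<bullet> axis 1 1) ^ m * u w) (?q \<xi>)))" .
  from schwartz_op_compose[OF schwartz_op_mult[OF tempered_const] schwartz_op_add[OF 1 2]]
  show ?thesis unfolding newton_coeff_def .
qed

text \<open>Multiplication by a power of Re w_1 keeps the frequency m in w_2, so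
  \<open>four_even_kernel\<close> supplies a factor (i r)^m. Together with the factor (- i r)^m of
  \<open>diag_expansion\<close> it makes up \<xi>^m. Both branches thus represent the same quantity,
  weighted by cutoffs that add up to 1.\<close>

lemma newton_coeff_eq:
  assumes F: "F \<in> schwartz_equivariant n" and m: "m \<le> n" and \<xi>: "0 < \<xi>"
  shows "of_real \<xi> ^ m * newton_coeff n m (\<lambda>w. F w $$ (m, 0)) \<xi> =
    (- \<i> * of_real (sqrt \<xi>)) ^ m / (fact m * of_real (sqrt (real (n choose m)))) *
      four (\<lambda>w. F w $$ (m, 0) * of_real (w \<bullet> axis 1 1) ^ m) (pole (sqrt \<xi>))"
proof -
  let ?r = "sqrt \<xi>" and ?v = "\<lambda>w. F w $$ (m, 0) * of_real (w \<bullet> axis 1 1) ^ m"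
  let ?A = "four ?v (pole ?r)" and ?c = "1 / (fact m * of_real (sqrt (real (n choose m)))) :: complex"
  let ?I = "LINT w|lborel. ((of_real (w \<bullet> axis 1 1) ^ m * of_real (w \<bullet> axis 2 1) ^ m) * F w $$ (m, 0)) * Km m (\<xi> * (w \<bullet> axis 2 1)\<^sup>2)"
  have car: "F z \<in> carrier_mat (n + 1) (n + 1)" for z
    using F by (auto simp: schwartz_equivariant_def schwartz_mat_def)
  have u: "(\<lambda>w. F w $$ (m, 0)) \<in> schwartz"
    using F m by (auto simp: schwartz_equivariant_def schwartz_mat_def)
  have cov: "covariant n (\<lambda>z a b. F z $$ (a, b))"
    using F by (simp add: schwartz_equivariant_def flip: equivariant_covariant[OF car])
  have v: "?v \<in> schwartz" by (rule schwartz_mult_right[OF u tempered_inner_power])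
  have "?v (rot_at 2 \<psi> w) = cis (real m * \<psi>) * ?v w" for \<psi> w
    using covariant_freq(2)[OF cov m, of \<psi> w] by (simp add: inner_axis)
  from four_even_kernel[OF v this]
  have "?A = (\<i> * of_real ?r) ^ m * (LINT w|lborel. ?v w * of_real (w \<bullet> axis 2 1) ^ m * of_real (Cm m (?r\<^sup>2 * (w \<bullet> axis 2 1)\<^sup>2)))" .
  also have "(LINT w|lborel. ?v w * of_real (w \<bullet> axis 2 1) ^ m * of_real (Cm m (?r\<^sup>2 * (w \<bullet> axis 2 1)\<^sup>2))) = ?I"
    using \<xi> by (intro Bochner_Integration.integral_cong[OF refl]) (simp add: Km_nonneg mult_ac)
  finally have I: "?A = (\<i> * of_real ?r) ^ m * ?I" .
  have "(\<i> * complex_of_real ?r) ^ m * (- \<i> * of_real ?r) ^ m = (of_real (?r * ?r)) ^ m"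
  proof -
    have "(\<i> * a) * (- \<i> * a) = a * a" for a by (simp add: complex_eq_iff algebra_simps)
    then have "(\<i> * complex_of_real ?r) * (- \<i> * of_real ?r) = of_real (?r * ?r)" by (simp only: of_real_mult)
    then show ?thesis by (simp only: power_mult_distrib[symmetric])
  qed
  also have "?r * ?r = \<xi>" using \<xi> by simp
  finally have rr: "(\<i> * complex_of_real ?r) ^ m * (- \<i> * of_real ?r) ^ m = of_real \<xi> ^ m" .
  have low: "(- \<i> * of_real ?r) ^ m * ?A = of_real \<xi> ^ m * ?I"
    unfolding I rr[symmetric] by (simp only: mult_ac)
  have sc: "complex_of_real \<xi> ^ m * of_real (\<xi> powr (- real m / 2)) = of_real ?r ^ m"
  proof -
    have "\<xi> ^ m = \<xi> powr real m" "?r ^ m = (\<xi> powr (1 / 2)) powr real m" using \<xi> by (simp_all add: powr_realpow powr_half_sqrt)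
    then have "\<xi> ^ m * \<xi> powr (- real m / 2) = ?r ^ m" using \<xi> by (simp add: powr_powr flip: powr_add)
    then show ?thesis by (simp flip: of_real_power of_real_mult)
  qed
  have high: "of_real \<xi> ^ m * ((- \<i>) ^ m * ((high_cut \<xi> * of_real (\<xi> powr (- real m / 2))) *
        four (\<lambda>w. of_real (w \<bullet> axis 1 1) ^ m * F w $$ (m, 0)) ((step (2 * \<xi> - 1) * sqrt \<xi>) *\<^sub>R axis 2 1))) =
      high_cut \<xi> * ((- \<i> * of_real ?r) ^ m * ?A)"
  proof (cases "1 < \<xi>")
    case True
    then have "(step (2 * \<xi> - 1) * sqrt \<xi>) *\<^sub>R axis 2 1 = pole ?r"
      by (simp add: step_eq_1 vec2_eq vector_2 axis_def of_real_def)
    moreover have "(\<lambda>w. of_real (w \<bullet> axis 1 1) ^ m * F w $$ (m, 0)) = ?v" by (simp add: mult.commute)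
    ultimately have "of_real \<xi> ^ m * ((- \<i>) ^ m * ((high_cut \<xi> * of_real (\<xi> powr (- real m / 2))) *
        four (\<lambda>w. of_real (w \<bullet> axis 1 1) ^ m * F w $$ (m, 0)) ((step (2 * \<xi> - 1) * sqrt \<xi>) *\<^sub>R axis 2 1))) =
      high_cut \<xi> * ((- \<i>) ^ m * (of_real \<xi> ^ m * of_real (\<xi> powr (- real m / 2))) * ?A)"
      by (simp only: mult_ac)
    then show ?thesis by (simp only: sc power_mult_distrib)
  qed (simp add: high_cut_def step_eq_0)
  have cut: "low_cut \<xi> = 1 - high_cut \<xi>" using \<xi> by (simp add: low_cut_def high_cut_def step_eq_1)
  have "of_real \<xi> ^ m * newton_coeff n m (\<lambda>w. F w $$ (m, 0)) \<xi> =
      ?c * (low_cut \<xi> * (of_real \<xi> ^ m * ?I) + high_cut \<xi> * ((- \<i> * of_real ?r) ^ m * ?A))"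
    unfolding newton_coeff_def high[symmetric] by (simp only: distrib_left mult_ac)
  also have "\<dots> = ?c * ((- \<i> * of_real ?r) ^ m * ?A)"
    unfolding low[symmetric] cut by (simp only: left_diff_distrib) simp
  finally show ?thesis by simp
qed

text \<open>On the ray of index j each factor is 2 (j - i) \<xi>, so the quotient is (j choose m)
  \<xi>^m. The cutoff is 1 for |\<eta>| \<le> n |\<xi>|, a region containing the spectrum, and 0
  once \<eta>^2 \<ge> n^2 \<xi>^2 + 1; it converts decay in \<xi> into decay on the plane.\<close>

definition newton_cut :: "nat \<Rightarrow> nat \<Rightarrow> real \<times> real \<Rightarrow> complex" where
  "newton_cut n m p = (\<Prod>i<m. of_real (snd p + (real n - 2 * real i) * fst p)) / (2 ^ m * fact m) *
     (1 - of_real (step ((snd p)\<^sup>2 - (real n * fst p)\<^sup>2)))"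

definition ext :: "nat \<Rightarrow> (complex ^ 2 \<Rightarrow> complex mat) \<Rightarrow> real \<times> real \<Rightarrow> complex" where
  "ext n F p = (\<Sum>m\<le>n. newton_cut n m p * newton_coeff n m (\<lambda>w. F w $$ (m, 0)) (fst p))"

lemma schwartz_op_ext: "schwartz_op (\<lambda>u p. newton_cut n m p * newton_coeff n m u (fst p))"
proof -
  have fst_t: "tempered (\<lambda>p :: real \<times> real. of_real (fst p))" and snd_t: "tempered (\<lambda>p :: real \<times> real. of_real (snd p))"
    using tempered_inner[of "(1, 0) :: real \<times> real"] tempered_inner[of "(0, 1) :: real \<times> real"]
    by (simp_all add: inner_prod_def)
  have "schwartz_op (\<lambda>h p. newton_cut n m p * h (fst p))"
  \<comment> \<open>Where the cutoff is nonzero, |\<eta>| \<le> n |\<xi>| + 1, hence 1 + norm p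
    \<le> (n + 1) |\<xi>| + 2; this explains n + 2.\<close>
  proof (rule schwartz_op_pullback[where ?C0.0 = "real n + 2" and ?N0.0 = 1])
    have "tempered (\<lambda>p :: real \<times> real. of_real ((snd p)\<^sup>2 - (real n * fst p)\<^sup>2))"
      unfolding of_real_diff of_real_power of_real_mult
      by (intro tempered_diff tempered_power tempered_mult tempered_const fst_t snd_t)
    from tempered_step_compose[OF this]
    have "tempered (\<lambda>p :: real \<times> real. of_real (step ((snd p)\<^sup>2 - (real n * fst p)\<^sup>2)))" .
    moreover have "tempered (\<lambda>p :: real \<times> real. of_real (snd p + (real n - 2 * real i) * fst p))" for i
      unfolding of_real_add of_real_mult by (intro tempered_add tempered_mult tempered_const fst_t snd_t)
    ultimately show "tempered (newton_cut n m)"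
      unfolding newton_cut_def divide_inverse by (intro tempered_mult tempered_diff tempered_const tempered_prod)
    show "tempered (\<lambda>p :: real \<times> real. of_real (fst p \<bullet> b))" for b :: real
      using tempered_mult[OF fst_t tempered_const[of "of_real b"]] by simp
    show "newton_cut n m p = 0" if "(real n + 2) * (1 + norm (fst p)) ^ 1 < 1 + norm p" for p
    proof -
      have "1 \<le> (snd p)\<^sup>2 - (real n * fst p)\<^sup>2"
      proof (rule ccontr)
        assume "\<not> ?thesis"
        then have "(snd p)\<^sup>2 \<le> (real n * \<bar>fst p\<bar>)\<^sup>2 + 1" by (simp add: power_mult_distrib)
        also have "\<dots> \<le> (real n * \<bar>fst p\<bar> + 1)\<^sup>2" by (simp add: power2_sum)
        finally have "\<bar>snd p\<bar> \<le> real n * \<bar>fst p\<bar> + 1" by (simp add: abs_le_square_iff[symmetric])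
        moreover have "norm p \<le> \<bar>fst p\<bar> + \<bar>snd p\<bar>"
          using norm_Pair_le[of "fst p" "snd p"] by simp
        ultimately have "norm p \<le> \<bar>fst p\<bar> + (real n * \<bar>fst p\<bar> + 1)" by linarith
        then have "1 + norm p \<le> (real n + 2) * (1 + norm (fst p)) ^ 1"
          by (simp add: algebra_simps)
        with that show False by simp
      qed
      then show ?thesis by (simp add: newton_cut_def step_eq_1)
    qed
  qed
  from schwartz_op_compose[OF this schwartz_op_newton_coeff] show ?thesis .
qed

lemma newton_cut_eq:
  assumes "j \<le> n"
  shows "newton_cut n m (\<xi>, (- real n + 2 * real j) * \<xi>) = of_nat (j choose m) * of_real \<xi> ^ m"
proof -
  have "\<bar>- real n + 2 * real j\<bar> \<le> real n" using assms by simp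
  then have "(- real n + 2 * real j)\<^sup>2 \<le> (real n)\<^sup>2" by (simp add: abs_le_square_iff[symmetric])
  then have "((- real n + 2 * real j) * \<xi>)\<^sup>2 \<le> (real n * \<xi>)\<^sup>2"
    unfolding power_mult_distrib by (intro mult_right_mono) simp_all
  then have st: "step (((- real n + 2 * real j) * \<xi>)\<^sup>2 - (real n * \<xi>)\<^sup>2) = 0" by (intro step_eq_0) simp
  have "(- real n + 2 * real j) * \<xi> + (real n - 2 * real i) * \<xi> = 2 * ((real j - real i) * \<xi>)" for i
    by (simp add: algebra_simps)
  then have "(\<Prod>i<m. complex_of_real ((- real n + 2 * real j) * \<xi> + (real n - 2 * real i) * \<xi>)) =
      (\<Prod>i<m. 2 * ((of_nat j - of_nat i) * of_real \<xi>))" by simp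
  also have "\<dots> = 2 ^ m * ((\<Prod>i<m. of_nat j - of_nat i) * of_real \<xi> ^ m)"
    by (simp add: prod.distrib)
  also have "(\<Prod>i<m. of_nat j - of_nat i :: complex) = fact m * of_nat (j choose m)"
  proof -
    have "(of_nat j gchoose m :: complex) = of_nat (j choose m)" by (simp add: binomial_gbinomial)
    then show ?thesis by (simp add: gbinomial_prod_rev atLeast0LessThan field_simps)
  qed
  finally show ?thesis unfolding newton_cut_def fst_conv snd_conv st by simp
qed

lemma schwartz_add:
  fixes f g :: "'a::euclidean_space \<Rightarrow> complex"
  assumes f: "f \<in> schwartz" and g: "g \<in> schwartz" shows "(\<lambda>x. f x + g x) \<in> schwartz"
proof (rule schwartzI)
  show "smooth (\<lambda>x. f x + g x)" by (intro smooth_add schwartz_smooth f g)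
  fix N and bs :: "'a list" assume bs: "bs \<in> lists Basis"
  have "(1 + norm x) ^ N * norm (iterated_partial bs (\<lambda>x. f x + g x) x) \<le> schwartz_seminorm N bs f + schwartz_seminorm N bs g" for x
  proof -
    have "(1 + norm x) ^ N * norm (iterated_partial bs f x + iterated_partial bs g x) \<le>
        (1 + norm x) ^ N * (norm (iterated_partial bs f x) + norm (iterated_partial bs g x))"
      by (intro mult_left_mono norm_triangle_ineq) simp
    also have "\<dots> \<le> schwartz_seminorm N bs f + schwartz_seminorm N bs g"
      unfolding distrib_left by (intro add_mono schwartz_seminorm_upper f g bs)
    finally show ?thesis by (simp only: iterated_partial_add[OF schwartz_smooth[OF f] schwartz_smooth[OF g] bs])
  qed
  then show "\<exists>B. \<forall>x. (1 + norm x) ^ N * norm (iterated_partial bs (\<lambda>x. f x + g x) x) \<le> B" by blast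
qed

lemma ext_schwartz: "F \<in> schwartz_mat n \<Longrightarrow> ext n F \<in> schwartz"
proof -
  assume "F \<in> schwartz_mat n"
  then have "(\<lambda>w. F w $$ (m, 0)) \<in> schwartz" if "m \<le> n" for m using that by (simp add: schwartz_mat_def)
  then have S: "(\<lambda>p. newton_cut n m p * newton_coeff n m (\<lambda>w. F w $$ (m, 0)) (fst p)) \<in> schwartz" if "m \<le> n" for m
    using that by (intro schwartz_op_in[OF schwartz_op_ext]) simp
  have "(\<lambda>p. \<Sum>m\<in>M. newton_cut n m p * newton_coeff n m (\<lambda>w. F w $$ (m, 0)) (fst p)) \<in> schwartz"
    if "finite M" "M \<subseteq> {..n}" for M
    using that
  proof (induction M)
    case (insert m M)
    then have "m \<le> n" "(\<lambda>p. \<Sum>m\<in>M. newton_cut n m p * newton_coeff n m (\<lambda>w. F w $$ (m, 0)) (fst p)) \<in> schwartz" by auto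
    from schwartz_add[OF S[OF this(1)] this(2)] show ?case using insert.hyps by simp
  qed (simp add: schwartz_zero)
  from this[of "{..n}"] show ?thesis unfolding ext_def by simp
qed

text \<open>For \<xi> > 0 the Newton expansions of both sides have equal terms. The origin is
  reached by continuity of both sides along the ray.\<close>

lemma ext_eq:
  assumes F: "F \<in> schwartz_equivariant n" and j: "j \<le> n" and \<xi>: "0 \<le> \<xi>"
  shows "ext n F (\<xi>, (- real n + 2 * real j) * \<xi>) = four (\<lambda>w. F w $$ (j, j)) (pole (sqrt \<xi>))"
proof -
  let ?l = "\<lambda>\<xi>. ext n F (\<xi>, (- real n + 2 * real j) * \<xi>)" and ?r = "\<lambda>\<xi>. four (\<lambda>w. F w $$ (j, j)) (pole (sqrt \<xi>))"
  have pos: "?l \<xi> = ?r \<xi>" if "0 < \<xi>" for \<xi>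
  proof -
    have "0 < sqrt \<xi>" using that by simp
    have "?l \<xi> = (\<Sum>m\<le>n. of_nat (j choose m) * (of_real \<xi> ^ m * newton_coeff n m (\<lambda>w. F w $$ (m, 0)) \<xi>))"
      unfolding ext_def newton_cut_eq[OF j] fst_conv by (simp only: mult.assoc)
    also have "\<dots> = ?r \<xi>"
      unfolding diag_expansion[OF F j \<open>0 < sqrt \<xi>\<close>]
      by (intro sum.cong refl) (simp only: newton_coeff_eq[OF F _ that] atMost_iff)
    finally show ?thesis .
  qed
  have mat: "F \<in> schwartz_mat n" using F by (simp add: schwartz_equivariant_def)
  then have S: "(\<lambda>w. F w $$ (j, j)) \<in> schwartz" using j by (simp add: schwartz_mat_def)
  have "continuous_on UNIV (ext n F)"
    using smooth_continuous[OF schwartz_smooth[OF ext_schwartz[OF mat]], of "[]"] by simp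
  then have "isCont (ext n F) (0, 0)" by (simp add: continuous_on_eq_continuous_at)
  moreover have "((\<lambda>\<xi>. (\<xi>, (- real n + 2 * real j) * \<xi>)) \<longlongrightarrow> (0, 0)) (at_right 0)"
    by (intro tendsto_eq_intros) auto
  ultimately have L: "(?l \<longlongrightarrow> ext n F (0, 0)) (at_right 0)" by (rule isCont_tendsto_compose)
  have "((\<lambda>\<xi>. sqrt \<xi>) \<longlongrightarrow> 0) (at_right 0)" by (intro tendsto_eq_intros) auto
  from isCont_tendsto_compose[OF four_continuous[OF S] isCont_tendsto_compose[OF isCont_pole this]]
  have "(?r \<longlongrightarrow> four (\<lambda>w. F w $$ (j, j)) (pole 0)) (at_right 0)" .
  then have "(?l \<longlongrightarrow> four (\<lambda>w. F w $$ (j, j)) (pole 0)) (at_right 0)"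
  proof (rule Lim_transform_eventually)
    show "\<forall>\<^sub>F \<xi> in at_right 0. ?r \<xi> = ?l \<xi>"
      by (rule eventually_at_rightI[of 0 1]) (simp_all only: pos greaterThanLessThan_iff zero_less_one)
  qed
  with L have "ext n F (0, 0) = four (\<lambda>w. F w $$ (j, j)) (pole 0)"
    by (intro tendsto_unique[OF trivial_limit_at_right_real])
  then show ?thesis using pos[of \<xi>] \<xi> by (cases "\<xi> = 0") simp_all
qed
section \<open>The topological isomorphism\<close>

lemma schwartz_diff:
  assumes "f \<in> schwartz" "g \<in> schwartz" shows "(\<lambda>x. f x - g x) \<in> schwartz"
  using schwartz_add[OF assms(1) schwartz_cmult[OF assms(2), of "- 1"]] by simp

lemma schwartz_seminorm_triangle:
  assumes fg: "f \<in> schwartz" "g \<in> schwartz" and bs: "bs \<in> lists Basis"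
  shows "schwartz_seminorm N bs (\<lambda>x. f x + g x) \<le> schwartz_seminorm N bs f + schwartz_seminorm N bs g"
proof (rule schwartz_seminorm_least)
  fix x
  have "(1 + norm x) ^ N * norm (iterated_partial bs f x + iterated_partial bs g x) \<le>
      (1 + norm x) ^ N * (norm (iterated_partial bs f x) + norm (iterated_partial bs g x))"
    by (intro mult_left_mono norm_triangle_ineq) simp
  also have "\<dots> \<le> schwartz_seminorm N bs f + schwartz_seminorm N bs g"
    unfolding distrib_left by (intro add_mono schwartz_seminorm_upper fg bs)
  finally show "(1 + norm x) ^ N * norm (iterated_partial bs (\<lambda>x. f x + g x) x) \<le> schwartz_seminorm N bs f + schwartz_seminorm N bs g"
    by (simp only: iterated_partial_add[OF schwartz_smooth[OF fg(1)] schwartz_smooth[OF fg(2)] bs])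
qed

lemma schwartz_seminorm_diff_triangle:
  assumes "f \<in> schwartz" "g \<in> schwartz" "h \<in> schwartz" "bs \<in> lists Basis"
  shows "schwartz_seminorm N bs (\<lambda>x. f x - h x) \<le> schwartz_seminorm N bs (\<lambda>x. f x - g x) + schwartz_seminorm N bs (\<lambda>x. g x - h x)"
  using schwartz_seminorm_triangle[OF schwartz_diff[OF assms(1,2)] schwartz_diff[OF assms(2,3)] assms(4), of N] by simp

lemma schwartz_seminorm_sum:
  assumes "finite M" "\<And>m. m \<in> M \<Longrightarrow> f m \<in> schwartz" "bs \<in> lists Basis"
  shows "(\<lambda>x. \<Sum>m\<in>M. f m x) \<in> schwartz \<and> schwartz_seminorm N bs (\<lambda>x. \<Sum>m\<in>M. f m x) \<le> (\<Sum>m\<in>M. schwartz_seminorm N bs (f m))"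
  using assms(1,2)
proof (induction M)
  case empty
  then show ?case by (simp add: schwartz_zero schwartz_seminorm_zero)
next
  case (insert m M)
  then have fm: "f m \<in> schwartz" and S: "(\<lambda>x. \<Sum>m\<in>M. f m x) \<in> schwartz"
    and le: "schwartz_seminorm N bs (\<lambda>x. \<Sum>m\<in>M. f m x) \<le> (\<Sum>m\<in>M. schwartz_seminorm N bs (f m))" by simp_all
  show ?case
    using insert.hyps schwartz_add[OF fm S] order_trans[OF schwartz_seminorm_triangle[OF fm S assms(3), of N] add_left_mono[OF le]] by simp
qed

section \<open>Continuity in topologies generated by pseudometrics\<close>

lemma schwartz_op_continuous:
  assumes op: "schwartz_op \<Phi>" and bs: "bs \<in> lists Basis" and e: "0 < e"
  shows "\<exists>M \<delta>. 0 < \<delta> \<and> (\<forall>f\<in>schwartz. \<forall>g\<in>schwartz. pnorm M (\<lambda>x. f x - g x) < \<delta> \<longrightarrow>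
    schwartz_seminorm N bs (\<lambda>x. \<Phi> f x - \<Phi> g x) < e)"
proof -
  obtain M C where C: "\<And>f. f \<in> schwartz \<Longrightarrow> schwartz_seminorm N bs (\<Phi> f) \<le> C * pnorm M f"
    using schwartz_op_seminorm[OF op bs, of N] by blast
  let ?\<delta> = "e / (\<bar>C\<bar> + 1)"
  have "schwartz_seminorm N bs (\<lambda>x. \<Phi> f x - \<Phi> g x) < e"
    if fg: "f \<in> schwartz" "g \<in> schwartz" and lt: "pnorm M (\<lambda>x. f x - g x) < ?\<delta>" for f g
  proof -
    let ?p = "pnorm M (\<lambda>x. f x - g x)"
    have p: "0 \<le> ?p" by (rule pnorm_nonneg[OF schwartz_diff[OF fg]])
    have "schwartz_seminorm N bs (\<lambda>x. \<Phi> f x - \<Phi> g x) = schwartz_seminorm N bs (\<Phi> (\<lambda>x. f x - g x))"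
      by (rule arg_cong[where f = "schwartz_seminorm N bs"]) (rule ext, simp only: schwartz_op_diff[OF op fg])
    also have "\<dots> \<le> C * ?p" by (rule C[OF schwartz_diff[OF fg]])
    also have "\<dots> \<le> (\<bar>C\<bar> + 1) * ?p" using p by (intro mult_right_mono) auto
    also have "\<dots> < (\<bar>C\<bar> + 1) * ?\<delta>" by (rule mult_strict_left_mono[OF lt]) simp
    also have "\<dots> = e" by (simp add: add_nonneg_eq_0_iff)
    finally show ?thesis .
  qed
  moreover have "0 < ?\<delta>" using e by simp
  ultimately show ?thesis by blast
qed

lemma pseudometric_nbhd:
  assumes top: "topspace (pseudometric_topology S D) = S" and D': "finite D'" "D' \<subseteq> D"
    and f: "f \<in> S" "\<And>d. d \<in> D' \<Longrightarrow> d f f = 0" and e: "0 < e"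
  shows "\<exists>V. openin (pseudometric_topology S D) V \<and> f \<in> V \<and> V \<subseteq> S \<and> (\<forall>g\<in>V. \<forall>d\<in>D'. d f g < e)"
proof -
  \<comment> \<open>The intersection with the whole space covers an empty family
    \<open>D'\<close>.\<close>
  let ?V = "(\<Inter>d\<in>D'. {g \<in> S. d f g < e}) \<inter> topspace (pseudometric_topology S D)"
  have "openin (pseudometric_topology S D) {g \<in> S. d f g < e}" if "d \<in> D'" for d
    unfolding pseudometric_topology_def
    by (rule topology_generated_by_Basis) (use that D' f(1) e in blast)
  then have "openin (pseudometric_topology S D) ?V" by (intro openin_INT D'(1))
  moreover have "f \<in> ?V" using f(1) e by (simp add: top f(2))
  ultimately show ?thesis using top by (intro exI[of _ ?V]) auto
qed

text \<open>The generating balls have arbitrary centres. The triangle inequality reduces them to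
  balls around the image point, where the local condition applies.\<close>

lemma continuous_map_pseudometric:
  assumes \<Phi>: "\<And>x. x \<in> topspace X \<Longrightarrow> \<Phi> x \<in> S" and ne: "D \<noteq> {}"
    and self: "\<And>d f. d \<in> D \<Longrightarrow> f \<in> S \<Longrightarrow> d f f = 0"
    and tri: "\<And>d f g h. d \<in> D \<Longrightarrow> f \<in> S \<Longrightarrow> g \<in> S \<Longrightarrow> h \<in> S \<Longrightarrow> d f h \<le> d f g + d g h"
    and cont: "\<And>d x e. d \<in> D \<Longrightarrow> x \<in> topspace X \<Longrightarrow> 0 < e \<Longrightarrow> \<exists>V. openin X V \<and> x \<in> V \<and> (\<forall>y\<in>V. d (\<Phi> x) (\<Phi> y) < e)"
  shows "continuous_map X (pseudometric_topology S D) \<Phi>"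
proof -
  have op: "openin X (\<Phi> -` {g \<in> S. d f g < e} \<inter> topspace X)" if f: "f \<in> S" and d: "d \<in> D" for f d e
  proof (subst openin_subopen, intro ballI)
    fix x assume x: "x \<in> \<Phi> -` {g \<in> S. d f g < e} \<inter> topspace X"
    then have "0 < e - d f (\<Phi> x)" by simp
    moreover have "x \<in> topspace X" using x by simp
    ultimately have "\<exists>V. openin X V \<and> x \<in> V \<and> (\<forall>y\<in>V. d (\<Phi> x) (\<Phi> y) < e - d f (\<Phi> x))" by (intro cont d)
    then obtain V where V: "openin X V" "x \<in> V" "\<forall>y\<in>V. d (\<Phi> x) (\<Phi> y) < e - d f (\<Phi> x)"
      by (elim exE conjE) (rule that)
    have "V \<subseteq> \<Phi> -` {g \<in> S. d f g < e} \<inter> topspace X"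
    proof
      fix y assume y: "y \<in> V"
      then have yX: "y \<in> topspace X" using openin_subset[OF V(1)] by blast
      have "d f (\<Phi> y) \<le> d f (\<Phi> x) + d (\<Phi> x) (\<Phi> y)" using x yX by (intro tri d f \<Phi>) auto
      then show "y \<in> \<Phi> -` {g \<in> S. d f g < e} \<inter> topspace X" using bspec[OF V(3) y] \<Phi>[OF yX] yX by simp
    qed
    then show "\<exists>T. openin X T \<and> x \<in> T \<and> T \<subseteq> \<Phi> -` {g \<in> S. d f g < e} \<inter> topspace X"
      using V(1,2) by (intro exI[of _ V] conjI)
  qed
  have img: "\<Phi> ` topspace X \<subseteq> \<Union>{{g \<in> S. d f g < e} | f d e. f \<in> S \<and> d \<in> D \<and> 0 < e}"
  proof -
    have "topspace (pseudometric_topology S D) = S" by (rule topspace_pseudometric_topology[OF ne]) (rule self)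
    then have "\<Union>{{g \<in> S. d f g < e} | f d e. f \<in> S \<and> d \<in> D \<and> 0 < e} = S"
      by (simp only: pseudometric_topology_def topology_generated_by_topspace)
    then show ?thesis by (simp only:) (intro image_subsetI \<Phi>)
  qed
  show ?thesis unfolding pseudometric_topology_def continuous_on_generated_topo_iff
  proof (intro conjI allI impI img)
    fix U assume "U \<in> {{g \<in> S. d f g < e} | f d e. f \<in> S \<and> d \<in> D \<and> 0 < e}"
    then show "openin X (\<Phi> -` U \<inter> topspace X)"
      unfolding mem_Collect_eq by (elim exE conjE) (simp only: op)
  qed
qed

text \<open>\<open>E\<close> extracts the scalar function that the seminorms see, either a matrix
  entry or the function itself, so that one statement serves both spaces.\<close>

lemma pnorm_nbhd:
  assumes top: "topspace (pseudometric_topology S D) = S"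
    and D: "\<And>bs. bs \<in> lists Basis \<Longrightarrow> (\<lambda>F G. schwartz_seminorm M bs (\<lambda>x. E F x - E G x)) \<in> D"
    and F: "F \<in> S" and e: "0 < e"
  shows "\<exists>V. openin (pseudometric_topology S D) V \<and> F \<in> V \<and> V \<subseteq> S \<and> (\<forall>G\<in>V. pnorm M (\<lambda>x::'a::euclidean_space. E F x - E G x) < e)"
proof -
  let ?B = "{bs. set bs \<subseteq> (Basis :: 'a set) \<and> length bs \<le> M}"
  let ?d = "\<lambda>bs F G. schwartz_seminorm M bs (\<lambda>x. E F x - E G x)"
  let ?e = "e / (real (card ?B) + 1)"
  have sub: "?d ` ?B \<subseteq> D" using D by (auto simp: in_lists_conv_set)
  have "0 < ?e" using e by simp
  have "\<exists>V. openin (pseudometric_topology S D) V \<and> F \<in> V \<and> V \<subseteq> S \<and> (\<forall>G\<in>V. \<forall>d\<in>?d ` ?B. d F G < ?e)"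
    by (rule pseudometric_nbhd[OF top finite_imageI[OF finite_bs] sub F _ \<open>0 < ?e\<close>]) (auto simp: schwartz_seminorm_zero)
  then obtain V where V: "openin (pseudometric_topology S D) V" "F \<in> V" "V \<subseteq> S" "\<forall>G\<in>V. \<forall>d\<in>?d ` ?B. d F G < ?e"
    by (elim exE conjE) (rule that)
  have "pnorm M (\<lambda>x. E F x - E G x) < e" if "G \<in> V" for G
  proof -
    have "pnorm M (\<lambda>x. E F x - E G x) \<le> (\<Sum>bs\<in>?B. ?e)"
      unfolding pnorm_def
    proof (rule sum_mono)
      fix bs assume "bs \<in> ?B"
      from bspec[OF bspec[OF V(4) that] imageI[OF this]] show "?d bs F G \<le> ?e" by (rule less_imp_le)
    qed
    also have "\<dots> = real (card ?B) * ?e" by simp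
    also have "\<dots> < (real (card ?B) + 1) * ?e" using \<open>0 < ?e\<close> by (intro mult_strict_right_mono) auto
    also have "\<dots> = e" by (simp add: add_nonneg_eq_0_iff)
    finally show ?thesis .
  qed
  then show ?thesis using V(1-3) by (intro exI[of _ V] conjI ballI)
qed

lemma schwartz_equivariantD:
  assumes "F \<in> schwartz_equivariant n"
  shows "F \<in> schwartz_mat n" "F z \<in> carrier_mat (n + 1) (n + 1)"
    "a \<le> n \<Longrightarrow> b \<le> n \<Longrightarrow> (\<lambda>z. F z $$ (a, b)) \<in> schwartz" "covariant n (\<lambda>z a b. F z $$ (a, b))"
proof -
  show "F \<in> schwartz_mat n" using assms by (simp add: schwartz_equivariant_def)
  then show car: "F z \<in> carrier_mat (n + 1) (n + 1)" "a \<le> n \<Longrightarrow> b \<le> n \<Longrightarrow> (\<lambda>z. F z $$ (a, b)) \<in> schwartz" for z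
    by (simp_all add: schwartz_mat_def)
  show "covariant n (\<lambda>z a b. F z $$ (a, b))"
    using assms by (simp add: schwartz_equivariant_def flip: equivariant_covariant[OF car(1)])
qed

text \<open>\<open>ext\<close> is built from the entries of column 0, each passed through a Schwartz
  operator. Continuity therefore holds on the full matrix Schwartz space and is inherited by the
  equivariant subspace.\<close>

lemma ext_continuous: "continuous_map (schwartz_equivariant_topology n) schwartz_topology (ext n)"
proof -
  let ?op = "\<lambda>m u p. newton_cut n m p * newton_coeff n m u (fst p)"
  have "continuous_map (schwartz_mat_topology n) schwartz_topology (ext n)"
    unfolding schwartz_topology_def
  proof (rule continuous_map_pseudometric; (unfold topspace_schwartz_mat_topology)?)
    show "ext n F \<in> schwartz" if "F \<in> schwartz_mat n" for F by (rule ext_schwartz[OF that])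
    show "{\<lambda>f g :: real \<times> real \<Rightarrow> complex. schwartz_seminorm N bs (\<lambda>x. f x - g x) | N bs. bs \<in> lists Basis} \<noteq> {}"
      using lists.Nil by fast
    fix d assume "d \<in> {\<lambda>f g :: real \<times> real \<Rightarrow> complex. schwartz_seminorm N bs (\<lambda>x. f x - g x) | N bs. bs \<in> lists Basis}"
    then obtain N bs where d: "d = (\<lambda>f g. schwartz_seminorm N bs (\<lambda>x. f x - g x))" and bs: "bs \<in> lists Basis" by blast
    show "d f f = 0" for f by (simp add: d schwartz_seminorm_zero)
    show "d f h \<le> d f g + d g h" if "f \<in> schwartz" "g \<in> schwartz" "h \<in> schwartz" for f g h
      unfolding d by (rule schwartz_seminorm_diff_triangle[OF that bs])
    fix F :: "complex ^ 2 \<Rightarrow> complex mat" and e :: real assume F: "F \<in> schwartz_mat n" and e: "0 < e"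
    \<comment> \<open>There are n + 1 summands; dividing by n + 2 keeps the final inequality
      strict.\<close>
    let ?e = "e / (real n + 2)"
    have "\<exists>V. openin (schwartz_mat_topology n) V \<and> F \<in> V \<and> V \<subseteq> schwartz_mat n \<and>
        (\<forall>G\<in>V. schwartz_seminorm N bs (\<lambda>p. ?op m (\<lambda>w. F w $$ (m, 0)) p - ?op m (\<lambda>w. G w $$ (m, 0)) p) < ?e)" if m: "m \<le> n" for m
    proof -
      have e': "0 < ?e" using e by simp
      obtain M \<delta> where \<delta>0: "0 < \<delta>" and \<delta>: "\<forall>f\<in>schwartz. \<forall>g\<in>schwartz. pnorm M (\<lambda>x. f x - g x) < \<delta> \<longrightarrow>
          schwartz_seminorm N bs (\<lambda>x. ?op m f x - ?op m g x) < ?e"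
        using schwartz_op_continuous[OF schwartz_op_ext[of n m] bs e', of N] by (elim exE conjE) (rule that)
      have D: "(\<lambda>F G. schwartz_seminorm M bs (\<lambda>x :: complex ^ 2. F x $$ (m, 0) - G x $$ (m, 0))) \<in>
          {\<lambda>F G. schwartz_seminorm N bs (\<lambda>x. F x $$ (i, j) - G x $$ (i, j)) | N bs i j. bs \<in> lists Basis \<and> i \<le> n \<and> j \<le> n}"
        if "bs \<in> lists Basis" for bs
        unfolding mem_Collect_eq by (rule exI[of _ M], rule exI[of _ bs], rule exI[of _ m], rule exI[of _ 0]) (simp add: that m)
      have "\<exists>V. openin (schwartz_mat_topology n) V \<and> F \<in> V \<and> V \<subseteq> schwartz_mat n \<and> (\<forall>G\<in>V. pnorm M (\<lambda>x. F x $$ (m, 0) - G x $$ (m, 0)) < \<delta>)"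
        unfolding schwartz_mat_topology_def
        by (rule pnorm_nbhd[where E = "\<lambda>F x. F x $$ (m, 0)", OF topspace_schwartz_mat_topology[unfolded schwartz_mat_topology_def] D F \<delta>0])
      then obtain V where V: "openin (schwartz_mat_topology n) V" "F \<in> V" "V \<subseteq> schwartz_mat n"
          "\<forall>G\<in>V. pnorm M (\<lambda>x. F x $$ (m, 0) - G x $$ (m, 0)) < \<delta>" by (elim exE conjE) (rule that)
      have S: "(\<lambda>w. G w $$ (m, 0)) \<in> schwartz" if "G \<in> schwartz_mat n" for G using that m by (simp add: schwartz_mat_def)
      have "schwartz_seminorm N bs (\<lambda>p. ?op m (\<lambda>w. F w $$ (m, 0)) p - ?op m (\<lambda>w. G w $$ (m, 0)) p) < ?e" if "G \<in> V" for G
        by (rule \<delta>[rule_format, OF S[OF F] S[OF subsetD[OF V(3) that]] bspec[OF V(4) that]])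
      then show ?thesis using V(1-3) by (intro exI[of _ V] conjI ballI)
    qed
    then have "\<forall>m\<in>{..n}. \<exists>V. openin (schwartz_mat_topology n) V \<and> F \<in> V \<and> V \<subseteq> schwartz_mat n \<and>
        (\<forall>G\<in>V. schwartz_seminorm N bs (\<lambda>p. ?op m (\<lambda>w. F w $$ (m, 0)) p - ?op m (\<lambda>w. G w $$ (m, 0)) p) < ?e)" by simp
    from bchoice[OF this] obtain V where V0: "\<forall>m\<in>{..n}. openin (schwartz_mat_topology n) (V m) \<and> F \<in> V m \<and> V m \<subseteq> schwartz_mat n \<and>
        (\<forall>G\<in>V m. schwartz_seminorm N bs (\<lambda>p. ?op m (\<lambda>w. F w $$ (m, 0)) p - ?op m (\<lambda>w. G w $$ (m, 0)) p) < ?e)"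
      by (elim exE) (rule that)
    have V: "openin (schwartz_mat_topology n) (V m)" "F \<in> V m" "V m \<subseteq> schwartz_mat n"
        "\<forall>G\<in>V m. schwartz_seminorm N bs (\<lambda>p. ?op m (\<lambda>w. F w $$ (m, 0)) p - ?op m (\<lambda>w. G w $$ (m, 0)) p) < ?e"
      if "m \<in> {..n}" for m
    proof -
      note c = bspec[OF V0 that]
      show "openin (schwartz_mat_topology n) (V m)" "F \<in> V m" "V m \<subseteq> schwartz_mat n"
        "\<forall>G\<in>V m. schwartz_seminorm N bs (\<lambda>p. ?op m (\<lambda>w. F w $$ (m, 0)) p - ?op m (\<lambda>w. G w $$ (m, 0)) p) < ?e"
        by (rule conjunct1[OF c] conjunct1[OF conjunct2[OF c]] conjunct1[OF conjunct2[OF conjunct2[OF c]]]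
            conjunct2[OF conjunct2[OF conjunct2[OF c]]])+
    qed
    let ?V = "\<Inter>m\<in>{..n}. V m"
    have "openin (schwartz_mat_topology n) ?V" by (intro openin_Inter) (auto simp del: atMost_iff intro: V(1))
    moreover have "F \<in> ?V" by (intro INT_I V(2))
    moreover have "d (ext n F) (ext n G) < e" if G: "G \<in> ?V" for G
    proof -
      let ?f = "\<lambda>m p. ?op m (\<lambda>w. F w $$ (m, 0)) p - ?op m (\<lambda>w. G w $$ (m, 0)) p"
      have Gm: "G \<in> schwartz_mat n" using G V(3)[of 0] by (auto simp only: atMost_iff)
      have op: "?op m (\<lambda>w. H w $$ (m, 0)) \<in> schwartz" if "H \<in> schwartz_mat n" "m \<le> n" for H m
        using that by (intro schwartz_op_in[OF schwartz_op_ext]) (simp add: schwartz_mat_def)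
      have S: "?f m \<in> schwartz" if "m \<in> {..n}" for m
        using that by (intro schwartz_diff op F Gm) simp_all
      have "d (ext n F) (ext n G) = schwartz_seminorm N bs (\<lambda>p. \<Sum>m\<le>n. ?f m p)"
        by (simp add: d ext_def sum_subtractf)
      also have "\<dots> \<le> (\<Sum>m\<le>n. schwartz_seminorm N bs (?f m))"
        by (rule schwartz_seminorm_sum[OF finite_atMost _ bs, THEN conjunct2]) (rule S)
      also have "\<dots> \<le> (\<Sum>m\<le>n. ?e)"
      proof (rule sum_mono)
        fix m assume m: "m \<in> {..n}"
        from bspec[OF V(4)[OF m] INT_D[OF G m]] show "schwartz_seminorm N bs (?f m) \<le> ?e" by (rule less_imp_le)
      qed
      also have "\<dots> = (real n + 1) * ?e" by (simp add: add.commute)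
      also have "\<dots> < (real n + 2) * ?e" using e by (intro mult_strict_right_mono) auto
      also have "\<dots> = e" by (simp add: add_nonneg_eq_0_iff)
      finally show ?thesis .
    qed
    ultimately show "\<exists>V. openin (schwartz_mat_topology n) V \<and> F \<in> V \<and> (\<forall>G\<in>V. d (ext n F) (ext n G) < e)"
      by (intro exI[of _ ?V] conjI ballI)
  qed
  then show ?thesis unfolding schwartz_equivariant_topology_def by (rule continuous_map_from_subtopology)
qed

lemma lift_continuous: "continuous_map schwartz_topology (schwartz_equivariant_topology n) (lift n)"
proof -
  have "continuous_map schwartz_topology (schwartz_mat_topology n) (lift n)"
    unfolding schwartz_mat_topology_def
  proof (rule continuous_map_pseudometric; (unfold topspace_schwartz_topology)?)
    show "lift n f \<in> schwartz_mat n" if "f \<in> schwartz" for f by (rule schwartz_equivariantD(1)[OF lift_in[OF that]])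
    let ?D = "{\<lambda>F G. schwartz_seminorm N bs (\<lambda>x :: complex ^ 2. F x $$ (i, j) - G x $$ (i, j) :: complex) | N bs i j. bs \<in> lists Basis \<and> i \<le> n \<and> j \<le> n}"
    have "(\<lambda>F G. schwartz_seminorm 0 [] (\<lambda>x :: complex ^ 2. F x $$ (0, 0) - G x $$ (0, 0))) \<in> ?D"
      by (intro CollectI exI[of _ 0] exI[of _ "[]"]) simp
    then show "?D \<noteq> {}" by (rule ex_in_conv[THEN iffD1, OF exI])
    fix d assume "d \<in> ?D"
    then obtain N bs i j where d: "d = (\<lambda>F G. schwartz_seminorm N bs (\<lambda>x. F x $$ (i, j) - G x $$ (i, j)))"
      and bs: "bs \<in> lists Basis" and ij: "i \<le> n" "j \<le> n" by blast
    show "d f f = 0" for f by (simp add: d schwartz_seminorm_zero)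
    show "d f h \<le> d f g + d g h" if "f \<in> schwartz_mat n" "g \<in> schwartz_mat n" "h \<in> schwartz_mat n" for f g h
      unfolding d using that ij by (intro schwartz_seminorm_diff_triangle bs) (simp_all add: schwartz_mat_def)
    fix f :: "real \<times> real \<Rightarrow> complex" and e :: real assume f: "f \<in> schwartz" and e: "0 < e"
    obtain M \<delta> where \<delta>0: "0 < \<delta>" and \<delta>: "\<forall>f\<in>schwartz. \<forall>g\<in>schwartz. pnorm M (\<lambda>x. f x - g x) < \<delta> \<longrightarrow>
        schwartz_seminorm N bs (\<lambda>x. lift n f x $$ (i, j) - lift n g x $$ (i, j)) < e"
      using schwartz_op_continuous[OF schwartz_op_lift[OF ij] bs e, of N] by (elim exE conjE) (rule that)
    have D: "(\<lambda>f g. schwartz_seminorm M bs (\<lambda>x :: real \<times> real. f x - g x)) \<in>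
        {\<lambda>f g. schwartz_seminorm N bs (\<lambda>x. f x - g x) | N bs. bs \<in> lists Basis}" if "bs \<in> lists Basis" for bs
      unfolding mem_Collect_eq by (rule exI[of _ M], rule exI[of _ bs]) (simp add: that)
    have "\<exists>V. openin schwartz_topology V \<and> f \<in> V \<and> V \<subseteq> schwartz \<and> (\<forall>g\<in>V. pnorm M (\<lambda>x. f x - g x) < \<delta>)"
      unfolding schwartz_topology_def
      by (rule pnorm_nbhd[where E = "\<lambda>f. f", OF topspace_schwartz_topology[unfolded schwartz_topology_def] D f \<delta>0])
    then obtain V where V: "openin schwartz_topology V" "f \<in> V" "V \<subseteq> schwartz" "\<forall>g\<in>V. pnorm M (\<lambda>x. f x - g x) < \<delta>"
      by (elim exE conjE) (rule that)
    have "d (lift n f) (lift n g) < e" if "g \<in> V" for g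
      unfolding d by (rule \<delta>[rule_format, OF f subsetD[OF V(3) that] bspec[OF V(4) that]])
    then show "\<exists>V. openin schwartz_topology V \<and> f \<in> V \<and> (\<forall>g\<in>V. d (lift n f) (lift n g) < e)"
      using V(1,2) by (intro exI[of _ V] conjI ballI)
  qed
  then show ?thesis unfolding schwartz_equivariant_topology_def continuous_map_in_subtopology
    using lift_in by (auto simp: topspace_schwartz_topology)
qed

section \<open>The spherical transform as restriction after \<open>ext\<close>, with
  \<open>lift\<close> as right inverse\<close>

lemma spherical_transform_eq:
  assumes F: "F \<in> schwartz_equivariant n"
  shows "spherical_transform n F = restrict (ext n F) (spectrum_D n)"
proof
  fix p :: "real \<times> real"
  obtain \<xi> \<eta> where p: "p = (\<xi>, \<eta>)" by (cases p)
  show "spherical_transform n F p = restrict (ext n F) (spectrum_D n) p"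
  proof (cases "p \<in> spectrum_D n")
    case True
    then obtain j where j: "j \<le> n" "0 \<le> \<xi>" "\<eta> = (- real n + 2 * real j) * \<xi>" unfolding p spectrum_D_def by auto
    \<comment> \<open>At \<xi> = 0 every index is admissible. All of them give the same value
      because \<open>ext n F\<close> is a single function on the plane, so the definite description
      is meaningful.\<close>
    have val: "1 / of_nat (n + 1) * (LINT z|lborel. mat_trace (F z * Phi n \<xi> i (- z))) = ext n F (\<xi>, \<eta>)"
      if "i \<le> n" "\<eta> = (- real n + 2 * real i) * \<xi>" for i
      unfolding transform_formula[OF F that(1)] that(2) by (rule ext_eq[OF F that(1) j(2), symmetric])
    have "(THE w. \<exists>j\<le>n. \<eta> = (- real n + 2 * real j) * \<xi> \<and>
       w = 1 / of_nat (n + 1) * (LINT z|lborel. mat_trace (F z * Phi n \<xi> j (- z)))) = ext n F (\<xi>, \<eta>)"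
    proof (rule the_equality)
      show "\<exists>j\<le>n. \<eta> = (- real n + 2 * real j) * \<xi> \<and> ext n F (\<xi>, \<eta>) = 1 / of_nat (n + 1) * (LINT z|lborel. mat_trace (F z * Phi n \<xi> j (- z)))"
        using j val[OF j(1,3)] by (intro exI[of _ j]) simp
    next
      fix w assume "\<exists>j\<le>n. \<eta> = (- real n + 2 * real j) * \<xi> \<and> w = 1 / of_nat (n + 1) * (LINT z|lborel. mat_trace (F z * Phi n \<xi> j (- z)))"
      then show "w = ext n F (\<xi>, \<eta>)" by (elim exE conjE) (simp only: val)
    qed
    then show ?thesis using True by (simp add: spherical_transform_def p)
  qed (simp add: spherical_transform_def)
qed

lemma spherical_transform_at:
  assumes "F \<in> schwartz_equivariant n" "j \<le> n" "0 \<le> \<xi>"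
  shows "spherical_transform n F (\<xi>, (- real n + 2 * real j) * \<xi>) = four (\<lambda>w. F w $$ (j, j)) (pole (sqrt \<xi>))"
proof -
  have "(\<xi>, (- real n + 2 * real j) * \<xi>) \<in> spectrum_D n" using assms unfolding spectrum_D_def by blast
  then show ?thesis using ext_eq[OF assms] by (simp add: spherical_transform_eq[OF assms(1)])
qed

lemma spherical_transform_eqI:
  assumes "F \<in> schwartz_equivariant n"
    and "\<And>\<xi> j. 0 \<le> \<xi> \<Longrightarrow> j \<le> n \<Longrightarrow> four (\<lambda>w. F w $$ (j, j)) (pole (sqrt \<xi>)) = f (\<xi>, (- real n + 2 * real j) * \<xi>)"
  shows "spherical_transform n F = restrict f (spectrum_D n)"
proof
  fix p
  show "spherical_transform n F p = restrict f (spectrum_D n) p"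
  proof (cases "p \<in> spectrum_D n")
    case True
    then obtain \<xi> j where p: "p = (\<xi>, (- real n + 2 * real j) * \<xi>)" "0 \<le> \<xi>" "j \<le> n" unfolding spectrum_D_def by blast
    then show ?thesis using True spherical_transform_at[OF assms(1) p(3,2)] assms(2)[OF p(2,3)] by simp
  qed (simp add: spherical_transform_def)
qed

lemma spherical_transform_lift:
  assumes "f \<in> schwartz" shows "spherical_transform n (lift n f) = restrict f (spectrum_D n)"
proof (rule spherical_transform_eqI[OF lift_in[OF assms]])
  fix \<xi> :: real and j assume \<xi>: "0 \<le> \<xi>" and j: "j \<le> n"
  show "four (\<lambda>w. lift n f w $$ (j, j)) (pole (sqrt \<xi>)) = f (\<xi>, (- real n + 2 * real j) * \<xi>)"
    unfolding four_lift[OF assms j j] newton_fun_pole[OF assms j] using \<xi> by simp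
qed

text \<open>The transform records the diagonal of the Fourier transform at the poles, which
  determines a covariant function; Fourier inversion then recovers the entries.\<close>

lemma spherical_transform_inj: "inj_on (spherical_transform n) (schwartz_equivariant n)"
proof (rule inj_onI)
  fix F H assume F: "F \<in> schwartz_equivariant n" and H: "H \<in> schwartz_equivariant n"
    and eq: "spherical_transform n F = spherical_transform n H"
  note FD = schwartz_equivariantD[OF F] and HD = schwartz_equivariantD[OF H]
  have "F z $$ (a, b) = H z $$ (a, b)" if ab: "a \<le> n" "b \<le> n" for z a b
  proof -
    have "four (\<lambda>w. F w $$ (a, b)) x = four (\<lambda>w. H w $$ (a, b)) x" for x
    proof (rule covariant_eq[OF four_covariant[OF FD(3,4)] four_covariant[OF HD(3,4)] _ ab])
      fix r :: real and j assume "0 \<le> r" "j \<le> n"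
      then show "four (\<lambda>w. F w $$ (j, j)) (pole r) = four (\<lambda>w. H w $$ (j, j)) (pole r)"
        using spherical_transform_at[OF F, of j "r\<^sup>2"] spherical_transform_at[OF H, of j "r\<^sup>2"] eq by simp
    qed
    then have "four (\<lambda>w. F w $$ (a, b)) = four (\<lambda>w. H w $$ (a, b))" by (rule ext)
    then have "of_real ((2 * pi) ^ DIM(complex ^ 2)) * F (- (- z)) $$ (a, b) = of_real ((2 * pi) ^ DIM(complex ^ 2)) * H (- (- z)) $$ (a, b)"
      using four_inversion[OF FD(3)[OF ab], of "- z"] four_inversion[OF HD(3)[OF ab], of "- z"] by metis
    then show ?thesis by simp
  qed
  note entry = this
  show "F = H"
  proof
    fix z
    have "dim_row (F z) = n + 1" "dim_col (F z) = n + 1" "dim_row (H z) = n + 1" "dim_col (H z) = n + 1"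
      using carrier_matD[OF FD(2)[of z]] carrier_matD[OF HD(2)[of z]] by simp_all
    then show "F z = H z" using entry by (intro eq_matI) simp_all
  qed
qed

lemma covariant_add:
  assumes X: "covariant n X" and Y: "covariant n Y" shows "covariant n (\<lambda>z a b. X z a b + Y z a b)"
proof -
  have "conjm n \<zeta> (\<lambda>c d. P c d + Q c d) a b = conjm n \<zeta> P a b + conjm n \<zeta> Q a b" for \<zeta> P Q a b
    unfolding conjm_def by (simp add: algebra_simps sum.distrib)
  then show ?thesis using X Y unfolding covariant_def by simp
qed

lemma schwartz_equivariant_lincomb:
  assumes F: "F \<in> schwartz_equivariant n" and H: "H \<in> schwartz_equivariant n"
  shows "(\<lambda>z. a \<cdot>\<^sub>m F z + b \<cdot>\<^sub>m H z) \<in> schwartz_equivariant n"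
    and "i \<le> n \<Longrightarrow> j \<le> n \<Longrightarrow> (a \<cdot>\<^sub>m F z + b \<cdot>\<^sub>m H z) $$ (i, j) = a * F z $$ (i, j) + b * H z $$ (i, j)"
proof -
  note FD = schwartz_equivariantD[OF F] and HD = schwartz_equivariantD[OF H]
  show idx: "i \<le> n \<Longrightarrow> j \<le> n \<Longrightarrow> (a \<cdot>\<^sub>m F z + b \<cdot>\<^sub>m H z) $$ (i, j) = a * F z $$ (i, j) + b * H z $$ (i, j)" for i j z
    using FD(2)[of z] HD(2)[of z] by auto
  have car: "a \<cdot>\<^sub>m F z + b \<cdot>\<^sub>m H z \<in> carrier_mat (n + 1) (n + 1)" for z
    using FD(2)[of z] HD(2)[of z] by auto
  have "covariant n (\<lambda>z i j. (a \<cdot>\<^sub>m F z + b \<cdot>\<^sub>m H z) $$ (i, j))"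
    by (rule covariant_cong[OF covariant_add[OF covariant_cmult[OF FD(4)] covariant_cmult[OF HD(4)]]]) (rule idx[symmetric])
  then have "equivariant n (\<lambda>z. a \<cdot>\<^sub>m F z + b \<cdot>\<^sub>m H z)" by (simp only: equivariant_covariant[OF car])
  moreover have "(\<lambda>z. (a \<cdot>\<^sub>m F z + b \<cdot>\<^sub>m H z) $$ (i, j)) \<in> schwartz" if "i \<le> n" "j \<le> n" for i j
    unfolding idx[OF that] by (intro schwartz_add schwartz_cmult FD(3) HD(3) that)
  ultimately show "(\<lambda>z. a \<cdot>\<^sub>m F z + b \<cdot>\<^sub>m H z) \<in> schwartz_equivariant n"
    using car by (simp add: schwartz_equivariant_def schwartz_mat_def del: index_add_mat)
qed

lemma spherical_transform_linear:
  assumes F: "F \<in> schwartz_equivariant n" and H: "H \<in> schwartz_equivariant n"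
  shows "spherical_transform n (\<lambda>z. a \<cdot>\<^sub>m F z + b \<cdot>\<^sub>m H z) =
    (\<lambda>p\<in>spectrum_D n. a * spherical_transform n F p + b * spherical_transform n H p)"
proof (rule spherical_transform_eqI[OF schwartz_equivariant_lincomb(1)[OF F H]])
  fix \<xi> :: real and j assume \<xi>: "0 \<le> \<xi>" and j: "j \<le> n"
  let ?z = "pole (sqrt \<xi>)"
  note S = schwartz_equivariantD(3)[OF F j j] schwartz_equivariantD(3)[OF H j j]
  have "four (\<lambda>w. (a \<cdot>\<^sub>m F w + b \<cdot>\<^sub>m H w) $$ (j, j)) ?z =
      (LINT w|lborel. a * (F w $$ (j, j) * cis (w \<bullet> ?z)) + b * (H w $$ (j, j) * cis (w \<bullet> ?z)))"
    unfolding four_def schwartz_equivariant_lincomb(2)[OF F H j j] by (simp only: distrib_right mult.assoc)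
  also have "\<dots> = a * four (\<lambda>w. F w $$ (j, j)) ?z + b * four (\<lambda>w. H w $$ (j, j)) ?z"
    unfolding four_def by (subst Bochner_Integration.integral_add) (intro integrable_mult_right four_integrable S | simp only: integral_mult_right_zero)+
  finally show "four (\<lambda>w. (a \<cdot>\<^sub>m F w + b \<cdot>\<^sub>m H w) $$ (j, j)) ?z = a * spherical_transform n F (\<xi>, (- real n + 2 * real j) * \<xi>) + b * spherical_transform n H (\<xi>, (- real n + 2 * real j) * \<xi>)"
    by (simp only: spherical_transform_at[OF F j \<xi>] spherical_transform_at[OF H j \<xi>])
qed

text \<open>Continuity of the inverse is obtained as openness of the transform, without defining an
  inverse on the spectrum, where functions have no canonical extension to the plane.\<close>

lemma spherical_transform_homeomorphic:
  "homeomorphic_map (schwartz_equivariant_topology n) (schwartz_spectrum_topology n) (spherical_transform n)"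
proof (rule bijective_open_imp_homeomorphic_map)
  let ?rest = "\<lambda>f :: real \<times> real \<Rightarrow> complex. restrict f (spectrum_D n)"
  have "continuous_map (schwartz_equivariant_topology n) (schwartz_spectrum_topology n) (?rest \<circ> ext n)"
    by (rule continuous_map_compose[OF ext_continuous])
      (simp add: schwartz_spectrum_topology_def quotient_imp_continuous_map[OF quotient_map_quotient_topology])
  then show "continuous_map (schwartz_equivariant_topology n) (schwartz_spectrum_topology n) (spherical_transform n)"
    by (rule continuous_map_eq) (simp add: topspace_schwartz_equivariant_topology spherical_transform_eq)
  have image: "spherical_transform n F \<in> ?rest ` schwartz" if "F \<in> schwartz_equivariant n" for F
    unfolding spherical_transform_eq[OF that] by (intro imageI ext_schwartz schwartz_equivariantD(1)[OF that])
  have lift: "?rest f = spherical_transform n (lift n f)" if "f \<in> schwartz" for f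
    using spherical_transform_lift[OF that] by simp
  show "open_map (schwartz_equivariant_topology n) (schwartz_spectrum_topology n) (spherical_transform n)"
    unfolding open_map_def
  proof (intro allI impI)
    fix U assume U: "openin (schwartz_equivariant_topology n) U"
    then have US: "U \<subseteq> schwartz_equivariant n" using openin_subset topspace_schwartz_equivariant_topology by blast
    have sub: "spherical_transform n ` U \<subseteq> ?rest ` schwartz"
      by (intro image_subsetI image subsetD[OF US])
    \<comment> \<open>Each restriction is the transform of its lift, so by injectivity it lies in
      the image of \<open>U\<close> exactly when the lift lies in \<open>U\<close>. Openness in the
      quotient topology thereby becomes continuity of \<open>lift\<close>.\<close>
    have eq: "{f \<in> schwartz. ?rest f \<in> spherical_transform n ` U} = {f \<in> schwartz. lift n f \<in> U}"
    proof (rule Collect_cong, rule conj_cong[OF refl])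
      fix f :: "real \<times> real \<Rightarrow> complex" assume f: "f \<in> schwartz"
      show "?rest f \<in> spherical_transform n ` U \<longleftrightarrow> lift n f \<in> U"
        unfolding lift[OF f] by (rule inj_on_image_mem_iff[OF spherical_transform_inj lift_in[OF f] US])
    qed
    have op: "openin schwartz_topology {f \<in> schwartz. lift n f \<in> U}"
      using openin_continuous_map_preimage[OF lift_continuous U] by (simp only: topspace_schwartz_topology)
    show "openin (schwartz_spectrum_topology n) (spherical_transform n ` U)"
      unfolding schwartz_spectrum_topology_def openin_quotient_topology topspace_schwartz_topology eq
      using sub op by (rule conjI)
  qed
  show "spherical_transform n ` topspace (schwartz_equivariant_topology n) = topspace (schwartz_spectrum_topology n)"
    unfolding topspace_schwartz_equivariant_topology topspace_schwartz_spectrum_topology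
  proof (intro equalityI subsetI)
    fix g assume "g \<in> spherical_transform n ` schwartz_equivariant n"
    then show "g \<in> ?rest ` schwartz" using image by (elim imageE) (simp only:)
  next
    fix g assume "g \<in> ?rest ` schwartz"
    then obtain f where "f \<in> schwartz" "g = spherical_transform n (lift n f)" using lift by (elim imageE) simp
    then show "g \<in> spherical_transform n ` schwartz_equivariant n" by (simp add: lift_in)
  qed
  show "inj_on (spherical_transform n) (topspace (schwartz_equivariant_topology n))"
    unfolding topspace_schwartz_equivariant_topology by (rule spherical_transform_inj)
qed

theorem theorem7p1:
  fixes n :: nat
  shows "(\<forall>F\<in>schwartz_equivariant n. \<forall>H\<in>schwartz_equivariant n. \<forall>a b :: complex.
            spherical_transform n (\<lambda>z. a \<cdot>\<^sub>m F z + b \<cdot>\<^sub>m H z) =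
              (\<lambda>p\<in>spectrum_D n. a * spherical_transform n F p + b * spherical_transform n H p))
         \<and> homeomorphic_map (schwartz_equivariant_topology n) (schwartz_spectrum_topology n)
              (spherical_transform n)"
  by (intro conjI ballI allI spherical_transform_linear spherical_transform_homeomorphic)

end
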